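(* Let $K$ be a field of characteristic zero, $R=K[x,y,z]$, and let $I = (x^a, y^b, z^c, x^\alpha y^\beta z^\gamma)$ with $0<\alpha<a$, $0<\beta<b$, $0<\gamma<c$. Assume that the syzygy bundle $\widetilde{\mathrm{syz}}\, I$ is semistable. Set $k = \left\lfloor \frac13(a+b+c+\alpha+\beta+\gamma)\right\rfloor$. Then the generic splitting type $(p,q,r)$ of $\widetilde{\mathrm{syz}}\, I$, ordered so that $p \leq q \leq r$, is $$(p,q,r) = \begin{cases} (-k-1,-k,-k) & \text{if } a+b+c+\alpha+\beta+\gamma = 3k+1;\\ (-k-1,-k-1,-k) & \text{if } a+b+c+\alpha+\beta+\gamma = 3k+2;\\ (-k,-k,-k) & \text{if } a+b+c+\alpha+\beta+\gamma = 3k \text{ and } R/I \text{ has the weak Lefschetz property};\\ (-k-1,-k,-k+1) & \text{if } a+b+c+\alpha+\beta+\gamma = 3k \text{ and } R/I \text{ fails to have the weak Lefschetz property}. \end{cases}$$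
   Context: For an Artinian ideal $I$ of $R = K[x,y,z]$ minimally generated by forms $f_1,\dots,f_m$, $\mathrm{syz}\, I$ is the kernel of $\bigoplus_{i=1}^m R(-\deg f_i) \to I$, and the syzygy bundle $\widetilde{\mathrm{syz}}\, I$ is its sheafification on $\mathbb{P}^2$, a vector bundle of rank $m-1$ (rank $3$ here). It is semistable if $\mu(F) \leq \mu(\widetilde{\mathrm{syz}}\, I)$ for every nonzero coherent subsheaf $F$, where $\mu = c_1/\mathrm{rk}$. The restriction of $\widetilde{\mathrm{syz}}\, I$ to a line $H$ of $\mathbb{P}^2$ splits as $\mathcal{O}_H(p)\oplus\mathcal{O}_H(q)\oplus\mathcal{O}_H(r)$; the triple $(p,q,r)$ is the same for all general lines $H$ and is called the generic splitting type. A standard graded Artinian $K$-algebra $A$ has the weak Lefschetz property if there is a linear form $\ell$ such that $\times\ell: [A]_i\to[A]_{i+1}$ has maximal rank for all $i$. *)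

theory Defs
  imports
    "HOL-Analysis.Analysis"
    "HOL-Library.Poly_Mapping"
    "HOL-Algebra.QuotRing"
    "HOL-Algebra.Module"
begin

section \<open>The polynomial ring in three variables\<close>

text \<open>The variables are indexed by the three-element type \<open>3 = {0, 1, 2}\<close>; the exponent of a
  monomial is a finitely supported function \<open>3 \<Rightarrow>\<^sub>0 nat\<close>.\<close>

type_synonym 'k poly3 = "(3 \<Rightarrow>\<^sub>0 nat) \<Rightarrow>\<^sub>0 'k"

definition Var :: "3 \<Rightarrow> 'k::comm_ring_1 poly3"
  where "Var i = Poly_Mapping.single (Poly_Mapping.single i 1) 1"

definition Const :: "'k::comm_ring_1 \<Rightarrow> 'k poly3"
  where "Const a = Poly_Mapping.single 0 a"

definition mdeg :: "(3 \<Rightarrow>\<^sub>0 nat) \<Rightarrow> nat"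
  where "mdeg m = (\<Sum>i\<in>UNIV. Poly_Mapping.lookup m i)"

definition forms :: "int \<Rightarrow> 'k::comm_ring_1 poly3 set"
  where "forms t = {f. \<forall>m\<in>Poly_Mapping.keys f. int (mdeg m) = t}"

definition pdeg :: "'k::comm_ring_1 poly3 \<Rightarrow> nat"
  where "pdeg f = Max (mdeg ` Poly_Mapping.keys f)"

definition peval :: "'k::comm_ring_1 poly3 \<Rightarrow> (3 \<Rightarrow> 'k) \<Rightarrow> 'k"
  where "peval f c =
    (\<Sum>m\<in>Poly_Mapping.keys f. Poly_Mapping.lookup f m * (\<Prod>i\<in>UNIV. c i ^ Poly_Mapping.lookup m i))"

definition linear_form :: "(3 \<Rightarrow> 'k::comm_ring_1) \<Rightarrow> 'k poly3"
  where "linear_form c = (\<Sum>i\<in>UNIV. Const (c i) * Var i)"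

definition PR :: "'k::comm_ring_1 poly3 ring"
  where "PR = \<lparr>carrier = UNIV, mult = (*), one = 1, zero = 0, add = (+)\<rparr>"

section \<open>Graded modules over the polynomial ring\<close>

record ('a, 'm) gmodule = "('a, 'm) module" +
  piece :: "int \<Rightarrow> 'm set"

text \<open>\<open>twist n\<close> is \<open>R(n)\<close>, and \<open>gfree d\<close> is the direct sum of the \<open>R(- d\<^sub>i)\<close>.\<close>

definition twist :: "int \<Rightarrow> ('k::comm_ring_1 poly3, 'k poly3) gmodule"
  where "twist n = \<lparr>carrier = UNIV, mult = (*), one = 1, zero = 0, add = (+), smult = (*),
    piece = (\<lambda>t. forms (t + n))\<rparr>"

definition gfree :: "(int ^ 'n) \<Rightarrow> ('k::comm_ring_1 poly3, 'k poly3 ^ 'n) gmodule"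
  where "gfree d = \<lparr>carrier = UNIV, mult = undefined, one = undefined, zero = 0, add = (+),
    smult = (*s), piece = (\<lambda>t. {v. \<forall>i. v $ i \<in> forms (t - d $ i)})\<rparr>"

text \<open>The kernel of the map \<open>\<Oplus>R(- deg f\<^sub>i) \<rightarrow> R\<close>, \<open>v \<mapsto> \<Sum> v\<^sub>i f\<^sub>i\<close>, for a tuple \<open>f\<close> of nonzero forms.\<close>

definition syz :: "('k::comm_ring_1 poly3 ^ 'n) \<Rightarrow> ('k poly3, 'k poly3 ^ 'n) gmodule"
  where "syz f =
    (let G = gfree (\<chi> i. int (pdeg (f $ i))); Z = {v. (\<Sum>i\<in>UNIV. v $ i * f $ i) = 0}
     in G\<lparr>carrier := carrier G \<inter> Z, piece := (\<lambda>t. piece G t \<inter> Z)\<rparr>)"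

definition gquot :: "('a, 'm) gmodule \<Rightarrow> 'm set \<Rightarrow> ('a, 'm set) gmodule"
  where "gquot M N = \<lparr>carrier = a_rcosets\<^bsub>M\<^esub> N, mult = undefined, one = undefined,
    zero = N, add = set_add M, smult = (\<lambda>r A. \<Union>m\<in>A. N +>\<^bsub>M\<^esub> (r \<odot>\<^bsub>M\<^esub> m)),
    piece = (\<lambda>t. (\<lambda>m. N +>\<^bsub>M\<^esub> m) ` piece M t)\<rparr>"

section \<open>The projective plane and sheafification\<close>

text \<open>The projective plane is the scheme \<open>Proj R\<close>: its points are the homogeneous prime ideals that
  do not contain the irrelevant ideal.  An ideal is homogeneous if it is generated by forms.\<close>

type_synonym 'k point = "'k poly3 set"

definition P2 :: "'k::comm_ring_1 point set"
  where "P2 = {p. primeideal p PR \<and> p = genideal PR (p \<inter> (\<Union>t. forms t)) \<and> \<not> range Var \<subseteq> p}"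

definition zopen :: "'k::comm_ring_1 point set \<Rightarrow> bool"
  where "zopen U \<longleftrightarrow> (\<exists>S \<subseteq> (\<Union>t. forms t). U = {p \<in> P2. \<not> S \<subseteq> p})"

text \<open>A germ of \<open>M~\<close> at \<open>p\<close> is an element of the degree-zero homogeneous localisation \<open>M\<^sub>(\<^sub>p\<^sub>)\<close>,
  represented as the equivalence class of a fraction \<open>m / f\<close> with \<open>m\<close> and \<open>f\<close> of the same degree.\<close>

type_synonym ('k, 'm) germ = "('m \<times> 'k poly3) set"

definition frac ::
    "('k::comm_ring_1 poly3, 'm) gmodule \<Rightarrow> 'k point \<Rightarrow> 'm \<Rightarrow> 'k poly3 \<Rightarrow> ('k, 'm) germ"
  where "frac M p m f = {(m', f'). (\<exists>e. m' \<in> piece M e \<and> f' \<in> forms e \<and> f' \<notin> p) \<and>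
    (\<exists>e. \<exists>h\<in>forms e. h \<notin> p \<and> h \<odot>\<^bsub>M\<^esub> (f' \<odot>\<^bsub>M\<^esub> m) = h \<odot>\<^bsub>M\<^esub> (f \<odot>\<^bsub>M\<^esub> m'))}"

definition germ_add ::
    "('k::comm_ring_1 poly3, 'm) gmodule \<Rightarrow> 'k point \<Rightarrow> ('k, 'm) germ \<Rightarrow> ('k, 'm) germ \<Rightarrow> ('k, 'm) germ"
  where "germ_add M p A B =
    (\<Union>(m, f)\<in>A. \<Union>(n, g)\<in>B. frac M p (g \<odot>\<^bsub>M\<^esub> m \<oplus>\<^bsub>M\<^esub> f \<odot>\<^bsub>M\<^esub> n) (f * g))"

definition germ_smult ::
    "('k::comm_ring_1 poly3, 'm) gmodule \<Rightarrow> 'k point \<Rightarrow> ('k, 'k poly3) germ \<Rightarrow> ('k, 'm) germ \<Rightarrow> ('k, 'm) germ"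
  where "germ_smult M p A B = (\<Union>(r, f)\<in>A. \<Union>(m, g)\<in>B. frac M p (r \<odot>\<^bsub>M\<^esub> m) (f * g))"

type_synonym ('k, 'm) sect = "'k point \<Rightarrow> ('k, 'm) germ"

text \<open>Sections over \<open>U\<close> are functions on \<open>U\<close> (extended by \<open>undefined\<close>) with values in the germs
  that are locally given by one fraction, so restriction of sections is \<open>restrict\<close>.\<close>

definition sections ::
    "('k::comm_ring_1 poly3, 'm) gmodule \<Rightarrow> 'k point set \<Rightarrow> ('k, 'm) sect set"
  where "sections M U = {s \<in> extensional U. \<forall>p\<in>U. \<exists>V m f e. zopen V \<and> p \<in> V \<and> V \<subseteq> U \<and>
    m \<in> piece M e \<and> f \<in> forms e \<and> (\<forall>q\<in>V. f \<notin> q \<and> s q = frac M q m f)}"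

definition struct_sheaf :: "'k::comm_ring_1 point set \<Rightarrow> ('k, 'k poly3) sect ring"  (\<open>\<O>\<close>)
  where "\<O> U = \<lparr>carrier = sections (twist 0) U,
    mult = (\<lambda>s t. \<lambda>p\<in>U. germ_smult (twist 0) p (s p) (t p)),
    one = (\<lambda>p\<in>U. frac (twist 0) p 1 1),
    zero = (\<lambda>p\<in>U. frac (twist 0) p 0 1),
    add = (\<lambda>s t. \<lambda>p\<in>U. germ_add (twist 0) p (s p) (t p))\<rparr>"

type_synonym ('k, 'm) sheaf = "'k point set \<Rightarrow> (('k, 'k poly3) sect, ('k, 'm) sect) module"

definition sheafify :: "('k::comm_ring_1 poly3, 'm) gmodule \<Rightarrow> ('k, 'm) sheaf"
  where "sheafify M U = \<lparr>carrier = sections M U, mult = undefined, one = undefined,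
    zero = (\<lambda>p\<in>U. frac M p \<zero>\<^bsub>M\<^esub> 1),
    add = (\<lambda>s t. \<lambda>p\<in>U. germ_add M p (s p) (t p)),
    smult = (\<lambda>s t. \<lambda>p\<in>U. germ_smult M p (s p) (t p))\<rparr>"

definition sheaf_iso :: "('k::comm_ring_1, 'm) sheaf \<Rightarrow> ('k, 'n) sheaf \<Rightarrow> bool"
  where "sheaf_iso E F \<longleftrightarrow> (\<exists>\<phi>. \<forall>U. zopen U \<longrightarrow>
    bij_betw (\<phi> U) (carrier (E U)) (carrier (F U)) \<and>
    (\<forall>s\<in>carrier (E U). \<forall>t\<in>carrier (E U). \<phi> U (s \<oplus>\<^bsub>E U\<^esub> t) = \<phi> U s \<oplus>\<^bsub>F U\<^esub> \<phi> U t) \<and>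
    (\<forall>a\<in>carrier (\<O> U). \<forall>s\<in>carrier (E U). \<phi> U (a \<odot>\<^bsub>E U\<^esub> s) = a \<odot>\<^bsub>F U\<^esub> \<phi> U s) \<and>
    (\<forall>V. zopen V \<and> V \<subseteq> U \<longrightarrow> (\<forall>s\<in>carrier (E U). \<phi> V (restrict s V) = restrict (\<phi> U s) V)))"

section \<open>Coherent subsheaves, rank, first Chern class, semistability\<close>

definition subsheaf ::
    "('k::comm_ring_1, 'm) sheaf \<Rightarrow> ('k point set \<Rightarrow> ('k, 'm) sect set) \<Rightarrow> bool"
  where "subsheaf E F \<longleftrightarrow> (\<forall>U. zopen U \<longrightarrow>
    submodule (F U) (\<O> U) (E U) \<and>
    (\<forall>V. zopen V \<and> V \<subseteq> U \<longrightarrow> (\<forall>s\<in>F U. restrict s V \<in> F V)) \<and>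
    (\<forall>s\<in>carrier (E U).
       (\<forall>p\<in>U. \<exists>V. zopen V \<and> p \<in> V \<and> V \<subseteq> U \<and> restrict s V \<in> F V) \<longrightarrow> s \<in> F U))"

text \<open>\<open>a\<^sub>0 e\<^sub>0 + \<dots> + a\<^sub>r\<^sub>-\<^sub>1 e\<^sub>r\<^sub>-\<^sub>1\<close> on \<open>W\<close>, where the \<open>e\<^sub>i\<close> are sections over some \<open>V \<supseteq> W\<close>.\<close>

definition lincomb ::
    "('k::comm_ring_1, 'm) sheaf \<Rightarrow> 'k point set \<Rightarrow> nat \<Rightarrow> (nat \<Rightarrow> ('k, 'k poly3) sect) \<Rightarrow>
     (nat \<Rightarrow> ('k, 'm) sect) \<Rightarrow> ('k, 'm) sect"
  where "lincomb E W r a e = (\<Oplus>\<^bsub>E W\<^esub>i\<in>{..<r}. a i \<odot>\<^bsub>E W\<^esub> restrict (e i) W)"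

definition finite_type ::
    "('k::comm_ring_1, 'm) sheaf \<Rightarrow> ('k point set \<Rightarrow> ('k, 'm) sect set) \<Rightarrow> bool"
  where "finite_type E F \<longleftrightarrow> (\<forall>p\<in>P2. \<exists>V r e. zopen V \<and> p \<in> V \<and> (\<forall>i<r. e i \<in> F V) \<and>
    (\<forall>W s q. zopen W \<and> W \<subseteq> V \<and> s \<in> F W \<and> q \<in> W \<longrightarrow>
       (\<exists>W' a. zopen W' \<and> q \<in> W' \<and> W' \<subseteq> W \<and> a \<in> {..<r} \<rightarrow> carrier (\<O> W') \<and>
          restrict s W' = lincomb E W' r a e)))"

text \<open>An \<open>\<O>\<close>-submodule of a coherent sheaf is coherent if and only if it is of finite type, because the
  finiteness condition on relations between sections is inherited from the ambient sheaf.\<close>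

definition coherent_subsheaf ::
    "('k::comm_ring_1, 'm) sheaf \<Rightarrow> ('k point set \<Rightarrow> ('k, 'm) sect set) \<Rightarrow> bool"
  where "coherent_subsheaf E F \<longleftrightarrow> subsheaf E F \<and> finite_type E F"

definition nonzero_subsheaf ::
    "('k::comm_ring_1, 'm) sheaf \<Rightarrow> ('k point set \<Rightarrow> ('k, 'm) sect set) \<Rightarrow> bool"
  where "nonzero_subsheaf E F \<longleftrightarrow> (\<exists>U. zopen U \<and> F U \<noteq> {\<zero>\<^bsub>E U\<^esub>})"

text \<open>\<open>e\<^sub>0, \<dots>, e\<^sub>r\<^sub>-\<^sub>1\<close> define an isomorphism from the \<open>r\<close>-th power of \<open>\<O>\<close> to \<open>F\<close> over \<open>V\<close>.\<close>

definition frame ::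
    "('k::comm_ring_1, 'm) sheaf \<Rightarrow> ('k point set \<Rightarrow> ('k, 'm) sect set) \<Rightarrow> 'k point set \<Rightarrow> nat \<Rightarrow>
     (nat \<Rightarrow> ('k, 'm) sect) \<Rightarrow> bool"
  where "frame E F V r e \<longleftrightarrow> e \<in> {..<r} \<rightarrow>\<^sub>E F V \<and>
    (\<forall>W. zopen W \<and> W \<subseteq> V \<longrightarrow>
      (\<forall>s\<in>F W. \<exists>!a. a \<in> {..<r} \<rightarrow>\<^sub>E carrier (\<O> W) \<and> s = lincomb E W r a e))"

definition is_rank ::
    "('k::comm_ring_1, 'm) sheaf \<Rightarrow> ('k point set \<Rightarrow> ('k, 'm) sect set) \<Rightarrow> nat \<Rightarrow> bool"
  where "is_rank E F r \<longleftrightarrow> (\<exists>V e. zopen V \<and> V \<noteq> {} \<and> frame E F V r e)"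

text \<open>An isomorphism from the \<open>r\<close>-th exterior power of \<open>F\<close> to \<open>L\<close> over \<open>U\<close>, where \<open>F\<close> is locally free of
  rank \<open>r\<close> and \<open>L\<close> is invertible over \<open>U\<close>.  By the universal property of exterior powers it is an
  alternating \<open>r\<close>-linear map of sheaves that sends local frames of \<open>F\<close> to local generators
  of \<open>L\<close>; it suffices to have one such frame around each point.\<close>

definition det_iso ::
    "('k::comm_ring_1, 'm) sheaf \<Rightarrow> ('k point set \<Rightarrow> ('k, 'm) sect set) \<Rightarrow> nat \<Rightarrow> ('k, 'n) sheaf \<Rightarrow>
     'k point set \<Rightarrow> ('k point set \<Rightarrow> (nat \<Rightarrow> ('k, 'm) sect) \<Rightarrow> ('k, 'n) sect) \<Rightarrow> bool"
  where "det_iso E F r L U \<delta> \<longleftrightarrow>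
    (\<forall>V. zopen V \<and> V \<subseteq> U \<longrightarrow> (\<forall>s \<in> {..<r} \<rightarrow>\<^sub>E F V.
       \<delta> V s \<in> carrier (L V) \<and>
       (\<forall>W. zopen W \<and> W \<subseteq> V \<longrightarrow> \<delta> W (\<lambda>i\<in>{..<r}. restrict (s i) W) = restrict (\<delta> V s) W) \<and>
       (\<forall>i<r. \<forall>t\<in>F V. \<delta> V (s(i := s i \<oplus>\<^bsub>E V\<^esub> t)) = \<delta> V s \<oplus>\<^bsub>L V\<^esub> \<delta> V (s(i := t))) \<and>
       (\<forall>i<r. \<forall>a\<in>carrier (\<O> V). \<delta> V (s(i := a \<odot>\<^bsub>E V\<^esub> s i)) = a \<odot>\<^bsub>L V\<^esub> \<delta> V s) \<and>
       (\<forall>i<r. \<forall>j<r. i \<noteq> j \<and> s i = s j \<longrightarrow> \<delta> V s = \<zero>\<^bsub>L V\<^esub>))) \<and>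
    (\<forall>p\<in>U. \<exists>V e. zopen V \<and> p \<in> V \<and> V \<subseteq> U \<and> frame E F V r e \<and>
       frame L (\<lambda>W. carrier (L W)) V 1 (\<lambda>i\<in>{..<1}. \<delta> V e))"

text \<open>Every point outside \<open>U\<close> has codimension at least two.\<close>

definition codim2_complement :: "'k::comm_ring_1 point set \<Rightarrow> bool"
  where "codim2_complement U \<longleftrightarrow> (\<forall>p\<in>P2 - U. \<exists>q0\<in>P2. \<exists>q1\<in>P2. q0 \<subset> q1 \<and> q1 \<subset> p)"

text \<open>A torsion-free coherent sheaf \<open>F\<close> on the projective plane is locally free outside a closed subset of
  codimension at least two; \<open>c\<^sub>1(F)\<close> is the integer \<open>c\<close> such that its determinant line bundle
  there is isomorphic to \<open>\<O>(c)\<close>.  Rank, first Chern class and slope exist and are unique for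
  nonzero coherent subsheaves of a vector bundle; they are stated as relations.\<close>

definition is_c1 ::
    "('k::comm_ring_1, 'm) sheaf \<Rightarrow> ('k point set \<Rightarrow> ('k, 'm) sect set) \<Rightarrow> int \<Rightarrow> bool"
  where "is_c1 E F c \<longleftrightarrow> (\<exists>r U \<delta>. is_rank E F r \<and> zopen U \<and> codim2_complement U \<and>
    det_iso E F r (sheafify (twist c)) U \<delta>)"

definition is_slope ::
    "('k::comm_ring_1, 'm) sheaf \<Rightarrow> ('k point set \<Rightarrow> ('k, 'm) sect set) \<Rightarrow> real \<Rightarrow> bool"
  where "is_slope E F \<mu> \<longleftrightarrow>
    (\<exists>r c. r > 0 \<and> is_rank E F r \<and> is_c1 E F c \<and> \<mu> = real_of_int c / real r)"

definition semistable :: "('k::comm_ring_1, 'm) sheaf \<Rightarrow> bool"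
  where "semistable E \<longleftrightarrow> (\<forall>F. coherent_subsheaf E F \<and> nonzero_subsheaf E F \<longrightarrow>
    (\<forall>\<mu> \<mu>'. is_slope E F \<mu> \<and> is_slope E (\<lambda>U. carrier (E U)) \<mu>' \<longrightarrow> \<mu> \<le> \<mu>'))"

section \<open>Generic splitting type\<close>

text \<open>The restriction of \<open>M~\<close> to the line \<open>H\<close> defined by \<open>l\<close> is the sheaf associated with
  \<open>M / l M = M \<otimes> R/l\<close>.  It is represented by its direct image on the projective plane; direct image
  along the closed immersion is fully faithful, so this does not change isomorphism.\<close>

definition restrict_line ::
    "'k::comm_ring_1 poly3 \<Rightarrow> ('k poly3, 'm) gmodule \<Rightarrow> ('k, 'm set) sheaf"
  where "restrict_line l M = sheafify (gquot M ((\<lambda>m. l \<odot>\<^bsub>M\<^esub> m) ` carrier M))"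

text \<open>For the general line \<open>H\<close>, the restriction of \<open>M~\<close> to \<open>H\<close> is the restriction of
  \<open>\<O>(p) \<oplus> \<O>(q) \<oplus> \<O>(r)\<close>.  Lines are points of the dual plane, and each nonempty open
  subset of the dual plane contains the nonvanishing locus of a nonzero form \<open>\<Phi>\<close>
  in the coefficients \<open>c\<close> of a linear form.\<close>

definition has_generic_splitting_type ::
    "('k::comm_ring_1 poly3, 'm) gmodule \<Rightarrow> int \<times> int \<times> int \<Rightarrow> bool"
  where "has_generic_splitting_type M = (\<lambda>(p, q, r). p \<le> q \<and> q \<le> r \<and>
    (\<exists>\<Phi> e. \<Phi> \<in> forms e \<and> \<Phi> \<noteq> 0 \<and>
      (\<forall>c. (\<exists>i. c i \<noteq> 0) \<and> peval \<Phi> c \<noteq> 0 \<longrightarrow>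
        sheaf_iso (restrict_line (linear_form c) M)
          (restrict_line (linear_form c) (gfree (vector [- p, - q, - r] :: int ^ 3))))))"

section \<open>Weak Lefschetz property\<close>

definition quot_piece :: "'k::comm_ring_1 poly3 set \<Rightarrow> nat \<Rightarrow> 'k poly3 set set"
  where "quot_piece I i = (\<lambda>f. I +>\<^bsub>PR\<^esub> f) ` forms (int i)"

definition weak_lefschetz :: "'k::comm_ring_1 poly3 set \<Rightarrow> bool"
  where "weak_lefschetz I \<longleftrightarrow> (\<exists>l\<in>forms 1. \<forall>i.
    let \<mu> = (\<lambda>A. (I +>\<^bsub>PR\<^esub> l) \<otimes>\<^bsub>PR Quot I\<^esub> A)
    in inj_on \<mu> (quot_piece I i) \<or> \<mu> ` quot_piece I i = quot_piece I (Suc i))"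

end

theory Submission imports Defs begin

text \<open>
  Write \<open>s\<close> for the sum of all exponents, and let \<open>f\<^sub>1, \<dots>, f\<^sub>4\<close> be the four monomials.

  The torus acts on the plane and preserves the four monomials up to constants, and all lines that avoid the
  three coordinate points are equivalent under it.  So the splitting type is that of the bundle on any one of
  these lines, and the lines are general in the sense that the product of their three coefficients does not
  vanish.  On such a line the monomials become products of powers of the binary forms \<open>x\<close>, \<open>y\<close> and
  \<open>x + y\<close>, dehomogenized to \<open>t\<close>, \<open>1\<close> and \<open>1 + t\<close>.  Their module of syzygies is free, with a homogeneous
  basis in degrees \<open>\<delta>\<^sub>0 \<le> \<delta>\<^sub>1 \<le> \<delta>\<^sub>2\<close> of sum \<open>s\<close> (\<open>graded_basis_exists\<close>), and the splitting type is
  \<open>(- \<delta>\<^sub>2, - \<delta>\<^sub>1, - \<delta>\<^sub>0)\<close> (\<open>splitting\<close>, \<open>generic_splitting_type\<close>).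

  Semistability enters only through numerical inequalities (\<open>slope_bounds_of_semistable\<close>).  The whole bundle has
  slope \<open>- s / 3\<close>.  The Koszul syzygies of three of the monomials generate a subsheaf of rank two whose first
  Chern class is minus the sum of the three degrees, and a syzygy between two monomials generates a subsheaf of
  rank one whose slope is minus the degree of their least common multiple.  Hence each degree is at most
  \<open>s / 3\<close>, and each least common multiple of two of the monomials has degree at least \<open>s / 3\<close>.  To compute these
  slopes, a subsheaf is given by a graded submodule with a volume form, that is, an alternating multilinear map
  for which Cramer's rule holds; its degree is the first Chern class (\<open>slope_of_volume_form\<close>).

  The theorem of Grauert and Muelich, that consecutive entries of the splitting type differ by at most one, is
  proved directly.  The derivation \<open>x y (\<partial>\<^sub>x - \<partial>\<^sub>y)\<close> multiplies each of the binary forms by a linear form.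
  Hence it acts on the syzygies and raises the degree by one.  If some gap in the degrees \<open>\<delta>\<close> were at least two,
  the basis elements below the gap would span a stable submodule.  Its Pluecker coordinates, multiplied by the
  forms, would be constant multiples of a single polynomial, whose divisibility by the monomials forces the degrees below the gap
  to be too large for the inequalities (\<open>first_gap\<close>, \<open>second_gap\<close>).

  Now the sum \<open>s\<close> determines the degrees, except that \<open>s = 3 k\<close> allows both \<open>(k, k, k)\<close> and \<open>(k - 1, k, k + 1)\<close>
  (\<open>basis_degrees\<close>).  Here the weak Lefschetz property decides.  Multiplication by the linear form of a general line
  is injective from degree \<open>i\<close> to degree \<open>i + 1\<close> if there are no syzygies of degree \<open>i + 1\<close> on the line, and it
  is surjective if the binary forms generate everything in degree \<open>i + 1\<close>.  For \<open>(k, k, k)\<close> one of the two holds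
  in each degree (\<open>weak_lefschetz_of_balanced\<close>).  For \<open>(k - 1, k, k + 1)\<close> the map from degree \<open>k - 2\<close> to degree
  \<open>k - 1\<close> is neither injective, because of the first basis element, nor surjective, because of the last one
  (\<open>balanced_of_weak_lefschetz\<close>).  It suffices to consider linear forms in which all variables occur, because
  maximal rank is inherited by them (\<open>general_linear_form\<close>).
\<close>

section \<open>Germs of graded modules\<close>

lemma PR_simps [simp]: "carrier PR = UNIV" "mult PR = (*)" "one PR = 1" "zero PR = 0" "add PR = (+)"
  by (simp_all add: PR_def)

lemma forms_zero [simp]: "0 \<in> forms t"
  by (simp add: forms_def)

lemma forms_add: "f \<in> forms t \<Longrightarrow> g \<in> forms t \<Longrightarrow> f + g \<in> forms t"
  using Poly_Mapping.keys_add[of f g] by (auto simp: forms_def)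

lemma forms_uminus: "f \<in> forms t \<Longrightarrow> - f \<in> forms t"
  by (simp add: forms_def)

lemma forms_diff: "f \<in> forms t \<Longrightarrow> g \<in> forms t \<Longrightarrow> f - g \<in> forms t"
  using forms_add[of f t "- g"] forms_uminus[of g t] by simp

lemma mdeg_add: "mdeg (m + n) = mdeg m + mdeg n"
  by (simp add: mdeg_def lookup_add sum.distrib)

lemma forms_mult: "f \<in> forms s \<Longrightarrow> g \<in> forms t \<Longrightarrow> f * g \<in> forms (s + t)"
  using keys_mult[of f g] by (fastforce simp: forms_def mdeg_add)

lemma forms_one [simp]: "1 \<in> forms 0"
  by (auto simp: forms_def mdeg_def)

lemma forms_power: "f \<in> forms s \<Longrightarrow> f ^ n \<in> forms (int n * s)"
  by (induction n) (auto intro: forms_mult simp: algebra_simps dest: forms_mult)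

lemma forms_sum: "(\<And>i. i \<in> A \<Longrightarrow> f i \<in> forms t) \<Longrightarrow> sum f A \<in> forms t"
  by (induction A rule: infinite_finite_induct) (auto intro: forms_add)

lemma forms_prod: "(\<And>i. i \<in> A \<Longrightarrow> f i \<in> forms (t i)) \<Longrightarrow> prod f A \<in> forms (sum t A)"
  by (induction A rule: infinite_finite_induct) (auto intro: forms_mult)

lemma Var_forms [simp]: "Var i \<in> forms 1"
  by (auto simp: forms_def Var_def mdeg_def lookup_single when_def simp flip: of_nat_sum)

lemma Const_forms [simp]: "Const a \<in> forms 0"
  by (auto simp: forms_def Const_def mdeg_def)

lemma P2_prime: "p \<in> P2 \<Longrightarrow> primeideal p PR"
  by (simp add: P2_def)

lemma P2_mult: assumes "p \<in> P2" "f \<notin> p" "g \<notin> p" shows "f * g \<notin> p"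
  using primeideal.I_prime[OF P2_prime[OF assms(1)], of f g] assms by auto

lemma P2_one: assumes "p \<in> P2" shows "1 \<notin> p"
proof
  interpret primeideal p PR by (rule P2_prime[OF assms])
  assume "1 \<in> p"
  then have "p = carrier PR" using one_imp_carrier by simp
  then show False using I_notcarr by simp
qed

lemma P2_zero: assumes "p \<in> P2" shows "0 \<in> p"
proof -
  interpret primeideal p PR by (rule P2_prime[OF assms])
  show ?thesis using additive_subgroup.zero_closed[OF is_additive_subgroup] by simp
qed

lemma P2_multI: assumes "p \<in> P2" "f \<in> p" shows "g * f \<in> p" "f * g \<in> p"
proof -
  interpret primeideal p PR by (rule P2_prime[OF assms(1)])
  show "g * f \<in> p" "f * g \<in> p" using I_l_closed[of f g] I_r_closed[of f g] assms by auto
qed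

lemma P2_mult_iff: "p \<in> P2 \<Longrightarrow> f * g \<notin> p \<longleftrightarrow> f \<notin> p \<and> g \<notin> p"
  using P2_mult P2_multI by blast

lemma P2_power: "p \<in> P2 \<Longrightarrow> f \<notin> p \<Longrightarrow> f ^ n \<notin> p"
  by (induction n) (auto simp: P2_mult P2_one)

lemma P2_prod: "p \<in> P2 \<Longrightarrow> (\<And>i. i \<in> A \<Longrightarrow> f i \<notin> p) \<Longrightarrow> prod f A \<notin> p"
  by (induction A rule: infinite_finite_induct) (auto simp: P2_mult P2_one)

lemma P2_Var: "p \<in> P2 \<Longrightarrow> \<exists>i. Var i \<notin> p"
  by (auto simp: P2_def)

lemma zopen_subset: "zopen U \<Longrightarrow> U \<subseteq> P2"
  by (auto simp: zopen_def)

lemma zopen_nonvanishing: "h \<in> forms e \<Longrightarrow> zopen {p \<in> P2. h \<notin> p}"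
  unfolding zopen_def by (rule exI[of _ "{h}"]) auto

lemma zopen_P2: "zopen P2"
  unfolding zopen_def
  by (rule exI[of _ "{1}"]) (use P2_one in \<open>auto intro: exI[of _ 0]\<close>)

lemma zopen_Int: assumes "zopen U" "zopen V" shows "zopen (U \<inter> V)"
proof -
  obtain S T where S: "S \<subseteq> (\<Union>t. forms t)" "U = {p \<in> P2. \<not> S \<subseteq> p}"
    and T: "T \<subseteq> (\<Union>t. forms t)" "V = {p \<in> P2. \<not> T \<subseteq> p}"
    using assms by (auto simp: zopen_def)
  let ?Q = "{s * t |s t. s \<in> S \<and> t \<in> T}"
  have "?Q \<subseteq> (\<Union>t. forms t)" 
  proof clarify
    fix s t assume "s \<in> S" "t \<in> T"
    then obtain d e where "s \<in> forms d" "t \<in> forms e" using S(1) T(1) by blast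
    then show "s * t \<in> (\<Union>t. forms t)" using forms_mult by blast
  qed
  moreover have "U \<inter> V = {p \<in> P2. \<not> ?Q \<subseteq> p}"
  proof (rule Set.set_eqI)
    fix p
    show "p \<in> U \<inter> V \<longleftrightarrow> p \<in> {p \<in> P2. \<not> ?Q \<subseteq> p}"
    proof
      assume "p \<in> U \<inter> V"
      then obtain s t where "p \<in> P2" "s \<in> S" "s \<notin> p" "t \<in> T" "t \<notin> p"
        unfolding S(2) T(2) by auto
      then show "p \<in> {p \<in> P2. \<not> ?Q \<subseteq> p}" using P2_mult[of p s t] by blast
    next
      assume "p \<in> {p \<in> P2. \<not> ?Q \<subseteq> p}"
      then obtain s t where "p \<in> P2" "s \<in> S" "t \<in> T" "s * t \<notin> p" by auto
      then show "p \<in> U \<inter> V" unfolding S(2) T(2) using P2_multI[of p] by auto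
    qed
  qed
  ultimately show ?thesis unfolding zopen_def by blast
qed

text \<open>Only the laws that the calculus of fractions needs are required, so that quotients of graded
  modules qualify as soon as representatives can be chosen.\<close>

locale germ_module =
  fixes M :: "('k::comm_ring_1 poly3, 'm) gmodule" (structure)
  assumes piece_carrier: "x \<in> piece M e \<Longrightarrow> x \<in> carrier M"
    and add_piece: "x \<in> piece M e \<Longrightarrow> y \<in> piece M e \<Longrightarrow> x \<oplus> y \<in> piece M e"
    and smult_piece: "r \<in> forms d \<Longrightarrow> x \<in> piece M e \<Longrightarrow> r \<odot> x \<in> piece M (d + e)"
    and smult_closed: "x \<in> carrier M \<Longrightarrow> r \<odot> x \<in> carrier M"
    and smult_assoc: "x \<in> carrier M \<Longrightarrow> r \<odot> (s \<odot> x) = (r * s) \<odot> x"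
    and smult_distrib: "x \<in> carrier M \<Longrightarrow> y \<in> carrier M \<Longrightarrow> r \<odot> (x \<oplus> y) = r \<odot> x \<oplus> r \<odot> y"
    and smult_one: "x \<in> carrier M \<Longrightarrow> 1 \<odot> x = x"

definition isfrac :: "('k::comm_ring_1 poly3, 'm) gmodule \<Rightarrow> 'k point \<Rightarrow> 'm \<Rightarrow> 'k poly3 \<Rightarrow> bool"
  where "isfrac M p m f \<longleftrightarrow> (\<exists>e. m \<in> piece M e \<and> f \<in> forms e \<and> f \<notin> p)"

lemma isfracI: "m \<in> piece M e \<Longrightarrow> f \<in> forms e \<Longrightarrow> f \<notin> p \<Longrightarrow> isfrac M p m f"
  by (auto simp: isfrac_def)

lemma frac_mem_iff: "(m', f') \<in> frac M p m f \<longleftrightarrow> isfrac M p m' f' \<and>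
    (\<exists>e. \<exists>h\<in>forms e. h \<notin> p \<and> h \<odot>\<^bsub>M\<^esub> (f' \<odot>\<^bsub>M\<^esub> m) = h \<odot>\<^bsub>M\<^esub> (f \<odot>\<^bsub>M\<^esub> m'))"
  by (simp add: frac_def isfrac_def)

context germ_module
begin

lemma isfrac_carrier: "isfrac M p m f \<Longrightarrow> m \<in> carrier M"
  by (auto simp: isfrac_def piece_carrier)

lemma frac_refl: assumes "p \<in> P2" "isfrac M p m f" shows "(m, f) \<in> frac M p m f"
  using assms P2_one[OF assms(1)] by (auto simp: frac_mem_iff intro!: exI[of _ 0] bexI[of _ 1])

text \<open>Equality of fractions is transitive because the denominator in the middle, which does not vanish at
  the point, may be absorbed into the form that witnesses the equality.\<close>

lemma frac_eqv_trans:
  assumes p: "p \<in> P2" and "isfrac M p m f" "isfrac M p m' f'" "isfrac M p m'' f''"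
    and h: "h \<in> forms d" "h \<notin> p" "h \<odot> (f' \<odot> m) = h \<odot> (f \<odot> m')"
    and g: "g \<in> forms e" "g \<notin> p" "g \<odot> (f'' \<odot> m') = g \<odot> (f' \<odot> m'')"
  shows "\<exists>e. \<exists>h\<in>forms e. h \<notin> p \<and> h \<odot> (f'' \<odot> m) = h \<odot> (f \<odot> m'')"
proof -
  note c = assms(2-4)[THEN isfrac_carrier]
  obtain b where f': "f' \<in> forms b" "f' \<notin> p" using assms(3) by (auto simp: isfrac_def)
  have h': "(h * f') \<odot> m = (h * f) \<odot> m'" using h(3) c by (simp add: smult_assoc)
  have g': "(g * f'') \<odot> m' = (g * f') \<odot> m''" using g(3) c by (simp add: smult_assoc)
  have "(h * g * f') \<odot> (f'' \<odot> m) = (g * f'') \<odot> ((h * f') \<odot> m)"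
    using c by (simp add: smult_assoc mult_ac)
  also have "\<dots> = (h * f) \<odot> ((g * f'') \<odot> m')"
    unfolding h' using c by (simp add: smult_assoc mult_ac)
  also have "\<dots> = (h * g * f') \<odot> (f \<odot> m'')"
    unfolding g' using c by (simp add: smult_assoc mult_ac)
  finally show ?thesis
    using forms_mult[OF forms_mult[OF h(1) g(1)] f'(1)] P2_mult[OF p P2_mult[OF p h(2) g(2)] f'(2)] by blast
qed

lemma frac_eq_iff:
  assumes p: "p \<in> P2" and m: "isfrac M p m f" and m': "isfrac M p m' f'"
  shows "frac M p m f = frac M p m' f' \<longleftrightarrow>
    (\<exists>e. \<exists>h\<in>forms e. h \<notin> p \<and> h \<odot> (f' \<odot> m) = h \<odot> (f \<odot> m'))"
proof
  assume "frac M p m f = frac M p m' f'"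
  then have "(m', f') \<in> frac M p m f" using frac_refl[OF p m'] by simp
  then show "\<exists>e. \<exists>h\<in>forms e. h \<notin> p \<and> h \<odot> (f' \<odot> m) = h \<odot> (f \<odot> m')" by (simp add: frac_mem_iff)
next
  assume "\<exists>e. \<exists>h\<in>forms e. h \<notin> p \<and> h \<odot> (f' \<odot> m) = h \<odot> (f \<odot> m')"
  then obtain e h where h: "h \<in> forms e" "h \<notin> p" "h \<odot> (f' \<odot> m) = h \<odot> (f \<odot> m')" by blast
  show "frac M p m f = frac M p m' f'"
  proof (rule Set.set_eqI, clarify)
    fix n g
    show "(n, g) \<in> frac M p m f \<longleftrightarrow> (n, g) \<in> frac M p m' f'"
    proof
      assume "(n, g) \<in> frac M p m f"
      then show "(n, g) \<in> frac M p m' f'"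
        using frac_eqv_trans[OF p m' m _ h(1,2) h(3)[symmetric]] by (auto simp: frac_mem_iff)
    next
      assume "(n, g) \<in> frac M p m' f'"
      then show "(n, g) \<in> frac M p m f"
        using frac_eqv_trans[OF p m m' _ h(1,2) h(3)] by (auto simp: frac_mem_iff)
    qed
  qed
qed

lemma frac_eqI:
  assumes "p \<in> P2" "isfrac M p m f" "isfrac M p m' f'" "f' \<odot> m = f \<odot> m'"
  shows "frac M p m f = frac M p m' f'"
  unfolding frac_eq_iff[OF assms(1-3)]
  using assms(4) P2_one[OF assms(1)] by (intro exI[of _ 0] bexI[of _ 1]) auto

lemma frac_mem_eq:
  assumes "p \<in> P2" "isfrac M p m f" "(m', f') \<in> frac M p m f"
  shows "isfrac M p m' f'" "frac M p m' f' = frac M p m f"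
  using assms frac_eq_iff[OF assms(1,2), of m' f'] by (auto simp: frac_mem_iff)

lemma isfrac_smult:
  "p \<in> P2 \<Longrightarrow> isfrac M p m f \<Longrightarrow> h \<in> forms e \<Longrightarrow> h \<notin> p \<Longrightarrow> isfrac M p (h \<odot> m) (h * f)"
  unfolding isfrac_def using smult_piece forms_mult P2_mult by blast

lemma frac_cancel:
  assumes "p \<in> P2" "isfrac M p m f" "h \<in> forms e" "h \<notin> p"
  shows "frac M p (h \<odot> m) (h * f) = frac M p m f"
  using assms isfrac_carrier[OF assms(2)]
  by (intro frac_eqI isfrac_smult) (auto simp: smult_assoc mult_ac)

lemma isfrac_add:
  assumes "p \<in> P2" "isfrac M p m f" "isfrac M p n g"
  shows "isfrac M p (g \<odot> m \<oplus> f \<odot> n) (f * g)"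
proof -
  obtain d e where *: "m \<in> piece M d" "f \<in> forms d" "f \<notin> p" "n \<in> piece M e" "g \<in> forms e" "g \<notin> p"
    using assms by (auto simp: isfrac_def)
  have "g \<odot> m \<in> piece M (d + e)" "f \<odot> n \<in> piece M (d + e)"
    using smult_piece[OF *(5,1)] smult_piece[OF *(2,4)] by (simp_all add: add.commute)
  then show ?thesis
    using * assms(1) by (intro isfracI[of _ _ "d + e"] add_piece forms_mult P2_mult)
qed

lemma germ_add_frac:
  assumes p: "p \<in> P2" and m: "isfrac M p m f" and n: "isfrac M p n g"
  shows "germ_add M p (frac M p m f) (frac M p n g) = frac M p (g \<odot> m \<oplus> f \<odot> n) (f * g)"
proof -
  have *: "frac M p (g1 \<odot> m1 \<oplus> f1 \<odot> n1) (f1 * g1) = frac M p (g \<odot> m \<oplus> f \<odot> n) (f * g)"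
    if m1: "(m1, f1) \<in> frac M p m f" and n1: "(n1, g1) \<in> frac M p n g" for m1 f1 n1 g1
  proof -
    note i = frac_mem_eq(1)[OF p m m1] frac_mem_eq(1)[OF p n n1]
    note c = isfrac_carrier[OF m] isfrac_carrier[OF n] i[THEN isfrac_carrier]
    obtain d h where h: "h \<in> forms d" "h \<notin> p" "(h * f1) \<odot> m = (h * f) \<odot> m1"
      using m1 c by (auto simp: frac_mem_iff smult_assoc)
    obtain e k where k: "k \<in> forms e" "k \<notin> p" "(k * g1) \<odot> n = (k * g) \<odot> n1"
      using n1 c by (auto simp: frac_mem_iff smult_assoc)
    have "(h * k) \<odot> ((f * g) \<odot> (g1 \<odot> m1 \<oplus> f1 \<odot> n1)) =
        (k * g * g1) \<odot> ((h * f) \<odot> m1) \<oplus> (h * f * f1) \<odot> ((k * g) \<odot> n1)"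
      using c by (simp add: smult_distrib smult_assoc smult_closed mult_ac)
    also have "\<dots> = (k * g * g1) \<odot> ((h * f1) \<odot> m) \<oplus> (h * f * f1) \<odot> ((k * g1) \<odot> n)"
      by (simp only: h(3) k(3))
    also have "\<dots> = (h * k) \<odot> ((f1 * g1) \<odot> (g \<odot> m \<oplus> f \<odot> n))"
      using c by (simp add: smult_distrib smult_assoc smult_closed mult_ac)
    finally show ?thesis
      using frac_eq_iff[OF p isfrac_add[OF p i] isfrac_add[OF p m n]]
        forms_mult[OF h(1) k(1)] P2_mult[OF p h(2) k(2)] by metis
  qed
  show ?thesis
    unfolding germ_add_def using * frac_refl[OF p m] frac_refl[OF p n] by fast
qed

end

text \<open>Sections of \<open>\<O>\<close> are germs of \<open>twist 0\<close>, and determinants take their values in \<open>twist c\<close>.\<close>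

lemma twist_simps [simp]: "carrier (twist n) = UNIV" "mult (twist n) = (*)" "one (twist n) = 1"
  "zero (twist n) = 0" "add (twist n) = (+)" "smult (twist n) = (*)" "piece (twist n) t = forms (t + n)"
  by (simp_all add: twist_def)

lemma germ_module_twist: "germ_module (twist n)"
  by unfold_locales (auto simp: algebra_simps forms_add dest: forms_mult)

context germ_module
begin

lemma isfrac_germ_smult:
  assumes "p \<in> P2" "isfrac (twist 0) p r f" "isfrac M p m g"
  shows "isfrac M p (r \<odot> m) (f * g)"
proof -
  obtain d e where *: "r \<in> forms d" "f \<in> forms d" "f \<notin> p" "m \<in> piece M e" "g \<in> forms e" "g \<notin> p"
    using assms by (auto simp: isfrac_def)
  then show ?thesis using assms(1) by (intro isfracI[of _ _ "d + e"] smult_piece forms_mult P2_mult)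
qed

lemma germ_smult_frac:
  assumes p: "p \<in> P2" and r: "isfrac (twist 0) p r f" and m: "isfrac M p m g"
  shows "germ_smult M p (frac (twist 0) p r f) (frac M p m g) = frac M p (r \<odot> m) (f * g)"
proof -
  interpret T: germ_module "twist 0" by (rule germ_module_twist)
  have *: "frac M p (r1 \<odot> m1) (f1 * g1) = frac M p (r \<odot> m) (f * g)"
    if r1: "(r1, f1) \<in> frac (twist 0) p r f" and m1: "(m1, g1) \<in> frac M p m g" for r1 f1 m1 g1
  proof -
    note i = T.frac_mem_eq(1)[OF p r r1] frac_mem_eq(1)[OF p m m1]
    note c = isfrac_carrier[OF m] i(2)[THEN isfrac_carrier]
    obtain d h where h: "h \<in> forms d" "h \<notin> p" "h * (f1 * r) = h * (f * r1)"
      using r1 by (auto simp: frac_mem_iff)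
    obtain e k where k: "k \<in> forms e" "k \<notin> p" "(k * g1) \<odot> m = (k * g) \<odot> m1"
      using m1 c by (auto simp: frac_mem_iff smult_assoc)
    have "(h * k) \<odot> ((f * g) \<odot> (r1 \<odot> m1)) = (h * (f * r1)) \<odot> ((k * g) \<odot> m1)"
      using c by (simp add: smult_assoc smult_closed mult_ac)
    also have "\<dots> = (h * (f1 * r)) \<odot> ((k * g1) \<odot> m)"
      by (simp only: h(3) k(3))
    also have "\<dots> = (h * k) \<odot> ((f1 * g1) \<odot> (r \<odot> m))"
      using c by (simp add: smult_assoc smult_closed mult_ac)
    finally show ?thesis
      using frac_eq_iff[OF p isfrac_germ_smult[OF p i] isfrac_germ_smult[OF p r m]]
        forms_mult[OF h(1) k(1)] P2_mult[OF p h(2) k(2)] by metis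
  qed
  show ?thesis
    unfolding germ_smult_def using * T.frac_refl[OF p r] frac_refl[OF p m] by fast
qed

lemma sectionsD:
  assumes "s \<in> sections M U" "p \<in> U"
  obtains V m e f where "zopen V" "p \<in> V" "V \<subseteq> U" "m \<in> piece M e" "f \<in> forms e"
    "\<forall>q\<in>V. f \<notin> q \<and> s q = frac M q m f \<and> isfrac M q m f"
proof -
  obtain V m f e where *: "zopen V" "p \<in> V" "V \<subseteq> U" "m \<in> piece M e" "f \<in> forms e"
    "\<forall>q\<in>V. f \<notin> q \<and> s q = frac M q m f"
    using assms unfolding sections_def by blast
  then show thesis by (intro that[of V m e f]) (auto intro: isfracI)
qed

lemma section_germ:
  assumes "s \<in> sections M U" "p \<in> U"
  obtains m f where "isfrac M p m f" "s p = frac M p m f"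
  by (rule sectionsD[OF assms]) (use assms(2) in blast)

end

lemma sectionsI:
  assumes "s \<in> extensional U"
    and "\<And>p. p \<in> U \<Longrightarrow> \<exists>V m f e. zopen V \<and> p \<in> V \<and> V \<subseteq> U \<and> m \<in> piece M e \<and> f \<in> forms e \<and>
      (\<forall>q\<in>V. f \<notin> q \<and> s q = frac M q m f)"
  shows "s \<in> sections M U"
  using assms unfolding sections_def by blast

lemma sections_extensional: "s \<in> sections M U \<Longrightarrow> s \<in> extensional U"
  by (simp add: sections_def)

section \<open>Isomorphisms of associated sheaves\<close>

text \<open>Sheaves associated with graded modules are isomorphic as soon as homogeneous elements correspond
  under a relation which is one-to-one and, up to forms that do not vanish at a given point, total on
  both sides.  Working with a relation makes the situation symmetric, so that the inverse
  isomorphism comes from the converse relation.\<close>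

locale local_correspondence = A: germ_module A + B: germ_module B
  for A :: "('k::comm_ring_1 poly3, 'm) gmodule" and B :: "('k poly3, 'n) gmodule" +
  fixes T :: "int \<Rightarrow> 'm \<Rightarrow> 'n \<Rightarrow> bool"
  assumes T_piece: "T e m n \<Longrightarrow> m \<in> piece A e \<and> n \<in> piece B e"
    and T_add: "T e m n \<Longrightarrow> T e m' n' \<Longrightarrow> T e (m \<oplus>\<^bsub>A\<^esub> m') (n \<oplus>\<^bsub>B\<^esub> n')"
    and T_smult: "T e m n \<Longrightarrow> r \<in> forms d \<Longrightarrow> T (d + e) (r \<odot>\<^bsub>A\<^esub> m) (r \<odot>\<^bsub>B\<^esub> n)"
    and T_inj: "T e m n \<Longrightarrow> T e m' n \<Longrightarrow> m = m'"
    and T_fun: "T e m n \<Longrightarrow> T e m n' \<Longrightarrow> n = n'"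
    and T_total: "m \<in> piece A e \<Longrightarrow> p \<in> P2 \<Longrightarrow> \<exists>d. \<exists>h\<in>forms d. h \<notin> p \<and> (\<exists>n. T (d + e) (h \<odot>\<^bsub>A\<^esub> m) n)"
    and T_surj: "n \<in> piece B e \<Longrightarrow> p \<in> P2 \<Longrightarrow> \<exists>d. \<exists>h\<in>forms d. h \<notin> p \<and> (\<exists>m. T (d + e) m (h \<odot>\<^bsub>B\<^esub> n))"
begin

text \<open>The fraction \<open>m / f\<close> goes to \<open>n / f\<close>, where \<open>n\<close> is the partner of \<open>m\<close>.  The choice is harmless, because
  equal fractions on the left have equal partners on the right.\<close>

definition germ_map :: "'k point \<Rightarrow> ('k, 'm) germ \<Rightarrow> ('k, 'n) germ"
  where "germ_map p G = (SOME H. \<exists>m n f e. T e m n \<and> f \<in> forms e \<and> f \<notin> p \<and> (m, f) \<in> G \<and> H = frac B p n f)"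

lemma germ_map_frac:
  assumes p: "p \<in> P2" and T: "T e m n" and f: "f \<in> forms e" "f \<notin> p"
  shows "germ_map p (frac A p m f) = frac B p n f"
proof -
  have i: "isfrac A p m f" "isfrac B p n f" using T_piece[OF T] f by (auto intro: isfracI)
  have "\<exists>m' n' f' e. T e m' n' \<and> f' \<in> forms e \<and> f' \<notin> p \<and> (m', f') \<in> frac A p m f \<and>
      germ_map p (frac A p m f) = frac B p n' f'"
    unfolding germ_map_def
    by (rule someI[where x = "frac B p n f"]) (use assms A.frac_refl[OF p i(1)] in blast)
  then obtain m' n' f' e' where *: "T e' m' n'" "f' \<in> forms e'" "f' \<notin> p" "(m', f') \<in> frac A p m f"
      "germ_map p (frac A p m f) = frac B p n' f'" by blast
  have i': "isfrac B p n' f'" using T_piece[OF *(1)] * by (auto intro: isfracI)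
  obtain d h where h: "h \<in> forms d" "h \<notin> p" "h \<odot>\<^bsub>A\<^esub> (f' \<odot>\<^bsub>A\<^esub> m) = h \<odot>\<^bsub>A\<^esub> (f \<odot>\<^bsub>A\<^esub> m')"
    using *(4) by (auto simp: frac_mem_iff)
  have "T (d + (e' + e)) (h \<odot>\<^bsub>A\<^esub> (f' \<odot>\<^bsub>A\<^esub> m)) (h \<odot>\<^bsub>B\<^esub> (f' \<odot>\<^bsub>B\<^esub> n))"
    "T (d + (e + e')) (h \<odot>\<^bsub>A\<^esub> (f \<odot>\<^bsub>A\<^esub> m')) (h \<odot>\<^bsub>B\<^esub> (f \<odot>\<^bsub>B\<^esub> n'))"
    using T *(1,2) f h(1) by (auto intro!: T_smult)
  then have "h \<odot>\<^bsub>B\<^esub> (f' \<odot>\<^bsub>B\<^esub> n) = h \<odot>\<^bsub>B\<^esub> (f \<odot>\<^bsub>B\<^esub> n')"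
    using T_fun h(3) by (metis add.commute)
  then have "frac B p n f = frac B p n' f'"
    unfolding B.frac_eq_iff[OF p i(2) i'] using h by blast
  then show ?thesis using *(5) by simp
qed

text \<open>Multiplying numerator and denominator by a form that does not vanish at the point makes the numerator
  acquire a partner, so that \<open>germ_map\<close> can be computed on every germ.\<close>

lemma germ_matched:
  assumes p: "p \<in> P2" and m: "m \<in> piece A e" "f \<in> forms e" "f \<notin> p"
  obtains h d n where "h \<in> forms d" "h \<notin> p" "T (d + e) (h \<odot>\<^bsub>A\<^esub> m) n" "frac A p m f = frac A p (h \<odot>\<^bsub>A\<^esub> m) (h * f)"
    "h * f \<in> forms (d + e)" "h * f \<notin> p"
proof -
  obtain h d n where h: "h \<in> forms d" "h \<notin> p" "T (d + e) (h \<odot>\<^bsub>A\<^esub> m) n"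
    using T_total[OF m(1) p] by blast
  then show ?thesis
    using m p that[of h d n] A.frac_cancel[OF p isfracI[OF m] h(1,2)] forms_mult[OF h(1) m(2)]
    by (simp add: P2_mult)
qed

lemma germ_map_add:
  assumes p: "p \<in> P2" and m: "isfrac A p m f" and n: "isfrac A p n g"
  shows "germ_map p (germ_add A p (frac A p m f) (frac A p n g)) =
    germ_add B p (germ_map p (frac A p m f)) (germ_map p (frac A p n g))"
proof -
  obtain d where m': "m \<in> piece A d" "f \<in> forms d" "f \<notin> p" using m by (auto simp: isfrac_def)
  obtain e where n': "n \<in> piece A e" "g \<in> forms e" "g \<notin> p" using n by (auto simp: isfrac_def)
  obtain h1 d1 m1 where 1: "h1 \<in> forms d1" "h1 \<notin> p" "T (d1 + d) (h1 \<odot>\<^bsub>A\<^esub> m) m1"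
    "frac A p m f = frac A p (h1 \<odot>\<^bsub>A\<^esub> m) (h1 * f)" "h1 * f \<in> forms (d1 + d)" "h1 * f \<notin> p"
    using germ_matched[OF p m'] .
  obtain h2 d2 n2 where 2: "h2 \<in> forms d2" "h2 \<notin> p" "T (d2 + e) (h2 \<odot>\<^bsub>A\<^esub> n) n2"
    "frac A p n g = frac A p (h2 \<odot>\<^bsub>A\<^esub> n) (h2 * g)" "h2 * g \<in> forms (d2 + e)" "h2 * g \<notin> p"
    using germ_matched[OF p n'] .
  note i = isfracI[OF _ 1(5,6)] isfracI[OF _ 2(5,6)]
  note t1 = T_piece[OF 1(3)] and t2 = T_piece[OF 2(3)]
  have "T (d1 + d + (d2 + e)) ((h2 * g) \<odot>\<^bsub>A\<^esub> (h1 \<odot>\<^bsub>A\<^esub> m) \<oplus>\<^bsub>A\<^esub> (h1 * f) \<odot>\<^bsub>A\<^esub> (h2 \<odot>\<^bsub>A\<^esub> n))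
      ((h2 * g) \<odot>\<^bsub>B\<^esub> m1 \<oplus>\<^bsub>B\<^esub> (h1 * f) \<odot>\<^bsub>B\<^esub> n2)"
    using T_smult[OF 1(3) 2(5)] T_smult[OF 2(3) 1(5)] by (intro T_add) (simp_all add: add_ac)
  then have "germ_map p (frac A p ((h2 * g) \<odot>\<^bsub>A\<^esub> (h1 \<odot>\<^bsub>A\<^esub> m) \<oplus>\<^bsub>A\<^esub> (h1 * f) \<odot>\<^bsub>A\<^esub> (h2 \<odot>\<^bsub>A\<^esub> n)) (h1 * f * (h2 * g)))
      = frac B p ((h2 * g) \<odot>\<^bsub>B\<^esub> m1 \<oplus>\<^bsub>B\<^esub> (h1 * f) \<odot>\<^bsub>B\<^esub> n2) (h1 * f * (h2 * g))"
    using 1 2 p by (intro germ_map_frac) (auto intro: forms_mult simp: P2_mult)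
  then show ?thesis
    unfolding 1(4) 2(4) germ_map_frac[OF p 1(3,5,6)] germ_map_frac[OF p 2(3,5,6)]
    using A.germ_add_frac[OF p i(1) i(2)] B.germ_add_frac[OF p i(1) i(2)] t1 t2 by auto
qed

lemma germ_map_smult:
  assumes p: "p \<in> P2" and r: "isfrac (twist 0) p r g" and m: "isfrac A p m f"
  shows "germ_map p (germ_smult A p (frac (twist 0) p r g) (frac A p m f)) =
    germ_smult B p (frac (twist 0) p r g) (germ_map p (frac A p m f))"
proof -
  obtain d where m': "m \<in> piece A d" "f \<in> forms d" "f \<notin> p" using m by (auto simp: isfrac_def)
  obtain e where r': "r \<in> forms e" "g \<in> forms e" "g \<notin> p" using r by (auto simp: isfrac_def)
  obtain h d1 m1 where 1: "h \<in> forms d1" "h \<notin> p" "T (d1 + d) (h \<odot>\<^bsub>A\<^esub> m) m1"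
    "frac A p m f = frac A p (h \<odot>\<^bsub>A\<^esub> m) (h * f)" "h * f \<in> forms (d1 + d)" "h * f \<notin> p"
    using germ_matched[OF p m'] .
  note i = isfracI[OF _ 1(5,6)]
  note t1 = T_piece[OF 1(3)]
  have "germ_map p (frac A p (r \<odot>\<^bsub>A\<^esub> (h \<odot>\<^bsub>A\<^esub> m)) (g * (h * f))) = frac B p (r \<odot>\<^bsub>B\<^esub> m1) (g * (h * f))"
    using 1 r' p by (intro germ_map_frac[OF _ T_smult]) (auto intro: forms_mult simp: P2_mult)
  then show ?thesis
    unfolding 1(4) germ_map_frac[OF p 1(3,5,6)]
    using A.germ_smult_frac[OF p r i] B.germ_smult_frac[OF p r i] t1 by auto
qed

lemma germ_map_section:
  assumes U: "zopen U" and s: "s \<in> sections A U"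
  shows "(\<lambda>p\<in>U. germ_map p (s p)) \<in> sections B U"
proof (rule sectionsI)
  fix p assume p: "p \<in> U"
  then have p2: "p \<in> P2" using zopen_subset[OF U] by auto
  obtain V m e f where V0: "zopen V" "p \<in> V" "V \<subseteq> U" "m \<in> piece A e" "f \<in> forms e"
    "\<forall>q\<in>V. f \<notin> q \<and> s q = frac A q m f \<and> isfrac A q m f"
    by (rule A.sectionsD[OF s p])
  have V: "zopen V" "p \<in> V" "V \<subseteq> U" "m \<in> piece A e" "f \<in> forms e"
    "\<And>q. q \<in> V \<Longrightarrow> f \<notin> q" "\<And>q. q \<in> V \<Longrightarrow> s q = frac A q m f" "\<And>q. q \<in> V \<Longrightarrow> isfrac A q m f"
    using V0 by auto
  obtain h d n where h: "h \<in> forms d" "h \<notin> p" "T (d + e) (h \<odot>\<^bsub>A\<^esub> m) n"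
    by (rule germ_matched[OF p2 V(4,5) V(6)[OF V(2)]])
  let ?W = "V \<inter> {q \<in> P2. h \<notin> q}"
  have "(h * f) \<notin> q \<and> (\<lambda>p\<in>U. germ_map p (s p)) q = frac B q n (h * f)" if "q \<in> ?W" for q
  proof -
    have q: "q \<in> P2" "q \<in> V" "h \<notin> q" "q \<in> U" using that V by auto
    have "s q = frac A q (h \<odot>\<^bsub>A\<^esub> m) (h * f)"
      using V(7)[OF q(2)] A.frac_cancel[OF q(1) V(8)[OF q(2)] h(1) q(3)] by simp
    then show ?thesis
      using q V(6)[OF q(2)] germ_map_frac[OF q(1) h(3) forms_mult[OF h(1) V(5)]] by (simp add: P2_mult)
  qed
  then show "\<exists>V m f e. zopen V \<and> p \<in> V \<and> V \<subseteq> U \<and> m \<in> piece B e \<and> f \<in> forms e \<and>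
      (\<forall>q\<in>V. f \<notin> q \<and> (\<lambda>p\<in>U. germ_map p (s p)) q = frac B q m f)"
    using V h p2 T_piece[OF h(3)]
    by (intro exI[of _ ?W] exI[of _ n] exI[of _ "h * f"] exI[of _ "d + e"])
       (auto intro: zopen_Int zopen_nonvanishing forms_mult)
qed auto

end

lemma local_correspondence_converse:
  assumes "local_correspondence A B T"
  shows "local_correspondence B A (\<lambda>e n m. T e m n)"
proof -
  interpret local_correspondence A B T by fact
  show ?thesis
    by unfold_locales
      (rule T_piece[THEN conj_commute[THEN iffD1]] T_add T_smult T_fun T_inj T_surj T_total; assumption)+
qed

lemma (in local_correspondence) germ_map_inverse:
  assumes p: "p \<in> P2" and m: "isfrac A p m f"
  shows "local_correspondence.germ_map A (\<lambda>e n m. T e m n) p (germ_map p (frac A p m f)) = frac A p m f"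
proof -
  interpret C: local_correspondence B A "\<lambda>e n m. T e m n"
    by (rule local_correspondence_converse) unfold_locales
  obtain d where m': "m \<in> piece A d" "f \<in> forms d" "f \<notin> p" using m by (auto simp: isfrac_def)
  obtain h d1 m1 where 1: "h \<in> forms d1" "h \<notin> p" "T (d1 + d) (h \<odot>\<^bsub>A\<^esub> m) m1"
    "frac A p m f = frac A p (h \<odot>\<^bsub>A\<^esub> m) (h * f)" "h * f \<in> forms (d1 + d)" "h * f \<notin> p"
    using germ_matched[OF p m'] .
  show ?thesis
    unfolding 1(4) germ_map_frac[OF p 1(3,5,6)] by (rule C.germ_map_frac[OF p 1(3,5,6)])
qed

theorem sheaf_iso_of_local_correspondence:
  fixes A :: "('k::comm_ring_1 poly3, 'm) gmodule" and B :: "('k poly3, 'n) gmodule"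
  assumes "local_correspondence A B T"
  shows "sheaf_iso (sheafify A) (sheafify B)"
proof -
  interpret local_correspondence A B T by fact
  interpret C: local_correspondence B A "\<lambda>e n m. T e m n"
    by (rule local_correspondence_converse) fact
  interpret O: germ_module "twist 0" by (rule germ_module_twist)
  let ?\<phi> = "\<lambda>U s. \<lambda>p\<in>U. germ_map p (s p)" and ?\<psi> = "\<lambda>U s. \<lambda>p\<in>U. C.germ_map p (s p)"
  have inv: "?\<psi> U (?\<phi> U s) = s" if U: "zopen U" and s: "s \<in> sections A U" for U s
  proof (rule extensionalityI[of _ U])
    fix p assume p: "p \<in> U"
    then have "p \<in> P2" using zopen_subset[OF U] by auto
    moreover obtain m f where "isfrac A p m f" "s p = frac A p m f" using A.section_germ[OF s p] .
    ultimately show "?\<psi> U (?\<phi> U s) p = s p" using p germ_map_inverse by simp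
  qed (use s sections_extensional in auto)
  have inv': "?\<phi> U (?\<psi> U s) = s" if U: "zopen U" and s: "s \<in> sections B U" for U s
  proof (rule extensionalityI[of _ U])
    fix p assume p: "p \<in> U"
    then have "p \<in> P2" using zopen_subset[OF U] by auto
    moreover obtain m f where "isfrac B p m f" "s p = frac B p m f" using B.section_germ[OF s p] .
    ultimately show "?\<phi> U (?\<psi> U s) p = s p" using p C.germ_map_inverse by simp
  qed (use s sections_extensional in auto)
  show ?thesis
    unfolding sheaf_iso_def
  proof (intro exI[of _ ?\<phi>] allI impI conjI ballI)
    fix U :: "'k poly3 set set" assume U: "zopen U"
    show "bij_betw (?\<phi> U) (carrier (sheafify A U)) (carrier (sheafify B U))"
      by (rule bij_betw_byWitness[of _ "?\<psi> U"])
        (use U inv inv' germ_map_section C.germ_map_section in \<open>auto simp: sheafify_def\<close>)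
    fix s t assume s: "s \<in> carrier (sheafify A U)"
    show "?\<phi> U (s \<oplus>\<^bsub>sheafify A U\<^esub> t) = ?\<phi> U s \<oplus>\<^bsub>sheafify B U\<^esub> ?\<phi> U t"
      if t: "t \<in> carrier (sheafify A U)"
    proof (rule extensionalityI[of _ U])
      fix p assume p: "p \<in> U"
      then have p2: "p \<in> P2" using zopen_subset[OF U] by auto
      obtain m f where m: "isfrac A p m f" "s p = frac A p m f"
        using A.section_germ[OF _ p] s by (auto simp: sheafify_def)
      obtain n g where n: "isfrac A p n g" "t p = frac A p n g"
        using A.section_germ[OF _ p] t by (auto simp: sheafify_def)
      show "?\<phi> U (s \<oplus>\<^bsub>sheafify A U\<^esub> t) p = (?\<phi> U s \<oplus>\<^bsub>sheafify B U\<^esub> ?\<phi> U t) p"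
        using p germ_map_add[OF p2 m(1) n(1)] m n by (simp add: sheafify_def)
    qed (auto simp: sheafify_def)
  next
    fix U :: "'k poly3 set set" and a s assume U: "zopen U"
      and a: "a \<in> carrier (\<O> U)" and s: "s \<in> carrier (sheafify A U)"
    show "?\<phi> U (a \<odot>\<^bsub>sheafify A U\<^esub> s) = a \<odot>\<^bsub>sheafify B U\<^esub> ?\<phi> U s"
    proof (rule extensionalityI[of _ U])
      fix p assume p: "p \<in> U"
      then have p2: "p \<in> P2" using zopen_subset[OF U] by auto
      obtain m f where m: "isfrac A p m f" "s p = frac A p m f"
        using A.section_germ[OF _ p] s by (auto simp: sheafify_def)
      obtain r g where r: "isfrac (twist 0) p r g" "a p = frac (twist 0) p r g"
        using O.section_germ[OF _ p] a by (auto simp: struct_sheaf_def)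
      show "?\<phi> U (a \<odot>\<^bsub>sheafify A U\<^esub> s) p = (a \<odot>\<^bsub>sheafify B U\<^esub> ?\<phi> U s) p"
        using p germ_map_smult[OF p2 r(1) m(1)] m r by (simp add: sheafify_def)
    qed (auto simp: sheafify_def)
  next
    fix U V :: "'k poly3 set set" and s assume "zopen U" "zopen V \<and> V \<subseteq> U"
    then show "?\<phi> V (restrict s V) = restrict (?\<phi> U s) V"
      by (auto simp: restrict_def fun_eq_iff)
  qed
qed

section \<open>Subsheaves defined by graded submodules\<close>

lemma sheafify_simps [simp]: "carrier (sheafify M U) = sections M U"
  "zero (sheafify M U) = (\<lambda>p\<in>U. frac M p \<zero>\<^bsub>M\<^esub> 1)"
  "add (sheafify M U) = (\<lambda>s t. \<lambda>p\<in>U. germ_add M p (s p) (t p))"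
  "smult (sheafify M U) = (\<lambda>s t. \<lambda>p\<in>U. germ_smult M p (s p) (t p))"
  by (simp_all add: sheafify_def)

lemma carrier_struct_sheaf [simp]: "carrier (\<O> U) = sections (twist 0) U"
  by (simp add: struct_sheaf_def)

text \<open>The subsheaf generated by the submodule with the homogeneous pieces \<open>N e\<close>: locally the numerators can be
  taken from \<open>N\<close>.\<close>

definition subsections ::
    "('k::comm_ring_1 poly3, 'm) gmodule \<Rightarrow> (int \<Rightarrow> 'm set) \<Rightarrow> 'k point set \<Rightarrow> ('k, 'm) sect set"
  where "subsections M N U = {s \<in> extensional U. \<forall>p\<in>U. \<exists>V m f e. zopen V \<and> p \<in> V \<and> V \<subseteq> U \<and>
    m \<in> N e \<and> f \<in> forms e \<and> (\<forall>q\<in>V. f \<notin> q \<and> s q = frac M q m f)}"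

lemma sections_eq_subsections: "sections M = subsections M (piece M)"
  by (simp add: sections_def subsections_def fun_eq_iff)

lemma subsectionsI:
  assumes "s \<in> extensional U"
    and "\<And>p. p \<in> U \<Longrightarrow> \<exists>V m f e. zopen V \<and> p \<in> V \<and> V \<subseteq> U \<and> m \<in> N e \<and> f \<in> forms e \<and>
      (\<forall>q\<in>V. f \<notin> q \<and> s q = frac M q m f)"
  shows "s \<in> subsections M N U"
  using assms unfolding subsections_def by blast

lemma subsectionsD:
  assumes "s \<in> subsections M N U" "p \<in> U"
  obtains V m e f where "zopen V" "p \<in> V" "V \<subseteq> U" "m \<in> N e" "f \<in> forms e"
    "\<forall>q\<in>V. f \<notin> q \<and> s q = frac M q m f"
  using assms unfolding subsections_def by blast

lemma subsections_extensional: "s \<in> subsections M N U \<Longrightarrow> s \<in> extensional U"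
  by (simp add: subsections_def)

lemma subsections_restrict:
  assumes s: "s \<in> subsections M N U" and V: "zopen V" "V \<subseteq> U"
  shows "restrict s V \<in> subsections M N V"
proof (rule subsectionsI)
  fix p assume p: "p \<in> V"
  then have "p \<in> U" using V by auto
  obtain X m e f where X: "zopen X" "p \<in> X" "X \<subseteq> U" "m \<in> N e" "f \<in> forms e"
    "\<forall>q\<in>X. f \<notin> q \<and> s q = frac M q m f"
    by (rule subsectionsD[OF s \<open>p \<in> U\<close>])
  then show "\<exists>X m f e. zopen X \<and> p \<in> X \<and> X \<subseteq> V \<and> m \<in> N e \<and> f \<in> forms e \<and>
      (\<forall>q\<in>X. f \<notin> q \<and> restrict s V q = frac M q m f)"
    using p V by (intro exI[of _ "X \<inter> V"] exI[of _ m] exI[of _ f] exI[of _ e]) (auto intro: zopen_Int)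
qed auto

lemma local_fraction_subsection:
  assumes "zopen U" "m \<in> N e" "f \<in> forms e" "\<And>q. q \<in> U \<Longrightarrow> f \<notin> q"
  shows "(\<lambda>p\<in>U. frac M p m f) \<in> subsections M N U"
proof (rule subsectionsI)
  fix p assume "p \<in> U"
  then show "\<exists>V m' f' e. zopen V \<and> p \<in> V \<and> V \<subseteq> U \<and> m' \<in> N e \<and> f' \<in> forms e \<and>
      (\<forall>q\<in>V. f' \<notin> q \<and> (\<lambda>p\<in>U. frac M p m f) q = frac M q m' f')"
    using assms by (intro exI[of _ U] exI[of _ m] exI[of _ f] exI[of _ e]) auto
qed auto

locale graded_module = germ_module M for M :: "('k::comm_ring_1 poly3, 'm) gmodule" (structure) +
  assumes add_closed: "x \<in> carrier M \<Longrightarrow> y \<in> carrier M \<Longrightarrow> x \<oplus> y \<in> carrier M"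
    and zero_piece: "\<zero> \<in> piece M e"
    and add_comm: "x \<in> carrier M \<Longrightarrow> y \<in> carrier M \<Longrightarrow> x \<oplus> y = y \<oplus> x"
    and add_assoc: "x \<in> carrier M \<Longrightarrow> y \<in> carrier M \<Longrightarrow> z \<in> carrier M \<Longrightarrow> x \<oplus> y \<oplus> z = x \<oplus> (y \<oplus> z)"
    and add_zero: "x \<in> carrier M \<Longrightarrow> \<zero> \<oplus> x = x"
    and smult_add: "x \<in> carrier M \<Longrightarrow> (t + s) \<odot> x = t \<odot> x \<oplus> s \<odot> x"
    and smult_zero: "x \<in> carrier M \<Longrightarrow> 0 \<odot> x = \<zero>"
begin

lemma zero_carrier: "\<zero> \<in> carrier M"
  using zero_piece piece_carrier by blast

lemma smult_zero_right: "t \<odot> \<zero> = \<zero>"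
  using smult_assoc[OF zero_carrier, of t 0] smult_zero[OF zero_carrier] by simp

lemma abelian_monoid: "abelian_monoid M"
  by (rule abelian_monoidI) (auto simp: add_closed zero_carrier add_assoc add_zero intro: add_comm)

sublocale abelian_monoid M
  by (rule abelian_monoid)

lemma finsum_lessThan_Suc:
  "(\<And>i. i < Suc r \<Longrightarrow> x i \<in> carrier M) \<Longrightarrow>
    finsum M x {..<Suc r} = x r \<oplus> finsum M x {..<r}"
  unfolding lessThan_Suc by (subst finsum_insert) (auto simp: Pi_def)

lemma finsum_lessThan_closed: "(\<And>i. i < (r::nat) \<Longrightarrow> x i \<in> carrier M) \<Longrightarrow> finsum M x {..<r} \<in> carrier M"
  by (rule finsum_closed) auto

lemma smult_finsum:
  "(\<And>i. i < (r::nat) \<Longrightarrow> x i \<in> carrier M) \<Longrightarrow> t \<odot> finsum M x {..<r} = finsum M (\<lambda>i. t \<odot> x i) {..<r}"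
proof (induction r)
  case 0
  show ?case by (simp add: smult_zero_right)
next
  case (Suc r)
  have "finsum M x {..<r} \<in> carrier M" by (rule finsum_lessThan_closed) (use Suc.prems in auto)
  then show ?case using Suc by (simp add: finsum_lessThan_Suc smult_distrib smult_closed)
qed

lemma germ_add_same:
  assumes p: "p \<in> P2" and *: "m \<in> piece M e" "n \<in> piece M e" "f \<in> forms e" "f \<notin> p"
  shows "germ_add M p (frac M p m f) (frac M p n f) = frac M p (m \<oplus> n) f"
proof -
  have i: "isfrac M p m f" "isfrac M p n f" using * by (auto intro: isfracI)
  have "frac M p (f \<odot> m \<oplus> f \<odot> n) (f * f) = frac M p (f \<odot> (m \<oplus> n)) (f * f)"
    using * by (simp add: smult_distrib piece_carrier)
  also have "\<dots> = frac M p (m \<oplus> n) f"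
    using * p by (intro frac_cancel) (auto intro: isfracI add_piece)
  finally show ?thesis by (simp add: germ_add_frac[OF p i])
qed

lemma isfrac_zero: "p \<in> P2 \<Longrightarrow> isfrac M p \<zero> 1"
  by (rule isfracI[of _ _ 0]) (auto simp: zero_piece P2_one)

lemma isfrac_zero': "p \<in> P2 \<Longrightarrow> f \<in> forms e \<Longrightarrow> f \<notin> p \<Longrightarrow> isfrac M p \<zero> f"
  by (rule isfracI[of _ _ e]) (auto simp: zero_piece)

lemma frac_zero: "p \<in> P2 \<Longrightarrow> f \<in> forms e \<Longrightarrow> f \<notin> p \<Longrightarrow> frac M p \<zero> f = frac M p \<zero> 1"
  by (rule frac_eqI) (auto simp: isfrac_zero isfrac_zero' smult_zero_right)

end

locale graded_submodule = graded_module M for M :: "('k::comm_ring_1 poly3, 'm) gmodule" (structure) +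
  fixes N :: "int \<Rightarrow> 'm set"
  assumes N_piece: "x \<in> N e \<Longrightarrow> x \<in> piece M e"
    and N_add: "x \<in> N e \<Longrightarrow> y \<in> N e \<Longrightarrow> x \<oplus> y \<in> N e"
    and N_smult: "t \<in> forms d \<Longrightarrow> x \<in> N e \<Longrightarrow> t \<odot> x \<in> N (d + e)"
    and N_zero: "\<zero> \<in> N e"
begin

lemma N_carrier: "x \<in> N e \<Longrightarrow> x \<in> carrier M"
  by (rule piece_carrier[OF N_piece])

lemma subsections_sub: "s \<in> subsections M N U \<Longrightarrow> s \<in> sections M U"
proof (rule sectionsI)
  assume s: "s \<in> subsections M N U"
  then show "s \<in> extensional U" by (rule subsections_extensional)
  fix p assume "p \<in> U"
  obtain V m e f where "zopen V" "p \<in> V" "V \<subseteq> U" "m \<in> N e" "f \<in> forms e"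
    "\<forall>q\<in>V. f \<notin> q \<and> s q = frac M q m f" by (rule subsectionsD[OF s \<open>p \<in> U\<close>])
  then show "\<exists>V m f e. zopen V \<and> p \<in> V \<and> V \<subseteq> U \<and> m \<in> piece M e \<and> f \<in> forms e \<and>
      (\<forall>q\<in>V. f \<notin> q \<and> s q = frac M q m f)"
    by (intro exI[of _ V] exI[of _ m] exI[of _ f] exI[of _ e]) (auto intro: N_piece)
qed

lemma subsection_germ:
  assumes "s \<in> subsections M N U" "p \<in> U"
  obtains m e f where "m \<in> N e" "f \<in> forms e" "f \<notin> p" "s p = frac M p m f"
  by (rule subsectionsD[OF assms]) (use that in blast)

lemma N_finsum: "(\<And>i. i < (r::nat) \<Longrightarrow> x i \<in> N e) \<Longrightarrow> finsum M x {..<r} \<in> N e"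
proof (induction r)
  case (Suc r)
  then show ?case by (subst finsum_lessThan_Suc) (auto intro: N_add N_carrier)
qed (simp add: N_zero)

lemma subsections_zero: assumes "zopen U" shows "(\<lambda>p\<in>U. frac M p \<zero> 1) \<in> subsections M N U"
  by (rule local_fraction_subsection[of _ _ _ 0]) (use assms zopen_subset[OF assms] P2_one N_zero in auto)

lemma subsections_add:
  assumes U: "zopen U" and s: "s \<in> subsections M N U" and t: "t \<in> subsections M N U"
  shows "(\<lambda>p\<in>U. germ_add M p (s p) (t p)) \<in> subsections M N U"
proof (rule subsectionsI)
  fix p assume p: "p \<in> U"
  obtain V m d f where V: "zopen V" "p \<in> V" "V \<subseteq> U" "m \<in> N d" "f \<in> forms d"
    "\<forall>q\<in>V. f \<notin> q \<and> s q = frac M q m f" by (rule subsectionsD[OF s p])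
  obtain W n e g where W: "zopen W" "p \<in> W" "W \<subseteq> U" "n \<in> N e" "g \<in> forms e"
    "\<forall>q\<in>W. g \<notin> q \<and> t q = frac M q n g" by (rule subsectionsD[OF t p])
  have "f * g \<notin> q \<and> germ_add M q (s q) (t q) = frac M q (g \<odot> m \<oplus> f \<odot> n) (f * g)" if "q \<in> V \<inter> W" for q
  proof -
    have q: "q \<in> P2" "f \<notin> q" "g \<notin> q" "s q = frac M q m f" "t q = frac M q n g"
      using that V W zopen_subset[OF U] by auto
    then show ?thesis
      using germ_add_frac[OF q(1) isfracI[OF N_piece[OF V(4)] V(5)] isfracI[OF N_piece[OF W(4)] W(5)]]
      by (simp add: P2_mult)
  qed
  moreover have "g \<odot> m \<oplus> f \<odot> n \<in> N (d + e)"
    using N_smult[OF W(5) V(4)] N_smult[OF V(5) W(4)] by (intro N_add) (simp_all add: add.commute)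
  ultimately show "\<exists>V m f e. zopen V \<and> p \<in> V \<and> V \<subseteq> U \<and> m \<in> N e \<and> f \<in> forms e \<and>
      (\<forall>q\<in>V. f \<notin> q \<and> (\<lambda>p\<in>U. germ_add M p (s p) (t p)) q = frac M q m f)"
    using V W
    by (intro exI[of _ "V \<inter> W"] exI[of _ "g \<odot> m \<oplus> f \<odot> n"] exI[of _ "f * g"] exI[of _ "d + e"] conjI
        zopen_Int forms_mult) auto
qed auto

lemma subsections_smult:
  assumes U: "zopen U" and a: "a \<in> sections (twist 0) U" and t: "t \<in> subsections M N U"
  shows "(\<lambda>p\<in>U. germ_smult M p (a p) (t p)) \<in> subsections M N U"
proof (rule subsectionsI)
  fix p assume p: "p \<in> U"
  obtain V m d f where V: "zopen V" "p \<in> V" "V \<subseteq> U" "m \<in> piece (twist 0) d" "f \<in> forms d"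
    "\<forall>q\<in>V. f \<notin> q \<and> a q = frac (twist 0) q m f" by (rule subsectionsD[OF a[unfolded sections_eq_subsections] p])
  obtain W n e g where W: "zopen W" "p \<in> W" "W \<subseteq> U" "n \<in> N e" "g \<in> forms e"
    "\<forall>q\<in>W. g \<notin> q \<and> t q = frac M q n g" by (rule subsectionsD[OF t p])
  have "f * g \<notin> q \<and> germ_smult M q (a q) (t q) = frac M q (m \<odot> n) (f * g)" if "q \<in> V \<inter> W" for q
  proof -
    have q: "q \<in> P2" "f \<notin> q" "g \<notin> q" "a q = frac (twist 0) q m f" "t q = frac M q n g"
      using that V W zopen_subset[OF U] by auto
    then show ?thesis
      using germ_smult_frac[OF q(1) isfracI[OF V(4,5) q(2)] isfracI[OF N_piece[OF W(4)] W(5) q(3)]]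
      by (simp add: P2_mult)
  qed
  moreover have "m \<odot> n \<in> N (d + e)" "f * g \<in> forms (d + e)"
    using N_smult[OF _ W(4), of m d] V(4) forms_mult[OF V(5) W(5)] by simp_all
  ultimately show "\<exists>V m f e. zopen V \<and> p \<in> V \<and> V \<subseteq> U \<and> m \<in> N e \<and> f \<in> forms e \<and>
      (\<forall>q\<in>V. f \<notin> q \<and> (\<lambda>p\<in>U. germ_smult M p (a p) (t p)) q = frac M q m f)"
    using V W by (intro exI[of _ "V \<inter> W"] exI[of _ "m \<odot> n"] exI[of _ "f * g"] exI[of _ "d + e"] conjI zopen_Int) auto
qed auto

end

sublocale graded_module \<subseteq> P: graded_submodule M "piece M"
  by unfold_locales (auto simp: add_piece smult_piece zero_piece)

context graded_module
begin

lemma sections_minus: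
  assumes U: "zopen U" and s: "s \<in> sections M U" and "p \<in> U"
  shows "germ_add M p (germ_smult M p (frac (twist 0) p (- 1) 1) (s p)) (s p) = frac M p \<zero> 1"
proof -
  have p: "p \<in> P2" using assms(3) zopen_subset[OF U] by auto
  obtain m f where m: "isfrac M p m f" "s p = frac M p m f" by (rule section_germ[OF s \<open>p \<in> U\<close>])
  obtain e where e: "m \<in> piece M e" "f \<in> forms e" "f \<notin> p" using m by (auto simp: isfrac_def)
  have "isfrac (twist 0) p (- 1) 1"
    using P2_one[OF p] by (intro isfracI[of _ _ 0]) (auto intro: forms_uminus)
  then have "germ_smult M p (frac (twist 0) p (- 1) 1) (s p) = frac M p ((- 1) \<odot> m) f"
    using m p by (simp add: germ_smult_frac)
  moreover have "(- 1) \<odot> m \<in> piece M e" using smult_piece[OF forms_uminus[OF forms_one] e(1)] by simp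
  moreover have "(- 1) \<odot> m \<oplus> m = \<zero>"
    using smult_add[of m "- 1" 1] e by (simp add: piece_carrier smult_one smult_zero)
  ultimately show ?thesis
    using germ_add_same[OF p, of "(- 1) \<odot> m" e m f] e m(2) frac_zero[OF p e(2,3)] by simp
qed

lemma minus_one_section: assumes "zopen U" shows "(\<lambda>p\<in>U. frac (twist 0) p (- 1) 1) \<in> sections (twist 0) U"
  unfolding sections_eq_subsections
  by (rule local_fraction_subsection[of _ _ _ 0])
     (use assms zopen_subset[OF assms] P2_one in \<open>auto intro: forms_uminus\<close>)

text \<open>Subsheaves and linear combinations of sections refer to the additive group of sections, whose laws
  are checked germ by germ.\<close>

lemma abelian_group_sections:
  assumes U: "zopen U"
  shows "abelian_group (sheafify M U)"
proof (rule abelian_groupI)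
  note sub = zopen_subset[OF U]
  show "s \<oplus>\<^bsub>sheafify M U\<^esub> t \<in> carrier (sheafify M U)"
    if "s \<in> carrier (sheafify M U)" "t \<in> carrier (sheafify M U)" for s t
    using P.subsections_add[OF U] that by (simp add: sections_eq_subsections)
  show "\<zero>\<^bsub>sheafify M U\<^esub> \<in> carrier (sheafify M U)"
    using P.subsections_zero[OF U] by (simp add: sections_eq_subsections)
  show "s \<oplus>\<^bsub>sheafify M U\<^esub> t \<oplus>\<^bsub>sheafify M U\<^esub> u = s \<oplus>\<^bsub>sheafify M U\<^esub> (t \<oplus>\<^bsub>sheafify M U\<^esub> u)"
    if s: "s \<in> carrier (sheafify M U)" and t: "t \<in> carrier (sheafify M U)" and u: "u \<in> carrier (sheafify M U)" for s t u
  proof -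
    have "germ_add M p (germ_add M p (s p) (t p)) (u p) = germ_add M p (s p) (germ_add M p (t p) (u p))"
      if p: "p \<in> U" for p
    proof -
      have p2: "p \<in> P2" using p sub by auto
      obtain m f where m: "isfrac M p m f" "s p = frac M p m f" using section_germ[OF _ p] s by auto
      obtain n g where n: "isfrac M p n g" "t p = frac M p n g" using section_germ[OF _ p] t by auto
      obtain k h where k: "isfrac M p k h" "u p = frac M p k h" using section_germ[OF _ p] u by auto
      note c = m(1)[THEN isfrac_carrier] n(1)[THEN isfrac_carrier] k(1)[THEN isfrac_carrier]
      show ?thesis
        using m n k p2 c
        by (simp add: germ_add_frac isfrac_add smult_distrib smult_assoc smult_closed add_closed add_assoc mult_ac)
    qed
    then show ?thesis by (auto simp: restrict_def fun_eq_iff)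
  qed
  show "s \<oplus>\<^bsub>sheafify M U\<^esub> t = t \<oplus>\<^bsub>sheafify M U\<^esub> s"
    if s: "s \<in> carrier (sheafify M U)" and t: "t \<in> carrier (sheafify M U)" for s t
  proof -
    have "germ_add M p (s p) (t p) = germ_add M p (t p) (s p)" if p: "p \<in> U" for p
    proof -
      have p2: "p \<in> P2" using p sub by auto
      obtain m f where m: "isfrac M p m f" "s p = frac M p m f" using section_germ[OF _ p] s by auto
      obtain n g where n: "isfrac M p n g" "t p = frac M p n g" using section_germ[OF _ p] t by auto
      note c = m(1)[THEN isfrac_carrier] n(1)[THEN isfrac_carrier]
      show ?thesis
        using m n p2 add_comm[of "g \<odot> m" "f \<odot> n"] c
        by (simp add: germ_add_frac smult_closed mult.commute)
    qed
    then show ?thesis by (auto simp: restrict_def fun_eq_iff)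
  qed
  show "\<zero>\<^bsub>sheafify M U\<^esub> \<oplus>\<^bsub>sheafify M U\<^esub> s = s" if s: "s \<in> carrier (sheafify M U)" for s
  proof (rule extensionalityI[of _ U])
    fix p assume p: "p \<in> U"
    have p2: "p \<in> P2" using p sub by auto
    obtain m f where m: "isfrac M p m f" "s p = frac M p m f" using section_germ[OF _ p] s by auto
    note c = m(1)[THEN isfrac_carrier]
    show "(\<zero>\<^bsub>sheafify M U\<^esub> \<oplus>\<^bsub>sheafify M U\<^esub> s) p = s p"
      using p germ_add_frac[OF p2 isfrac_zero[OF p2] m(1)] m c
      by (simp add: smult_zero_right add_zero smult_one)
  qed (use s sections_extensional in auto)
  show "\<exists>t\<in>carrier (sheafify M U). t \<oplus>\<^bsub>sheafify M U\<^esub> s = \<zero>\<^bsub>sheafify M U\<^esub>"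
    if s: "s \<in> carrier (sheafify M U)" for s
  proof
    show "(\<lambda>p\<in>U. germ_smult M p ((\<lambda>p\<in>U. frac (twist 0) p (- 1) 1) p) (s p)) \<in> carrier (sheafify M U)"
      using P.subsections_smult[OF U minus_one_section[OF U]] s by (simp add: sections_eq_subsections)
    show "(\<lambda>p\<in>U. germ_smult M p ((\<lambda>p\<in>U. frac (twist 0) p (- 1) 1) p) (s p)) \<oplus>\<^bsub>sheafify M U\<^esub> s = \<zero>\<^bsub>sheafify M U\<^esub>"
      using sections_minus[OF U] s by (auto simp: restrict_def fun_eq_iff)
  qed
qed

end

context graded_submodule
begin

lemma subsheaf_subsections: "subsheaf (sheafify M) (subsections M N)"
  unfolding subsheaf_def
proof (intro allI impI conjI)
  fix U :: "'k poly3 set set" assume U: "zopen U"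
  interpret E: abelian_group "sheafify M U" by (rule abelian_group_sections[OF U])
  show "submodule (subsections M N U) (\<O> U) (sheafify M U)"
  proof (intro submodule.intro subgroup.intro submodule_axioms.intro)
    show "subsections M N U \<subseteq> carrier (add_monoid (sheafify M U))"
      using subsections_sub by auto
    show "x \<otimes>\<^bsub>add_monoid (sheafify M U)\<^esub> y \<in> subsections M N U"
      if "x \<in> subsections M N U" "y \<in> subsections M N U" for x y
      using subsections_add[OF U that] by simp
    show "\<one>\<^bsub>add_monoid (sheafify M U)\<^esub> \<in> subsections M N U"
      using subsections_zero[OF U] by simp
    show "inv\<^bsub>add_monoid (sheafify M U)\<^esub> s \<in> subsections M N U" if s: "s \<in> subsections M N U" for s
    proof -
      let ?t = "\<lambda>p\<in>U. germ_smult M p ((\<lambda>p\<in>U. frac (twist 0) p (- 1) 1) p) (s p)"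
      have t: "?t \<in> subsections M N U"
        by (rule subsections_smult[OF U minus_one_section[OF U] s])
      have "?t \<oplus>\<^bsub>sheafify M U\<^esub> s = \<zero>\<^bsub>sheafify M U\<^esub>"
        using sections_minus[OF U subsections_sub[OF s]] by (auto simp: restrict_def fun_eq_iff)
      then have "\<ominus>\<^bsub>sheafify M U\<^esub> s = ?t"
        using E.minus_equality subsections_sub[OF t] subsections_sub[OF s] by simp
      then show ?thesis using t by (simp add: a_inv_def)
    qed
    show "a \<odot>\<^bsub>sheafify M U\<^esub> x \<in> subsections M N U"
      if "a \<in> carrier (\<O> U)" "x \<in> subsections M N U" for a x
      using subsections_smult[OF U _ that(2)] that(1) by simp
  qed
next
  show "\<forall>s\<in>subsections M N U. restrict s V \<in> subsections M N V" if "zopen V \<and> V \<subseteq> U" for U V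
    using that subsections_restrict by blast
next
  fix U :: "'k poly3 set set" assume U: "zopen U"
  show "\<forall>s\<in>carrier (sheafify M U). (\<forall>p\<in>U. \<exists>V. zopen V \<and> p \<in> V \<and> V \<subseteq> U \<and> restrict s V \<in> subsections M N V)
      \<longrightarrow> s \<in> subsections M N U"
  proof (intro ballI impI subsectionsI)
    fix s assume "s \<in> carrier (sheafify M U)"
    then show "s \<in> extensional U" by (simp add: sections_extensional)
  next
    fix s p
    assume *: "\<forall>p\<in>U. \<exists>V. zopen V \<and> p \<in> V \<and> V \<subseteq> U \<and> restrict s V \<in> subsections M N V" and "p \<in> U"
    then obtain V where V: "zopen V" "p \<in> V" "V \<subseteq> U" "restrict s V \<in> subsections M N V" by blast
    obtain W m e f where W: "zopen W" "p \<in> W" "W \<subseteq> V" "m \<in> N e" "f \<in> forms e"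
      "\<forall>q\<in>W. f \<notin> q \<and> restrict s V q = frac M q m f" by (rule subsectionsD[OF V(4,2)])
    then show "\<exists>V m f e. zopen V \<and> p \<in> V \<and> V \<subseteq> U \<and> m \<in> N e \<and> f \<in> forms e \<and>
        (\<forall>q\<in>V. f \<notin> q \<and> s q = frac M q m f)"
      using V by (intro exI[of _ W] exI[of _ m] exI[of _ f] exI[of _ e]) (auto simp: subset_iff)
  qed
qed

end

section \<open>Linear combinations of sections and finite generation\<close>

text \<open>Finitely many germs of functions have a common denominator.\<close>

lemma twist_section_add_denominators:
  fixes a :: "nat \<Rightarrow> ('k::comm_ring_1, 'k poly3) sect"
  assumes q: "q \<in> P2" "q \<in> W" and a: "\<And>i. i < r \<Longrightarrow> a i \<in> sections (twist 0) W"
  shows "\<exists>h d x. h \<in> forms d \<and> h \<notin> q \<and> (\<forall>i<r. x i \<in> forms d \<and> a i q = frac (twist 0) q (x i) h)"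
  using a
proof (induction r)
  case 0
  show ?case using P2_one[OF q(1)] forms_one by blast
next
  case (Suc r)
  interpret T: germ_module "twist 0" by (rule germ_module_twist)
  obtain h d x where h: "h \<in> forms d" "h \<notin> q" "\<forall>i<r. x i \<in> forms d \<and> a i q = frac (twist 0) q (x i) h"
    using Suc.IH[OF Suc.prems] by (metis less_SucI)
  obtain y k where y: "isfrac (twist 0) q y k" "a r q = frac (twist 0) q y k"
    using T.section_germ[OF Suc.prems[of r] q(2)] by auto
  obtain e where e: "y \<in> forms e" "k \<in> forms e" "k \<notin> q" using y by (auto simp: isfrac_def)
  let ?x = "\<lambda>i. if i < r then k * x i else h * y"
  have "?x i \<in> forms (e + d) \<and> a i q = frac (twist 0) q (?x i) (k * h)" if "i < Suc r" for i
  proof (cases "i < r")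
    case True
    then have "frac (twist 0) q (k * x i) (k * h) = frac (twist 0) q (x i) h"
      using T.frac_cancel[OF q(1) isfracI[of "x i" "twist 0" d h q] e(2,3)] h by simp
    then show ?thesis using True h forms_mult[OF e(2), of "x i" d] by simp
  next
    case False
    have "frac (twist 0) q (h * y) (h * k) = frac (twist 0) q y k"
      using T.frac_cancel[OF q(1) y(1) h(1,2)] by simp
    moreover have "h * y \<in> forms (e + d)" using forms_mult[OF h(1) e(1)] by (simp add: add.commute)
    ultimately show ?thesis using False that y less_Suc_eq by (auto simp: mult.commute)
  qed
  then show ?case using forms_mult[OF e(2) h(1)] P2_mult[OF q(1) e(3) h(2)]
    by (intro exI[of _ "k * h"] exI[of _ "e + d"] exI[of _ ?x]) simp
qed

context graded_module
begin

text \<open>With common denominators, the germ of a linear combination of sections is one fraction whose numerator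
  is the corresponding combination in the module.  This turns statements about frames and generators into
  linear algebra over the polynomial ring.\<close>

lemma lincomb_germ:
  assumes W: "zopen W" and q: "q \<in> W"
    and a: "\<And>i. i < r \<Longrightarrow> a i \<in> sections (twist 0) W"
    and e: "\<And>i. i < r \<Longrightarrow> restrict (e i) W \<in> sections M W"
    and ax: "\<And>i. i < r \<Longrightarrow> x i \<in> forms d \<and> a i q = frac (twist 0) q (x i) h" and h: "h \<in> forms d" "h \<notin> q"
    and en: "\<And>i. i < r \<Longrightarrow> n i \<in> piece M d' \<and> e i q = frac M q (n i) g" and g: "g \<in> forms d'" "g \<notin> q"
  shows "lincomb (sheafify M) W r a e q = frac M q (finsum M (\<lambda>i. x i \<odot> n i) {..<r}) (h * g)"
  using a e ax en
proof (induction r)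
  have q2: "q \<in> P2" using q zopen_subset[OF W] by auto
  case 0
  then show ?case
    using q frac_zero[OF q2 forms_mult[OF h(1) g(1)]] P2_mult[OF q2 h(2) g(2)] W abelian_group_sections[OF W]
    by (simp add: lincomb_def abelian_monoid.finsum_empty abelian_group.axioms(1))
next
  have q2: "q \<in> P2" using q zopen_subset[OF W] by auto
  case (Suc r)
  interpret E: abelian_group "sheafify M W" by (rule abelian_group_sections[OF W])
  let ?t = "\<lambda>i. a i \<odot>\<^bsub>sheafify M W\<^esub> restrict (e i) W"
  have t: "?t i \<in> carrier (sheafify M W)" if "i < Suc r" for i
    using P.subsections_smult[OF W Suc.prems(1)[OF that]] Suc.prems(2)[OF that]
    by (simp add: sections_eq_subsections)
  have xn: "x i \<odot> n i \<in> piece M (d + d')" if "i < Suc r" for i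
    using Suc.prems(3,4)[OF that] smult_piece by blast
  have "lincomb (sheafify M) W (Suc r) a e = ?t r \<oplus>\<^bsub>sheafify M W\<^esub> lincomb (sheafify M) W r a e"
    unfolding lincomb_def lessThan_Suc by (rule E.finsum_insert) (use t in \<open>auto simp del: sheafify_simps\<close>)
  then have "lincomb (sheafify M) W (Suc r) a e q
      = germ_add M q (germ_smult M q (a r q) (e r q)) (lincomb (sheafify M) W r a e q)"
    using q by simp
  also have "lincomb (sheafify M) W r a e q = frac M q (finsum M (\<lambda>i. x i \<odot> n i) {..<r}) (h * g)"
    using Suc by simp
  also have "germ_smult M q (a r q) (e r q) = frac M q (x r \<odot> n r) (h * g)"
    using Suc.prems(3,4)[of r] q2 h g
      germ_smult_frac[OF q2 isfracI[of "x r" "twist 0" d h] isfracI[of "n r" M d' g]] by simp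
  also have "germ_add M q (frac M q (x r \<odot> n r) (h * g)) (frac M q (finsum M (\<lambda>i. x i \<odot> n i) {..<r}) (h * g))
      = frac M q (x r \<odot> n r \<oplus> finsum M (\<lambda>i. x i \<odot> n i) {..<r}) (h * g)"
    using xn h g q2 by (intro germ_add_same P.N_finsum) (auto intro: forms_mult simp: P2_mult)
  also have "x r \<odot> n r \<oplus> finsum M (\<lambda>i. x i \<odot> n i) {..<r} = finsum M (\<lambda>i. x i \<odot> n i) {..<Suc r}"
    using xn by (subst finsum_lessThan_Suc) (auto intro: piece_carrier)
  finally show ?case .
qed

lemma lincomb_extensional:
  assumes W: "zopen W" and a: "\<And>i. i < r \<Longrightarrow> a i \<in> sections (twist 0) W"
    and e: "\<And>i. i < r \<Longrightarrow> restrict (e i) W \<in> sections M W"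
  shows "lincomb (sheafify M) W r a e \<in> extensional W"
proof -
  interpret E: abelian_group "sheafify M W" by (rule abelian_group_sections[OF W])
  have "lincomb (sheafify M) W r a e \<in> carrier (sheafify M W)"
    unfolding lincomb_def
  proof (rule E.finsum_closed, rule Pi_I)
    fix i assume "i \<in> {..<r}"
    then show "a i \<odot>\<^bsub>sheafify M W\<^esub> restrict (e i) W \<in> carrier (sheafify M W)"
      using P.subsections_smult[OF W a[of i], of "restrict (e i) W"] e[of i]
      by (simp add: sections_eq_subsections)
  qed
  then show ?thesis by (simp add: sections_extensional)
qed

end

text \<open>Where a variable does not vanish, its powers bring homogeneous generators to one degree and then to
  degree zero; the resulting sections generate locally.\<close>

lemma (in graded_submodule) coherent_of_generators:
  fixes k :: nat
  assumes G: "\<And>i. i < k \<Longrightarrow> G i \<in> N (int (dg i))"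
    and gen: "\<And>v e. v \<in> N e \<Longrightarrow>
      \<exists>t. (\<forall>i<k. t i \<in> forms (e - int (dg i))) \<and> v = finsum M (\<lambda>i. t i \<odot> G i) {..<k}"
  shows "coherent_subsheaf (sheafify M) (subsections M N)"
  unfolding coherent_subsheaf_def finite_type_def
proof (intro conjI subsheaf_subsections ballI)
  fix p :: "'k poly3 set" assume p: "p \<in> P2"
  then obtain j where j: "Var j \<notin> p" using P2_Var by blast
  let ?V = "{q \<in> P2. Var j \<notin> q}"
  have V: "zopen ?V" by (rule zopen_nonvanishing[OF Var_forms])
  define D where "D = (\<Sum>i<k. dg i)"
  have D: "dg i \<le> D" if "i < k" for i
    unfolding D_def by (rule member_le_sum) (use that in auto)
  have vp: "Var j ^ n \<in> forms (int n)" for n using forms_power[OF Var_forms, of j n] by simp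
  \<comment> \<open>The generators are brought to one degree, so that they get a common denominator.\<close>
  define G' where "G' i = Var j ^ (D - dg i) \<odot> G i" for i
  have G': "G' i \<in> N (int D)" if "i < k" for i
    using N_smult[OF vp G[OF that], of "D - dg i"] D[OF that] by (simp add: G'_def)
  define e where "e i = (\<lambda>q\<in>?V. frac M q (G' i) (Var j ^ D))" for i
  have eV: "e i \<in> subsections M N ?V" if "i < k" for i
    unfolding e_def using V G'[OF that] vp by (intro local_fraction_subsection) (auto simp: P2_power)
  show "\<exists>V r e. zopen V \<and> p \<in> V \<and> (\<forall>i<r. e i \<in> subsections M N V) \<and>
      (\<forall>W s q. zopen W \<and> W \<subseteq> V \<and> s \<in> subsections M N W \<and> q \<in> W \<longrightarrow>
         (\<exists>W' a. zopen W' \<and> q \<in> W' \<and> W' \<subseteq> W \<and> a \<in> {..<r} \<rightarrow> carrier (\<O> W') \<and>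
            restrict s W' = lincomb (sheafify M) W' r a e))"
  proof (rule exI[of _ ?V], rule exI[of _ k], rule exI[of _ e], intro conjI allI impI)
    show "zopen ?V" "p \<in> ?V" using V p j by auto
    show "e i \<in> subsections M N ?V" if "i < k" for i by (rule eV[OF that])
    fix W s q assume as: "zopen W \<and> W \<subseteq> ?V \<and> s \<in> subsections M N W \<and> q \<in> W"
    then have "s \<in> subsections M N W" "q \<in> W" by auto
    then obtain X v d f where X: "zopen X" "q \<in> X" "X \<subseteq> W" "v \<in> N d" "f \<in> forms d"
      "\<forall>q\<in>X. f \<notin> q \<and> s q = frac M q v f" by (rule subsectionsD)
    obtain t where t: "\<And>i. i < k \<Longrightarrow> t i \<in> forms (d - int (dg i))" "v = finsum M (\<lambda>i. t i \<odot> G i) {..<k}"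
      using gen[OF X(4)] by blast
    define x where "x i = t i * Var j ^ dg i" for i
    have x: "x i \<in> forms d" if "i < k" for i
      using forms_mult[OF t(1)[OF that] vp, of "dg i"] by (simp add: x_def)
    define a where "a i = (\<lambda>q\<in>X. frac (twist 0) q (x i) f)" for i
    have aX: "a i \<in> sections (twist 0) X" if "i < k" for i
      unfolding a_def sections_eq_subsections using X x[OF that]
      by (intro local_fraction_subsection) auto
    have eX: "restrict (e i) X \<in> sections M X" if "i < k" for i
      using subsections_sub[OF subsections_restrict[OF eV[OF that] X(1)]] X(3) as by auto
    have "lincomb (sheafify M) X k a e = restrict s X"
    proof (rule extensionalityI[of _ X])
      fix y assume y: "y \<in> X"
      then have y2: "y \<in> P2" "Var j \<notin> y" using X as by auto
      have "lincomb (sheafify M) X k a e y = frac M y (finsum M (\<lambda>i. x i \<odot> G' i) {..<k}) (f * Var j ^ D)"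
        by (rule lincomb_germ[OF X(1) y])
          (use aX eX x X(5,6) y y2 N_piece[OF G'] vp in \<open>simp_all add: a_def e_def P2_power\<close>)
      also have "finsum M (\<lambda>i. x i \<odot> G' i) {..<k} = finsum M (\<lambda>i. Var j ^ D \<odot> (t i \<odot> G i)) {..<k}"
      proof (rule finsum_cong')
        fix i assume "i \<in> {..<k}"
        then have i: "i < k" by simp
        have "(Var j :: 'k poly3) ^ dg i * Var j ^ (D - dg i) = Var j ^ D"
          using D[OF i] by (simp flip: power_add)
        then show "x i \<odot> G' i = Var j ^ D \<odot> (t i \<odot> G i)"
          using N_carrier[OF G[OF i]] by (simp add: x_def G'_def smult_assoc mult_ac)
      qed (use G in \<open>auto intro!: smult_closed intro: N_carrier\<close>)
      also have "\<dots> = Var j ^ D \<odot> v"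
        unfolding t(2) using G by (subst smult_finsum) (auto intro!: smult_closed intro: N_carrier)
      also have "frac M y (Var j ^ D \<odot> v) (f * Var j ^ D) = s y"
        using frac_cancel[OF y2(1) isfracI[OF N_piece[OF X(4)] X(5)] vp[of D] P2_power[OF y2]] X(6) y
        by (simp add: mult.commute)
      finally show "lincomb (sheafify M) X k a e y = restrict s X y" using y by simp
    qed (use lincomb_extensional[OF X(1), of k a e] aX eX in auto)
    then show "\<exists>W' a. zopen W' \<and> q \<in> W' \<and> W' \<subseteq> W \<and> a \<in> {..<k} \<rightarrow> carrier (\<O> W') \<and>
        restrict s W' = lincomb (sheafify M) W' k a e"
      using X aX by (intro exI[of _ X] exI[of _ a]) auto
  qed
qed

section \<open>Rank, determinant and slope of a subsheaf with a volume form\<close>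

text \<open>A volume form is an alternating multilinear map \<open>lam\<close> of degree \<open>c\<close> on \<open>r\<close>-tuples of members of \<open>N\<close> for which
  Cramer's rule holds.  It determines the first Chern class: \<open>lam\<close> induces a map from the \<open>r\<close>-th exterior power
  of the sheaf of \<open>N\<close> to \<open>\<O>(c)\<close>, which is an isomorphism where \<open>lam\<close> takes nonvanishing values.\<close>

locale volume_form = graded_submodule M N for M :: "('k::comm_ring_1 poly3, 'm) gmodule" (structure) and N +
  fixes r :: nat and c :: int and lam :: "(nat \<Rightarrow> 'm) \<Rightarrow> 'k poly3"
  assumes lam_forms: "(\<And>i. i < r \<Longrightarrow> n i \<in> N (d i)) \<Longrightarrow> lam n \<in> forms ((\<Sum>i<r. d i) + c)"
    and lam_add: "(\<And>i. i < r \<Longrightarrow> n i \<in> N (d i)) \<Longrightarrow> j < r \<Longrightarrow> x \<in> N e \<Longrightarrow> y \<in> N e \<Longrightarrow>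
      lam (n(j := x \<oplus> y)) = lam (n(j := x)) + lam (n(j := y))"
    and lam_smult: "(\<And>i. i < r \<Longrightarrow> n i \<in> N (d i)) \<Longrightarrow> j < r \<Longrightarrow> x \<in> N e \<Longrightarrow> t \<in> forms d' \<Longrightarrow>
      lam (n(j := t \<odot> x)) = t * lam (n(j := x))"
    and lam_alternating: "(\<And>i. i < r \<Longrightarrow> n i \<in> N (d i)) \<Longrightarrow> i < r \<Longrightarrow> j < r \<Longrightarrow> i \<noteq> j \<Longrightarrow> n i = n j \<Longrightarrow> lam n = 0"
    and lam_cong: "(\<And>i. i < r \<Longrightarrow> n i = n' i) \<Longrightarrow> lam n = lam n'"
    and cramer: "(\<And>i. i < r \<Longrightarrow> n i \<in> N (d i)) \<Longrightarrow> v \<in> N e \<Longrightarrow>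
      lam n \<odot> v = finsum M (\<lambda>i. lam (n(i := v)) \<odot> n i) {..<r}"
begin

lemma lam_zero:
  assumes "\<And>i. i < r \<Longrightarrow> n i \<in> N (d i)" "j < r"
  shows "lam (n(j := \<zero>)) = 0"
  using lam_smult[of n d j "\<zero>" 0 0 0, OF assms N_zero] smult_zero[OF zero_carrier] by simp

lemma lam_finsum:
  fixes k :: nat
  assumes n: "\<And>i. i < r \<Longrightarrow> n i \<in> N (d i)" and j: "j < r"
    and x: "\<And>i. i < k \<Longrightarrow> x i \<in> forms a" and v: "\<And>i. i < k \<Longrightarrow> v i \<in> N b"
  shows "lam (n(j := finsum M (\<lambda>i. x i \<odot> v i) {..<k})) = (\<Sum>i<k. x i * lam (n(j := v i)))"
  using x v
proof (induction k)
  case 0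
  show ?case using lam_zero[of n d j, OF n j] by (simp add: fun_upd_def)
next
  case (Suc k)
  have xv: "x i \<odot> v i \<in> N (a + b)" if "i < Suc k" for i
    by (rule N_smult) (use Suc.prems that in auto)
  have "finsum M (\<lambda>i. x i \<odot> v i) {..<Suc k} = x k \<odot> v k \<oplus> finsum M (\<lambda>i. x i \<odot> v i) {..<k}"
    by (rule finsum_lessThan_Suc) (rule N_carrier[OF xv])
  moreover have "finsum M (\<lambda>i. x i \<odot> v i) {..<k} \<in> N (a + b)"
    by (rule N_finsum) (use xv in auto)
  ultimately show ?case
    using lam_add[of n d j "x k \<odot> v k", OF n j xv[of k]]
      lam_smult[of n d j "v k", OF n j Suc.prems(2)[of k] Suc.prems(1)[of k]] Suc
    by (simp add: fun_upd_def)
qed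

lemma lam_scale:
  assumes n: "\<And>i. i < r \<Longrightarrow> n i \<in> N (d i)" and t: "\<And>i. i < r \<Longrightarrow> t i \<in> forms (e i)"
  shows "lam (\<lambda>i. t i \<odot> n i) = (\<Prod>i<r. t i) * lam n"
proof -
  have *: "lam (\<lambda>i. if i < k then t i \<odot> n i else n i) = (\<Prod>i<k. t i) * lam n" if "k \<le> r" for k
    using that
  proof (induction k)
    case (Suc k)
    let ?g = "\<lambda>i. if i < k then t i \<odot> n i else n i"
    have g: "?g i \<in> N (if i < k then e i + d i else d i)" if "i < r" for i
      using n[OF that] N_smult[OF t n, OF that that] by simp
    have "(\<lambda>i. if i < Suc k then t i \<odot> n i else n i) = ?g(k := t k \<odot> n k)"
      by (auto simp: fun_eq_iff less_Suc_eq)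
    then have "lam (\<lambda>i. if i < Suc k then t i \<odot> n i else n i) = lam (?g(k := t k \<odot> n k))"
      by (rule arg_cong)
    also have "\<dots> = t k * lam (?g(k := n k))"
      by (rule lam_smult[OF g, where d' = "e k" and e = "d k"]) (use Suc.prems n[of k] t[of k] in auto)
    also have "?g(k := n k) = ?g" by (auto simp: fun_eq_iff)
    finally show ?case using Suc by simp
  qed simp
  have "lam (\<lambda>i. t i \<odot> n i) = lam (\<lambda>i. if i < r then t i \<odot> n i else n i)"
    by (rule lam_cong) simp
  then show ?thesis using *[of r] by simp
qed

subsection \<open>Local frames\<close>

text \<open>By Cramer's rule, the coordinates of \<open>v\<close> with respect to \<open>n\<close> are the quotients of \<open>lam (n(i := v))\<close> by \<open>lam n\<close>.
  The common degree of the members provides a common denominator \<open>g\<close>.\<close>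

lemma frame_of_nonvanishing_volume:
  assumes V: "zopen V" and n: "\<And>i. i < r \<Longrightarrow> n i \<in> N e" and g: "g \<in> forms e"
    and nv: "\<And>q. q \<in> V \<Longrightarrow> lam n \<notin> q \<and> g \<notin> q"
  shows "frame (sheafify M) (subsections M N) V r (\<lambda>i\<in>{..<r}. \<lambda>p\<in>V. frac M p (n i) g)"
    (is "frame _ _ _ _ ?e")
  unfolding frame_def
proof (intro conjI allI impI ballI)
  let ?u = "lam n"
  have eV: "(\<lambda>p\<in>V. frac M p (n i) g) \<in> subsections M N V" if "i < r" for i
    using V n[OF that] g nv by (intro local_fraction_subsection) auto
  then show "?e \<in> {..<r} \<rightarrow>\<^sub>E subsections M N V" by auto
  have u: "?u \<in> forms (int r * e + c)" using lam_forms[of n "\<lambda>_. e"] n by simp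
  have upd: "lam (n(j := v)) \<in> forms ((int r - 1) * e + d + c)" if "j < r" "v \<in> N d" for j v d
  proof -
    have "lam (n(j := v)) \<in> forms ((\<Sum>i<r. if i = j then d else e) + c)"
      by (rule lam_forms) (use n that in auto)
    moreover have "(\<Sum>i<r. if i = j then d else e) = (\<Sum>i<r. (if i = j then d - e else 0) + e)"
      by (rule sum.cong) auto
    ultimately show ?thesis using that(1) by (simp add: sum.distrib algebra_simps)
  qed
  fix W s assume "zopen W \<and> W \<subseteq> V" and s: "s \<in> subsections M N W"
  then have W: "zopen W" "W \<subseteq> V" by auto
  have WP: "W \<subseteq> P2" by (rule zopen_subset[OF W(1)])
  have eW: "restrict (?e i) W \<in> sections M W" if "i < r" for i
    using subsections_sub[OF subsections_restrict[OF eV[OF that] W]] that by simp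
  have comb: "lincomb (sheafify M) W r a ?e q = frac M q (finsum M (\<lambda>i. x i \<odot> n i) {..<r}) (h * g)"
    if a: "\<And>i. i < r \<Longrightarrow> a i \<in> sections (twist 0) W" and q: "q \<in> W"
      and x: "\<And>i. i < r \<Longrightarrow> x i \<in> forms d \<and> a i q = frac (twist 0) q (x i) h"
      and h: "h \<in> forms d" "h \<notin> q" for a q x h d
  proof (rule lincomb_germ[OF W(1) q a eW x h])
    show "g \<in> forms e" "g \<notin> q" using g nv q W by auto
    show "n i \<in> piece M e \<and> ?e i q = frac M q (n i) g" if "i < r" for i
      using that q W N_piece[OF n[OF that]] by auto
  qed auto
  show "\<exists>!a. a \<in> {..<r} \<rightarrow>\<^sub>E carrier (\<O> W) \<and> s = lincomb (sheafify M) W r a ?e"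
  proof (rule ex_ex1I)
    \<comment> \<open>The coefficients are given by Cramer's rule; any local fraction may be used to compute them.\<close>
    define C where "C q i v f = frac (twist 0) q (lam (n(i := v)) * g) (?u * f)" for q i v f
    have C_indep: "C q i v f = C q i v' f'"
      if q: "q \<in> W" and i: "i < r" and v: "v \<in> N d" "f \<in> forms d" "f \<notin> q"
        and v': "v' \<in> N d'" "f' \<in> forms d'" "f' \<notin> q" and eq: "frac M q v f = frac M q v' f'"
      for q i v f v' f' d d'
    proof -
      interpret T: germ_module "twist 0" by (rule germ_module_twist)
      have q2: "q \<in> P2" "q \<in> V" using q WP W by auto
      obtain k h where h: "h \<in> forms k" "h \<notin> q" "h \<odot> (f' \<odot> v) = h \<odot> (f \<odot> v')"
        using frac_eq_iff[OF q2(1) isfracI[OF N_piece[OF v(1)] v(2,3)] isfracI[OF N_piece[OF v'(1)] v'(2,3)]] eq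
        by auto
      have "(h * f') * lam (n(i := v)) = lam (n(i := (h * f') \<odot> v))"
        by (rule lam_smult[of n "\<lambda>_. e", OF n i v(1) forms_mult[OF h(1) v'(2)], symmetric])
      also have "(h * f') \<odot> v = (h * f) \<odot> v'"
        using h(3) v v' by (simp add: smult_assoc N_carrier)
      also have "lam (n(i := (h * f) \<odot> v')) = (h * f) * lam (n(i := v'))"
        by (rule lam_smult[of n "\<lambda>_. e", OF n i v'(1) forms_mult[OF h(1) v(2)]])
      finally have *: "h * f' * lam (n(i := v)) = h * f * lam (n(i := v'))" .
      have **: "h * ((?u * f') * (lam (n(i := v)) * g)) = h * ((?u * f) * (lam (n(i := v')) * g))"
        using arg_cong[OF *, of "\<lambda>x. x * (?u * g)"] by (simp add: mult_ac)
      have i1: "isfrac (twist 0) q (lam (n(i := v)) * g) (?u * f)"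
        using forms_mult[OF upd[OF i v(1)] g] forms_mult[OF u v(2)] nv[OF q2(2)] v(3) q2
        by (intro isfracI[of _ _ "int r * e + c + d"]) (auto simp: algebra_simps P2_mult)
      have i2: "isfrac (twist 0) q (lam (n(i := v')) * g) (?u * f')"
        using forms_mult[OF upd[OF i v'(1)] g] forms_mult[OF u v'(2)] nv[OF q2(2)] v'(3) q2
        by (intro isfracI[of _ _ "int r * e + c + d'"]) (auto simp: algebra_simps P2_mult)
      show ?thesis
        unfolding C_def T.frac_eq_iff[OF q2(1) i1 i2]
        by (rule exI[of _ k], rule bexI[of _ h]) (use h ** in auto)
    qed
    define R where "R q vf \<longleftrightarrow> (\<exists>d. fst vf \<in> N d \<and> snd vf \<in> forms d \<and> snd vf \<notin> q \<and>
      s q = frac M q (fst vf) (snd vf))" for q vf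
    define a where "a = (\<lambda>i\<in>{..<r}. \<lambda>q\<in>W. C q i (fst (SOME vf. R q vf)) (snd (SOME vf. R q vf)))"
    have a_eq: "a i q = C q i v f"
      if "q \<in> W" "i < r" "v \<in> N d" "f \<in> forms d" "f \<notin> q" "s q = frac M q v f" for q i v f d
    proof -
      have "R q (v, f)" using that by (auto simp: R_def)
      then have "R q (SOME vf. R q vf)" by (rule someI)
      then obtain d' where R: "fst (SOME vf. R q vf) \<in> N d'" "snd (SOME vf. R q vf) \<in> forms d'"
          "snd (SOME vf. R q vf) \<notin> q" "s q = frac M q (fst (SOME vf. R q vf)) (snd (SOME vf. R q vf))"
        unfolding R_def by blast
      have "C q i (fst (SOME vf. R q vf)) (snd (SOME vf. R q vf)) = C q i v f"
        by (rule C_indep[OF that(1,2) R(1-3) that(3-5)]) (use R that in simp)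
      then show ?thesis using that by (simp add: a_def)
    qed
    have aW: "a i \<in> sections (twist 0) W" if i: "i < r" for i
    proof (rule sectionsI)
      show "a i \<in> extensional W" using i by (simp add: a_def)
      fix p assume p: "p \<in> W"
      obtain X v d f where X: "zopen X" "p \<in> X" "X \<subseteq> W" "v \<in> N d" "f \<in> forms d"
        "\<forall>q\<in>X. f \<notin> q \<and> s q = frac M q v f" by (rule subsectionsD[OF s p])
      have "lam (n(i := v)) * g \<in> forms (int r * e + c + d)" "?u * f \<in> forms (int r * e + c + d)"
        using forms_mult[OF upd[OF i X(4)] g] forms_mult[OF u X(5)] by (simp_all add: algebra_simps)
      moreover have "?u * f \<notin> q \<and> a i q = frac (twist 0) q (lam (n(i := v)) * g) (?u * f)" if "q \<in> X" for q
      proof -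
        have "q \<in> W" "q \<in> P2" "f \<notin> q" "s q = frac M q v f" "?u \<notin> q" using that X(3,6) nv W WP by auto
        then show ?thesis using a_eq[OF _ i X(4,5)] by (simp add: P2_mult C_def)
      qed
      ultimately show "\<exists>V m f e. zopen V \<and> p \<in> V \<and> V \<subseteq> W \<and> m \<in> piece (twist 0) e \<and> f \<in> forms e \<and>
          (\<forall>q\<in>V. f \<notin> q \<and> a i q = frac (twist 0) q m f)"
        using X(1-3) by (intro exI[of _ X] exI[of _ "lam (n(i := v)) * g"] exI[of _ "?u * f"]
            exI[of _ "int r * e + c + d"]) simp
    qed
    show "\<exists>a. a \<in> {..<r} \<rightarrow>\<^sub>E carrier (\<O> W) \<and> s = lincomb (sheafify M) W r a ?e"
    proof (intro exI[of _ a] conjI)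
      show "a \<in> {..<r} \<rightarrow>\<^sub>E carrier (\<O> W)" using aW by (auto simp: a_def)
      show "s = lincomb (sheafify M) W r a ?e"
      proof (rule extensionalityI[of _ W])
        show "s \<in> extensional W" by (rule subsections_extensional[OF s])
        show "lincomb (sheafify M) W r a ?e \<in> extensional W"
          by (rule lincomb_extensional[OF W(1) aW eW]) auto
        fix q assume q: "q \<in> W"
        have q2: "q \<in> P2" "q \<in> V" "?u \<notin> q" "g \<notin> q" using q WP W nv by auto
        obtain v d f where v: "v \<in> N d" "f \<in> forms d" "f \<notin> q" "s q = frac M q v f"
          by (rule subsection_germ[OF s q])
        have "lincomb (sheafify M) W r a ?e q
            = frac M q (finsum M (\<lambda>i. (lam (n(i := v)) * g) \<odot> n i) {..<r}) (?u * f * g)"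
        proof (rule comb[OF aW q])
          show "lam (n(i := v)) * g \<in> forms (int r * e + c + d) \<and>
              a i q = frac (twist 0) q (lam (n(i := v)) * g) (?u * f)" if "i < r" for i
            using forms_mult[OF upd[OF that v(1)] g] a_eq[OF q that v]
            by (simp add: algebra_simps C_def)
          show "?u * f \<in> forms (int r * e + c + d)" "?u * f \<notin> q"
            using forms_mult[OF u v(2)] q2 v(3) by (simp_all add: P2_mult)
        qed
        also have "finsum M (\<lambda>i. (lam (n(i := v)) * g) \<odot> n i) {..<r} = g \<odot> (?u \<odot> v)"
        proof -
          have cr: "?u \<odot> v = finsum M (\<lambda>i. lam (n(i := v)) \<odot> n i) {..<r}"
            by (rule cramer[of n "\<lambda>_. e" v d, OF n v(1)])
          have "g \<odot> (?u \<odot> v) = g \<odot> finsum M (\<lambda>i. lam (n(i := v)) \<odot> n i) {..<r}"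
            by (simp only: cr)
          also have "\<dots> = finsum M (\<lambda>i. g \<odot> (lam (n(i := v)) \<odot> n i)) {..<r}"
            by (rule smult_finsum) (rule smult_closed[OF N_carrier[OF n]])
          also have "\<dots> = finsum M (\<lambda>i. (lam (n(i := v)) * g) \<odot> n i) {..<r}"
            by (rule finsum_cong') (auto simp: smult_assoc N_carrier[OF n] mult.commute intro!: smult_closed)
          finally show ?thesis by simp
        qed
        also have "\<dots> = (g * ?u) \<odot> v" using N_carrier[OF v(1)] by (simp add: smult_assoc)
        also have "?u * f * g = (g * ?u) * f" by (simp add: mult_ac)
        also have "frac M q ((g * ?u) \<odot> v) ((g * ?u) * f) = frac M q v f"
          by (rule frac_cancel[OF q2(1) isfracI[OF N_piece[OF v(1)] v(2,3)] forms_mult[OF g u]])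
            (use q2 in \<open>simp add: P2_mult\<close>)
        finally show "s q = lincomb (sheafify M) W r a ?e q" using v(4) by (simp only:)
      qed
    qed
  next
    fix a a'
    assume a: "a \<in> {..<r} \<rightarrow>\<^sub>E carrier (\<O> W) \<and> s = lincomb (sheafify M) W r a ?e"
      and a': "a' \<in> {..<r} \<rightarrow>\<^sub>E carrier (\<O> W) \<and> s = lincomb (sheafify M) W r a' ?e"
    have aW: "a i \<in> sections (twist 0) W" "a' i \<in> sections (twist 0) W" if "i < r" for i
      using a a' that by auto
    show "a = a'"
    proof (rule extensionalityI[of _ "{..<r}"])
      show "a \<in> extensional {..<r}" "a' \<in> extensional {..<r}" using a a' by (auto simp: PiE_def)
      fix j assume "j \<in> {..<r}"
      then have j: "j < r" by simp
      show "a j = a' j"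
      proof (rule extensionalityI[of _ W])
        show "a j \<in> extensional W" "a' j \<in> extensional W" using aW[OF j] sections_extensional by auto
        fix q assume q: "q \<in> W"
        have q2: "q \<in> P2" "q \<in> V" "?u \<notin> q" "g \<notin> q" using q WP W nv by auto
        obtain h d x where h: "h \<in> forms d" "h \<notin> q" "\<forall>i<r. x i \<in> forms d \<and> a i q = frac (twist 0) q (x i) h"
          using twist_section_add_denominators[of q W r a, OF q2(1) q aW(1)] by blast
        obtain h' d' x' where h': "h' \<in> forms d'" "h' \<notin> q"
            "\<forall>i<r. x' i \<in> forms d' \<and> a' i q = frac (twist 0) q (x' i) h'"
          using twist_section_add_denominators[of q W r a', OF q2(1) q aW(2)] by blast
        let ?S = "\<lambda>x. finsum M (\<lambda>i. x i \<odot> n i) {..<r}"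
        have "lincomb (sheafify M) W r a ?e q = frac M q (?S x) (h * g)"
          by (rule comb[OF aW(1) q _ h(1,2)]) (use h(3) in auto)
        moreover have "lincomb (sheafify M) W r a' ?e q = frac M q (?S x') (h' * g)"
          by (rule comb[OF aW(2) q _ h'(1,2)]) (use h'(3) in auto)
        moreover have "lincomb (sheafify M) W r a ?e = lincomb (sheafify M) W r a' ?e"
          using a a' by metis
        ultimately have eq: "frac M q (?S x) (h * g) = frac M q (?S x') (h' * g)" by simp
        have S: "?S x \<in> N (d + e)"
          by (rule N_finsum) (use h(3) n in \<open>auto intro: N_smult\<close>)
        have S': "?S x' \<in> N (d' + e)"
          by (rule N_finsum) (use h'(3) n in \<open>auto intro: N_smult\<close>)
        obtain b k where k: "k \<in> forms b" "k \<notin> q" "k \<odot> ((h' * g) \<odot> ?S x) = k \<odot> ((h * g) \<odot> ?S x')"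
          using frac_eq_iff[OF q2(1) isfracI[OF N_piece[OF S] forms_mult[OF h(1) g]]
              isfracI[OF N_piece[OF S'] forms_mult[OF h'(1) g]]] eq h(2) h'(2) q2
          by (auto simp: P2_mult)
        have pick: "lam (n(j := ?S x)) = x j * ?u" if x: "\<forall>i<r. x i \<in> forms d" for x d
        proof -
          have "lam (n(j := ?S x)) = (\<Sum>i<r. x i * lam (n(j := n i)))"
            by (rule lam_finsum[of n "\<lambda>_. e", OF n j]) (use x n in auto)
          also have "\<dots> = (\<Sum>i<r. if i = j then x j * ?u else 0)"
          proof (rule sum.cong)
            fix i assume "i \<in> {..<r}"
            moreover have "lam (n(j := n i)) = 0" if "i \<noteq> j" "i < r"
              by (rule lam_alternating[of "n(j := n i)" "\<lambda>_. e" i j]) (use n that j in auto)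
            ultimately show "x i * lam (n(j := n i)) = (if i = j then x j * ?u else 0)" by auto
          qed simp
          finally show ?thesis using j by simp
        qed
        have "(k * (h' * g)) * lam (n(j := ?S x)) = lam (n(j := (k * (h' * g)) \<odot> ?S x))"
          by (rule lam_smult[of n "\<lambda>_. e", OF n j S forms_mult[OF k(1) forms_mult[OF h'(1) g]], symmetric])
        also have "(k * (h' * g)) \<odot> ?S x = (k * (h * g)) \<odot> ?S x'"
          using k(3) N_carrier[OF S] N_carrier[OF S'] by (simp add: smult_assoc)
        also have "lam (n(j := (k * (h * g)) \<odot> ?S x')) = (k * (h * g)) * lam (n(j := ?S x'))"
          by (rule lam_smult[of n "\<lambda>_. e", OF n j S' forms_mult[OF k(1) forms_mult[OF h(1) g]]])
        finally have "(k * (h' * g)) * (x j * ?u) = (k * (h * g)) * (x' j * ?u)"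
          using pick[of x d] pick[of x' d'] h(3) h'(3)
          by (simp del: fun_upd_apply)
        then have *: "(k * g * ?u) * (h' * x j) = (k * g * ?u) * (h * x' j)" by (simp add: mult_ac)
        interpret T: germ_module "twist 0" by (rule germ_module_twist)
        have i12: "isfrac (twist 0) q (x j) h" "isfrac (twist 0) q (x' j) h'"
          using h h' j by (auto intro: isfracI[of _ _ d] isfracI[of _ _ d'])
        have "frac (twist 0) q (x j) h = frac (twist 0) q (x' j) h'"
          unfolding T.frac_eq_iff[OF q2(1) i12]
          by (rule exI[of _ "b + e + (int r * e + c)"], rule bexI[of _ "k * g * ?u"])
             (use * k q2 g u in \<open>auto simp: P2_mult intro!: forms_mult\<close>)
        then show "a j q = a' j q" using h(3) h'(3) j by simp
      qed
    qed
  qed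
qed

subsection \<open>The determinant\<close>

text \<open>Some fraction that represents a germ; \<open>volume_eq\<close> shows that the volume does not depend on it.\<close>

definition rep :: "'k point \<Rightarrow> ('k, 'm) germ \<Rightarrow> 'm \<times> 'k poly3"
  where "rep p G = (SOME vf. \<exists>d. fst vf \<in> N d \<and> snd vf \<in> forms d \<and> snd vf \<notin> p \<and> G = frac M p (fst vf) (snd vf))"

definition volume :: "'k point set \<Rightarrow> (nat \<Rightarrow> ('k, 'm) sect) \<Rightarrow> ('k, 'k poly3) sect"
  where "volume V s = (\<lambda>p\<in>V. frac (twist c) p (lam (\<lambda>i. fst (rep p (s i p)))) (\<Prod>i<r. snd (rep p (s i p))))"

lemma isfrac_volume:
  assumes p: "p \<in> P2" and m: "\<And>i. i < r \<Longrightarrow> m i \<in> N (d i) \<and> f i \<in> forms (d i) \<and> f i \<notin> p"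
  shows "isfrac (twist c) p (lam m) (\<Prod>i<r. f i)"
  using lam_forms[of m d] forms_prod[of "{..<r}" f d] P2_prod[OF p, of "{..<r}" f] m
  by (intro isfracI[of _ _ "\<Sum>i<r. d i"]) auto

lemma volume_eq:
  assumes p: "p \<in> P2" "p \<in> V"
    and m: "\<And>i. i < r \<Longrightarrow> m i \<in> N (d i) \<and> f i \<in> forms (d i) \<and> f i \<notin> p \<and> s i p = frac M p (m i) (f i)"
  shows "volume V s p = frac (twist c) p (lam m) (\<Prod>i<r. f i)"
proof -
  interpret T: germ_module "twist c" by (rule germ_module_twist)
  let ?m = "\<lambda>i. fst (rep p (s i p))" and ?f = "\<lambda>i. snd (rep p (s i p))"
  have "\<exists>d'. ?m i \<in> N d' \<and> ?f i \<in> forms d' \<and> ?f i \<notin> p \<and> s i p = frac M p (?m i) (?f i)" if "i < r" for i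
    unfolding rep_def by (rule someI[of _ "(m i, f i)"]) (use m[OF that] in auto)
  then obtain d' where m': "\<And>i. i < r \<Longrightarrow> ?m i \<in> N (d' i) \<and> ?f i \<in> forms (d' i) \<and> ?f i \<notin> p \<and>
      s i p = frac M p (?m i) (?f i)" by metis
  have "\<exists>e. \<exists>h\<in>forms e. h \<notin> p \<and> h \<odot> (?f i \<odot> m i) = h \<odot> (f i \<odot> ?m i)" if "i < r" for i
    using m[OF that] m'[OF that]
      frac_eq_iff[OF p(1) isfracI[OF N_piece, of "m i" "d i" "f i"] isfracI[OF N_piece, of "?m i" "d' i" "?f i"]]
    by simp
  then obtain e h where h: "\<And>i. i < r \<Longrightarrow> h i \<in> forms (e i) \<and> h i \<notin> p \<and> h i \<odot> (?f i \<odot> m i) = h i \<odot> (f i \<odot> ?m i)"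
    by metis
  have "(\<Prod>i<r. h i * ?f i) * lam m = lam (\<lambda>i. (h i * ?f i) \<odot> m i)"
    by (rule lam_scale[symmetric, of _ d _ "\<lambda>i. e i + d' i"]) (use m m' h in \<open>auto intro: forms_mult\<close>)
  also have "\<dots> = lam (\<lambda>i. (h i * f i) \<odot> ?m i)"
  proof (rule lam_cong)
    fix i assume i: "i < r"
    have "m i \<in> carrier M" "?m i \<in> carrier M" using m[OF i] m'[OF i] N_carrier by blast+
    then show "(h i * ?f i) \<odot> m i = (h i * f i) \<odot> ?m i"
      using h[OF i] by (simp add: smult_assoc)
  qed
  also have "\<dots> = (\<Prod>i<r. h i * f i) * lam ?m"
    by (rule lam_scale[of _ d' _ "\<lambda>i. e i + d i"]) (use m m' h in \<open>auto intro: forms_mult\<close>)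
  finally have "(\<Prod>i<r. h i) * ((\<Prod>i<r. ?f i) * lam m) = (\<Prod>i<r. h i) * ((\<Prod>i<r. f i) * lam ?m)"
    by (simp add: prod.distrib mult_ac)
  moreover have "(\<Prod>i<r. h i) \<in> forms (\<Sum>i<r. e i)" "(\<Prod>i<r. h i) \<notin> p"
    using forms_prod[of "{..<r}" h e] P2_prod[OF p(1), of "{..<r}" h] h by auto
  ultimately have "frac (twist c) p (lam m) (\<Prod>i<r. f i) = frac (twist c) p (lam ?m) (\<Prod>i<r. ?f i)"
    using T.frac_eq_iff[OF p(1) isfrac_volume[OF p(1), of m d f] isfrac_volume[OF p(1), of ?m d' ?f]] m m'
    by auto
  then show ?thesis using p by (simp add: volume_def)
qed

lemma zopen_INT: "zopen V \<Longrightarrow> (\<And>i. i < (k::nat) \<Longrightarrow> zopen (X i)) \<Longrightarrow> zopen (V \<inter> (\<Inter>i<k. X i))"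
proof (induction k)
  case (Suc k)
  have "V \<inter> (\<Inter>i<Suc k. X i) = (V \<inter> (\<Inter>i<k. X i)) \<inter> X k" by (auto simp: less_Suc_eq)
  then show ?case using Suc by (auto intro: zopen_Int)
qed simp

lemma subsections_germs:
  assumes V: "zopen V" and s: "\<And>i. i < r \<Longrightarrow> s i \<in> subsections M N V" and p: "p \<in> V"
  shows "\<exists>X m d f. zopen X \<and> p \<in> X \<and> X \<subseteq> V \<and> (\<forall>i<r. m i \<in> N (d i) \<and> f i \<in> forms (d i)) \<and>
    (\<forall>i<r. \<forall>q\<in>X. f i \<notin> q \<and> s i q = frac M q (m i) (f i))"
proof -
  have "\<exists>X m d f. zopen X \<and> p \<in> X \<and> X \<subseteq> V \<and> m \<in> N d \<and> f \<in> forms d \<and> (\<forall>q\<in>X. f \<notin> q \<and> s i q = frac M q m f)"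
    if "i < r" for i
    by (rule subsectionsD[OF s[OF that] p]) metis
  then obtain X m d f where *: "\<And>i. i < r \<Longrightarrow> zopen (X i) \<and> p \<in> X i \<and> X i \<subseteq> V \<and> m i \<in> N (d i) \<and>
      f i \<in> forms (d i) \<and> (\<forall>q\<in>X i. f i \<notin> q \<and> s i q = frac M q (m i) (f i))" by metis
  show ?thesis
    by (intro exI[of _ "V \<inter> (\<Inter>i<r. X i)"] exI[of _ m] exI[of _ d] exI[of _ f] conjI zopen_INT V)
      (use * p in auto)
qed

lemma volume_section:
  assumes V: "zopen V" and s: "\<And>i. i < r \<Longrightarrow> s i \<in> subsections M N V"
  shows "volume V s \<in> sections (twist c) V"
proof (rule sectionsI)
  fix p assume p: "p \<in> V"
  obtain X m d f where X: "zopen X" "p \<in> X" "X \<subseteq> V"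
    "\<And>i. i < r \<Longrightarrow> m i \<in> N (d i) \<and> f i \<in> forms (d i)"
    "\<And>i q. i < r \<Longrightarrow> q \<in> X \<Longrightarrow> f i \<notin> q \<and> s i q = frac M q (m i) (f i)"
    using subsections_germs[of V s p, OF V s p] by metis
  have "(\<Prod>i<r. f i) \<notin> q \<and> volume V s q = frac (twist c) q (lam m) (\<Prod>i<r. f i)" if "q \<in> X" for q
  proof -
    have "q \<in> P2" "q \<in> V" using that X zopen_subset[OF V] by auto
    then show ?thesis using volume_eq[of q V m d f s] P2_prod[of q "{..<r}" f] X(4,5) that by simp
  qed
  then show "\<exists>X m f e. zopen X \<and> p \<in> X \<and> X \<subseteq> V \<and> m \<in> piece (twist c) e \<and> f \<in> forms e \<and>
      (\<forall>q\<in>X. f \<notin> q \<and> volume V s q = frac (twist c) q m f)"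
    using X lam_forms[of m d] forms_prod[of "{..<r}" f d]
    by (intro exI[of _ X] exI[of _ "lam m"] exI[of _ "\<Prod>i<r. f i"] exI[of _ "\<Sum>i<r. d i"]) simp
qed (simp add: volume_def)

lemma volume_multilinear:
  assumes V: "zopen V" and s: "\<And>i. i < r \<Longrightarrow> s i \<in> subsections M N V" and i: "i < r"
  shows "t \<in> subsections M N V \<Longrightarrow> volume V (s(i := \<lambda>p\<in>V. germ_add M p (s i p) (t p))) =
      (\<lambda>p\<in>V. germ_add (twist c) p (volume V s p) (volume V (s(i := t)) p))" (is "?T \<Longrightarrow> ?A")
    and "a \<in> sections (twist 0) V \<Longrightarrow> volume V (s(i := \<lambda>p\<in>V. germ_smult M p (a p) (s i p))) =
      (\<lambda>p\<in>V. germ_smult (twist c) p (a p) (volume V s p))" (is "?S \<Longrightarrow> ?B")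
proof -
  interpret C: germ_module "twist c" by (rule germ_module_twist)
  interpret O: germ_module "twist 0" by (rule germ_module_twist)
  have prod_upd: "(\<Prod>j<r. (f(i := y)) j) = y * (\<Prod>j\<in>{..<r} - {i}. f j)" for f :: "nat \<Rightarrow> 'k poly3" and y
    using i by (subst prod.remove[of _ i]) auto
  have prod_f: "(\<Prod>j<r. f j) = f i * (\<Prod>j\<in>{..<r} - {i}. f j)" for f :: "nat \<Rightarrow> 'k poly3"
    using i by (subst prod.remove[of _ i]) auto
  show ?A if t: ?T
  proof (rule extensionalityI[of _ V])
    fix p assume p: "p \<in> V"
    have p2: "p \<in> P2" using p zopen_subset[OF V] by auto
    obtain X m d f where X: "zopen X" "p \<in> X" "X \<subseteq> V"
      "\<And>i. i < r \<Longrightarrow> m i \<in> N (d i) \<and> f i \<in> forms (d i)"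
      "\<And>i q. i < r \<Longrightarrow> q \<in> X \<Longrightarrow> f i \<notin> q \<and> s i q = frac M q (m i) (f i)"
      using subsections_germs[of V s p, OF V s p] by metis
    obtain n e g where n: "n \<in> N e" "g \<in> forms e" "g \<notin> p" "t p = frac M p n g"
      by (rule subsection_germ[OF t p])
    note mi = X(4)[OF i] X(5)[OF i X(2)]
    have sum: "g \<odot> m i \<in> N (d i + e)" "f i \<odot> n \<in> N (d i + e)"
      using N_smult[OF n(2), of "m i" "d i"] N_smult[of "f i" "d i" n e] mi n by (simp_all add: add.commute)
    have germ: "germ_add M p (s i p) (t p) = frac M p (g \<odot> m i \<oplus> f i \<odot> n) (f i * g)"
      using germ_add_frac[OF p2 isfracI[OF N_piece, of "m i" "d i" "f i"] isfracI[OF N_piece[OF n(1)] n(2,3)]] mi n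
      by simp
    let ?P = "\<Prod>j\<in>{..<r} - {i}. f j"
    have 1: "volume V (s(i := \<lambda>p\<in>V. germ_add M p (s i p) (t p))) p
        = frac (twist c) p (lam (m(i := g \<odot> m i \<oplus> f i \<odot> n))) (\<Prod>j<r. (f(i := f i * g)) j)"
      by (rule volume_eq[OF p2 p, of _ "d(i := d i + e)"])
        (use X(2,4,5) germ sum p mi n(2,3) p2 in \<open>auto intro: N_add forms_mult simp: P2_mult\<close>)
    have 2: "volume V s p = frac (twist c) p (lam m) (\<Prod>j<r. f j)"
      by (rule volume_eq[OF p2 p, of _ d]) (use X(2,4,5) in auto)
    have 3: "volume V (s(i := t)) p = frac (twist c) p (lam (m(i := n))) (\<Prod>j<r. (f(i := g)) j)"
      by (rule volume_eq[OF p2 p, of _ "d(i := e)"]) (use X(2,4,5) n in auto)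
    have i1: "isfrac (twist c) p (lam (m(i := g \<odot> m i \<oplus> f i \<odot> n))) (\<Prod>j<r. (f(i := f i * g)) j)"
      by (rule isfrac_volume[OF p2, of _ "d(i := d i + e)"])
        (use X(2,4,5) sum mi n(2,3) p2 in \<open>auto intro: N_add forms_mult simp: P2_mult\<close>)
    have i2: "isfrac (twist c) p (lam m) (\<Prod>j<r. f j)"
      by (rule isfrac_volume[OF p2, of _ d]) (use X(2,4,5) in auto)
    have i3: "isfrac (twist c) p (lam (m(i := n))) (\<Prod>j<r. (f(i := g)) j)"
      by (rule isfrac_volume[OF p2, of _ "d(i := e)"]) (use X(2,4,5) n in auto)
    have "lam (m(i := g \<odot> m i \<oplus> f i \<odot> n)) = g * lam m + f i * lam (m(i := n))"
      using lam_add[of m d i "g \<odot> m i" _ "f i \<odot> n", OF _ i sum]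
        lam_smult[of m d i "m i" "d i" g e] lam_smult[of m d i n e "f i" "d i"] X(4) i n by simp
    then have "frac (twist c) p (lam (m(i := g \<odot> m i \<oplus> f i \<odot> n))) (\<Prod>j<r. (f(i := f i * g)) j)
        = germ_add (twist c) p (frac (twist c) p (lam m) (\<Prod>j<r. f j))
            (frac (twist c) p (lam (m(i := n))) (\<Prod>j<r. (f(i := g)) j))"
      unfolding C.germ_add_frac[OF p2 i2 i3]
      by (intro C.frac_eqI[OF p2 i1 C.isfrac_add[OF p2 i2 i3]])
        (simp add: prod_upd prod_f[of f] algebra_simps del: fun_upd_apply)
    then show "volume V (s(i := \<lambda>p\<in>V. germ_add M p (s i p) (t p))) p =
        (\<lambda>p\<in>V. germ_add (twist c) p (volume V s p) (volume V (s(i := t)) p)) p"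
      using p 1 2 3 by simp
  qed (simp_all add: volume_def)
  show ?B if a: ?S
  proof (rule extensionalityI[of _ V])
    fix p assume p: "p \<in> V"
    have p2: "p \<in> P2" using p zopen_subset[OF V] by auto
    obtain X m d f where X: "zopen X" "p \<in> X" "X \<subseteq> V"
      "\<And>i. i < r \<Longrightarrow> m i \<in> N (d i) \<and> f i \<in> forms (d i)"
      "\<And>i q. i < r \<Longrightarrow> q \<in> X \<Longrightarrow> f i \<notin> q \<and> s i q = frac M q (m i) (f i)"
      using subsections_germs[of V s p, OF V s p] by metis
    obtain y g where y0: "isfrac (twist 0) p y g" "a p = frac (twist 0) p y g"
      by (rule O.section_germ[OF a p])
    then obtain e where y: "y \<in> forms e" "g \<in> forms e" "g \<notin> p" by (auto simp: isfrac_def)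
    note mi = X(4)[OF i] X(5)[OF i X(2)]
    have sum: "y \<odot> m i \<in> N (e + d i)" using N_smult[OF y(1)] mi by blast
    have germ: "germ_smult M p (a p) (s i p) = frac M p (y \<odot> m i) (g * f i)"
      using germ_smult_frac[OF p2 y0(1) isfracI[OF N_piece, of "m i" "d i" "f i"]] mi y0 by simp
    have 1: "volume V (s(i := \<lambda>p\<in>V. germ_smult M p (a p) (s i p))) p
        = frac (twist c) p (lam (m(i := y \<odot> m i))) (\<Prod>j<r. (f(i := g * f i)) j)"
      by (rule volume_eq[OF p2 p, of _ "d(i := e + d i)"])
        (use X(2,4,5) germ sum p mi y p2 in \<open>auto intro: forms_mult simp: P2_mult\<close>)
    have 2: "volume V s p = frac (twist c) p (lam m) (\<Prod>j<r. f j)"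
      by (rule volume_eq[OF p2 p, of _ d]) (use X(2,4,5) in auto)
    have i2: "isfrac (twist c) p (lam m) (\<Prod>j<r. f j)"
      by (rule isfrac_volume[OF p2, of _ d]) (use X(2,4,5) in auto)
    have "lam (m(i := y \<odot> m i)) = y * lam m"
      using lam_smult[of m d i "m i" "d i" y e] X(4) i y by simp
    then show "volume V (s(i := \<lambda>p\<in>V. germ_smult M p (a p) (s i p))) p =
        (\<lambda>p\<in>V. germ_smult (twist c) p (a p) (volume V s p)) p"
      using p 1 2 C.germ_smult_frac[OF p2 y0(1) i2] y0(2)
      by (simp add: prod_upd prod_f[of f] mult_ac del: fun_upd_apply)
  qed (simp_all add: volume_def)
qed

lemma volume_alternating:
  assumes V: "zopen V" and s: "\<And>i. i < r \<Longrightarrow> s i \<in> subsections M N V"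
    and ij: "i < r" "j < r" "i \<noteq> j" "s i = s j"
  shows "volume V s = (\<lambda>p\<in>V. frac (twist c) p 0 1)"
proof (rule extensionalityI[of _ V])
  fix p assume p: "p \<in> V"
  have p2: "p \<in> P2" using p zopen_subset[OF V] by auto
  obtain X m d f where X: "zopen X" "p \<in> X" "X \<subseteq> V"
    "\<And>i. i < r \<Longrightarrow> m i \<in> N (d i) \<and> f i \<in> forms (d i)"
    "\<And>i q. i < r \<Longrightarrow> q \<in> X \<Longrightarrow> f i \<notin> q \<and> s i q = frac M q (m i) (f i)"
    using subsections_germs[of V s p, OF V s p] by metis
  interpret C: germ_module "twist c" by (rule germ_module_twist)
  let ?m = "m(j := m i)" and ?f = "f(j := f i)" and ?d = "d(j := d i)"
  have m: "?m l \<in> N (?d l) \<and> ?f l \<in> forms (?d l) \<and> ?f l \<notin> p \<and> s l p = frac M p (?m l) (?f l)" if "l < r" for l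
    using X(4,5)[OF that] X(4,5)[OF ij(1)] X(2) ij(4) by auto
  have "volume V s p = frac (twist c) p (lam ?m) (\<Prod>j<r. ?f j)"
    by (rule volume_eq[of p V ?m ?d ?f s, OF p2 p m])
  also have "lam ?m = 0" by (rule lam_alternating[of _ ?d, OF _ ij(1-3)]) (use m ij in auto)
  also have "frac (twist c) p 0 (\<Prod>j<r. ?f j) = frac (twist c) p 0 1"
    using isfrac_volume[OF p2, of ?m ?d ?f] m \<open>lam ?m = 0\<close> P2_one[OF p2]
    by (intro C.frac_eqI[OF p2]) (auto intro!: isfracI[of _ _ 0])
  finally show "volume V s p = (\<lambda>p\<in>V. frac (twist c) p 0 1) p" using p by simp
qed (simp_all add: volume_def)

end

lemma graded_module_twist: "graded_module (twist c)"
  by (intro graded_module.intro germ_module_twist graded_module_axioms.intro) (auto simp: algebra_simps)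

text \<open>The twists themselves carry the tautological volume form of rank one, so that local generators of \<open>\<O>(c)\<close>
  are frames in the sense of \<open>frame_of_nonvanishing_volume\<close>.\<close>

lemma volume_form_twist: "volume_form (twist c) (piece (twist c)) 1 c (\<lambda>n. n 0)"
proof -
  interpret T: graded_module "twist c" by (rule graded_module_twist)
  show ?thesis
  proof unfold_locales
    fix n :: "nat \<Rightarrow> 'a poly3" and v :: "'a poly3"
    have "finsum (twist c) (\<lambda>i. (n(i := v)) 0 \<odot>\<^bsub>twist c\<^esub> n i) {..<1} = v * n 0"
      using T.finsum_lessThan_Suc[of 0 "\<lambda>i. (n(i := v)) 0 * n i"] by simp
    then show "n 0 \<odot>\<^bsub>twist c\<^esub> v = finsum (twist c) (\<lambda>i. (n(i := v)) 0 \<odot>\<^bsub>twist c\<^esub> n i) {..<1}"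
      by (simp add: mult.commute)
  qed auto
qed

context volume_form
begin

lemma frame_volume:
  assumes V: "zopen V" and n: "\<And>i. i < r \<Longrightarrow> n i \<in> N e" and g: "g \<in> forms e"
    and nv: "\<And>q. q \<in> V \<Longrightarrow> lam n \<notin> q \<and> g \<notin> q"
  shows "frame (sheafify (twist c)) (\<lambda>W. carrier (sheafify (twist c) W)) V 1
    (\<lambda>i\<in>{..<1}. volume V (\<lambda>i\<in>{..<r}. \<lambda>p\<in>V. frac M p (n i) g))"
proof -
  interpret T: volume_form "twist c" "piece (twist c)" 1 c "\<lambda>n. n 0" by (rule volume_form_twist)
  have "volume V (\<lambda>i\<in>{..<r}. \<lambda>p\<in>V. frac M p (n i) g) = (\<lambda>p\<in>V. frac (twist c) p (lam n) (g ^ r))"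
  proof (rule extensionalityI[of _ V])
    fix p assume p: "p \<in> V"
    then have p2: "p \<in> P2" using zopen_subset[OF V] by auto
    have "volume V (\<lambda>i\<in>{..<r}. \<lambda>p\<in>V. frac M p (n i) g) p = frac (twist c) p (lam n) (\<Prod>i<r. g)"
      by (rule volume_eq[OF p2 p, of n "\<lambda>_. e" "\<lambda>_. g"]) (use n g nv[OF p] p in simp)
    then show "volume V (\<lambda>i\<in>{..<r}. \<lambda>p\<in>V. frac M p (n i) g) p = (\<lambda>p\<in>V. frac (twist c) p (lam n) (g ^ r)) p"
      using p by simp
  qed (simp_all add: volume_def)
  moreover have "frame (sheafify (twist c)) (subsections (twist c) (piece (twist c))) V 1
      (\<lambda>i\<in>{..<1}. \<lambda>p\<in>V. frac (twist c) p (lam n) (g ^ r))"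
  proof (rule T.frame_of_nonvanishing_volume[OF V, of "\<lambda>_. lam n" "int r * e"])
    show "lam n \<in> piece (twist c) (int r * e)" using lam_forms[of n "\<lambda>_. e"] n by simp
    show "g ^ r \<in> forms (int r * e)" by (rule forms_power[OF g])
    show "lam n \<notin> q \<and> g ^ r \<notin> q" if "q \<in> V" for q
      using nv[OF that] that zopen_subset[OF V] by (auto simp: P2_power)
  qed
  ultimately show ?thesis by (simp add: sections_eq_subsections)
qed

text \<open>The volume form is a determinant isomorphism on \<open>U\<close>, since Cramer's rule makes members of \<open>N\<close> with
  nonvanishing volume a local frame which is sent to a local generator of \<open>\<O>(c)\<close>.\<close>

theorem slope_of_volume_form:
  assumes U: "zopen U" "codim2_complement U" "U \<noteq> {}" and r: "0 < r"
    and local: "\<And>p. p \<in> U \<Longrightarrow> \<exists>n e g. (\<forall>i<r. n i \<in> N e) \<and> g \<in> forms e \<and> lam n \<notin> p \<and> g \<notin> p"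
  shows "is_slope (sheafify M) (subsections M N) (real_of_int c / real r)"
    and "nonzero_subsheaf (sheafify M) (subsections M N)"
proof -
  have fr: "\<exists>V n e g. zopen V \<and> p \<in> V \<and> V \<subseteq> U \<and> (\<forall>i<r. n i \<in> N e) \<and> g \<in> forms e \<and>
      (\<forall>q\<in>V. lam n \<notin> q \<and> g \<notin> q)" if p: "p \<in> U" for p
  proof -
    obtain n e g where n: "\<forall>i<r. n i \<in> N e" "g \<in> forms e" "lam n \<notin> p" "g \<notin> p" using local[OF p] by blast
    have p2: "p \<in> P2" using p zopen_subset[OF U(1)] by auto
    have "lam n * g \<in> forms ((\<Sum>i<r. e) + c + e)"
      by (rule forms_mult[OF lam_forms n(2)]) (use n in auto)
    then have "zopen (U \<inter> {q \<in> P2. lam n * g \<notin> q})" by (intro zopen_Int U zopen_nonvanishing)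
    moreover have "p \<in> U \<inter> {q \<in> P2. lam n * g \<notin> q}" using p p2 n by (simp add: P2_mult)
    moreover have "\<forall>q\<in>U \<inter> {q \<in> P2. lam n * g \<notin> q}. lam n \<notin> q \<and> g \<notin> q" by (auto simp: P2_mult_iff)
    ultimately show ?thesis using n by (intro exI[of _ "U \<inter> {q \<in> P2. lam n * g \<notin> q}"] exI[of _ n] exI[of _ e] exI[of _ g]) simp
  qed
  obtain p where p: "p \<in> U" using U by auto
  obtain V n e g where V: "zopen V" "p \<in> V" "V \<subseteq> U" "\<And>i. i < r \<Longrightarrow> n i \<in> N e" "g \<in> forms e"
    "\<And>q. q \<in> V \<Longrightarrow> lam n \<notin> q \<and> g \<notin> q" using fr[OF p] by metis
  have rank: "is_rank (sheafify M) (subsections M N) r"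
    unfolding is_rank_def using frame_of_nonvanishing_volume[OF V(1,4,5,6)] V(1,2) by blast
  have "det_iso (sheafify M) (subsections M N) r (sheafify (twist c)) U volume"
    unfolding det_iso_def
  proof (intro conjI allI impI ballI)
    fix V s assume "zopen V \<and> V \<subseteq> U" and s0: "s \<in> {..<r} \<rightarrow>\<^sub>E subsections M N V"
    then have V: "zopen V" by auto
    have s: "s i \<in> subsections M N V" if "i < r" for i using s0 that by auto
    show "volume V s \<in> carrier (sheafify (twist c) V)" using volume_section[OF V s] by simp
    show "volume W (\<lambda>i\<in>{..<r}. restrict (s i) W) = restrict (volume V s) W" if W: "zopen W \<and> W \<subseteq> V" for W
    proof (rule extensionalityI[of _ W])
      fix p assume p: "p \<in> W"
      then have p': "p \<in> V" "p \<in> P2" using W zopen_subset by auto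
      obtain X m d f where X: "zopen X" "p \<in> X" "X \<subseteq> V"
        "\<And>i. i < r \<Longrightarrow> m i \<in> N (d i) \<and> f i \<in> forms (d i)"
        "\<And>i q. i < r \<Longrightarrow> q \<in> X \<Longrightarrow> f i \<notin> q \<and> s i q = frac M q (m i) (f i)"
        using subsections_germs[of V s p, OF V s p'(1)] by metis
      have "volume W (\<lambda>i\<in>{..<r}. restrict (s i) W) p = frac (twist c) p (lam m) (\<Prod>i<r. f i)"
        by (rule volume_eq[OF p'(2) p, of m d f]) (use X p in auto)
      moreover have "volume V s p = frac (twist c) p (lam m) (\<Prod>i<r. f i)"
        by (rule volume_eq[OF p'(2,1), of m d f]) (use X p in auto)
      ultimately show "volume W (\<lambda>i\<in>{..<r}. restrict (s i) W) p = restrict (volume V s) W p" using p by simp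
    qed (simp_all only: volume_def restrict_extensional)
    show "volume V (s(i := s i \<oplus>\<^bsub>sheafify M V\<^esub> t)) =
        volume V s \<oplus>\<^bsub>sheafify (twist c) V\<^esub> volume V (s(i := t))"
      if "i < r" "t \<in> subsections M N V" for i t
      using volume_multilinear(1)[OF V s that] by simp
    show "volume V (s(i := a \<odot>\<^bsub>sheafify M V\<^esub> s i)) = a \<odot>\<^bsub>sheafify (twist c) V\<^esub> volume V s"
      if "i < r" "a \<in> carrier (\<O> V)" for i a
      using volume_multilinear(2)[OF V s that(1)] that(2) by simp
    show "volume V s = \<zero>\<^bsub>sheafify (twist c) V\<^esub>" if "i < r" "j < r" "i \<noteq> j \<and> s i = s j" for i j
      using volume_alternating[OF V s that(1,2)] that(3) by simp
  next
    fix p assume p: "p \<in> U"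
    obtain V n e g where V: "zopen V" "p \<in> V" "V \<subseteq> U" "\<And>i. i < r \<Longrightarrow> n i \<in> N e" "g \<in> forms e"
      "\<And>q. q \<in> V \<Longrightarrow> lam n \<notin> q \<and> g \<notin> q" using fr[OF p] by metis
    show "\<exists>V e. zopen V \<and> p \<in> V \<and> V \<subseteq> U \<and> frame (sheafify M) (subsections M N) V r e \<and>
        frame (sheafify (twist c)) (\<lambda>W. carrier (sheafify (twist c) W)) V 1 (\<lambda>i\<in>{..<1}. volume V e)"
      using V(1-3) frame_of_nonvanishing_volume[OF V(1,4,5,6)] frame_volume[OF V(1,4,5,6)]
      by (intro exI[of _ V] exI[of _ "\<lambda>i\<in>{..<r}. \<lambda>p\<in>V. frac M p (n i) g"]) simp
  qed
  then have "is_c1 (sheafify M) (subsections M N) c"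
    unfolding is_c1_def using rank U by blast
  then show "is_slope (sheafify M) (subsections M N) (real_of_int c / real r)"
    unfolding is_slope_def using r rank by blast
  show "nonzero_subsheaf (sheafify M) (subsections M N)"
    unfolding nonzero_subsheaf_def
  proof (intro exI[of _ V] conjI V notI)
    assume *: "subsections M N V = {\<zero>\<^bsub>sheafify M V\<^esub>}"
    have p2: "p \<in> P2" using V(2) zopen_subset[OF V(1)] by auto
    have "(\<lambda>p\<in>V. frac M p (n 0) g) \<in> subsections M N V"
      by (rule local_fraction_subsection[of V "n 0" N e g, OF V(1) V(4)[OF r] V(5)]) (use V(6) in auto)
    then have "frac M p (n 0) g = frac M p \<zero> 1" using * V(2) by (auto simp: fun_eq_iff restrict_def split: if_splits)
    then obtain b k where k: "k \<in> forms b" "k \<notin> p" "k \<odot> (1 \<odot> n 0) = k \<odot> (g \<odot> \<zero>)"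
      using frac_eq_iff[OF p2 isfracI[OF N_piece[OF V(4)[OF r]] V(5)] isfrac_zero[OF p2]] V(6)[OF V(2)] by auto
    then have "k \<odot> n 0 = \<zero>" using N_carrier[OF V(4)[OF r]] by (simp add: smult_one smult_zero_right)
    moreover have "lam (n(0 := k \<odot> n 0)) = k * lam n"
      using lam_smult[of n "\<lambda>_. e", OF V(4) r V(4)[OF r] k(1)] by simp
    ultimately have "k * lam n = 0" using lam_zero[of n "\<lambda>_. e", OF V(4) r] by simp
    then show False using P2_mult[OF p2 k(2)] V(6)[OF V(2)] P2_zero[OF p2] by metis
  qed
qed

end

section \<open>Monomials\<close>

abbreviation monom3 :: "(3 \<Rightarrow>\<^sub>0 nat) \<Rightarrow> 'k::comm_ring_1 poly3"
  where "monom3 m \<equiv> Poly_Mapping.single m 1"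

lemma lookup_mult_monom:
  fixes g :: "'a::comm_ring_1 poly3"
  shows "Poly_Mapping.lookup (g * monom3 e) (m + e) = Poly_Mapping.lookup g m"
proof -
  have "Poly_Mapping.lookup (g * monom3 e) (m + e) = Sum_any (\<lambda>l. (Poly_Mapping.lookup g l when m = l))"
    unfolding lookup_mult
  proof (rule Sum_any.cong)
    fix l
    have "Sum_any (\<lambda>q. (Poly_Mapping.lookup (monom3 e :: 'a poly3) q when m + e = l + q)) = (1 when m = l)"
    proof (cases "m = l")
      case False
      then have "(\<lambda>q. (Poly_Mapping.lookup (monom3 e :: 'a poly3) q when m + e = l + q)) = (\<lambda>_. 0)"
        by (auto simp: fun_eq_iff lookup_single when_def)
      from arg_cong[OF this, of Sum_any] show ?thesis using False by simp
    qed (simp add: lookup_single when_def)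
    then show "Poly_Mapping.lookup g l * Sum_any (\<lambda>q. (Poly_Mapping.lookup (monom3 e) q when m + e = l + q)) =
        (Poly_Mapping.lookup g l when m = l)" by (simp add: when_def)
  qed
  then show ?thesis by simp
qed

lemma keys_mult_monom: "Poly_Mapping.keys (g * monom3 e) = (\<lambda>m. m + e) ` Poly_Mapping.keys g"
proof (intro subset_antisym subsetI)
  fix m assume "m \<in> Poly_Mapping.keys (g * monom3 e)"
  then show "m \<in> (\<lambda>m. m + e) ` Poly_Mapping.keys g" using keys_mult[of g "monom3 e"] by (auto split: if_splits)
next
  fix m assume "m \<in> (\<lambda>m. m + e) ` Poly_Mapping.keys g"
  then show "m \<in> Poly_Mapping.keys (g * monom3 e)" by (auto simp: in_keys_iff lookup_mult_monom)
qed

lemma monom_forms: "monom3 e \<in> forms (int (mdeg e))"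
  by (auto simp: forms_def)

lemma forms_cancel_monom:
  assumes "g * monom3 e \<in> forms t"
  shows "g \<in> forms (t - int (mdeg e))"
  using assms by (force simp: forms_def keys_mult_monom mdeg_add)

lemma sum_monomials: "(\<Sum>m\<in>Poly_Mapping.keys g. Poly_Mapping.single m (Poly_Mapping.lookup g m)) = (g :: 'a \<Rightarrow>\<^sub>0 'b::comm_monoid_add)"
  by (rule poly_mapping_eqI) (auto simp: lookup_sum lookup_single when_def in_keys_iff)

lemma mult_single_monom: "Poly_Mapping.single m x * monom3 e = Poly_Mapping.single (m + e) x"
  by (simp add: mult_single)

lemma exponent_diff_add:
  fixes m e :: "3 \<Rightarrow>\<^sub>0 nat"
  assumes "\<And>i. Poly_Mapping.lookup e i \<le> Poly_Mapping.lookup m i"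
  shows "m - e + e = m"
  by (rule poly_mapping_eqI) (use assms in \<open>simp add: lookup_add lookup_minus\<close>)

lemma monom_dvdI:
  fixes g :: "'k::comm_ring_1 poly3"
  assumes "\<And>m i. m \<in> Poly_Mapping.keys g \<Longrightarrow> Poly_Mapping.lookup e i \<le> Poly_Mapping.lookup m i"
  obtains h where "g = h * monom3 e"
proof
  have "g = (\<Sum>m\<in>Poly_Mapping.keys g. Poly_Mapping.single (m - e + e) (Poly_Mapping.lookup g m))"
    using assms by (subst sum_monomials[symmetric], intro sum.cong) (auto simp: exponent_diff_add)
  then show "g = (\<Sum>m\<in>Poly_Mapping.keys g. Poly_Mapping.single (m - e) (Poly_Mapping.lookup g m)) * monom3 e"
    by (simp add: sum_distrib_right mult_single_monom)
qed

text \<open>A monomial divides a product with a coprime monomial only if it divides the other factor.  This replaces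
  unique factorization below.\<close>

lemma monom_dvd_cancel:
  fixes g h :: "'k::comm_ring_1 poly3"
  assumes eq: "g * monom3 e = h * monom3 e'" and disj: "\<And>i. Poly_Mapping.lookup e i = 0 \<or> Poly_Mapping.lookup e' i = 0"
  obtains q where "g = q * monom3 e'"
proof (rule monom_dvdI[of g e'])
  fix m i assume "m \<in> Poly_Mapping.keys g"
  then have "m + e \<in> Poly_Mapping.keys (h * monom3 e')" using eq keys_mult_monom[of g e] by auto
  then obtain m' where "m + e = m' + e'" by (auto simp: keys_mult_monom)
  then have "Poly_Mapping.lookup m i + Poly_Mapping.lookup e i = Poly_Mapping.lookup m' i + Poly_Mapping.lookup e' i" by (metis lookup_add)
  then show "Poly_Mapping.lookup e' i \<le> Poly_Mapping.lookup m i" using disj[of i] by auto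
qed (rule that)

lemma Var_power: "Var i ^ n = monom3 (Poly_Mapping.single i n)"
  by (induction n) (auto simp: Var_def mult_single single_add[symmetric])

lemma monom_nonzero: "monom3 e \<noteq> (0 :: 'k::comm_ring_1 poly3)"
  by (metis lookup_single_eq lookup_zero zero_neq_one)

lemma pdeg_monom: "pdeg (monom3 e :: 'k::comm_ring_1 poly3) = mdeg e"
  by (simp add: pdeg_def)

section \<open>The generic point and the coordinate lines\<close>

lemma ring_PR: "cring PR"
proof (intro cringI abelian_groupI comm_monoidI)
  show "\<exists>y\<in>carrier PR. y \<oplus>\<^bsub>PR\<^esub> x = \<zero>\<^bsub>PR\<^esub>" if "x \<in> carrier PR" for x :: "'a poly3"
    by (rule bexI[of _ "- x"]) auto
qed (auto simp: algebra_simps)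

lemma ideal_PR_I:
  assumes "0 \<in> J" "\<And>g h. g \<in> J \<Longrightarrow> h \<in> J \<Longrightarrow> g + h \<in> J" "\<And>g h. g \<in> J \<Longrightarrow> h * g \<in> J"
  shows "ideal J PR"
proof -
  interpret R: cring "PR :: 'a poly3 ring" by (rule ring_PR)
  have *: "\<ominus>\<^bsub>PR\<^esub> g = - g" for g :: "'a poly3"
    by (rule R.minus_equality) auto
  have neg: "- g \<in> J" if "g \<in> J" for g using assms(3)[OF that, of "- 1"] by simp
  show ?thesis
  proof (rule idealI[OF R.ring_axioms])
    show "subgroup J (add_monoid PR)"
    proof (rule subgroup.intro)
      show "inv\<^bsub>add_monoid PR\<^esub> g \<in> J" if "g \<in> J" for g
        using neg[OF that] *[of g] by (simp add: a_inv_def)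
    qed (use assms in auto)
  qed (use assms in \<open>auto simp: mult.commute\<close>)
qed

text \<open>The zero ideal is the generic point; it shows that open sets are nonempty, and it starts the chains of
  points which measure codimension.\<close>

lemma zero_point: "{0} \<in> (P2 :: 'k::idom poly3 set set)"
proof -
  interpret R: cring "PR :: 'k poly3 ring" by (rule ring_PR)
  have id: "ideal {0 :: 'k poly3} PR" by (rule ideal_PR_I) auto
  have "primeideal {0 :: 'k poly3} PR"
  proof (rule primeidealI[OF id ring_PR])
    show "carrier PR \<noteq> {0 :: 'k poly3}"
      using monom_nonzero[of 0, where 'k='k] by (metis PR_simps(1) UNIV_I singletonD)
  qed auto
  moreover have "{0 :: 'k poly3} = genideal PR ({0} \<inter> (\<Union>t. forms t))"
    using R.genideal_zero by simp
  moreover have "\<not> range Var \<subseteq> {0 :: 'k poly3}"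
    using monom_nonzero[of "Poly_Mapping.single 0 1", where 'k='k] by (auto simp: Var_def)
  ultimately show ?thesis by (simp add: P2_def)
qed

text \<open>The generic point of a coordinate line, that is, the ideal generated by the variable \<open>i\<close>.  Membership is
  described by exponents, because it can then be read off term by term.\<close>

definition line_point :: "3 \<Rightarrow> 'k::comm_ring_1 point"
  where "line_point i = {g. \<forall>m\<in>Poly_Mapping.keys g. 0 < Poly_Mapping.lookup m i}"

lemma line_point_memD:
  fixes g :: "'k::comm_ring_1 poly3"
  assumes "g \<in> line_point i"
  obtains h where "g = h * Var i"
proof (rule monom_dvdI[of g "Poly_Mapping.single i 1"])
  show "Poly_Mapping.lookup (Poly_Mapping.single i 1) j \<le> Poly_Mapping.lookup m j" if "m \<in> Poly_Mapping.keys g" for m j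
    using assms that by (auto simp: line_point_def lookup_single when_def)
qed (rule that, simp add: Var_def)

lemma Var_in_line_point: "Var i \<in> (line_point j :: 'k::comm_ring_1 poly3 set) \<longleftrightarrow> i = j"
  by (auto simp: line_point_def Var_def lookup_single when_def)

lemma line_point_ideal: "ideal (line_point i) PR"
proof (rule ideal_PR_I)
  fix g h :: "'a poly3"
  assume g: "g \<in> line_point i"
  show "h * g \<in> line_point i" using g keys_mult[of h g] by (force simp: line_point_def lookup_add)
  assume h: "h \<in> line_point i"
  show "g + h \<in> line_point i" using g h Poly_Mapping.keys_add[of g h] by (auto simp: line_point_def)
qed (simp add: line_point_def)

lemma line_point: "line_point i \<in> (P2 :: 'k::idom poly3 set set)"
proof -
  interpret R: cring "PR :: 'k poly3 ring" by (rule ring_PR)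
  let ?L = "line_point i :: 'k poly3 set"
  interpret L: ideal ?L PR by (rule line_point_ideal)
  have mult: "h * g \<in> ?L" "g * h \<in> ?L" if "g \<in> ?L" for g h
    using L.I_l_closed[OF that, of h] L.I_r_closed[OF that, of h] by auto
  have add: "g + h \<in> ?L" if "g \<in> ?L" "h \<in> ?L" for g h
    using additive_subgroup.a_closed[OF L.is_additive_subgroup that] by simp
  \<comment> \<open>Modulo the ideal, a polynomial is represented by the sum of its terms that avoid the variable.\<close>
  define rd where "rd g = (\<Sum>m | m \<in> Poly_Mapping.keys g \<and> Poly_Mapping.lookup m i = 0. Poly_Mapping.single m (Poly_Mapping.lookup g m))" for g :: "'k poly3"
  have rd_lookup: "Poly_Mapping.lookup (rd g) m = (if Poly_Mapping.lookup m i = 0 then Poly_Mapping.lookup g m else 0)" for g m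
    unfolding rd_def by (auto simp: lookup_sum lookup_single when_def in_keys_iff)
  have rd_diff: "g - rd g \<in> ?L" for g
    by (auto simp: line_point_def in_keys_iff lookup_minus rd_lookup split: if_splits)
  have rd_nonzero: "rd g \<noteq> 0" if g: "g \<notin> ?L" for g
  proof -
    obtain m where "m \<in> Poly_Mapping.keys g" "Poly_Mapping.lookup m i = 0" using g by (auto simp: line_point_def)
    then have "Poly_Mapping.lookup (rd g) m \<noteq> 0" by (simp add: rd_lookup in_keys_iff)
    then show ?thesis by auto
  qed
  have "primeideal ?L PR"
  proof (rule primeidealI[OF line_point_ideal ring_PR])
    have "1 \<notin> ?L" by (simp add: line_point_def)
    then show "carrier PR \<noteq> ?L" by auto
  next
    fix g h :: "'k poly3"
    assume "g \<otimes>\<^bsub>PR\<^esub> h \<in> ?L"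
    then have gh: "g * h \<in> ?L" by simp
    show "g \<in> ?L \<or> h \<in> ?L"
    proof (rule ccontr)
      assume "\<not> (g \<in> ?L \<or> h \<in> ?L)"
      then have "rd g * rd h \<noteq> 0" using rd_nonzero by auto
      then obtain m where m: "m \<in> Poly_Mapping.keys (rd g * rd h)" by (metis keys_eq_empty ex_in_conv)
      then obtain m1 m2 where "m = m1 + m2" "m1 \<in> Poly_Mapping.keys (rd g)" "m2 \<in> Poly_Mapping.keys (rd h)"
        using keys_mult[of "rd g" "rd h"] by blast
      then have mi: "Poly_Mapping.lookup m i = 0" by (auto simp: lookup_add in_keys_iff rd_lookup split: if_splits)
      have "rd g * rd h = g * h + (- 1) * (g * (h - rd h) + (g - rd g) * rd h)" by (simp add: algebra_simps)
      also have "\<dots> \<in> ?L" by (intro add mult gh rd_diff)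
      finally show False using m mi by (auto simp: line_point_def)
    qed
  qed
  moreover have "?L = genideal PR (?L \<inter> (\<Union>t. forms t))"
  proof (rule subset_antisym)
    show "genideal PR (?L \<inter> (\<Union>t. forms t)) \<subseteq> ?L"
      by (rule R.genideal_minimal[OF line_point_ideal]) auto
    show "?L \<subseteq> genideal PR (?L \<inter> (\<Union>t. forms t))"
    proof
      fix g assume "g \<in> ?L"
      then obtain h where "g = h * Var i" by (rule line_point_memD)
      moreover have "Var i \<in> genideal PR (?L \<inter> (\<Union>t. forms t))"
      proof (rule subsetD[OF R.genideal_self])
        show "Var i \<in> ?L \<inter> (\<Union>t. forms t)" using Var_in_line_point[of i i] Var_forms[of i] by blast
      qed simp
      ultimately show "g \<in> genideal PR (?L \<inter> (\<Union>t. forms t))"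
        using ideal.I_l_closed[OF R.genideal_ideal, of "?L \<inter> (\<Union>t. forms t)" "Var i" h] by simp
    qed
  qed
  moreover have "\<not> range Var \<subseteq> ?L"
    using Var_in_line_point[of "i + 1" i, where 'k='k] by auto
  ultimately show ?thesis by (simp add: P2_def)
qed

text \<open>Subsheaves of rank two that involve the mixed monomial are locally free away from such points only,
  where the chain consists of the generic point and the generic point of a coordinate line.\<close>

lemma codim2_coordinate_point:
  fixes p :: "'k::idom point"
  assumes p: "p \<in> P2" and ij: "i \<noteq> j" "Var i \<in> p" "Var j \<in> p"
  shows "\<exists>q0\<in>P2. \<exists>q1\<in>P2. q0 \<subset> q1 \<and> q1 \<subset> p"
proof (rule bexI[of _ "{0}"], rule bexI[of _ "line_point i"], rule conjI)
  show "line_point i \<subset> p"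
  proof
    show "line_point i \<subseteq> p"
      using P2_multI[OF p ij(2)] by (auto elim: line_point_memD)
    show "line_point i \<noteq> p" using ij Var_in_line_point[of j i, where 'k='k] by auto
  qed
  have "Var i \<in> (line_point i :: 'k point)" "Var i \<noteq> (0 :: 'k poly3)"
    using Var_in_line_point[of i i, where 'k='k] monom_nonzero[of "Poly_Mapping.single i 1", where 'k='k]
    by (auto simp: Var_def)
  moreover have "0 \<in> (line_point i :: 'k point)" by (simp add: line_point_def)
  ultimately show "{0} \<subset> (line_point i :: 'k point)" by blast
qed (rule line_point zero_point)+

section \<open>Syzygy modules\<close>

lemma syz_simps [simp]:
  "carrier (syz f) = {v. (\<Sum>i\<in>UNIV. v $ i * f $ i) = 0}" "add (syz f) = (+)" "zero (syz f) = 0" "smult (syz f) = (*s)"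
  "piece (syz f) t = {v. (\<forall>i. v $ i \<in> forms (t - int (pdeg (f $ i)))) \<and> (\<Sum>i\<in>UNIV. v $ i * f $ i) = 0}"
  by (auto simp: syz_def gfree_def Let_def)

lemma syz_smult_sum: "(\<Sum>i\<in>UNIV. (r *s v) $ i * f $ i) = r * (\<Sum>i\<in>UNIV. v $ i * (f :: 'k::comm_ring_1 poly3 ^ 'n) $ i)"
  by (simp add: sum_distrib_left mult.assoc)

lemma graded_module_syz: "graded_module (syz (f :: 'k::comm_ring_1 poly3 ^ 'n))"
proof -
  have *: "r * v \<in> forms (d + e - t)" if "r \<in> forms d" "v \<in> forms (e - t)" for r v :: "'k poly3" and d e t
    using forms_mult[OF that] by (simp add: algebra_simps)
  show ?thesis
    by unfold_locales
      (auto simp: syz_smult_sum forms_add * vector_ssub_ldistrib vector_add_ldistrib vector_sadd_rdistrib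
        distrib_right sum.distrib vector_smult_assoc simp del: vector_smult_component,
        auto simp: *)
qed

lemma finsum_eq_sum:
  fixes M :: "('k::comm_ring_1 poly3, 'm::comm_monoid_add) gmodule"
  assumes "graded_module M" "add M = (+)" "zero M = 0" and "\<And>i. i < (r::nat) \<Longrightarrow> x i \<in> carrier M"
  shows "finsum M x {..<r} = (\<Sum>i<r. x i)"
proof -
  interpret graded_module M by fact
  show ?thesis using assms(4)
    by (induction r) (auto simp: finsum_lessThan_Suc assms(2,3) add.commute)
qed

definition generated ::
    "nat \<Rightarrow> (nat \<Rightarrow> 'k::comm_ring_1 poly3 ^ 'n) \<Rightarrow> (nat \<Rightarrow> nat) \<Rightarrow> int \<Rightarrow> ('k poly3 ^ 'n) set"
  where "generated k G dg e = {v. \<exists>t. (\<forall>i<k. t i \<in> forms (e - int (dg i))) \<and> v = (\<Sum>i<k. t i *s G i)}"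

lemma graded_submodule_generated:
  fixes f :: "'k::comm_ring_1 poly3 ^ 'n"
  assumes G: "\<And>i. i < k \<Longrightarrow> G i \<in> piece (syz f) (int (dg i))"
  shows "graded_submodule (syz f) (generated k G dg)"
proof -
  interpret graded_module "syz f" by (rule graded_module_syz)
  show ?thesis
  proof unfold_locales
    show "v \<in> piece (syz f) e" if "v \<in> generated k G dg e" for v e
    proof -
      obtain t where t: "\<forall>i<k. t i \<in> forms (e - int (dg i))" "v = (\<Sum>i<k. t i *s G i)"
        using \<open>v \<in> generated k G dg e\<close> by (auto simp: generated_def)
      have *: "t i \<odot>\<^bsub>syz f\<^esub> G i \<in> piece (syz f) e" if "i < k" for i
        using smult_piece[of "t i" "e - int (dg i)" "G i" "int (dg i)"] t that G by (simp del: syz_simps(5))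
      have "v = finsum (syz f) (\<lambda>i. t i \<odot>\<^bsub>syz f\<^esub> G i) {..<k}"
        unfolding t(2) by (subst finsum_eq_sum[OF graded_module_syz]) (use * in \<open>auto dest: piece_carrier simp del: syz_simps(1,5)\<close>)
      then show ?thesis using P.N_finsum[of k "\<lambda>i. t i \<odot>\<^bsub>syz f\<^esub> G i" e] * by (simp del: syz_simps)
    qed
    show "x \<oplus>\<^bsub>syz f\<^esub> y \<in> generated k G dg e" if x: "x \<in> generated k G dg e" and y: "y \<in> generated k G dg e" for x y e
    proof -
      obtain t where t: "\<forall>i<k. t i \<in> forms (e - int (dg i))" "x = (\<Sum>i<k. t i *s G i)"
        using x unfolding generated_def by blast
      moreover obtain u where "\<forall>i<k. u i \<in> forms (e - int (dg i))" "y = (\<Sum>i<k. u i *s G i)"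
        using y unfolding generated_def by blast
      ultimately show ?thesis unfolding generated_def
        by (intro CollectI exI[of _ "\<lambda>i. t i + u i"]) (auto simp: forms_add sum.distrib vector_sadd_rdistrib)
    qed
    show "r \<odot>\<^bsub>syz f\<^esub> x \<in> generated k G dg (d + e)" if r: "r \<in> forms d" and x: "x \<in> generated k G dg e" for r d x e
    proof -
      obtain t where t: "\<forall>i<k. t i \<in> forms (e - int (dg i))" "x = (\<Sum>i<k. t i *s G i)"
        using x unfolding generated_def by blast
      have "r * t i \<in> forms (d + e - int (dg i))" if "i < k" for i
        using forms_mult[OF r, of "t i" "e - int (dg i)"] t that by (simp add: algebra_simps)
      then show ?thesis using t(2) unfolding generated_def
        by (intro CollectI exI[of _ "\<lambda>i. r * t i"]) (auto simp: vec_eq_iff sum_distrib_left mult.assoc)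
    qed
    show "\<zero>\<^bsub>syz f\<^esub> \<in> generated k G dg e" for e
      unfolding generated_def by (intro CollectI exI[of _ "\<lambda>_. 0"]) auto
  qed
qed

lemma generator_mem: "i < k \<Longrightarrow> G i \<in> generated k G dg (int (dg i))"
  unfolding generated_def
  by (intro CollectI exI[of _ "\<lambda>j. if j = i then 1 else 0"])
     (auto simp: if_distrib[of "\<lambda>x. x *s _"] vec_eq_iff if_distrib[of "\<lambda>x. x * _"] sum.delta cong: if_cong)

lemma coherent_generated:
  fixes f :: "'k::comm_ring_1 poly3 ^ 'n"
  assumes G: "\<And>i. i < k \<Longrightarrow> G i \<in> piece (syz f) (int (dg i))"
  shows "coherent_subsheaf (sheafify (syz f)) (subsections (syz f) (generated k G dg))"
proof -
  interpret graded_submodule "syz f" "generated k G dg" by (rule graded_submodule_generated[OF G])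
  show ?thesis
  proof (rule coherent_of_generators[of k G dg])
    show "G i \<in> generated k G dg (int (dg i))" if "i < k" for i by (rule generator_mem[OF that])
    fix v e assume "v \<in> generated k G dg e"
    then obtain t where t: "\<forall>i<k. t i \<in> forms (e - int (dg i))" "v = (\<Sum>i<k. t i *s G i)"
      by (auto simp: generated_def)
    moreover have "finsum (syz f) (\<lambda>i. t i \<odot>\<^bsub>syz f\<^esub> G i) {..<k} = (\<Sum>i<k. t i \<odot>\<^bsub>syz f\<^esub> G i)"
      by (rule finsum_eq_sum[OF graded_module_syz]) (use G in \<open>auto intro!: smult_closed[OF piece_carrier[OF G]] simp del: syz_simps(1,4,5)\<close>)
    ultimately show "\<exists>t. (\<forall>i<k. t i \<in> forms (e - int (dg i))) \<and> v = finsum (syz f) (\<lambda>i. t i \<odot>\<^bsub>syz f\<^esub> G i) {..<k}"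
      by auto
  qed
qed

text \<open>Multiplying by powers of a variable that does not vanish at the point, one may allow members of
  different degrees.\<close>

lemma (in volume_form) slope_of_volume_form':
  assumes U: "zopen U" "codim2_complement U" "U \<noteq> {}" and r: "0 < r"
    and local: "\<And>p. p \<in> U \<Longrightarrow> \<exists>n e. (\<forall>i<r. n i \<in> N (int (e i))) \<and> lam n \<notin> p"
  shows "is_slope (sheafify M) (subsections M N) (real_of_int c / real r)"
    and "nonzero_subsheaf (sheafify M) (subsections M N)"
proof -
  have "\<exists>n e g. (\<forall>i<r. n i \<in> N e) \<and> g \<in> forms e \<and> lam n \<notin> p \<and> g \<notin> p" if p: "p \<in> U" for p
  proof -
    obtain n e where n: "\<forall>i<r. n i \<in> N (int (e i))" "lam n \<notin> p" using local[OF p] by blast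
    have p2: "p \<in> P2" using p zopen_subset[OF U(1)] by auto
    obtain j where j: "Var j \<notin> p" using P2_Var[OF p2] by blast
    define E where "E = (\<Sum>i<r. e i)"
    have E: "e i \<le> E" if "i < r" for i
      unfolding E_def by (rule member_le_sum) (use that in auto)
    have vp: "Var j ^ m \<in> forms (int m)" for m using forms_power[OF Var_forms, of j m] by simp
    let ?n = "\<lambda>i. Var j ^ (E - e i) \<odot> n i"
    have "lam ?n = (\<Prod>i<r. Var j ^ (E - e i)) * lam n"
      by (rule lam_scale[of _ "\<lambda>i. int (e i)" _ "\<lambda>i. int (E - e i)"]) (use n vp in auto)
    then have "lam ?n \<notin> p" using n(2) by (simp add: P2_mult P2_prod P2_power p2 j)
    moreover have "?n i \<in> N (int E)" if "i < r" for i
      using N_smult[OF vp, of "n i" "int (e i)" "E - e i"] n that E[OF that] by simp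
    ultimately show ?thesis
      using vp[of E] P2_power[OF p2 j, of E] by (intro exI[of _ ?n] exI[of _ "int E"] exI[of _ "Var j ^ E"]) auto
  qed
  then show "is_slope (sheafify M) (subsections M N) (real_of_int c / real r)"
    "nonzero_subsheaf (sheafify M) (subsections M N)"
    by (rule slope_of_volume_form[OF U r], blast)+
qed

section \<open>Consequences of semistability\<close>

lemma lessThan_3: "{..<3} = {0, 1, 2 :: nat}" and lessThan_2: "{..<2} = {0, 1 :: nat}"
  by auto

subsection \<open>The full syzygy bundle\<close>

text \<open>The volume of three syzygies of four forms is a maximal minor divided by the complementary form.
  The minor that omits the first component is used.\<close>

definition det3 :: "'a::comm_ring_1 ^ 4 \<Rightarrow> 'a ^ 4 \<Rightarrow> 'a ^ 4 \<Rightarrow> 'a"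
  where "det3 u v w = u $ 2 * (v $ 3 * w $ 4 - v $ 4 * w $ 3) - u $ 3 * (v $ 2 * w $ 4 - v $ 4 * w $ 2)
    + u $ 4 * (v $ 2 * w $ 3 - v $ 3 * w $ 2)"

lemma sum_quad: "(\<Sum>i\<in>UNIV. v $ i * f $ i) = v $ 1 * f $ 1 + v $ 2 * f $ 2 + v $ 3 * f $ 3 + v $ 4 * (f :: 'a::comm_ring_1 ^ 4) $ 4"
  by (simp add: sum_4)

lemma forms_mult_diff:
  "u \<in> forms (a - x) \<Longrightarrow> v \<in> forms (b - y) \<Longrightarrow> u * v \<in> forms (a + b - (x + y))"
  using forms_mult[of u "a - x" v "b - y"] by (simp add: algebra_simps)

text \<open>The maximal minors of three syzygies are proportional to the forms themselves, up to sign.  Hence the minor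
  that omits the first component is divisible by the first form if the first two forms are coprime.\<close>

lemma det3_minor:
  fixes f u v w :: "'a::comm_ring_1 ^ 4"
  assumes "u $ 1 * f $ 1 + u $ 2 * f $ 2 + u $ 3 * f $ 3 + u $ 4 * f $ 4 = 0"
    and "v $ 1 * f $ 1 + v $ 2 * f $ 2 + v $ 3 * f $ 3 + v $ 4 * f $ 4 = 0"
    and "w $ 1 * f $ 1 + w $ 2 * f $ 2 + w $ 3 * f $ 3 + w $ 4 * f $ 4 = 0"
  shows "det3 u v w * f $ 2 = - (u $ 1 * (v $ 3 * w $ 4 - v $ 4 * w $ 3) - u $ 3 * (v $ 1 * w $ 4 - v $ 4 * w $ 1)
    + u $ 4 * (v $ 1 * w $ 3 - v $ 3 * w $ 1)) * f $ 1"
proof -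
  have u: "u $ 2 * f $ 2 = - (u $ 1 * f $ 1 + u $ 3 * f $ 3 + u $ 4 * f $ 4)"
    and v: "v $ 2 * f $ 2 = - (v $ 1 * f $ 1 + v $ 3 * f $ 3 + v $ 4 * f $ 4)"
    and w: "w $ 2 * f $ 2 = - (w $ 1 * f $ 1 + w $ 3 * f $ 3 + w $ 4 * f $ 4)"
    using assms by (simp_all add: eq_neg_iff_add_eq_0 algebra_simps)
  have "det3 u v w * f $ 2 = (u $ 2 * f $ 2) * (v $ 3 * w $ 4 - v $ 4 * w $ 3)
      - u $ 3 * ((v $ 2 * f $ 2) * w $ 4 - v $ 4 * (w $ 2 * f $ 2))
      + u $ 4 * ((v $ 2 * f $ 2) * w $ 3 - v $ 3 * (w $ 2 * f $ 2))"
    by (simp add: det3_def algebra_simps)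
  then show ?thesis unfolding u v w by (simp add: algebra_simps)
qed

locale four_forms =
  fixes f :: "'k::idom poly3 ^ 4" and ex :: "4 \<Rightarrow> 3 \<Rightarrow>\<^sub>0 nat"
  assumes f_monom: "f $ i = monom3 (ex i)"
begin

abbreviation dg :: "4 \<Rightarrow> nat" where "dg i \<equiv> mdeg (ex i)"

lemma pdeg_f [simp]: "pdeg (f $ i) = dg i"
  by (simp add: f_monom pdeg_monom)

lemma f_nonzero [simp]: "f $ i \<noteq> 0"
  by (simp add: f_monom monom_nonzero)

lemma f_forms: "f $ i \<in> forms (int (dg i))"
  by (simp add: f_monom monom_forms)

lemma pieceD: assumes "v \<in> piece (syz f) e"
  shows "v $ i \<in> forms (e - int (dg i))"
    "v $ 1 * f $ 1 + v $ 2 * f $ 2 + v $ 3 * f $ 3 + v $ 4 * f $ 4 = 0"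
  using assms by (simp_all add: sum_quad)

lemma det3_forms:
  assumes "u \<in> piece (syz f) d" "v \<in> piece (syz f) d'" "w \<in> piece (syz f) d''"
  shows "det3 u v w \<in> forms (d + d' + d'' - (int (dg 2) + int (dg 3) + int (dg 4)))"
proof -
  have *: "u $ i * (v $ j * w $ l) \<in> forms (d + d' + d'' - (int (dg 2) + int (dg 3) + int (dg 4)))"
    if "int (dg i) + (int (dg j) + int (dg l)) = int (dg 2) + int (dg 3) + int (dg 4)" for i j l
    using forms_mult_diff[OF pieceD(1)[OF assms(1), of i] forms_mult_diff[OF pieceD(1)[OF assms(2), of j] pieceD(1)[OF assms(3), of l]]]
      that by (simp add: algebra_simps)
  have "det3 u v w = u $ 2 * (v $ 3 * w $ 4) - u $ 2 * (v $ 4 * w $ 3) - (u $ 3 * (v $ 2 * w $ 4) - u $ 3 * (v $ 4 * w $ 2))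
    + (u $ 4 * (v $ 2 * w $ 3) - u $ 4 * (v $ 3 * w $ 2))"
    by (simp add: det3_def algebra_simps)
  then show ?thesis by (auto intro!: forms_add forms_diff *)
qed

definition vol3 :: "(nat \<Rightarrow> 'k poly3 ^ 4) \<Rightarrow> 'k poly3"
  where "vol3 n = (THE L. L * f $ 1 = det3 (n 0) (n 1) (n 2))"

lemma vol3_eqI: "L * f $ 1 = det3 (n 0) (n 1) (n 2) \<Longrightarrow> vol3 n = L"
  unfolding vol3_def by (rule the_equality) (assumption, metis f_nonzero mult_right_cancel)

lemma vol3_mult:
  assumes cop: "\<And>i. Poly_Mapping.lookup (ex 1) i = 0 \<or> Poly_Mapping.lookup (ex 2) i = 0"
    and n: "\<And>i. i < 3 \<Longrightarrow> n i \<in> piece (syz f) (d i)"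
  shows "vol3 n * f $ 1 = det3 (n 0) (n 1) (n 2)"
proof -
  note r = n[THEN pieceD(2)]
  have "\<exists>g. det3 (n 0) (n 1) (n 2) * f $ 2 = g * f $ 1"
    using det3_minor[OF r[of 0] r[of 1] r[of 2]] by (auto intro: exI)
  then obtain g where g: "det3 (n 0) (n 1) (n 2) * monom3 (ex 2) = g * monom3 (ex 1)"
    by (auto simp: f_monom)
  have cop': "Poly_Mapping.lookup (ex 2) i = 0 \<or> Poly_Mapping.lookup (ex 1) i = 0" for i
    using cop[of i] by (rule disj_commute[THEN iffD1])
  obtain q where "det3 (n 0) (n 1) (n 2) = q * monom3 (ex 1)"
    by (rule monom_dvd_cancel[OF g cop'])
  then have q: "q * f $ 1 = det3 (n 0) (n 1) (n 2)" by (simp add: f_monom)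
  show ?thesis using q vol3_eqI[where n = n, OF q] by simp
qed

lemma finsum_syz:
  assumes "\<And>i. i < (r::nat) \<Longrightarrow> n i \<in> piece (syz f) (d i)"
  shows "finsum (syz f) (\<lambda>i. c i \<odot>\<^bsub>syz f\<^esub> n i) {..<r} = (\<Sum>i<r. c i *s n i)"
proof -
  interpret graded_module "syz f" by (rule graded_module_syz)
  have "finsum (syz f) (\<lambda>i. c i \<odot>\<^bsub>syz f\<^esub> n i) {..<r} = (\<Sum>i<r. c i \<odot>\<^bsub>syz f\<^esub> n i)"
    by (rule finsum_eq_sum[OF graded_module_syz])
      (simp, simp, rule smult_closed[OF piece_carrier[OF assms]])
  then show ?thesis by simp
qed

text \<open>Multilinearity, the degree and Cramer's rule are identities between minors, from which the first form may be
  cancelled.\<close>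

lemma volume_form_syz:
  assumes cop: "\<And>i. Poly_Mapping.lookup (ex 1) i = 0 \<or> Poly_Mapping.lookup (ex 2) i = 0"
  shows "volume_form (syz f) (piece (syz f)) 3 (- (\<Sum>i\<in>UNIV. int (dg i))) vol3"
proof -
  interpret graded_module "syz f" by (rule graded_module_syz)
  note V = vol3_mult[OF cop]
  have upd: "(n(j := x)) i \<in> piece (syz f) ((d(j := e)) i)" if "x \<in> piece (syz f) e" "n i \<in> piece (syz f) (d i)"
    for n :: "nat \<Rightarrow> 'k poly3 ^ 4" and i j x d e
    using that by (simp del: syz_simps)
  have j3: "j = 0 \<or> j = 1 \<or> j = 2" if "j < 3" for j :: nat using that by auto
  show ?thesis
  proof (intro volume_form.intro volume_form_axioms.intro P.graded_submodule_axioms)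
    fix n :: "nat \<Rightarrow> 'k poly3 ^ 4" and d
    assume n: "\<And>i. i < 3 \<Longrightarrow> n i \<in> piece (syz f) (d i)"
    show "vol3 n \<in> forms ((\<Sum>i<3. d i) + - (\<Sum>i\<in>UNIV. int (dg i)))"
    proof -
      have "vol3 n * monom3 (ex 1) \<in> forms (d 0 + d 1 + d 2 - (int (dg 2) + int (dg 3) + int (dg 4)))"
        using V[of n d] det3_forms[OF n[of 0] n[of 1] n[of 2]] n by (simp add: f_monom)
      from forms_cancel_monom[OF this] show ?thesis
        by (simp add: lessThan_3 sum_4 algebra_simps)
    qed
    show "vol3 (n(j := x \<oplus>\<^bsub>syz f\<^esub> y)) = vol3 (n(j := x)) + vol3 (n(j := y))"
      if "j < 3" "x \<in> piece (syz f) e" "y \<in> piece (syz f) e" for j x y e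
    proof (rule vol3_eqI)
      have 1: "vol3 (n(j := x)) * f $ 1 = det3 ((n(j := x)) 0) ((n(j := x)) 1) ((n(j := x)) 2)"
        by (rule V[of _ "d(j := e)"]) (rule upd[OF that(2) n])
      have 2: "vol3 (n(j := y)) * f $ 1 = det3 ((n(j := y)) 0) ((n(j := y)) 1) ((n(j := y)) 2)"
        by (rule V[of _ "d(j := e)"]) (rule upd[OF that(3) n])
      show "(vol3 (n(j := x)) + vol3 (n(j := y))) * f $ 1 =
          det3 ((n(j := x \<oplus>\<^bsub>syz f\<^esub> y)) 0) ((n(j := x \<oplus>\<^bsub>syz f\<^esub> y)) 1) ((n(j := x \<oplus>\<^bsub>syz f\<^esub> y)) 2)"
        unfolding distrib_right 1 2 using j3[OF that(1)] by (auto simp: det3_def algebra_simps)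
    qed
    show "vol3 (n(j := t \<odot>\<^bsub>syz f\<^esub> x)) = t * vol3 (n(j := x))"
      if "j < 3" "x \<in> piece (syz f) e" "t \<in> forms d'" for j x e t d'
    proof (rule vol3_eqI)
      have 1: "vol3 (n(j := x)) * f $ 1 = det3 ((n(j := x)) 0) ((n(j := x)) 1) ((n(j := x)) 2)"
        by (rule V[of _ "d(j := e)"]) (rule upd[OF that(2) n])
      show "t * vol3 (n(j := x)) * f $ 1 =
          det3 ((n(j := t \<odot>\<^bsub>syz f\<^esub> x)) 0) ((n(j := t \<odot>\<^bsub>syz f\<^esub> x)) 1) ((n(j := t \<odot>\<^bsub>syz f\<^esub> x)) 2)"
        unfolding mult.assoc 1 using j3[OF that(1)] by (auto simp: det3_def algebra_simps)
    qed
    show "vol3 n = 0" if "i < 3" "j < 3" "i \<noteq> j" "n i = n j" for i j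
    proof (rule vol3_eqI)
      show "0 * f $ 1 = det3 (n 0) (n 1) (n 2)"
        using j3[OF that(1)] j3[OF that(2)] that(3,4) by (auto simp: det3_def algebra_simps)
    qed
    show "vol3 n \<odot>\<^bsub>syz f\<^esub> v = finsum (syz f) (\<lambda>i. vol3 (n(i := v)) \<odot>\<^bsub>syz f\<^esub> n i) {..<3}"
      if v: "v \<in> piece (syz f) e" for v e
    proof -
      have 0: "vol3 n * f $ 1 = det3 (n 0) (n 1) (n 2)" by (rule V[OF n])
      have 1: "vol3 (n(j := v)) * f $ 1 = det3 ((n(j := v)) 0) ((n(j := v)) 1) ((n(j := v)) 2)" for j
        by (rule V[of _ "d(j := e)"]) (rule upd[OF v n])
      let ?x = "vol3 n *s v - (vol3 (n(0 := v)) *s n 0 + vol3 (n(1 := v)) *s n 1 + vol3 (n(2 := v)) *s n 2)"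
      have eqn: "f $ 1 * ?x $ k = (vol3 n * f $ 1) * v $ k - ((vol3 (n(0 := v)) * f $ 1) * n 0 $ k
          + (vol3 (n(1 := v)) * f $ 1) * n 1 $ k + (vol3 (n(2 := v)) * f $ 1) * n 2 $ k)" for k
        by (simp add: algebra_simps)
      have coord: "?x $ k = 0" if k: "k = 2 \<or> k = 3 \<or> k = 4" for k
      proof -
        have "f $ 1 * ?x $ k = 0"
          unfolding eqn 0 1 using k by (elim disjE) (simp_all add: det3_def algebra_simps)
        then show ?thesis using f_nonzero[of 1] by (metis mult_eq_0_iff)
      qed
      \<comment> \<open>The first coordinate of a syzygy is determined by the others.\<close>
      have "?x $ 1 * f $ 1 + ?x $ 2 * f $ 2 + ?x $ 3 * f $ 3 + ?x $ 4 * f $ 4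
         = vol3 n * (v $ 1 * f $ 1 + v $ 2 * f $ 2 + v $ 3 * f $ 3 + v $ 4 * f $ 4)
           - (vol3 (n(0 := v)) * (n 0 $ 1 * f $ 1 + n 0 $ 2 * f $ 2 + n 0 $ 3 * f $ 3 + n 0 $ 4 * f $ 4)
            + vol3 (n(1 := v)) * (n 1 $ 1 * f $ 1 + n 1 $ 2 * f $ 2 + n 1 $ 3 * f $ 3 + n 1 $ 4 * f $ 4)
            + vol3 (n(2 := v)) * (n 2 $ 1 * f $ 1 + n 2 $ 2 * f $ 2 + n 2 $ 3 * f $ 3 + n 2 $ 4 * f $ 4))"
        by (simp add: algebra_simps)
      also have "\<dots> = 0" using pieceD(2)[OF v] n[of 0, THEN pieceD(2)] n[of 1, THEN pieceD(2)] n[of 2, THEN pieceD(2)]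
        by simp
      finally have "?x $ 1 * f $ 1 = 0" using coord[of 2] coord[of 3] coord[of 4] by (simp only: mult_zero_left add_0_right simp_thms)
      then have "?x $ 1 = 0" using f_nonzero[of 1] by (metis mult_eq_0_iff)
      then have "?x = 0" unfolding vec_eq_iff forall_4 using coord[of 2] coord[of 3] coord[of 4] by simp
      moreover have "finsum (syz f) (\<lambda>i. vol3 (n(i := v)) \<odot>\<^bsub>syz f\<^esub> n i) {..<3} = (\<Sum>i<3. vol3 (n(i := v)) *s n i)"
        by (rule finsum_syz[of 3 n d, OF n])
      ultimately show ?thesis by (simp add: lessThan_3 algebra_simps)
    qed
  qed (simp add: vol3_def)
qed

definition koszul :: "4 \<Rightarrow> 4 \<Rightarrow> 'k poly3 ^ 4"
  where "koszul i j = (\<chi> l. if l = i then f $ j else if l = j then - (f $ i) else 0)"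

lemma koszul_piece: assumes "i \<noteq> j" shows "koszul i j \<in> piece (syz f) (int (dg i + dg j))"
proof -
  have "(\<Sum>l\<in>UNIV. koszul i j $ l * f $ l) = (\<Sum>l\<in>UNIV. (if l = i then f $ j * f $ i else 0) + (if l = j then - (f $ i * f $ j) else 0))"
    by (rule sum.cong) (auto simp: koszul_def assms)
  also have "\<dots> = 0" by (simp add: sum.distrib mult.commute)
  finally show ?thesis
    using f_forms by (auto simp: koszul_def intro: forms_uminus)
qed

text \<open>Where \<open>f\<^sub>i\<close> does not vanish, the three Koszul syzygies that involve \<open>f\<^sub>i\<close> have the volume \<open>f\<^sub>i\<^sup>2\<close> up to sign, so the
  first Chern class is minus the sum of all degrees.\<close>

lemma slope_syz:
  assumes cop: "\<And>i. Poly_Mapping.lookup (ex 1) i = 0 \<or> Poly_Mapping.lookup (ex 2) i = 0"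
    and art: "\<And>p. p \<in> P2 \<Longrightarrow> \<exists>i\<in>{1, 2, 3}. f $ i \<notin> p"
  shows "is_slope (sheafify (syz f)) (\<lambda>U. carrier (sheafify (syz f) U)) (- real (\<Sum>i\<in>UNIV. dg i) / 3)"
proof -
  interpret W: volume_form "syz f" "piece (syz f)" 3 "- (\<Sum>i\<in>UNIV. int (dg i))" vol3
    by (rule volume_form_syz[OF cop])
  have "is_slope (sheafify (syz f)) (subsections (syz f) (piece (syz f))) (real_of_int (- (\<Sum>i\<in>UNIV. int (dg i))) / real 3)"
  proof (rule W.slope_of_volume_form')
    show "zopen (P2 :: 'k point set)" by (rule zopen_P2)
    show "codim2_complement (P2 :: 'k point set)" by (simp add: codim2_complement_def)
    show "(P2 :: 'k point set) \<noteq> {}" using zero_point by blast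
    fix p :: "'k point" assume p: "p \<in> P2"
    obtain i where i: "i = 1 \<or> i = 2 \<or> i = 3" "f $ i \<notin> p" using art[OF p] by blast
    \<comment> \<open>The three indices other than \<open>i\<close>.\<close>
    define oth where "oth l = (if l = 0 then if i = 1 then 2 else 1 else if l = 1 then if i = 3 then 2 else 3 else 4 :: 4)"
      for l :: nat
    define n where "n l = koszul i (oth l)" for l
    define e where "e l = dg i + dg (oth l)" for l
    have n: "n l \<in> piece (syz f) (int (e l))" for l
      unfolding n_def e_def by (rule koszul_piece) (use i(1) in \<open>auto simp: oth_def\<close>)
    have "vol3 n * f $ 1 = det3 (n 0) (n 1) (n 2)" by (rule vol3_mult[OF cop n])
    also have "\<dots> = (f $ i * f $ i) * f $ 1 \<or> \<dots> = (- (f $ i * f $ i)) * f $ 1"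
      using i(1) by (elim disjE) (simp_all add: n_def oth_def koszul_def det3_def)
    finally have "vol3 n = f $ i * f $ i \<or> vol3 n = - (f $ i * f $ i)"
      using f_nonzero[of 1] by (metis mult_right_cancel)
    moreover have "f $ i * f $ i \<notin> p" by (rule P2_mult[OF p i(2) i(2)])
    moreover have "- (f $ i * f $ i) \<notin> p"
      using P2_multI(1)[OF p, of "- (f $ i * f $ i)" "- 1"] \<open>f $ i * f $ i \<notin> p\<close> by auto
    ultimately show "\<exists>n e. (\<forall>i<3. n i \<in> piece (syz f) (int (e i))) \<and> vol3 n \<notin> p"
      using n by (intro exI[of _ n] exI[of _ e]) (auto simp del: syz_simps)
  qed simp
  then show ?thesis by (simp add: sections_eq_subsections)
qed

subsection \<open>Rank one subsheaves\<close>

text \<open>A syzygy of degree \<open>\<delta>\<close> generates a copy of \<open>\<O>(-\<delta>)\<close>, on which the coefficient is a volume form.\<close>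

lemma slope_rank_one:
  assumes w: "w \<in> piece (syz f) (int \<delta>)" "w \<noteq> 0"
  shows "\<exists>F. coherent_subsheaf (sheafify (syz f)) F \<and> nonzero_subsheaf (sheafify (syz f)) F \<and>
    is_slope (sheafify (syz f)) F (- real \<delta>)"
proof -
  let ?N = "generated 1 (\<lambda>_. w) (\<lambda>_. \<delta>)"
  have G: "(\<lambda>_. w) i \<in> piece (syz f) (int ((\<lambda>_. \<delta>) i))" for i :: nat using w by simp
  interpret graded_submodule "syz f" ?N by (rule graded_submodule_generated) (use G in simp)
  obtain l where l: "w $ l \<noteq> 0" using w(2) by (auto simp: vec_eq_iff)
  have w_cancel: "t *s w = u *s w \<longleftrightarrow> t = u" for t u
    using l by (auto simp: vec_eq_iff)
  define lam where "lam n = (THE t. n 0 = t *s w)" for n :: "nat \<Rightarrow> 'k poly3 ^ 4"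
  have lam: "lam n = t" if "n 0 = t *s w" for n t
    unfolding lam_def using that by (simp add: w_cancel)
  have mem: "\<exists>t\<in>forms (e - int \<delta>). v = t *s w" if "v \<in> ?N e" for v e
    using that by (auto simp: generated_def)
  have memI: "t *s w \<in> ?N (int \<delta>)" if "t \<in> forms 0" for t
    using that by (auto simp: generated_def)
  interpret V: volume_form "syz f" ?N 1 "- int \<delta>" lam
  proof unfold_locales
    fix n :: "nat \<Rightarrow> 'k poly3 ^ 4" and d assume n: "\<And>i. i < 1 \<Longrightarrow> n i \<in> ?N (d i)"
    then obtain t where t: "t \<in> forms (d 0 - int \<delta>)" "n 0 = t *s w" using mem[OF n[of 0]] by auto
    show "lam n \<in> forms ((\<Sum>i<1. d i) + - int \<delta>)" using lam[of n t, OF t(2)] t(1) by simp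
    show "lam (n(j := x \<oplus>\<^bsub>syz f\<^esub> y)) = lam (n(j := x)) + lam (n(j := y))"
      if j: "j < 1" and x: "x \<in> ?N e" and y: "y \<in> ?N e" for j x y e
    proof -
      obtain a b where "x = a *s w" "y = b *s w" using mem[OF x] mem[OF y] by auto
      then show ?thesis
        using j lam[of "n(j := x \<oplus>\<^bsub>syz f\<^esub> y)" "a + b"] lam[of "n(j := x)" a] lam[of "n(j := y)" b]
        by (simp add: vector_sadd_rdistrib)
    qed
    show "lam (n(j := t \<odot>\<^bsub>syz f\<^esub> x)) = t * lam (n(j := x))"
      if j: "j < 1" and x: "x \<in> ?N e" and "t \<in> forms d'" for j x e t d'
    proof -
      obtain a where "x = a *s w" using mem[OF x] by auto
      then show ?thesis
        using j lam[of "n(j := t \<odot>\<^bsub>syz f\<^esub> x)" "t * a"] lam[of "n(j := x)" a]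
        by (simp add: vector_smult_assoc)
    qed
    show "lam n \<odot>\<^bsub>syz f\<^esub> v = finsum (syz f) (\<lambda>i. lam (n(i := v)) \<odot>\<^bsub>syz f\<^esub> n i) {..<1}"
      if v: "v \<in> ?N e" for v e
    proof -
      obtain a where a: "v = a *s w" using mem[OF v] by auto
      have "finsum (syz f) (\<lambda>i. lam (n(i := v)) \<odot>\<^bsub>syz f\<^esub> n i) {..<1} = (\<Sum>i<1. lam (n(i := v)) *s n i)"
        by (rule finsum_syz[of 1 n d]) (rule N_piece[OF n])
      then show ?thesis
        using lam[of n t, OF t(2)] lam[of "n(0 := v)" a] a t(2) by (simp add: vector_smult_assoc mult.commute)
    qed
  next
    show "lam n = lam n'" if "\<And>i. i < 1 \<Longrightarrow> n i = n' i" for n n'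
      using that[of 0] by (simp add: lam_def)
  qed auto
  have 1: "lam (\<lambda>_. w) = 1" by (rule lam) simp
  have "\<exists>n e. (\<forall>i<1. n i \<in> ?N (int (e i))) \<and> lam n \<notin> p" if "p \<in> P2" for p
    by (intro exI[of _ "\<lambda>_. w"] exI[of _ "\<lambda>_. \<delta>"])
      (use memI[of 1] P2_one[OF that] 1 in auto)
  moreover have "codim2_complement (P2 :: 'k point set)" "(P2 :: 'k point set) \<noteq> {}"
    using zero_point by (auto simp: codim2_complement_def)
  ultimately have "is_slope (sheafify (syz f)) (subsections (syz f) ?N) (real_of_int (- int \<delta>) / real 1)"
    "nonzero_subsheaf (sheafify (syz f)) (subsections (syz f) ?N)"
    using V.slope_of_volume_form'[OF zopen_P2] by auto
  then show ?thesis
    using coherent_generated[of 1 "\<lambda>_. w" f "\<lambda>_. \<delta>"] G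
    by (intro exI[of _ "subsections (syz f) ?N"]) simp
qed

subsection \<open>Rank two subsheaves\<close>

text \<open>The subsheaf is generated by the Koszul syzygies of three of the forms.  Its members are the vector
  products with the vector \<open>F\<close> of these forms, and \<open>(F \<times> P) \<times> (F \<times> Q) = det(F, P, Q) F\<close>.  So \<open>det(F, P, Q)\<close>
  serves as the volume, and it is computed as a quotient of one component of the vector product.\<close>

lemma slope_rank_two:
  assumes dist: "i \<noteq> j" "j \<noteq> l" "i \<noteq> l"
    and U: "codim2_complement {p \<in> P2. f $ i \<notin> p \<or> f $ j \<notin> p \<or> f $ l \<notin> p}"
  shows "\<exists>F. coherent_subsheaf (sheafify (syz f)) F \<and> nonzero_subsheaf (sheafify (syz f)) F \<and>
    is_slope (sheafify (syz f)) F (- real (dg i + dg j + dg l) / 2)"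
proof -
  let ?U = "{p \<in> P2. f $ i \<notin> p \<or> f $ j \<notin> p \<or> f $ l \<notin> p}"
  define G where "G m = (if m = 0 then koszul j l else if m = 1 then koszul l i else koszul i j)" for m :: nat
  define gd where "gd m = (if m = 0 then dg j + dg l else if m = 1 then dg l + dg i else dg i + dg j)" for m :: nat
  let ?N = "generated 3 G gd"
  have G: "G m \<in> piece (syz f) (int (gd m))" for m
    unfolding G_def gd_def using koszul_piece dist by (simp del: syz_simps)
  interpret graded_submodule "syz f" ?N by (rule graded_submodule_generated[OF G])
  have other: "x $ m = 0" if "x = (\<Sum>a<3. t a *s G a)" "m \<noteq> i" "m \<noteq> j" "m \<noteq> l" for x t m
    using that by (simp add: lessThan_3 G_def koszul_def)
  have mem: "\<exists>t. v = (\<Sum>a<3. t a *s G a) \<and> v $ i = t 2 * f $ j - t 1 * f $ l \<and>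
      v $ j = t 0 * f $ l - t 2 * f $ i \<and> v $ l = t 1 * f $ i - t 0 * f $ j" if "v \<in> ?N e" for v e
  proof -
    obtain t where t: "v = (\<Sum>a<3. t a *s G a)" using \<open>v \<in> ?N e\<close> by (auto simp: generated_def)
    show ?thesis
      by (rule exI[of _ t]) (use t dist in \<open>simp add: lessThan_3 G_def koszul_def\<close>)
  qed
  have rel: "v $ i * f $ i + v $ j * f $ j + v $ l * f $ l = 0" if v: "v \<in> ?N e" for v e
  proof -
    obtain t :: "nat \<Rightarrow> 'k poly3" where t: "v $ i = t 2 * f $ j - t 1 * f $ l" "v $ j = t 0 * f $ l - t 2 * f $ i"
        "v $ l = t 1 * f $ i - t 0 * f $ j"
      using mem[OF v] by blast
    show ?thesis unfolding t by (simp add: algebra_simps)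
  qed
  define br where "br v w = v $ j * w $ l - v $ l * w $ j" for v w :: "'k poly3 ^ 4"
  define lam where "lam n = (THE L. L * f $ i = br (n 0) (n 1))" for n :: "nat \<Rightarrow> 'k poly3 ^ 4"
  have lam_eqI: "lam n = L" if "L * f $ i = br (n 0) (n 1)" for n L
    unfolding lam_def by (rule the_equality) (rule that, metis that f_nonzero mult_right_cancel)
  have lam: "lam n * f $ i = br (n 0) (n 1)" if n0: "n 0 \<in> ?N d" and n1: "n 1 \<in> ?N e" for n d e
  proof -
    obtain P :: "nat \<Rightarrow> 'k poly3" where P: "n 0 $ j = P 0 * f $ l - P 2 * f $ i" "n 0 $ l = P 1 * f $ i - P 0 * f $ j"
      using mem[OF n0] by blast
    obtain Q :: "nat \<Rightarrow> 'k poly3" where Q: "n 1 $ j = Q 0 * f $ l - Q 2 * f $ i" "n 1 $ l = Q 1 * f $ i - Q 0 * f $ j"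
      using mem[OF n1] by blast
    have *: "(f $ i * (P 1 * Q 2 - P 2 * Q 1) + f $ j * (P 2 * Q 0 - P 0 * Q 2) + f $ l * (P 0 * Q 1 - P 1 * Q 0)) * - 1 * f $ i
        = - br (n 0) (n 1)"
      unfolding br_def P Q by (simp add: algebra_simps)
    then have **: "(f $ i * (P 1 * Q 2 - P 2 * Q 1) + f $ j * (P 2 * Q 0 - P 0 * Q 2) + f $ l * (P 0 * Q 1 - P 1 * Q 0)) * f $ i
        = br (n 0) (n 1)" by (simp only: mult_minus1_right mult_minus_left neg_equal_iff_equal)
    show ?thesis unfolding lam_eqI[OF **] by (rule **)
  qed
  have upd: "(n(m := x)) a \<in> ?N ((d(m := e)) a)" if "x \<in> ?N e" "n a \<in> ?N (d a)" for n m x a d e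
    using that by simp
  have m2: "m = 0 \<or> m = 1" if "m < 2" for m :: nat using that by auto
  interpret V: volume_form "syz f" ?N 2 "- int (dg i + dg j + dg l)" lam
  proof unfold_locales
    fix n :: "nat \<Rightarrow> 'k poly3 ^ 4" and d assume n: "\<And>a. a < 2 \<Longrightarrow> n a \<in> ?N (d a)"
    have n0: "n 0 \<in> ?N (d 0)" "n 1 \<in> ?N (d 1)" using n by auto
    note p = N_piece[OF n0(1), THEN pieceD(1)] N_piece[OF n0(2), THEN pieceD(1)]
    show "lam n \<in> forms ((\<Sum>a<2. d a) + - int (dg i + dg j + dg l))"
    proof -
      have "br (n 0) (n 1) \<in> forms (d 0 + d 1 - (int (dg j) + int (dg l)))"
        unfolding br_def using forms_mult_diff[OF p(1)[of j] p(2)[of l]] forms_mult_diff[OF p(1)[of l] p(2)[of j]]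
        by (intro forms_diff) (simp_all add: add.commute)
      then have "lam n * monom3 (ex i) \<in> forms (d 0 + d 1 - (int (dg j) + int (dg l)))"
        using lam[OF n0] by (simp add: f_monom)
      from forms_cancel_monom[OF this] show ?thesis by (simp add: lessThan_2 algebra_simps)
    qed
    show "lam (n(m := x \<oplus>\<^bsub>syz f\<^esub> y)) = lam (n(m := x)) + lam (n(m := y))"
      if "m < 2" "x \<in> ?N e" "y \<in> ?N e" for m x y e
    proof (rule lam_eqI)
      have 1: "lam (n(m := x)) * f $ i = br ((n(m := x)) 0) ((n(m := x)) 1)"
        by (rule lam) (rule upd[of x e _ _ d, OF that(2)], rule n, simp)+
      have 2: "lam (n(m := y)) * f $ i = br ((n(m := y)) 0) ((n(m := y)) 1)"
        by (rule lam) (rule upd[of y e _ _ d, OF that(3)], rule n, simp)+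
      show "(lam (n(m := x)) + lam (n(m := y))) * f $ i =
          br ((n(m := x \<oplus>\<^bsub>syz f\<^esub> y)) 0) ((n(m := x \<oplus>\<^bsub>syz f\<^esub> y)) 1)"
        unfolding distrib_right 1 2 using m2[OF that(1)] by (auto simp: br_def algebra_simps)
    qed
    show "lam (n(m := t \<odot>\<^bsub>syz f\<^esub> x)) = t * lam (n(m := x))"
      if "m < 2" "x \<in> ?N e" "t \<in> forms d'" for m x e t d'
    proof (rule lam_eqI)
      have 1: "lam (n(m := x)) * f $ i = br ((n(m := x)) 0) ((n(m := x)) 1)"
        by (rule lam) (rule upd[of x e _ _ d, OF that(2)], rule n, simp)+
      show "t * lam (n(m := x)) * f $ i = br ((n(m := t \<odot>\<^bsub>syz f\<^esub> x)) 0) ((n(m := t \<odot>\<^bsub>syz f\<^esub> x)) 1)"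
        unfolding mult.assoc 1 using m2[OF that(1)] by (auto simp: br_def algebra_simps)
    qed
    show "lam n = 0" if "a < 2" "b < 2" "a \<noteq> b" "n a = n b" for a b
    proof (rule lam_eqI)
      show "0 * f $ i = br (n 0) (n 1)"
        using m2[OF that(1)] m2[OF that(2)] that(3,4) by (auto simp: br_def algebra_simps)
    qed
    show "lam n \<odot>\<^bsub>syz f\<^esub> v = finsum (syz f) (\<lambda>a. lam (n(a := v)) \<odot>\<^bsub>syz f\<^esub> n a) {..<2}"
      if v: "v \<in> ?N e" for v e
    proof -
      have 0: "lam n * f $ i = br (n 0) (n 1)" by (rule lam[OF n0])
      have 1: "lam (n(0 := v)) * f $ i = br v (n 1)"
        using lam[of "n(0 := v)" e "d 1"] v n0 by simp
      have 2: "lam (n(1 := v)) * f $ i = br (n 0) v"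
        using lam[of "n(1 := v)" "d 0" e] v n0 by simp
      let ?x = "lam n *s v - (lam (n(0 := v)) *s n 0 + lam (n(1 := v)) *s n 1)"
      have eqn: "f $ i * ?x $ b = (lam n * f $ i) * v $ b - ((lam (n(0 := v)) * f $ i) * n 0 $ b
          + (lam (n(1 := v)) * f $ i) * n 1 $ b)" for b
        by (simp add: algebra_simps)
      have coord: "?x $ b = 0" if b: "b = j \<or> b = l" for b
      proof -
        have "f $ i * ?x $ b = 0"
          unfolding eqn 0 1 2 using b by (elim disjE) (simp_all add: br_def algebra_simps)
        then show ?thesis using f_nonzero[of i] by (metis mult_eq_0_iff)
      qed
      have "?x $ i * f $ i + ?x $ j * f $ j + ?x $ l * f $ l
         = lam n * (v $ i * f $ i + v $ j * f $ j + v $ l * f $ l)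
           - (lam (n(0 := v)) * (n 0 $ i * f $ i + n 0 $ j * f $ j + n 0 $ l * f $ l)
            + lam (n(1 := v)) * (n 1 $ i * f $ i + n 1 $ j * f $ j + n 1 $ l * f $ l))"
        by (simp add: algebra_simps)
      also have "\<dots> = 0" using rel[OF v] rel[OF n0(1)] rel[OF n0(2)] by simp
      finally have "?x $ i * f $ i = 0" using coord[of j] coord[of l] by (simp only: mult_zero_left add_0_right simp_thms)
      then have xi: "?x $ i = 0" using f_nonzero[of i] by (metis mult_eq_0_iff)
      have x0: "?x $ b = 0" if "b \<noteq> i" "b \<noteq> j" "b \<noteq> l" for b
      proof -
        have "v $ b = 0" "n 0 $ b = 0" "n 1 $ b = 0"
          using mem[OF v] mem[OF n0(1)] mem[OF n0(2)] other that by blast+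
        then show ?thesis by simp
      qed
      have "?x $ b = 0" for b using xi x0[of b] coord[of b] by blast
      then have "?x = 0" by (simp only: vec_eq_iff zero_index simp_thms)
      moreover have "finsum (syz f) (\<lambda>a. lam (n(a := v)) \<odot>\<^bsub>syz f\<^esub> n a) {..<2} = (\<Sum>a<2. lam (n(a := v)) *s n a)"
        by (rule finsum_syz[of 2 n d]) (rule N_piece[OF n])
      ultimately show ?thesis by (simp add: lessThan_2 algebra_simps)
    qed
  next
    show "lam n = lam n'" if "\<And>a. a < 2 \<Longrightarrow> n a = n' a" for n n'
      using that[of 0] that[of 1] by (simp add: lam_def)
  qed
  have local: "\<exists>n e. (\<forall>a<2. n a \<in> ?N (int (e a))) \<and> lam n \<notin> p" if pU: "p \<in> ?U" for p
  proof -
    have p: "p \<in> P2" using pU by simp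
    have neg: "- g \<notin> p" if "g \<notin> p" for g using P2_multI(1)[OF p, of "- g" "- 1"] that by auto
    \<comment> \<open>The two Koszul syzygies that involve a form have this form as their volume, up to sign.\<close>
    have two: "\<exists>n e. (\<forall>a<2. n a \<in> ?N (int (e a))) \<and> lam n \<notin> p"
      if "x < 3" "y < 3" "g * f $ i = br (G x) (G y)" "g \<notin> p" for x y g
    proof (intro exI conjI allI impI)
      let ?n = "\<lambda>a::nat. if a = 0 then G x else G y"
      show "?n a \<in> ?N (int ((\<lambda>a. if a = 0 then gd x else gd y) a))" for a
        using generator_mem[of x 3 G gd] generator_mem[of y 3 G gd] that by simp
      show "lam ?n \<notin> p" using lam_eqI[of g ?n] that by simp
    qed
    consider "f $ i \<notin> p" | "f $ j \<notin> p" | "f $ l \<notin> p" using pU by auto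
    then show ?thesis
    proof cases
      case 1
      show ?thesis by (rule two[of 1 2 "f $ i"]) (use 1 dist in \<open>simp_all add: br_def G_def koszul_def\<close>)
    next
      case 2
      show ?thesis by (rule two[of 0 2 "- f $ j"]) (use neg[OF 2] dist in \<open>simp_all add: br_def G_def koszul_def mult.commute\<close>)
    next
      case 3
      show ?thesis by (rule two[of 0 1 "f $ l"]) (use 3 dist in \<open>simp_all add: br_def G_def koszul_def mult.commute\<close>)
    qed
  qed
  have zo: "zopen ?U"
    unfolding zopen_def by (rule exI[of _ "{f $ i, f $ j, f $ l}"]) (use f_forms in auto)
  have "{0} \<in> ?U" using zero_point by simp
  then have ne: "?U \<noteq> {}" by blast
  have "is_slope (sheafify (syz f)) (subsections (syz f) ?N) (real_of_int (- int (dg i + dg j + dg l)) / real 2)"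
    by (rule V.slope_of_volume_form'(1)[OF zo U ne _ local]) simp
  moreover have "nonzero_subsheaf (sheafify (syz f)) (subsections (syz f) ?N)"
    by (rule V.slope_of_volume_form'(2)[OF zo U ne _ local]) simp
  ultimately show ?thesis
    using coherent_generated[of 3 G f gd] G
    by (intro exI[of _ "subsections (syz f) ?N"]) (simp del: syz_simps)
qed

end

section \<open>Polynomials with degree bounds\<close>

text \<open>A binary form of degree \<open>m\<close> is encoded by its dehomogenization, a polynomial of degree at most
  \<open>m\<close>; there is only the zero form if \<open>m < 0\<close>.  Its coefficient at the \<open>m\<close>-th power, its value at infinity,
  is \<open>topc p m\<close>.\<close>

definition dle :: "'a::zero poly \<Rightarrow> int \<Rightarrow> bool"
  where "dle p m \<longleftrightarrow> p = 0 \<or> int (degree p) \<le> m"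

definition topc :: "'a::zero poly \<Rightarrow> int \<Rightarrow> 'a"
  where "topc p m = (if m < 0 then 0 else poly.coeff p (nat m))"

lemma dle_iff_coeff: "dle p m \<longleftrightarrow> (\<forall>j. m < int j \<longrightarrow> poly.coeff p j = 0)"
proof
  show "dle p m \<Longrightarrow> \<forall>j. m < int j \<longrightarrow> poly.coeff p j = 0" by (auto simp: dle_def coeff_eq_0)
  assume *: "\<forall>j. m < int j \<longrightarrow> poly.coeff p j = 0"
  then show "dle p m" using leading_coeff_0_iff[of p] by (force simp: dle_def not_le)
qed

lemma dle_zero [simp]: "dle 0 m" by (simp add: dle_def)

lemma dle_neg: "dle p m \<Longrightarrow> m < 0 \<Longrightarrow> p = 0" by (auto simp: dle_def)

lemma dle_mono: "dle p m \<Longrightarrow> m \<le> n \<Longrightarrow> dle p n" by (auto simp: dle_def)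

lemma dle_add: "dle p m \<Longrightarrow> dle q m \<Longrightarrow> dle (p + q) m" by (simp add: dle_iff_coeff)

lemma dle_diff: "dle p m \<Longrightarrow> dle q m \<Longrightarrow> dle (p - q) (m :: int)" for p q :: "'a::ab_group_add poly"
  by (simp add: dle_iff_coeff)

lemma dle_uminus: "dle p m \<Longrightarrow> dle (- p) m" for p :: "'a::ab_group_add poly"
  by (simp add: dle_iff_coeff)

lemma dle_mult: "dle p m \<Longrightarrow> dle q n \<Longrightarrow> dle (p * q) (m + n)" for p q :: "'a::idom poly"
  by (cases "p = 0 \<or> q = 0") (auto simp: dle_def degree_mult_eq)

lemma dle_mult': "dle p m \<Longrightarrow> dle q n \<Longrightarrow> m + n = k \<Longrightarrow> dle (p * q) k" for p q :: "'a::idom poly"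
  using dle_mult by blast

lemma dle_sum: "(\<And>i. i \<in> A \<Longrightarrow> dle (g i) m) \<Longrightarrow> dle (sum g A) m"
  by (induction A rule: infinite_finite_induct) (auto intro: dle_add)

lemma dle_const: "0 \<le> m \<Longrightarrow> dle [:x:] m" by (simp add: dle_def)

lemma topc_zero [simp]: "topc 0 m = 0" by (simp add: topc_def)

lemma topc_add: "topc (p + q) m = topc p m + topc q m" by (simp add: topc_def)

lemma topc_diff: "topc (p - q) m = topc p m - topc q m" for p q :: "'a::ab_group_add poly"
  by (simp add: topc_def)

lemma topc_mult: "dle p m \<Longrightarrow> dle q n \<Longrightarrow> topc (p * q) (m + n) = topc p m * topc q n" for p q :: "'a::idom poly"
proof -
  assume p: "dle p m" and q: "dle q n"
  show ?thesis
  proof (cases "p = 0 \<or> q = 0")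
    case False
    then have mn: "0 \<le> m" "0 \<le> n" using p q by (auto simp: dle_def)
    have "poly.coeff (p * q) (nat m + nat n) = poly.coeff p (nat m) * poly.coeff q (nat n)"
    proof -
      have "poly.coeff (p * q) (nat m + nat n) = (\<Sum>i\<le>nat m + nat n. poly.coeff p i * poly.coeff q (nat m + nat n - i))"
        by (rule coeff_mult)
      also have "\<dots> = (\<Sum>i\<in>{nat m}. poly.coeff p i * poly.coeff q (nat m + nat n - i))"
      proof (rule sum.mono_neutral_right)
        show "\<forall>i\<in>{..nat m + nat n} - {nat m}. poly.coeff p i * poly.coeff q (nat m + nat n - i) = 0"
        proof
          fix i assume "i \<in> {..nat m + nat n} - {nat m}"
          then have "m < int i \<or> n < int (nat m + nat n - i)" using mn by auto
          then show "poly.coeff p i * poly.coeff q (nat m + nat n - i) = 0"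
            using p q by (auto simp: dle_iff_coeff)
        qed
      qed auto
      finally show ?thesis by simp
    qed
    then show ?thesis using mn by (simp add: topc_def nat_add_distrib)
  qed auto
qed

lemma topc_mult': "dle p m \<Longrightarrow> dle q n \<Longrightarrow> m + n = k \<Longrightarrow> topc (p * q) k = topc p m * topc q n" for p q :: "'a::idom poly"
  using topc_mult by blast

lemma dle_lower: "dle p m \<Longrightarrow> topc p m = 0 \<Longrightarrow> dle p (m - 1)"
  unfolding dle_iff_coeff
proof (intro allI impI)
  fix j assume *: "\<forall>j. m < int j \<longrightarrow> poly.coeff p j = 0" "topc p m = 0" and j: "m - 1 < int j"
  show "poly.coeff p j = 0"
  proof (cases "m < int j")
    case False
    then have "j = nat m" "\<not> m < 0" using j by auto
    then show ?thesis using *(2) by (simp add: topc_def)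
  qed (use * in simp)
qed

lemma dle_topc_degree: "dle p m \<Longrightarrow> topc p m \<noteq> 0 \<Longrightarrow> int (degree p) = m"
  using le_degree[of p "nat m"] by (auto simp: dle_def topc_def split: if_splits)

abbreviation tX :: "'a::comm_ring_1 poly" where "tX \<equiv> [:0, 1:]"
abbreviation uX :: "'a::comm_ring_1 poly" where "uX \<equiv> [:1, 1:]"

lemma degree_uX_power: "degree ((uX :: 'a::idom poly) ^ n) = n"
  by (simp add: degree_power_eq)

lemma degree_tX_power: "degree ((tX :: 'a::idom poly) ^ n) = n"
  by (simp add: degree_power_eq)

lemma lead_uX_power: "poly.coeff ((uX :: 'a::idom poly) ^ n) n = 1"
  using lead_coeff_power[of "uX :: 'a poly" n] by (simp add: degree_uX_power)

lemma lead_tX_power: "poly.coeff ((tX :: 'a::idom poly) ^ n) n = 1"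
  using lead_coeff_power[of "tX :: 'a poly" n] by (simp add: degree_tX_power)

lemma degree_ge_of_two_powers:
  fixes P :: "'a::field_char_0 poly"
  assumes "P \<noteq> 0" "tX ^ m dvd P" "uX ^ n dvd P"
  shows "m + n \<le> degree P"
proof -
  obtain Q where Q: "P = tX ^ m * Q" using assms(2) by (auto elim: dvdE)
  have "Q \<noteq> 0" using Q assms by auto
  have "n \<le> Polynomial.order (- 1) P"
    using assms(3) order_divides[of "- 1" n P] assms(1) by simp
  also have "\<dots> = Polynomial.order (- 1) ((tX :: 'a poly) ^ m) + Polynomial.order (- 1) Q"
    using Q assms(1) by (simp add: order_mult)
  also have "Polynomial.order (- 1) ((tX :: 'a poly) ^ m) = 0"
    by (rule order_0I) simp
  finally have "n \<le> degree Q" using order_degree[OF \<open>Q \<noteq> 0\<close>, of "- 1"] by simp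
  then show ?thesis
    unfolding Q using \<open>Q \<noteq> 0\<close> by (simp add: degree_mult_eq degree_tX_power)
qed

text \<open>Compare leading coefficients; this is where the characteristic enters.\<close>

lemma degree_eq_of_wronskian:
  fixes p q :: "'a::field_char_0 poly"
  assumes w: "pderiv p * q = p * pderiv q" and "p \<noteq> 0" "q \<noteq> 0"
  shows "degree p = degree q"
proof (cases "degree p = 0 \<or> degree q = 0")
  case True
  then have "pderiv p = 0 \<or> pderiv q = 0" by (auto simp: pderiv_eq_0_iff)
  then have "pderiv p = 0 \<and> pderiv q = 0" using w assms by auto
  then show ?thesis by (simp add: pderiv_eq_0_iff)
next
  case False
  have lc: "lead_coeff (pderiv r) = of_nat (degree r) * lead_coeff r" if "degree r \<noteq> 0" for r :: "'a poly"
    using that by (simp add: degree_pderiv coeff_pderiv del: of_nat_Suc)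
  have "of_nat (degree p) * lead_coeff p * lead_coeff q = lead_coeff p * (of_nat (degree q) * lead_coeff q)"
    using arg_cong[OF w, of lead_coeff] False by (simp add: lead_coeff_mult lc)
  then have "(of_nat (degree p) :: 'a) = of_nat (degree q)" using assms by simp
  then show ?thesis by simp
qed

text \<open>A multiple of \<open>q\<close> is subtracted from \<open>p\<close> to remove the coefficient at the degree of \<open>q\<close>.  The difference satisfies
  the same equation, but it has another degree than \<open>q\<close> unless it vanishes.\<close>

lemma proportional_of_wronskian:
  fixes p q :: "'a::field_char_0 poly"
  assumes w: "pderiv p * q = p * pderiv q" and q: "q \<noteq> 0"
  shows "\<exists>x. p = [:x:] * q"
proof -
  let ?x = "poly.coeff p (degree q) / lead_coeff q"
  let ?r = "p - [:?x:] * q"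
  have "pderiv ?r * q = ?r * pderiv q"
    using w by (simp add: pderiv_diff pderiv_smult algebra_simps)
  moreover have "poly.coeff ?r (degree q) = 0" using q by simp
  ultimately have "?r = 0" using degree_eq_of_wronskian[of ?r q] q leading_coeff_0_iff[of ?r] by fastforce
  then show ?thesis by (intro exI[of _ ?x]) simp
qed

section \<open>Syzygies of four binary forms\<close>

text \<open>On a line that avoids the coordinate points, the four monomials become products of powers of three
  binary linear forms.  In an affine coordinate these are \<open>t\<close>, \<open>1\<close> and \<open>1 + t\<close>.\<close>

locale binary_forms =
  fixes a b c \<alpha> \<beta> \<gamma> :: nat and ty :: "'k::field_char_0 itself"
  assumes bounds: "0 < \<alpha>" "\<alpha> < a" "0 < \<beta>" "\<beta> < b" "0 < \<gamma>" "\<gamma> < c"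
begin

text \<open>The exponents of the three variables in the four monomials \<open>x\<^sup>a\<close>, \<open>y\<^sup>b\<close>, \<open>z\<^sup>c\<close> and \<open>x\<^sup>\<alpha> y\<^sup>\<beta> z\<^sup>\<gamma>\<close>, their degrees, and what
  becomes of them for \<open>x = t\<close>, \<open>y = 1\<close> and \<open>z = 1 + t\<close>.\<close>

definition xe :: "4 \<Rightarrow> nat" where "xe i = (if i = 1 then a else if i = 4 then \<alpha> else 0)"
definition ye :: "4 \<Rightarrow> nat" where "ye i = (if i = 2 then b else if i = 4 then \<beta> else 0)"
definition ze :: "4 \<Rightarrow> nat" where "ze i = (if i = 3 then c else if i = 4 then \<gamma> else 0)"
definition dd :: "4 \<Rightarrow> int" where "dd i = int (xe i + ye i + ze i)"
definition fh :: "4 \<Rightarrow> 'k poly" where "fh i = tX ^ xe i * uX ^ ze i"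

abbreviation total :: int where "total \<equiv> int (a + b + c + \<alpha> + \<beta> + \<gamma>)"

lemmas ex_defs = xe_def ye_def ze_def

lemma fh_values: "fh 1 = tX ^ a" "fh 2 = 1" "fh 3 = uX ^ c" "fh 4 = tX ^ \<alpha> * uX ^ \<gamma>"
  by (simp_all add: fh_def ex_defs)

lemma fh_nonzero [simp]: "fh i \<noteq> 0"
  by (simp add: fh_def)

lemma degree_fh: "degree (fh i) = xe i + ze i"
  by (simp add: fh_def degree_mult_eq degree_tX_power degree_uX_power)

lemma dle_fh: "dle (fh i) (dd i)"
  by (simp add: dle_def degree_fh dd_def)

lemma topc_fh: "topc (fh 1) (dd 1) = 1" "topc (fh 2) (dd 2) = 0" "topc (fh 3) (dd 3) = 1" "topc (fh 4) (dd 4) = 0"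
proof -
  show "topc (fh 1) (dd 1) = 1" "topc (fh 3) (dd 3) = 1"
    by (simp_all add: topc_def fh_values dd_def ex_defs lead_tX_power lead_uX_power)
  show "topc (fh 2) (dd 2) = 0"
    using bounds by (simp add: topc_def fh_values dd_def ex_defs)
  have "degree (fh 4) < nat (dd 4)" using bounds by (simp add: degree_fh dd_def ex_defs)
  then show "topc (fh 4) (dd 4) = 0"
    by (simp add: topc_def coeff_eq_0)
qed

text \<open>The syzygies of degree \<open>e\<close> of the four binary forms.\<close>

definition E :: "int \<Rightarrow> ('k poly ^ 4) set"
  where "E e = {v. (\<forall>i. dle (v $ i) (e - dd i)) \<and> (\<Sum>i\<in>UNIV. v $ i * fh i) = 0}"

lemma E_dle: "v \<in> E e \<Longrightarrow> dle (v $ i) (e - dd i)"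
  by (simp add: E_def)

lemma E_rel: "v \<in> E e \<Longrightarrow> v $ 1 * fh 1 + v $ 2 * fh 2 + v $ 3 * fh 3 + v $ 4 * fh 4 = 0"
  by (simp add: E_def sum_4)

lemma E_zero: "0 \<in> E e" by (simp add: E_def)

lemma E_add: "v \<in> E e \<Longrightarrow> w \<in> E e \<Longrightarrow> v + w \<in> E e"
  by (auto simp: E_def dle_add distrib_right sum.distrib)

lemma E_diff: "v \<in> E e \<Longrightarrow> w \<in> E e \<Longrightarrow> v - w \<in> E e"
  by (auto simp: E_def dle_diff left_diff_distrib sum_subtractf)

lemma E_mult: assumes "v \<in> E e" "dle p m" shows "p *s v \<in> E (m + e)"
proof -
  have "(\<Sum>i\<in>UNIV. (p *s v) $ i * fh i) = p * (\<Sum>i\<in>UNIV. v $ i * fh i)"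
    by (simp add: sum_distrib_left mult.assoc)
  then show ?thesis
    using assms dle_mult[OF assms(2), of "v $ i" "e - dd i" for i] by (auto simp: E_def algebra_simps)
qed

lemma E_neg: "v \<in> E e \<Longrightarrow> e < 0 \<Longrightarrow> v = 0"
  by (auto simp: E_def vec_eq_iff dd_def intro!: dle_neg)

definition tops :: "int \<Rightarrow> 'k poly ^ 4 \<Rightarrow> 'k ^ 4"
  where "tops e v = (\<chi> i. topc (v $ i) (e - dd i))"

lemma tops_add: "tops e (v + w) = tops e v + tops e w"
  by (simp add: tops_def vec_eq_iff topc_add)

lemma tops_diff: "tops e (v - w) = tops e v - tops e w"
  by (simp add: tops_def vec_eq_iff topc_diff)

lemma tops_mult: "v \<in> E e \<Longrightarrow> dle p m \<Longrightarrow> tops (m + e) (p *s v) = topc p m *s tops e v"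
  by (simp add: tops_def vec_eq_iff)
    (metis E_dle add_diff_eq topc_mult)

lemma E_lower: "v \<in> E e \<Longrightarrow> tops e v = 0 \<Longrightarrow> v \<in> E (e - 1)"
  using dle_lower[of "v $ i" "e - dd i" for i]
  by (auto simp: E_def tops_def vec_eq_iff algebra_simps)

text \<open>Only the first and the third form do not vanish at infinity.\<close>

lemma tops_relation: assumes v: "v \<in> E e" shows "tops e v $ 1 + tops e v $ 3 = 0"
proof -
  have *: "topc (v $ i * fh i) e = topc (v $ i) (e - dd i) * topc (fh i) (dd i)" for i
    by (rule topc_mult'[OF E_dle[OF v] dle_fh]) simp
  have "topc (v $ 1 * fh 1 + v $ 2 * fh 2 + v $ 3 * fh 3 + v $ 4 * fh 4) e = 0"
    using E_rel[OF v] by simp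
  then show ?thesis unfolding topc_add * topc_fh by (simp add: tops_def)
qed

text \<open>The vectors of top coefficients of syzygies of degree \<open>e\<close> form a space that grows with \<open>e\<close>.  Its
  limit is a hyperplane, and a graded basis appears at the degrees where it jumps.\<close>

definition T :: "nat \<Rightarrow> ('k ^ 4) set" where "T e = tops (int e) ` E (int e)"

lemma T_step: assumes "\<tau> \<in> T e" shows "\<tau> \<in> T (e + m)"
proof -
  obtain v where v: "v \<in> E (int e)" "\<tau> = tops (int e) v" using assms by (auto simp: T_def)
  have d: "dle (tX ^ m :: 'k poly) (int m)" by (simp add: dle_def degree_tX_power)
  have "topc (tX ^ m :: 'k poly) (int m) = 1" by (simp add: topc_def lead_tX_power)
  then have "tops (int m + int e) (tX ^ m *s v) = \<tau>" using tops_mult[OF v(1) d] v(2) by simp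
  then show ?thesis using E_mult[OF v(1) d] unfolding T_def by (auto simp: add.commute intro!: rev_image_eqI)
qed

lemma T_mono: "e \<le> e' \<Longrightarrow> \<tau> \<in> T e \<Longrightarrow> \<tau> \<in> T e'"
  using T_step[of \<tau> e "e' - e"] by simp

abbreviation h1 :: "'k ^ 4" where "h1 \<equiv> vector [1, 0, - 1, 0]"
abbreviation h2 :: "'k ^ 4" where "h2 \<equiv> vector [0, 1, 0, 0]"
abbreviation h3 :: "'k ^ 4" where "h3 \<equiv> vector [0, 0, 0, 1]"

lemma vector_4 [simp]:
  "(vector [w, x, y, z] :: 'a::zero ^ 4) $ 1 = w" "(vector [w, x, y, z] :: 'a ^ 4) $ 2 = x"
  "(vector [w, x, y, z] :: 'a ^ 4) $ 3 = y" "(vector [w, x, y, z] :: 'a ^ 4) $ 4 = z"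
  unfolding vector_def by simp_all

lemma hyperplane_span: assumes "(\<tau> :: 'k ^ 4) $ 1 + \<tau> $ 3 = 0" shows "\<tau> \<in> vec.span {h1, h2, h3}"
proof -
  have "\<tau> = \<tau> $ 1 *s h1 + \<tau> $ 2 *s h2 + \<tau> $ 4 *s h3"
    using assms by (simp add: vec_eq_iff forall_4 eq_neg_iff_add_eq_0 add.commute)
  also have "\<dots> \<in> vec.span {h1, h2, h3}"
    by (intro vec.span_add vec.span_scale vec.span_base) auto
  finally show ?thesis .
qed

lemma h_distinct: "h1 \<noteq> h2" "h1 \<noteq> h3" "h2 \<noteq> h3"
  by (auto simp: vec_eq_iff forall_4)

lemma h_independent: "vec.independent {h1, h2, h3}"
proof -
  have "h2 \<notin> vec.span {h3}" by (auto simp: vec.span_singleton vec_eq_iff forall_4)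
  moreover have "h1 \<notin> vec.span {h2, h3}"
    by (auto simp: vec.span_insert vec.span_singleton vec_eq_iff forall_4 algebra_simps)
  moreover have "h3 \<noteq> 0" by (auto simp: vec_eq_iff forall_4)
  ultimately show ?thesis
    using h_distinct by (simp add: vec.independent_insert)
qed

text \<open>The three vectors are the top coefficients of Koszul syzygies that involve the first form.\<close>

lemma T_limit: "\<exists>e. {h1, h2, h3} \<subseteq> T e"
proof -
  have k: "vector [p, q, r, s] \<in> E e" if "p * fh 1 + q * fh 2 + r * fh 3 + s * fh 4 = 0"
    "dle p (e - dd 1)" "dle q (e - dd 2)" "dle r (e - dd 3)" "dle s (e - dd 4)" for p q r s e
    using that by (simp add: E_def forall_4 sum_4)
  have 1: "h1 \<in> T (a + c)"
  proof -
    have "vector [fh 3, 0, - fh 1, 0] \<in> E (int (a + c))"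
      by (rule k) (auto simp: dd_def ex_defs fh_values dle_def degree_tX_power degree_uX_power)
    moreover have "tops (int (a + c)) (vector [fh 3, 0, - fh 1, 0]) = h1"
      by (simp add: tops_def vec_eq_iff forall_4 topc_def dd_def ex_defs fh_values lead_tX_power lead_uX_power)
    ultimately show ?thesis unfolding T_def by (metis imageI)
  qed
  have 2: "h2 \<in> T (a + b)"
  proof -
    have "vector [- 1, fh 1, 0, 0] \<in> E (int (a + b))"
      by (rule k) (auto simp: dd_def ex_defs fh_values dle_def degree_tX_power)
    moreover have "tops (int (a + b)) (vector [- 1, fh 1, 0, 0]) = h2"
      using bounds by (simp add: tops_def vec_eq_iff forall_4 topc_def dd_def ex_defs fh_values lead_tX_power)
    ultimately show ?thesis unfolding T_def by (metis imageI)
  qed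
  have 3: "h3 \<in> T (a + \<alpha> + \<beta> + \<gamma>)"
  proof -
    have d4: "degree (- fh 4) < \<alpha> + \<beta> + \<gamma>" using bounds by (simp add: degree_fh ex_defs)
    have "vector [- fh 4, 0, 0, fh 1] \<in> E (int (a + \<alpha> + \<beta> + \<gamma>))"
      by (rule k) (use d4 in \<open>auto simp: dd_def ex_defs fh_values dle_def degree_tX_power\<close>)
    moreover have "tops (int (a + \<alpha> + \<beta> + \<gamma>)) (vector [- fh 4, 0, 0, fh 1]) = h3"
      using coeff_eq_0[OF d4]
      by (auto simp: tops_def vec_eq_iff forall_4 topc_def dd_def ex_defs fh_values lead_tX_power nat_diff_distrib nat_add_distrib add.assoc)
    ultimately show ?thesis unfolding T_def by (metis imageI)
  qed
  show ?thesis
    by (rule exI[of _ "a + c + a + b + \<alpha> + \<beta> + \<gamma>"])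
      (use T_mono[OF _ 1] T_mono[OF _ 2] T_mono[OF _ 3] in auto)
qed

lemma T_escapes: assumes "finite S" "card S < 3" shows "\<exists>e. \<not> T e \<subseteq> vec.span S"
proof (rule ccontr)
  assume "\<nexists>e. \<not> T e \<subseteq> vec.span S"
  moreover obtain e where "{h1, h2, h3} \<subseteq> T e" using T_limit by blast
  ultimately have "{h1, h2, h3} \<subseteq> vec.span S" by blast
  then have "card {h1, h2, h3} \<le> card S"
    using vec.independent_span_bound[OF assms(1) h_independent] by simp
  then show False using assms(2) h_distinct by simp
qed

lemma T_jump:
  assumes "finite S" "card S < 3"
  shows "\<exists>e \<tau>. \<tau> \<in> T e \<and> \<tau> \<notin> vec.span S \<and> (\<forall>e'<e. T e' \<subseteq> vec.span S)"
proof -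
  let ?e = "LEAST e. \<not> T e \<subseteq> vec.span S"
  have "\<not> T ?e \<subseteq> vec.span S" using T_escapes[OF assms] by (rule LeastI_ex)
  then obtain \<tau> where "\<tau> \<in> T ?e" "\<tau> \<notin> vec.span S" by blast
  moreover have "T e' \<subseteq> vec.span S" if "e' < ?e" for e' using not_less_Least[OF that] by blast
  ultimately show ?thesis by blast
qed

definition comb :: "(nat \<Rightarrow> 'k poly ^ 4) \<Rightarrow> (nat \<Rightarrow> 'k poly) \<Rightarrow> 'k poly ^ 4"
  where "comb n x = x 0 *s n 0 + x 1 *s n 1 + x 2 *s n 2"

text \<open>A homogeneous basis of the module of syzygies over the polynomial ring in two variables.  Such a basis amounts
  to a splitting of the bundle on the line as \<open>\<O>(-\<delta>\<^sub>0) \<oplus> \<O>(-\<delta>\<^sub>1) \<oplus> \<O>(-\<delta>\<^sub>2)\<close>.\<close>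

definition graded_basis :: "(nat \<Rightarrow> 'k poly ^ 4) \<Rightarrow> (nat \<Rightarrow> nat) \<Rightarrow> bool"
  where "graded_basis n \<delta> \<longleftrightarrow> \<delta> 0 \<le> \<delta> 1 \<and> \<delta> 1 \<le> \<delta> 2 \<and> (\<forall>j<3. n j \<in> E (int (\<delta> j))) \<and>
    (\<forall>e v. v \<in> E e \<longrightarrow> (\<exists>x. (\<forall>j<3. dle (x j) (e - int (\<delta> j))) \<and> v = comb n x)) \<and>
    (\<forall>x. comb n x = 0 \<longrightarrow> (\<forall>j<3. x j = 0)) \<and> int (\<delta> 0 + \<delta> 1 + \<delta> 2) = total"

text \<open>The sum of the degrees is read off from a maximal minor of the basis.  Its degree is the largest possible,
  because its top coefficient is the determinant of the vectors of top coefficients.  On the other hand, the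
  minor is \<open>t\<^sup>a\<close> times another minor, which is a unit since all syzygies are combinations of the basis.\<close>

lemma basis_degree_sum:
  assumes n: "\<And>j. j < 3 \<Longrightarrow> n j \<in> E (int (\<delta> j))"
    and span: "\<And>e v. v \<in> E e \<Longrightarrow> \<exists>x. v = comb n x"
    and topspan: "\<And>\<tau>. \<tau> $ 1 + \<tau> $ 3 = 0 \<Longrightarrow>
      \<exists>y. \<tau> = y 0 *s tops (int (\<delta> 0)) (n 0) + y 1 *s tops (int (\<delta> 1)) (n 1) + y (2::nat) *s tops (int (\<delta> 2)) (n 2)"
  shows "int (\<delta> 0 + \<delta> 1 + \<delta> 2) = total"
proof -
  have inv: "det N \<noteq> 0 \<and> det N dvd 1" if "x ** N = mat 1" for x N :: "'a::idom ^ 3 ^ 3"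
    using arg_cong[OF that, of det] by (simp add: det_mul dvd_def) (metis mult.commute mult_zero_right zero_neq_one)
  let ?\<tau> = "\<lambda>j. tops (int (\<delta> j)) (n j)"
  let ?D = "int (\<delta> 0) + int (\<delta> 1) + int (\<delta> 2) - dd 2 - dd 3 - dd 4"
  \<comment> \<open>The minor without the first column has exact degree \<open>?D\<close>, since its top coefficient does not vanish.\<close>
  have d: "dle (n j $ i) (int (\<delta> j) - dd i)" if "j < 3" for i j using E_dle[OF n[OF that]] .
  have d0: "dle (n 0 $ i) (int (\<delta> 0) - dd i)" "dle (n 1 $ i) (int (\<delta> 1) - dd i)" "dle (n 2 $ i) (int (\<delta> 2) - dd i)" for i
    using d[of 0] d[of 1] d[of 2] by simp_all
  have m2: "dle (n 1 $ i * n 2 $ j) (int (\<delta> 1) - dd i + (int (\<delta> 2) - dd j))" for i j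
    by (rule dle_mult[OF d0(2,3)])
  have m3: "dle (n 0 $ i * (n 1 $ j * n 2 $ l)) ?D" if "dd i + dd j + dd l = dd 2 + dd 3 + dd 4" for i j l
    by (rule dle_mult'[OF d0(1) m2]) (use that in simp)
  have t3: "topc (n 0 $ i * (n 1 $ j * n 2 $ l)) ?D = ?\<tau> 0 $ i * (?\<tau> 1 $ j * ?\<tau> 2 $ l)"
    if "dd i + dd j + dd l = dd 2 + dd 3 + dd 4" for i j l
    using topc_mult'[OF d0(1)[of i] m2[of j l], of ?D] topc_mult[OF d0(2)[of j] d0(3)[of l]] that
    by (simp add: tops_def)
  have exp: "det3 u v w = u $ 2 * (v $ 3 * w $ 4) - u $ 2 * (v $ 4 * w $ 3) - (u $ 3 * (v $ 2 * w $ 4) - u $ 3 * (v $ 4 * w $ 2))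
    + (u $ 4 * (v $ 2 * w $ 3) - u $ 4 * (v $ 3 * w $ 2))" for u v w :: "'b::comm_ring_1 ^ 4"
    by (simp add: det3_def algebra_simps)
  have dleD: "dle (det3 (n 0) (n 1) (n 2)) ?D"
    unfolding exp by (intro dle_add dle_diff m3) simp_all
  have topD: "topc (det3 (n 0) (n 1) (n 2)) ?D = det3 (?\<tau> 0) (?\<tau> 1) (?\<tau> 2)"
    unfolding exp topc_add topc_diff by (simp add: t3 del: One_nat_def)
  have "det3 (?\<tau> 0) (?\<tau> 1) (?\<tau> 2) \<noteq> 0"
  proof -
    obtain y1 where y1: "vector [0, 1, 0, 0] = y1 0 *s ?\<tau> 0 + y1 1 *s ?\<tau> 1 + y1 (2::nat) *s ?\<tau> 2"
      using topspan[of "vector [0, 1, 0, 0]"] by auto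
    obtain y2 where y2: "vector [- 1, 0, 1, 0] = y2 0 *s ?\<tau> 0 + y2 1 *s ?\<tau> 1 + y2 (2::nat) *s ?\<tau> 2"
      using topspan[of "vector [- 1, 0, 1, 0]"] by auto
    obtain y3 where y3: "vector [0, 0, 0, 1] = y3 0 *s ?\<tau> 0 + y3 1 *s ?\<tau> 1 + y3 (2::nat) *s ?\<tau> 2"
      using topspan[of "vector [0, 0, 0, 1]"] by auto
    let ?N = "vector [vector [?\<tau> 0 $ 2, ?\<tau> 0 $ 3, ?\<tau> 0 $ 4], vector [?\<tau> 1 $ 2, ?\<tau> 1 $ 3, ?\<tau> 1 $ 4],
      vector [?\<tau> 2 $ 2, ?\<tau> 2 $ 3, ?\<tau> 2 $ 4]] :: 'k ^ 3 ^ 3"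
    let ?x = "vector [vector [y1 0, y1 1, y1 2], vector [y2 0, y2 1, y2 2], vector [y3 0, y3 1, y3 2]] :: 'k ^ 3 ^ 3"
    have "?x ** ?N = mat 1"
      using arg_cong[OF y1, of "\<lambda>v. v $ 2"] arg_cong[OF y1, of "\<lambda>v. v $ 3"] arg_cong[OF y1, of "\<lambda>v. v $ 4"]
        arg_cong[OF y2, of "\<lambda>v. v $ 2"] arg_cong[OF y2, of "\<lambda>v. v $ 3"] arg_cong[OF y2, of "\<lambda>v. v $ 4"]
        arg_cong[OF y3, of "\<lambda>v. v $ 2"] arg_cong[OF y3, of "\<lambda>v. v $ 3"] arg_cong[OF y3, of "\<lambda>v. v $ 4"]
      by (simp add: vec_eq_iff forall_3 matrix_matrix_mult_def sum_3 mat_def)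
    then have "det ?N \<noteq> 0" using inv by blast
    also have "det ?N = det3 (?\<tau> 0) (?\<tau> 1) (?\<tau> 2)" by (simp add: det_3 det3_def algebra_simps)
    finally show ?thesis .
  qed
  then have deg1: "int (degree (det3 (n 0) (n 1) (n 2))) = ?D"
    using dle_topc_degree[OF dleD] topD by simp
  \<comment> \<open>The minor without the second column is a unit, since the second form is a unit.\<close>
  let ?M = "n 0 $ 1 * (n 1 $ 3 * n 2 $ 4 - n 1 $ 4 * n 2 $ 3) - n 0 $ 3 * (n 1 $ 1 * n 2 $ 4 - n 1 $ 4 * n 2 $ 1)
    + n 0 $ 4 * (n 1 $ 1 * n 2 $ 3 - n 1 $ 3 * n 2 $ 1)"
  have "is_unit ?M"
  proof -
    have mem: "\<exists>e. vector [p, - (p * fh 1 + q * fh 3 + r * fh 4), q, r] \<in> E e" for p q r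
    proof -
      let ?v = "vector [p, - (p * fh 1 + q * fh 3 + r * fh 4), q, r] :: 'k poly ^ 4"
      have "?v \<in> E (\<Sum>i\<in>UNIV. int (degree (?v $ i)) + dd i)"
        unfolding E_def
      proof (intro CollectI conjI allI)
        fix i :: 4
        have "int (degree (?v $ i)) + dd i \<le> (\<Sum>i\<in>UNIV. int (degree (?v $ i)) + dd i)"
          by (rule member_le_sum) (auto simp: dd_def)
        then show "dle (?v $ i) ((\<Sum>i\<in>UNIV. int (degree (?v $ i)) + dd i) - dd i)" by (simp add: dle_def)
      qed (simp add: sum_4 fh_values algebra_simps)
      then show ?thesis ..
    qed
    have get: "\<exists>y. p = y 0 * n 0 $ 1 + y 1 * n 1 $ 1 + y 2 * n 2 $ 1 \<and> q = y 0 * n 0 $ 3 + y 1 * n 1 $ 3 + y 2 * n 2 $ 3 \<and>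
      r = y 0 * n 0 $ 4 + y 1 * n 1 $ 4 + y (2::nat) * n 2 $ 4" for p q r
    proof -
      obtain y where y: "vector [p, - (p * fh 1 + q * fh 3 + r * fh 4), q, r] = comb n y"
        using mem[of p q r] span by blast
      show ?thesis
        using arg_cong[OF y, of "\<lambda>v. v $ 1"] arg_cong[OF y, of "\<lambda>v. v $ 3"] arg_cong[OF y, of "\<lambda>v. v $ 4"]
        by (intro exI[of _ y]) (simp add: comb_def)
    qed
    obtain y1 :: "nat \<Rightarrow> 'k poly" where y1: "1 = y1 0 * n 0 $ 1 + y1 1 * n 1 $ 1 + y1 2 * n 2 $ 1" "0 = y1 0 * n 0 $ 3 + y1 1 * n 1 $ 3 + y1 2 * n 2 $ 3"
      "0 = y1 0 * n 0 $ 4 + y1 1 * n 1 $ 4 + y1 2 * n 2 $ 4" using get[of 1 0 0] by blast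
    obtain y2 :: "nat \<Rightarrow> 'k poly" where y2: "0 = y2 0 * n 0 $ 1 + y2 1 * n 1 $ 1 + y2 2 * n 2 $ 1" "1 = y2 0 * n 0 $ 3 + y2 1 * n 1 $ 3 + y2 2 * n 2 $ 3"
      "0 = y2 0 * n 0 $ 4 + y2 1 * n 1 $ 4 + y2 2 * n 2 $ 4" using get[of 0 1 0] by blast
    obtain y3 :: "nat \<Rightarrow> 'k poly" where y3: "0 = y3 0 * n 0 $ 1 + y3 1 * n 1 $ 1 + y3 2 * n 2 $ 1" "0 = y3 0 * n 0 $ 3 + y3 1 * n 1 $ 3 + y3 2 * n 2 $ 3"
      "1 = y3 0 * n 0 $ 4 + y3 1 * n 1 $ 4 + y3 2 * n 2 $ 4" using get[of 0 0 1] by blast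
    let ?N = "vector [vector [n 0 $ 1, n 0 $ 3, n 0 $ 4], vector [n 1 $ 1, n 1 $ 3, n 1 $ 4],
      vector [n 2 $ 1, n 2 $ 3, n 2 $ 4]] :: 'k poly ^ 3 ^ 3"
    let ?x = "vector [vector [y1 0, y1 1, y1 2], vector [y2 0, y2 1, y2 2], vector [y3 0, y3 1, y3 2]] :: 'k poly ^ 3 ^ 3"
    have "?x ** ?N = mat 1"
      using y1 y2 y3 by (simp add: vec_eq_iff forall_3 matrix_matrix_mult_def sum_3 mat_def)
    then have "is_unit (det ?N)" using inv by blast
    also have "det ?N = ?M" by (simp add: det_3 algebra_simps)
    finally show ?thesis .
  qed
  moreover have "det3 (n 0) (n 1) (n 2) = - (?M * tX ^ a)"
  proof -
    let ?f = "vector [fh 1, fh 2, fh 3, fh 4] :: 'k poly ^ 4"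
    have r: "n j $ 1 * ?f $ 1 + n j $ 2 * ?f $ 2 + n j $ 3 * ?f $ 3 + n j $ 4 * ?f $ 4 = 0" if "j < 3" for j
      using E_rel[OF n[OF that]] by simp
    show ?thesis
      using det3_minor[of "n 0" ?f "n 1" "n 2", OF r r r]
      by (simp only: vector_4 fh_values mult_1_right minus_mult_left)
  qed
  moreover have "degree (- (M * tX ^ a)) = a" if "is_unit M" for M :: "'k poly"
  proof -
    have "M \<noteq> 0" using that by auto
    then show ?thesis using that by (simp add: degree_mult_eq degree_tX_power is_unit_iff_degree)
  qed
  ultimately have "degree (det3 (n 0) (n 1) (n 2)) = a" by metis
  then show ?thesis using deg1 by (simp add: dd_def ex_defs)
qed

text \<open>A syzygy is chosen at each of the degrees where the space of top coefficient vectors grows.  Subtracting a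
  combination with the same top coefficients lowers the degree of any given syzygy, so they generate by
  induction; they are independent because their vectors of top coefficients are.\<close>

theorem graded_basis_exists: "\<exists>n \<delta>. graded_basis n \<delta>"
proof -
  obtain e0 \<tau>0 where 0: "\<tau>0 \<in> T e0" "\<tau>0 \<notin> vec.span {}" "\<And>e'. e' < e0 \<Longrightarrow> T e' \<subseteq> vec.span {}"
    using T_jump[of "{}"] by auto
  obtain e1 \<tau>1 where 1: "\<tau>1 \<in> T e1" "\<tau>1 \<notin> vec.span {\<tau>0}" "\<And>e'. e' < e1 \<Longrightarrow> T e' \<subseteq> vec.span {\<tau>0}"
    using T_jump[of "{\<tau>0}"] by auto
  have c2: "card {\<tau>1, \<tau>0} < 3" using card_insert_le_m1[of 2 "{\<tau>0}" \<tau>1] by simp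
  obtain e2 \<tau>2 where 2: "\<tau>2 \<in> T e2" "\<tau>2 \<notin> vec.span {\<tau>1, \<tau>0}" "\<And>e'. e' < e2 \<Longrightarrow> T e' \<subseteq> vec.span {\<tau>1, \<tau>0}"
    using T_jump[OF _ c2] by (metis finite.emptyI finite_insert)
  have e01: "e0 \<le> e1" using 0(3)[of e1] 1(1,2) vec.span_mono[of "{}" "{\<tau>0}"] by (meson empty_subsetI in_mono not_le_imp_less)
  have e12: "e1 \<le> e2" using 1(3)[of e2] 2(1,2) vec.span_mono[of "{\<tau>0}" "{\<tau>1, \<tau>0}"] by (meson in_mono not_le_imp_less subset_insertI)
  have ind1: "vec.independent {\<tau>0}" using 0(2) by (simp add: vec.independent_insert)
  have ind2: "vec.independent {\<tau>1, \<tau>0}" using ind1 1(2) vec.span_base[of \<tau>1 "{\<tau>0}"] by (auto simp: vec.independent_insert)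
  have ind3: "vec.independent {\<tau>2, \<tau>1, \<tau>0}" using ind2 2(2) vec.span_base[of \<tau>2 "{\<tau>1, \<tau>0}"] by (auto simp: vec.independent_insert)
  have dist: "\<tau>0 \<noteq> \<tau>1" "\<tau>2 \<noteq> \<tau>1" "\<tau>2 \<noteq> \<tau>0" using 1(2) 2(2) by (auto intro: vec.span_base)
  have T_hyper: "\<tau> $ 1 + \<tau> $ 3 = 0" if "\<tau> \<in> T e" for \<tau> e using that tops_relation by (auto simp: T_def)
  \<comment> \<open>The three vectors span the hyperplane, as it has dimension three.\<close>
  have full: "\<tau> \<in> vec.span {\<tau>2, \<tau>1, \<tau>0}" if "\<tau> $ 1 + \<tau> $ 3 = 0" for \<tau>
  proof (rule ccontr)
    assume no: "\<tau> \<notin> vec.span {\<tau>2, \<tau>1, \<tau>0}"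
    then have ind4: "vec.independent {\<tau>, \<tau>2, \<tau>1, \<tau>0}"
      using ind3 vec.span_base[of \<tau> "{\<tau>2, \<tau>1, \<tau>0}"] by (auto simp: vec.independent_insert)
    have "\<tau> \<notin> {\<tau>2, \<tau>1, \<tau>0}" using no vec.span_base[of \<tau> "{\<tau>2, \<tau>1, \<tau>0}"] by auto
    then have "card {\<tau>, \<tau>2, \<tau>1, \<tau>0} = 4" using dist by auto
    moreover have "{\<tau>, \<tau>2, \<tau>1, \<tau>0} \<subseteq> vec.span {h1, h2, h3}"
      using hyperplane_span[OF that] T_hyper[OF 0(1), THEN hyperplane_span] T_hyper[OF 1(1), THEN hyperplane_span]
        T_hyper[OF 2(1), THEN hyperplane_span] by simp
    ultimately have "4 \<le> card {h1, h2, h3}" using vec.independent_span_bound[OF _ ind4, of "{h1, h2, h3}"] by simp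
    then show False using h_distinct by simp
  qed
  obtain n0 where n0: "n0 \<in> E (int e0)" "\<tau>0 = tops (int e0) n0" using 0(1) by (auto simp: T_def)
  obtain n1 where n1: "n1 \<in> E (int e1)" "\<tau>1 = tops (int e1) n1" using 1(1) by (auto simp: T_def)
  obtain n2 where n2: "n2 \<in> E (int e2)" "\<tau>2 = tops (int e2) n2" using 2(1) by (auto simp: T_def)
  define n where "n j = (if j = 0 then n0 else if j = 1 then n1 else n2)" for j :: nat
  define \<delta> where "\<delta> j = (if j = 0 then e0 else if j = 1 then e1 else e2)" for j :: nat
  define \<tau> where "\<tau> j = (if j = 0 then \<tau>0 else if j = 1 then \<tau>1 else \<tau>2)" for j :: nat
  have nE: "n j \<in> E (int (\<delta> j))" for j using n0 n1 n2 by (simp add: n_def \<delta>_def)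
  have n\<tau>: "tops (int (\<delta> j)) (n j) = \<tau> j" for j using n0 n1 n2 by (simp add: n_def \<delta>_def \<tau>_def)
  have span3: "\<exists>y. \<sigma> = y 0 *s \<tau> 0 + y 1 *s \<tau> 1 + y (2::nat) *s \<tau> 2" if \<sigma>: "\<sigma> \<in> vec.span {\<tau>2, \<tau>1, \<tau>0}" for \<sigma>
  proof -
    obtain k2 k1 k0 where "\<sigma> - k2 *s \<tau>2 - k1 *s \<tau>1 = k0 *s \<tau>0"
      using \<sigma> by (auto simp: vec.span_insert vec.span_singleton)
    then have "\<sigma> = k0 *s \<tau> 0 + k1 *s \<tau> 1 + k2 *s \<tau> 2" by (simp add: \<tau>_def algebra_simps)
    then show ?thesis
      by (intro exI[of _ "\<lambda>j. if j = 0 then k0 else if j = 1 then k1 else k2"]) simp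
  qed
  have top_comb: "\<exists>y. tops e v = y 0 *s \<tau> 0 + y 1 *s \<tau> 1 + y (2::nat) *s \<tau> 2 \<and> (\<forall>j<3. e < int (\<delta> j) \<longrightarrow> y j = 0)"
    if v: "v \<in> E e" and e: "0 \<le> e" for e v
  proof -
    have vT: "tops e v \<in> T (nat e)" using v e by (auto simp: T_def)
    consider "nat e < e0" | "e0 \<le> nat e" "nat e < e1" | "e1 \<le> nat e" "nat e < e2" | "e2 \<le> nat e" by linarith
    then show ?thesis
    proof cases
      case 1
      then have "tops e v = 0" using 0(3) vT by auto
      then show ?thesis by (intro exI[of _ "\<lambda>_. 0"]) simp
    next
      case 2
      then have "tops e v \<in> vec.span {\<tau>0}" using 1(3) vT by blast
      then obtain k where "tops e v = k *s \<tau>0" by (auto simp: vec.span_singleton)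
      then show ?thesis using 2 e
        by (intro exI[of _ "\<lambda>j. if j = 0 then k else 0"]) (auto simp: \<tau>_def \<delta>_def)
    next
      case 3
      then have "tops e v \<in> vec.span {\<tau>1, \<tau>0}" using 2(3) vT by blast
      then obtain k1 k0 where "tops e v - k1 *s \<tau>1 = k0 *s \<tau>0" by (auto simp: vec.span_insert vec.span_singleton)
      then have "tops e v = k0 *s \<tau>0 + k1 *s \<tau>1" by (simp add: algebra_simps)
      then show ?thesis using 3 e e01
        by (intro exI[of _ "\<lambda>j. if j = 0 then k0 else if j = 1 then k1 else 0"]) (auto simp: \<tau>_def \<delta>_def)
    next
      case 4
      obtain y where "tops e v = y 0 *s \<tau> 0 + y 1 *s \<tau> 1 + y (2::nat) *s \<tau> 2"
        using span3[OF full[OF T_hyper[OF vT]]] by blast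
      then show ?thesis using 4 e e01 e12 by (intro exI[of _ y]) (auto simp: \<delta>_def)
    qed
  qed
  have gen: "\<exists>x. (\<forall>j<3. dle (x j) (e - int (\<delta> j))) \<and> v = comb n x" if "v \<in> E e" for e v
    using that
  proof (induction "nat (e + 1)" arbitrary: e v rule: less_induct)
    case less
    show ?case
    proof (cases "e < 0")
      case True
      then show ?thesis using E_neg[OF less.prems] by (intro exI[of _ "\<lambda>_. 0"]) (simp add: comb_def)
    next
      case False
      then obtain y where y: "tops e v = y 0 *s \<tau> 0 + y 1 *s \<tau> 1 + y (2::nat) *s \<tau> 2"
          "\<forall>j<3. e < int (\<delta> j) \<longrightarrow> y j = 0" using top_comb[OF less.prems] by auto
      define z where "z j = Polynomial.monom (y j) (nat (e - int (\<delta> j)))" for j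
      have z: "dle (z j) (e - int (\<delta> j))" "topc (z j) (e - int (\<delta> j)) = y j" if "j < 3" for j
        using y(2) that by (auto simp: z_def dle_iff_coeff topc_def)
      have zn: "z j *s n j \<in> E e" "tops e (z j *s n j) = y j *s \<tau> j" if "j < 3" for j
        using E_mult[OF nE[of j] z(1)[OF that]] tops_mult[OF nE[of j] z(1)[OF that]] z(2)[OF that] n\<tau> by simp_all
      have cz: "comb n z \<in> E e" using zn[of 0] zn[of 1] zn[of 2] by (simp add: comb_def E_add)
      have "tops e (v - comb n z) = 0"
        using zn[of 0] zn[of 1] zn[of 2] y(1) by (simp add: comb_def tops_diff tops_add)
      then have "v - comb n z \<in> E (e - 1)" using E_lower E_diff[OF less.prems cz] by blast
      then obtain x where x: "\<forall>j<3. dle (x j) (e - 1 - int (\<delta> j))" "v - comb n z = comb n x"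
        using less.hyps[of "e - 1"] False by auto
      have "dle (x j + z j) (e - int (\<delta> j))" if "j < 3" for j
        using x(1) that z(1)[OF that] by (intro dle_add) (auto intro: dle_mono)
      moreover have "v = comb n (\<lambda>j. x j + z j)"
        using x(2) by (simp add: comb_def vector_sadd_rdistrib algebra_simps)
      ultimately show ?thesis by (intro exI[of _ "\<lambda>j. x j + z j"]) simp
    qed
  qed
  \<comment> \<open>Each vector of top coefficients lies outside the span of the preceding ones.\<close>
  have \<tau>_ind: "y0 = 0 \<and> y1 = 0 \<and> y2 = 0" if eq: "y0 *s \<tau> 0 + y1 *s \<tau> 1 + y2 *s \<tau> 2 = 0" for y0 y1 y2
  proof -
    have "y2 = 0"
    proof (rule ccontr)
      assume "y2 \<noteq> 0"
      have "y2 *s \<tau>2 = (- y0) *s \<tau>0 + (- y1) *s \<tau>1"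
        using eq by (simp add: \<tau>_def algebra_simps eq_neg_iff_add_eq_0)
      then have "y2 *s \<tau>2 \<in> vec.span {\<tau>1, \<tau>0}"
        by (metis insert_iff vec.span_add vec.span_base vec.span_scale)
      then have "(1 / y2) *s (y2 *s \<tau>2) \<in> vec.span {\<tau>1, \<tau>0}" by (rule vec.span_scale)
      then show False using \<open>y2 \<noteq> 0\<close> 2(2) by (simp add: vector_smult_assoc)
    qed
    moreover have "y1 = 0"
    proof (rule ccontr)
      assume "y1 \<noteq> 0"
      have "y1 *s \<tau>1 = (- y0) *s \<tau>0"
        using eq \<open>y2 = 0\<close> by (simp add: \<tau>_def algebra_simps eq_neg_iff_add_eq_0)
      then have "y1 *s \<tau>1 \<in> vec.span {\<tau>0}"
        by (metis insert_iff vec.span_base vec.span_scale)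
      then have "(1 / y1) *s (y1 *s \<tau>1) \<in> vec.span {\<tau>0}" by (rule vec.span_scale)
      then show False using \<open>y1 \<noteq> 0\<close> 1(2) by (simp add: vector_smult_assoc)
    qed
    moreover have "y0 = 0" using eq 0(2) \<open>y2 = 0\<close> \<open>y1 = 0\<close> by (auto simp: \<tau>_def)
    ultimately show ?thesis by simp
  qed
  have ind_step: "\<forall>j<3. x j = 0" if "comb n x = 0" "\<forall>j<3. dle (x j) (int k - 1 - int (\<delta> j))" for x k
    using that
  proof (induction k)
    case 0
    show ?case
    proof (intro allI impI)
      fix j :: nat assume "j < 3"
      then have "dle (x j) (- 1 - int (\<delta> j))" using 0(2) by simp
      then show "x j = 0" by (rule dle_neg) simp
    qed
  next
    case (Suc k)
    have d: "dle (x j) (int k - int (\<delta> j))" if "j < 3" for j using Suc.prems(2) that by simp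
    have "tops (int k) (comb n x) = topc (x 0) (int k - int (\<delta> 0)) *s \<tau> 0 + topc (x 1) (int k - int (\<delta> 1)) *s \<tau> 1
        + topc (x 2) (int k - int (\<delta> 2)) *s \<tau> 2"
      using tops_mult[OF nE[of 0] d[of 0]] tops_mult[OF nE[of 1] d[of 1]] tops_mult[OF nE[of 2] d[of 2]]
      by (simp add: comb_def tops_add n\<tau>)
    moreover have "tops (int k) (comb n x) = 0" unfolding Suc.prems(1) by (simp add: tops_def vec_eq_iff)
    ultimately have "topc (x 0) (int k - int (\<delta> 0)) = 0 \<and> topc (x 1) (int k - int (\<delta> 1)) = 0 \<and> topc (x 2) (int k - int (\<delta> 2)) = 0"
      using \<tau>_ind by metis
    then have "topc (x j) (int k - int (\<delta> j)) = 0" if "j < 3" for j using that by (auto simp: numeral_3_eq_3 less_Suc_eq numeral_2_eq_2)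
    then have "dle (x j) (int k - 1 - int (\<delta> j))" if "j < 3" for j
      using dle_lower[OF d[OF that]] that by (simp add: algebra_simps)
    then show ?case using Suc by blast
  qed
  have ind: "\<forall>j<3. x j = 0" if "comb n x = 0" for x
  proof -
    define m where "m = (\<Sum>j<3. degree (x j) + \<delta> j)"
    have "\<forall>j<3. dle (x j) (int (Suc m) - 1 - int (\<delta> j))"
    proof (intro allI impI)
      fix j :: nat assume "j < 3"
      then have "degree (x j) + \<delta> j \<le> m" unfolding m_def by (intro member_le_sum[where f = "\<lambda>j. degree (x j) + \<delta> j"]) auto
      then show "dle (x j) (int (Suc m) - 1 - int (\<delta> j))" by (auto simp: dle_def)
    qed
    then show ?thesis by (rule ind_step[OF that])
  qed
  have "int (\<delta> 0 + \<delta> 1 + \<delta> 2) = total"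
  proof (rule basis_degree_sum)
    show "n j \<in> E (int (\<delta> j))" if "j < 3" for j by (rule nE)
    show "\<exists>x. v = comb n x" if "v \<in> E e" for e v using gen[OF that] by blast
    show "\<exists>y. \<sigma> = y 0 *s tops (int (\<delta> 0)) (n 0) + y 1 *s tops (int (\<delta> 1)) (n 1) + y (2::nat) *s tops (int (\<delta> 2)) (n 2)"
      if "\<sigma> $ 1 + \<sigma> $ 3 = 0" for \<sigma> unfolding n\<tau> by (rule span3[OF full[OF that]])
  qed
  moreover have "\<delta> 0 \<le> \<delta> 1" "\<delta> 1 \<le> \<delta> 2" using e01 e12 by (auto simp: \<delta>_def)
  ultimately have "graded_basis n \<delta>" unfolding graded_basis_def using nE gen ind by blast
  then show ?thesis by blast
qed

end

section \<open>The splitting type has no gaps\<close>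

context binary_forms
begin

text \<open>The derivation \<open>x y (\<partial>\<^sub>x - \<partial>\<^sub>y)\<close> kills \<open>x + y\<close>, and it multiplies each of the four forms by a
  linear form.  Therefore it induces a connection with logarithmic poles on the syzygy bundle of the
  line, which raises degrees by one.  The connection has the role that the relative tangent bundle of the
  incidence variety has in the theorem of Grauert and Muelich.\<close>

definition conn :: "int \<Rightarrow> 'k poly ^ 4 \<Rightarrow> 'k poly ^ 4"
  where "conn e v = (\<chi> i. tX * uX * pderiv (v $ i) + (of_nat (xe i) * uX + of_nat (ze i) * tX - of_int e * tX) * v $ i)"

text \<open>The derivation in the affine coordinate, on forms of degree \<open>e\<close>: by Euler's formula, \<open>y \<partial>\<^sub>y\<close> acts as
  \<open>e - t \<partial>\<^sub>t\<close>.\<close>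

definition der :: "int \<Rightarrow> 'k poly \<Rightarrow> 'k poly"
  where "der e g = tX * uX * pderiv g - of_int e * tX * g"

lemma pderiv_fh: "tX * uX * pderiv (fh i) = (of_nat (xe i) * uX + of_nat (ze i) * tX) * fh i"
proof -
  have p: "q * pderiv (q ^ m) = of_nat m * pderiv q * q ^ m" for q :: "'k poly" and m
    by (cases m) (simp_all add: pderiv_power_Suc of_nat_poly mult_ac del: of_nat_Suc power_Suc, simp add: mult_ac del: of_nat_Suc)
  have "pderiv tX = (1 :: 'k poly)" "pderiv uX = (1 :: 'k poly)" by (simp_all add: pderiv_pCons)
  then have "tX * pderiv (tX ^ m) = of_nat m * (tX :: 'k poly) ^ m"
    "uX * pderiv (uX ^ m) = of_nat m * (uX :: 'k poly) ^ m" for m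
    using p[of tX m] p[of uX m] by simp_all
  then have "tX * uX * pderiv (fh i) = uX * (of_nat (xe i) * tX ^ xe i) * uX ^ ze i
      + tX * (of_nat (ze i) * uX ^ ze i) * tX ^ xe i"
    unfolding fh_def pderiv_mult by (simp add: distrib_left mult_ac del: mult_pCons_left mult_pCons_right)
  then show ?thesis by (simp add: fh_def algebra_simps del: mult_pCons_left mult_pCons_right)
qed

lemma der_conn: "der e (v $ i * fh i) = conn e v $ i * fh i"
  using pderiv_fh[of i]
  unfolding der_def conn_def
  by (simp add: pderiv_mult algebra_simps del: mult_pCons_left mult_pCons_right)

lemma der_add: "der e (p + q) = der e p + der e q"
  by (simp add: der_def pderiv_add algebra_simps del: mult_pCons_left mult_pCons_right)

lemma der_sum: "der e (sum g A) = (\<Sum>i\<in>A. der e (g i))"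
  by (induction A rule: infinite_finite_induct) (simp_all add: der_add, simp_all add: der_def)

lemma conn_E: assumes v: "v \<in> E e" shows "conn e v \<in> E (e + 1)"
proof -
  have "(\<Sum>i\<in>UNIV. conn e v $ i * fh i) = der e (\<Sum>i\<in>UNIV. v $ i * fh i)"
    by (simp add: der_sum der_conn)
  also have "\<dots> = 0" using v by (simp add: E_def der_def)
  finally have rel: "(\<Sum>i\<in>UNIV. conn e v $ i * fh i) = 0" .
  have "dle (conn e v $ i) (e + 1 - dd i)" for i
  proof (cases "v $ i = 0")
    case False
    have d: "dle (v $ i) (e - dd i)" by (rule E_dle[OF v])
    have "dle (tX * uX * pderiv (v $ i)) (e + 1 - dd i)"
    proof (cases "pderiv (v $ i) = 0")
      case False
      then have "degree (v $ i) \<noteq> 0" by (simp add: pderiv_eq_0_iff)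
      moreover have "degree (tX * uX * pderiv (v $ i)) = degree (v $ i) - 1 + 2"
        using False by (subst degree_mult_eq) (simp_all add: degree_pderiv del: mult_pCons_left mult_pCons_right, simp)
      ultimately show ?thesis using d \<open>v $ i \<noteq> 0\<close> by (auto simp: dle_def)
    qed (simp add: dle_def)
    moreover have "dle ((of_nat (xe i) * uX + of_nat (ze i) * tX - of_int e * tX) * v $ i) (e + 1 - dd i)"
    proof (rule dle_mult'[OF _ d])
      have c: "dle (of_nat m * uX) 1" "dle (of_nat m * tX) 1" "dle (of_int l * tX) 1" for m :: nat and l :: int
        by (auto simp: of_nat_poly of_int_poly dle_def degree_pCons_eq_if)
      show "dle (of_nat (xe i) * uX + of_nat (ze i) * tX - of_int e * tX) 1"
        by (intro dle_add dle_diff c)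
    qed simp
    ultimately show ?thesis unfolding conn_def by (simp add: dle_add del: mult_pCons_left mult_pCons_right)
  qed (simp add: conn_def)
  then show ?thesis using rel by (simp add: E_def)
qed

text \<open>What semistability gives: bounds for the degrees of the generators and of least common multiples of
  one of the pure powers with the mixed monomial.\<close>

definition slope_bounds :: bool
  where "slope_bounds \<longleftrightarrow> 3 * int a \<le> total \<and> 3 * int b \<le> total \<and> 3 * int c \<le> total \<and> 3 * int (\<alpha> + \<beta> + \<gamma>) \<le> total \<and>
    total \<le> 3 * int (a + \<beta> + \<gamma>) \<and> total \<le> 3 * int (b + \<alpha> + \<gamma>) \<and> total \<le> 3 * int (c + \<alpha> + \<beta>)"

text \<open>The least common multiple of any two of the monomials has at least a third of the total degree.  For two
  pure powers this follows from the bounds for the generators.\<close>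

lemma pair_bound:
  assumes slope_bounds "i \<noteq> j"
  shows "total \<le> 3 * int (max (xe i) (xe j) + max (ye i) (ye j) + max (ze i) (ze j))"
proof -
  have m: "max a \<alpha> = a" "max \<alpha> a = a" "max b \<beta> = b" "max \<beta> b = b" "max c \<gamma> = c" "max \<gamma> c = c"
    using bounds by simp_all
  have "total \<le> 3 * int (a + b)" "total \<le> 3 * int (a + c)" "total \<le> 3 * int (b + c)"
    "total \<le> 3 * int (a + \<beta> + \<gamma>)" "total \<le> 3 * int (b + \<alpha> + \<gamma>)" "total \<le> 3 * int (c + \<alpha> + \<beta>)"
  proof -
    have sb: "3 * int a \<le> total" "3 * int b \<le> total" "3 * int c \<le> total" "3 * int (\<alpha> + \<beta> + \<gamma>) \<le> total"
      using assms(1) by (auto simp: slope_bounds_def)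
    show "total \<le> 3 * int (a + b)" "total \<le> 3 * int (a + c)" "total \<le> 3 * int (b + c)"
      using sb unfolding of_nat_add distrib_left by linarith+
    show "total \<le> 3 * int (a + \<beta> + \<gamma>)" "total \<le> 3 * int (b + \<alpha> + \<gamma>)" "total \<le> 3 * int (c + \<alpha> + \<beta>)"
      using assms(1) unfolding slope_bounds_def by blast+
  qed
  note q = this
  define Q where "Q p q \<longleftrightarrow> total \<le> 3 * int (max (xe p) (xe q) + max (ye p) (ye q) + max (ze p) (ze q))" for p q
  have "Q 1 2" "Q 1 3" "Q 2 3" "Q 1 4" "Q 2 4" "Q 3 4"
    unfolding Q_def ex_defs using q by (simp_all add: m add_ac del: of_nat_add)
  moreover have "Q p q = Q q p" for p q unfolding Q_def by (simp only: max.commute)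
  ultimately have "Q i j" using exhaust_4[of i] exhaust_4[of j] assms(2) by (elim disjE) simp_all
  then show ?thesis by (simp only: Q_def)
qed

text \<open>A syzygy does not involve basis elements of larger degree.\<close>

lemma comb_gap:
  assumes gb: "graded_basis n \<delta>" and v: "v \<in> E e"
  shows "\<exists>x. v = comb n x \<and> (\<forall>j<3. e < int (\<delta> j) \<longrightarrow> x j = 0)"
proof -
  obtain x where "\<forall>j<3. dle (x j) (e - int (\<delta> j))" "v = comb n x"
    using gb v unfolding graded_basis_def by blast
  then show ?thesis by (intro exI[of _ x]) (auto intro: dle_neg)
qed

lemma basis_mem: "graded_basis n \<delta> \<Longrightarrow> j < 3 \<Longrightarrow> n j \<in> E (int (\<delta> j))"
  by (simp add: graded_basis_def)

lemma comb_zero: "graded_basis n \<delta> \<Longrightarrow> comb n x = 0 \<Longrightarrow> j < 3 \<Longrightarrow> x j = 0"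
  unfolding graded_basis_def by blast

lemma basis_nonzero: assumes gb: "graded_basis n \<delta>" shows "n 0 \<noteq> 0"
proof
  assume "n 0 = 0"
  then have "comb n (\<lambda>j. if j = 0 then 1 else 0) = 0" by (simp add: comb_def)
  then show False using comb_zero[OF gb, of "\<lambda>j. if j = 0 then 1 else 0" 0] by simp
qed

lemma dvd_const_mult: "x \<noteq> 0 \<Longrightarrow> q dvd [:x:] * P \<Longrightarrow> q dvd (P :: 'k poly)"
  by (simp add: dvd_smult_iff)

text \<open>If the first gap is at least two, the connection preserves the line generated by the first basis
  element.  So the products of its components with the forms satisfy the same differential equation and are
  constant multiples of one polynomial.  At least two of them do not vanish, whence this polynomial is
  divisible by the least common multiple of two of the forms, and the first degree is at least a third of
  the total.  That leaves no room for the gap.\<close>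

lemma first_gap:
  assumes gb: "graded_basis n \<delta>" and sb: slope_bounds
  shows "\<delta> 1 \<le> \<delta> 0 + 1"
proof (rule ccontr)
  assume gap: "\<not> \<delta> 1 \<le> \<delta> 0 + 1"
  have ord: "\<delta> 1 \<le> \<delta> 2" "int (\<delta> 0 + \<delta> 1 + \<delta> 2) = total" using gb by (auto simp: graded_basis_def)
  let ?e = "int (\<delta> 0)"
  have n0: "n 0 \<in> E ?e" by (rule basis_mem[OF gb]) simp
  obtain x where x: "conn ?e (n 0) = comb n x" "\<forall>j<3. ?e + 1 < int (\<delta> j) \<longrightarrow> x j = 0"
    using comb_gap[OF gb conn_E[OF n0]] by blast
  \<comment> \<open>In degree \<open>\<delta> 0 + 1\<close> only the first basis element is available.\<close>
  have "x 1 = 0" "x 2 = 0" using x(2) gap ord by auto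
  then have x0: "conn ?e (n 0) = x 0 *s n 0" using x(1) by (simp add: comb_def)
  define u where "u i = n 0 $ i * fh i" for i
  \<comment> \<open>All components satisfy one differential equation of first order, so their Wronskians vanish.\<close>
  have du: "tX * uX * pderiv (u i) = (x 0 + of_int ?e * tX) * u i" for i
    using der_conn[of ?e "n 0" i] unfolding x0 der_def u_def[symmetric]
    by (simp add: algebra_simps u_def del: mult_pCons_left mult_pCons_right)
  have w: "pderiv (u i) * u j = u i * pderiv (u j)" for i j
  proof -
    have "(tX * uX) * (pderiv (u i) * u j) = (tX * uX * pderiv (u i)) * u j" by (simp only: mult.assoc)
    also have "\<dots> = u i * (tX * uX * pderiv (u j))" unfolding du by (simp only: mult_ac)
    also have "\<dots> = (tX * uX) * (u i * pderiv (u j))" by (simp only: mult_ac)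
    finally show ?thesis by (subst (asm) mult_cancel_left) auto
  qed
  obtain i0 where i0: "n 0 $ i0 \<noteq> 0" using basis_nonzero[OF gb] by (auto simp: vec_eq_iff)
  then have P: "u i0 \<noteq> 0" by (simp add: u_def)
  obtain y where y: "\<And>i. u i = [:y i:] * u i0" using proportional_of_wronskian[OF w P] by metis
  have yi0: "y i0 = 1" using y[of i0] P
    by (metis mult_cancel_right1 one_pCons pCons_eq_iff)
  have "(\<Sum>i\<in>UNIV. u i) = 0" using n0 by (simp add: E_def u_def)
  then have "(\<Sum>i\<in>UNIV. [:y i:]) * u i0 = 0" by (simp only: sum_distrib_right y[symmetric])
  then have "(\<Sum>i\<in>UNIV. [:y i:]) = 0" using P by simp
  then have "(\<Sum>i\<in>UNIV. y i) = 0" by (simp add: sum_4)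
  then obtain i1 where i1: "i1 \<noteq> i0" "y i1 \<noteq> 0"
    using yi0 by (metis (no_types, lifting) DiffE UNIV_I add_cancel_left_right finite_class.finite_UNIV insertI1 sum.neutral sum.remove zero_neq_one)
  have supp: "tX ^ xe i dvd u i0 \<and> uX ^ ze i dvd u i0 \<and> degree (u i0) + ye i \<le> \<delta> 0" if "y i \<noteq> 0" for i
  proof (intro conjI)
    have u: "[:y i:] * u i0 = n 0 $ i * (tX ^ xe i * uX ^ ze i)" using y[of i] by (simp add: u_def fh_def)
    show "tX ^ xe i dvd u i0"
      by (rule dvd_const_mult[OF that]) (unfold u, intro dvd_mult dvd_mult2 dvd_refl)
    show "uX ^ ze i dvd u i0"
      by (rule dvd_const_mult[OF that]) (unfold u, intro dvd_mult dvd_refl)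
    have ni: "n 0 $ i \<noteq> 0" using y[of i] that P by (auto simp: u_def)
    have "degree (u i0) = degree (u i)" using y[of i] that by simp
    also have "\<dots> = degree (n 0 $ i) + (xe i + ze i)" unfolding u_def using ni by (simp add: degree_mult_eq degree_fh)
    finally show "degree (u i0) + ye i \<le> \<delta> 0"
      using E_dle[OF n0, of i] ni by (auto simp: dle_def dd_def)
  qed
  have y0: "y i0 \<noteq> 0" using yi0 by simp
  have "tX ^ max (xe i0) (xe i1) dvd u i0" "uX ^ max (ze i0) (ze i1) dvd u i0"
    using supp[OF y0] supp[OF i1(2)] by (auto simp: max_def)
  then have "max (xe i0) (xe i1) + max (ze i0) (ze i1) \<le> degree (u i0)"
    by (rule degree_ge_of_two_powers[OF P])
  then have "max (xe i0) (xe i1) + max (ye i0) (ye i1) + max (ze i0) (ze i1) \<le> \<delta> 0"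
    using supp[OF y0] supp[OF i1(2)] by (auto simp: max_def split: if_splits)
  then have "3 * int (max (xe i0) (xe i1) + max (ye i0) (ye i1) + max (ze i0) (ze i1)) \<le> 3 * int (\<delta> 0)"
    by (simp only: mult_le_cancel_left_pos zero_less_numeral of_nat_le_iff)
  with pair_bound[OF sb i1(1)[symmetric]] have "total \<le> 3 * int (\<delta> 0)" by (rule order_trans)
  then show False using gap ord unfolding of_nat_add by linarith
qed

text \<open>The matrix \<open>z\<close> will hold the Pluecker coordinates of a plane up to a common factor of degree at most \<open>d\<close>,
  whose order of vanishing on the three coordinate lines is bounded below by the exponents \<open>xe\<close>, \<open>ye\<close> and \<open>ze\<close>.
  Which estimate yields the conclusion depends on the coordinates that vanish; the relations between the
  coordinates leave five cases.\<close>

lemma second_gap_cases: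
  fixes z :: "4 \<Rightarrow> 4 \<Rightarrow> 'k"
  assumes sb: slope_bounds and anti: "\<And>i j. z i j = - z j i" and row: "\<And>i. (\<Sum>j\<in>UNIV. z i j) = 0"
    and nz: "z p q \<noteq> 0"
    and bd: "\<And>i j k l m o'. z i j \<noteq> 0 \<Longrightarrow> z k l \<noteq> 0 \<Longrightarrow> z m o' \<noteq> 0 \<Longrightarrow>
      int (xe i + xe j + (ye k + ye l) + (ze m + ze o')) \<le> d"
  shows "2 * total \<le> 3 * d"
proof -
  have diag: "z i i = 0" for i
  proof -
    have "z i i + z i i = 0" using anti[of i i] by (metis add.right_inverse)
    then show ?thesis by (simp flip: mult_2)
  qed
  have r: "z 1 2 + z 1 3 + z 1 4 = 0" "- z 1 2 + z 2 3 + z 2 4 = 0" "- z 1 3 - z 2 3 + z 3 4 = 0" "- z 1 4 - z 2 4 - z 3 4 = 0"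
    using row[of 1] row[of 2] row[of 3] row[of 4] diag anti[of 2 1] anti[of 3 1] anti[of 3 2] anti[of 4 1] anti[of 4 2] anti[of 4 3]
    by (simp_all add: sum_4)
  note B = bd[of _ _ _ _ _ _, unfolded ex_defs]
  have sb': "3 * int a \<le> total" "3 * int b \<le> total" "3 * int c \<le> total" "3 * int (\<alpha> + \<beta> + \<gamma>) \<le> total"
    using sb by (auto simp: slope_bounds_def)
  consider "z 1 4 = 0" "z 2 4 = 0" "z 3 4 = 0" | "z 1 4 \<noteq> 0" "z 2 4 \<noteq> 0" "z 3 4 \<noteq> 0"
    | "z 1 4 = 0" "z 2 4 \<noteq> 0" "z 3 4 \<noteq> 0" | "z 1 4 \<noteq> 0" "z 2 4 = 0" "z 3 4 \<noteq> 0" | "z 1 4 \<noteq> 0" "z 2 4 \<noteq> 0" "z 3 4 = 0"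
    using r(4) by (cases "z 1 4 = 0"; cases "z 2 4 = 0"; cases "z 3 4 = 0") auto
  then show ?thesis
  proof cases
    case 1
    have "z 1 2 \<noteq> 0"
    proof
      assume z12: "z 1 2 = 0"
      then have "z 1 3 = 0" "z 2 3 = 0" using r 1 by auto
      then have "z i j = 0" for i j
        using exhaust_4[of i] exhaust_4[of j] z12 1 diag anti[of 2 1] anti[of 3 1] anti[of 3 2] anti[of 4 1] anti[of 4 2] anti[of 4 3]
        by (elim disjE) simp_all
      then show False using nz by simp
    qed
    moreover have "z 1 3 \<noteq> 0" using r(1) 1 \<open>z 1 2 \<noteq> 0\<close> by auto
    ultimately have "int (a + b + c) \<le> d" using B[of 1 2 1 2 1 3] by simp
    then show ?thesis using sb' unfolding of_nat_add distrib_left by linarith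
  next
    case 2
    then have "int (a + \<alpha> + (b + \<beta>) + (c + \<gamma>)) \<le> d" using B[of 1 4 2 4 3 4] by simp
    then show ?thesis using bounds unfolding of_nat_add distrib_left by linarith
  next
    case 3
    show ?thesis
    proof (cases "z 1 2 = 0")
      case True
      then have "int (\<alpha> + (b + \<beta>) + (c + \<gamma>)) \<le> d" using 3 B[of 2 4 2 4 3 4] by simp
      then show ?thesis using sb' unfolding of_nat_add distrib_left by linarith
    next
      case False
      then have "int (a + (b + \<beta>) + (c + \<gamma>)) \<le> d" using 3 B[of 1 2 2 4 3 4] by simp
      then show ?thesis using sb' bounds unfolding of_nat_add distrib_left by linarith
    qed
  next
    case 4
    show ?thesis
    proof (cases "z 1 2 = 0")
      case True
      then have "int (a + \<alpha> + \<beta> + (c + \<gamma>)) \<le> d" using 4 B[of 1 4 1 4 3 4] by simp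
      then show ?thesis using sb' unfolding of_nat_add distrib_left by linarith
    next
      case False
      then have "int (a + \<alpha> + b + (c + \<gamma>)) \<le> d" using 4 B[of 1 4 1 2 3 4] by simp
      then show ?thesis using sb' bounds unfolding of_nat_add distrib_left by linarith
    qed
  next
    case 5
    show ?thesis
    proof (cases "z 1 3 = 0")
      case True
      then have "int (a + \<alpha> + (b + \<beta>) + \<gamma>) \<le> d" using 5 B[of 1 4 2 4 1 4] by simp
      then show ?thesis using sb' unfolding of_nat_add distrib_left by linarith
    next
      case False
      then have "int (a + \<alpha> + (b + \<beta>) + c) \<le> d" using 5 B[of 1 4 2 4 1 3] by simp
      then show ?thesis using sb' bounds unfolding of_nat_add distrib_left by linarith
    qed
  qed
qed

text \<open>If the second gap is at least two, the connection preserves the plane spanned by the first two basis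
  elements.  Its Pluecker coordinates, multiplied by the forms, satisfy one differential equation of first
  order and are therefore constant multiples of one polynomial.\<close>

lemma second_gap:
  assumes gb: "graded_basis n \<delta>" and sb: slope_bounds
  shows "\<delta> 2 \<le> \<delta> 1 + 1"
proof (rule ccontr)
  assume gap: "\<not> \<delta> 2 \<le> \<delta> 1 + 1"
  have ord: "\<delta> 0 \<le> \<delta> 1" "int (\<delta> 0 + \<delta> 1 + \<delta> 2) = total" using gb by (auto simp: graded_basis_def)
  \<comment> \<open>In degree \<open>\<delta> 1 + 1\<close> the third basis element is not available.\<close>
  have stab: "\<exists>x0 x1. conn (int (\<delta> j)) (n j) = x0 *s n 0 + x1 *s n 1" if "j < 2" for j
  proof -
    have nj: "n j \<in> E (int (\<delta> j))" by (rule basis_mem[OF gb]) (use that in simp)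
    obtain x where x: "conn (int (\<delta> j)) (n j) = comb n x" "\<forall>l<3. int (\<delta> j) + 1 < int (\<delta> l) \<longrightarrow> x l = 0"
      using comb_gap[OF gb conn_E[OF nj]] by blast
    have "\<delta> j \<le> \<delta> 1" using that ord by (cases j) auto
    then have "x 2 = 0" using x(2) gap by auto
    then show ?thesis using x(1) by (auto simp: comb_def)
  qed
  obtain k00 k01 where k0: "conn (int (\<delta> 0)) (n 0) = k00 *s n 0 + k01 *s n 1" using stab[of 0] by auto
  obtain k10 k11 where k1: "conn (int (\<delta> 1)) (n 1) = k10 *s n 0 + k11 *s n 1" using stab[of 1] by auto
  have n0: "n 0 \<in> E (int (\<delta> 0))" and n1: "n 1 \<in> E (int (\<delta> 1))" using basis_mem[OF gb] by simp_all
  define u where "u i = n 0 $ i * fh i" for i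
  define v where "v i = n 1 $ i * fh i" for i
  define mi where "mi i j = n 0 $ i * n 1 $ j - n 0 $ j * n 1 $ i" for i j
  define P where "P i j = u i * v j - u j * v i" for i j
  have P_mi: "P i j = mi i j * (fh i * fh j)" for i j by (simp add: P_def mi_def u_def v_def algebra_simps)
  have du: "tX * uX * pderiv (u i) = (k00 + of_int (int (\<delta> 0)) * tX) * u i + k01 * v i" for i
    using der_conn[of "int (\<delta> 0)" "n 0" i] unfolding k0 der_def
    by (simp add: algebra_simps u_def v_def del: mult_pCons_left mult_pCons_right)
  have dv: "tX * uX * pderiv (v i) = k10 * u i + (k11 + of_int (int (\<delta> 1)) * tX) * v i" for i
    using der_conn[of "int (\<delta> 1)" "n 1" i] unfolding k1 der_def
    by (simp add: algebra_simps u_def v_def del: mult_pCons_left mult_pCons_right)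
  \<comment> \<open>By Liouville's formula the minors satisfy an equation that involves only the trace.\<close>
  have dP: "tX * uX * pderiv (P i j) = (k00 + k11 + of_int (int (\<delta> 0)) * tX + of_int (int (\<delta> 1)) * tX) * P i j" for i j
  proof -
    have "tX * uX * pderiv (P i j) = (tX * uX * pderiv (u i)) * v j + u i * (tX * uX * pderiv (v j))
        - (tX * uX * pderiv (u j)) * v i - u j * (tX * uX * pderiv (v i))"
      by (simp add: P_def pderiv_diff pderiv_mult algebra_simps del: mult_pCons_left mult_pCons_right)
    then show ?thesis unfolding du dv
      by (simp add: P_def algebra_simps del: mult_pCons_left mult_pCons_right)
  qed
  have w: "pderiv (P i j) * P k l = P i j * pderiv (P k l)" for i j k l
  proof -
    have "(tX * uX) * (pderiv (P i j) * P k l) = (tX * uX * pderiv (P i j)) * P k l" by (simp only: mult.assoc)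
    also have "\<dots> = P i j * (tX * uX * pderiv (P k l))" unfolding dP by (simp only: mult_ac)
    also have "\<dots> = (tX * uX) * (P i j * pderiv (P k l))" by (simp only: mult_ac)
    finally show ?thesis by (subst (asm) mult_cancel_left) auto
  qed
  obtain p where p: "n 0 $ p \<noteq> 0" using basis_nonzero[OF gb] by (auto simp: vec_eq_iff)
  have "\<exists>q. mi p q \<noteq> 0"
  proof (rule ccontr)
    assume "\<nexists>q. mi p q \<noteq> 0"
    then have "comb n (\<lambda>j. if j = 0 then n 1 $ p else if j = 1 then - (n 0 $ p) else 0) = 0"
      by (simp add: comb_def vec_eq_iff mi_def algebra_simps)
    from comb_zero[OF gb this, of 1] show False using p by simp
  qed
  then obtain q where "mi p q \<noteq> 0" by blast
  then have P0: "P p q \<noteq> 0" by (simp add: P_mi)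
  let ?P = "P p q"
  obtain z where z: "\<And>i j. P i j = [:z i j:] * ?P" using proportional_of_wronskian[OF w P0] by metis
  have su: "(\<Sum>i\<in>UNIV. u i) = 0" "(\<Sum>i\<in>UNIV. v i) = 0" using n0 n1 by (simp_all add: E_def u_def v_def)
  have supp: "tX ^ (xe i + xe j) dvd ?P \<and> uX ^ (ze i + ze j) dvd ?P \<and> degree ?P + (ye i + ye j) \<le> \<delta> 0 + \<delta> 1"
    if "z i j \<noteq> 0" for i j
  proof (intro conjI)
    have "[:z i j:] * ?P = P i j" by (rule z[symmetric])
    also have "\<dots> = mi i j * (tX ^ (xe i + xe j) * uX ^ (ze i + ze j))"
      unfolding P_mi by (simp add: fh_def power_add mult_ac del: mult_pCons_left mult_pCons_right)
    finally have e: "[:z i j:] * ?P = mi i j * (tX ^ (xe i + xe j) * uX ^ (ze i + ze j))" .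
    show "tX ^ (xe i + xe j) dvd ?P"
      by (rule dvd_const_mult[OF that]) (unfold e, intro dvd_mult dvd_mult2 dvd_refl)
    show "uX ^ (ze i + ze j) dvd ?P"
      by (rule dvd_const_mult[OF that]) (unfold e, intro dvd_mult dvd_refl)
    have m0: "mi i j \<noteq> 0" using e that P0 by auto
    have "degree ?P = degree (P i j)" using z[of i j] that by simp
    also have "\<dots> = degree (mi i j) + (xe i + ze i + (xe j + ze j))"
      unfolding P_mi using m0 by (simp add: degree_mult_eq degree_fh)
    finally have dP: "degree ?P = degree (mi i j) + (xe i + ze i + (xe j + ze j))" .
    have "dle (mi i j) (int (\<delta> 0) + int (\<delta> 1) - dd i - dd j)"
      unfolding mi_def
      by (intro dle_diff dle_mult'[OF E_dle[OF n0] E_dle[OF n1]]) simp_all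
    then show "degree ?P + (ye i + ye j) \<le> \<delta> 0 + \<delta> 1"
      using m0 dP by (auto simp: dle_def dd_def)
  qed
  have "2 * total \<le> 3 * (int (\<delta> 0) + int (\<delta> 1))"
  proof (rule second_gap_cases[OF sb, of z p q])
    show "z i j = - z j i" for i j
    proof -
      have "[:z i j:] * ?P = - ([:z j i:] * ?P)" unfolding z[symmetric] by (simp add: P_def)
      then have "([:z i j:] + [:z j i:]) * ?P = 0" by (simp only: distrib_right) simp
      then have "[:z i j:] + [:z j i:] = 0" using P0 by (metis mult_eq_0_iff)
      then show ?thesis by (simp add: eq_neg_iff_add_eq_0)
    qed
    show "(\<Sum>j\<in>UNIV. z i j) = 0" for i
    proof -
      have "(\<Sum>j\<in>UNIV. P i j) = u i * (\<Sum>j\<in>UNIV. v j) - (\<Sum>j\<in>UNIV. u j) * v i"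
        by (simp add: P_def sum_subtractf sum_distrib_left sum_distrib_right)
      then have "(\<Sum>j\<in>UNIV. [:z i j:]) * ?P = 0" unfolding su by (simp only: sum_distrib_right z[symmetric] mult_zero_left mult_zero_right diff_self)
      then have "(\<Sum>j\<in>UNIV. [:z i j:]) = 0" using P0 by simp
      then show ?thesis by (simp add: sum_4)
    qed
    show "z p q \<noteq> 0" using z[of p q] P0 by auto
    fix i j k l m o' assume nz: "z i j \<noteq> 0" "z k l \<noteq> 0" "z m o' \<noteq> 0"
    have "xe i + xe j + (ze m + ze o') \<le> degree ?P"
      using degree_ge_of_two_powers[OF P0] supp[OF nz(1)] supp[OF nz(3)] by blast
    then show "int (xe i + xe j + (ye k + ye l) + (ze m + ze o')) \<le> int (\<delta> 0) + int (\<delta> 1)"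
      using supp[OF nz(2)] by linarith
  qed
  then show False using gap ord unfolding of_nat_add distrib_left by linarith
qed

text \<open>Three integers with a given sum and without gaps larger than one are determined, except that a sum
  divisible by three leaves two possibilities.\<close>

theorem basis_degrees:
  assumes gb: "graded_basis n \<delta>" and sb: slope_bounds
  shows "total = 3 * k + 1 \<Longrightarrow> int (\<delta> 0) = k \<and> int (\<delta> 1) = k \<and> int (\<delta> 2) = k + 1"
    and "total = 3 * k + 2 \<Longrightarrow> int (\<delta> 0) = k \<and> int (\<delta> 1) = k + 1 \<and> int (\<delta> 2) = k + 1"
    and "total = 3 * k \<Longrightarrow> int (\<delta> 0) = k \<and> int (\<delta> 1) = k \<and> int (\<delta> 2) = k \<or>
      int (\<delta> 0) = k - 1 \<and> int (\<delta> 1) = k \<and> int (\<delta> 2) = k + 1"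
proof -
  have *: "\<delta> 0 \<le> \<delta> 1" "\<delta> 1 \<le> \<delta> 2" "int (\<delta> 0 + \<delta> 1 + \<delta> 2) = total" using gb by (auto simp: graded_basis_def)
  note g = first_gap[OF assms] second_gap[OF assms]
  have arith: "(t = 3 * k + 1 \<longrightarrow> x = k \<and> y = k \<and> z = k + 1) \<and> (t = 3 * k + 2 \<longrightarrow> x = k \<and> y = k + 1 \<and> z = k + 1) \<and>
      (t = 3 * k \<longrightarrow> x = k \<and> y = k \<and> z = k \<or> x = k - 1 \<and> y = k \<and> z = k + 1)"
    if "x \<le> y" "y \<le> z" "y \<le> x + 1" "z \<le> y + 1" and t: "x + y + z = t" for x y z t :: int
  proof -
    have y: "y = x \<or> y = x + 1" and z: "z = y \<or> z = y + 1" using that by linarith+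
    from y show ?thesis
    proof
      assume "y = x"
      from z show ?thesis by (rule disjE) (use t \<open>y = x\<close> in presburger)+
    next
      assume "y = x + 1"
      from z show ?thesis by (rule disjE) (use t \<open>y = x + 1\<close> in presburger)+
    qed
  qed
  have "int (\<delta> 0) + int (\<delta> 1) + int (\<delta> 2) = total" using *(3) by simp
  note r = arith[of "int (\<delta> 0)" "int (\<delta> 1)" "int (\<delta> 2)", OF _ _ _ _ this]
  show "total = 3 * k + 1 \<Longrightarrow> int (\<delta> 0) = k \<and> int (\<delta> 1) = k \<and> int (\<delta> 2) = k + 1"
    "total = 3 * k + 2 \<Longrightarrow> int (\<delta> 0) = k \<and> int (\<delta> 1) = k + 1 \<and> int (\<delta> 2) = k + 1"
    "total = 3 * k \<Longrightarrow> int (\<delta> 0) = k \<and> int (\<delta> 1) = k \<and> int (\<delta> 2) = k \<or>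
      int (\<delta> 0) = k - 1 \<and> int (\<delta> 1) = k \<and> int (\<delta> 2) = k + 1"
    using r *(1,2) g by auto
qed

end

section \<open>Restriction of forms to a line\<close>

definition part :: "((3 \<Rightarrow>\<^sub>0 nat) \<Rightarrow> bool) \<Rightarrow> 'k::comm_ring_1 poly3 \<Rightarrow> 'k poly3"
  where "part Q g = (\<Sum>m | m \<in> Poly_Mapping.keys g \<and> Q m. Poly_Mapping.single m (Poly_Mapping.lookup g m))"

lemma lookup_part: "Poly_Mapping.lookup (part Q g) m = (if Q m then Poly_Mapping.lookup g m else 0)"
  unfolding part_def by (auto simp: lookup_sum lookup_single when_def in_keys_iff)

lemma keys_part: "Poly_Mapping.keys (part Q g) = {m \<in> Poly_Mapping.keys g. Q m}"
  by (auto simp: in_keys_iff lookup_part split: if_splits)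

lemma part_forms: "g \<in> forms e \<Longrightarrow> part Q g \<in> forms e"
  by (auto simp: forms_def keys_part)

definition subst :: "(3 \<Rightarrow> 'k::comm_ring_1 poly) \<Rightarrow> 'k poly3 \<Rightarrow> 'k poly"
  where "subst P g = (\<Sum>m\<in>Poly_Mapping.keys g. [:Poly_Mapping.lookup g m:] * (\<Prod>i\<in>UNIV. P i ^ Poly_Mapping.lookup m i))"

lemma subst_superset:
  assumes "finite A" "Poly_Mapping.keys g \<subseteq> A"
  shows "subst P g = (\<Sum>m\<in>A. [:Poly_Mapping.lookup g m:] * (\<Prod>i\<in>UNIV. P i ^ Poly_Mapping.lookup m i))"
  unfolding subst_def by (rule sum.mono_neutral_left) (use assms in \<open>auto simp: in_keys_iff\<close>)

lemma subst_add: "subst P (g + h) = subst P g + subst P h"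
proof -
  let ?A = "Poly_Mapping.keys g \<union> Poly_Mapping.keys h"
  have "subst P (g + h) = (\<Sum>m\<in>?A. [:Poly_Mapping.lookup (g + h) m:] * (\<Prod>i\<in>UNIV. P i ^ Poly_Mapping.lookup m i))"
    by (rule subst_superset) (use Poly_Mapping.keys_add[of g h] in auto)
  also have "\<dots> = (\<Sum>m\<in>?A. [:Poly_Mapping.lookup g m:] * (\<Prod>i\<in>UNIV. P i ^ Poly_Mapping.lookup m i)
      + [:Poly_Mapping.lookup h m:] * (\<Prod>i\<in>UNIV. P i ^ Poly_Mapping.lookup m i))"
    by (rule sum.cong) (simp_all add: lookup_add smult_add_left)
  also have "\<dots> = subst P g + subst P h"
    unfolding sum.distrib by (subst (1 2) subst_superset[of ?A]) auto
  finally show ?thesis .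
qed

lemma subst_zero [simp]: "subst P 0 = 0"
  by (simp add: subst_def)

lemma subst_uminus: "subst P (- g) = - subst P g"
  using subst_add[of P g "- g"] by (simp add: eq_neg_iff_add_eq_0 add.commute)

lemma subst_diff: "subst P (g - h) = subst P g - subst P h"
  using subst_add[of P g "- h"] by (simp add: subst_uminus)

lemma subst_sum: "subst P (sum g A) = (\<Sum>i\<in>A. subst P (g i))"
  by (induction A rule: infinite_finite_induct) (auto simp: subst_add)

lemma subst_single: "subst P (Poly_Mapping.single m x) = [:x:] * (\<Prod>i\<in>UNIV. P i ^ Poly_Mapping.lookup m i)"
  by (subst subst_superset[of "{m}"]) auto

lemma subst_mult: "subst P (g * h) = subst P g * subst P h"
proof -
  have s: "subst P (Poly_Mapping.single m x * Poly_Mapping.single n y) =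
      subst P (Poly_Mapping.single m x) * subst P (Poly_Mapping.single n y)" for m n x y
    unfolding mult_single subst_single lookup_add power_add prod.distrib
    by (simp add: mult_ac)
  have "subst P (g * h) = subst P ((\<Sum>m\<in>Poly_Mapping.keys g. Poly_Mapping.single m (Poly_Mapping.lookup g m)) * (\<Sum>n\<in>Poly_Mapping.keys h. Poly_Mapping.single n (Poly_Mapping.lookup h n)))"
    by (simp only: sum_monomials)
  also have "\<dots> = subst P (\<Sum>m\<in>Poly_Mapping.keys g. Poly_Mapping.single m (Poly_Mapping.lookup g m)) * subst P (\<Sum>n\<in>Poly_Mapping.keys h. Poly_Mapping.single n (Poly_Mapping.lookup h n))"
    unfolding sum_product subst_sum s by simp
  finally show ?thesis by (simp only: sum_monomials)
qed

lemma UNIV_3': "(UNIV :: 3 set) = {0, 1, 2}"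
proof -
  have "(3 :: 3) = 0" by simp
  then show ?thesis using UNIV_3 by auto
qed

lemma prod_3: "(\<Prod>i\<in>(UNIV :: 3 set). g i) = g 0 * g 1 * (g 2 :: 'a::comm_monoid_mult)"
  unfolding UNIV_3' by (simp add: mult.assoc)

lemma sum_3': "(\<Sum>i\<in>(UNIV :: 3 set). g i) = g 0 + g 1 + (g 2 :: 'a::comm_monoid_add)"
  unfolding UNIV_3' by (simp add: add.assoc)

lemma exhaust_3': "(i :: 3) = 0 \<or> i = 1 \<or> i = 2"
  using UNIV_3' by auto

lemma Const_mult_single: "Const x * Poly_Mapping.single m y = Poly_Mapping.single m (x * y)"
  by (simp add: Const_def mult_single)

lemma linear_form_eq: "linear_form cf = Const (cf 0) * Var 0 + Const (cf 1) * Var 1 + Const (cf 2) * Var 2"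
  by (simp add: linear_form_def sum_3')

lemma linear_form_forms: "linear_form cf \<in> forms 1"
  unfolding linear_form_def
proof (rule forms_sum)
  show "Const (cf i) * Var i \<in> forms 1" for i
    using forms_mult[OF Const_forms Var_forms, of "cf i" i] by simp
qed

lemma lookup_linear_form: "Poly_Mapping.lookup (linear_form cf) (Poly_Mapping.single i 1) = cf i"
proof -
  have s: "Poly_Mapping.single j (1 :: nat) = Poly_Mapping.single i 1 \<longleftrightarrow> j = i" for j :: 3
    by (metis lookup_single_eq lookup_single_not_eq zero_neq_one)
  show ?thesis
    by (simp add: linear_form_def lookup_sum Var_def Const_mult_single lookup_single when_def s[simplified])
qed

text \<open>The line \<open>c\<^sub>0 x + c\<^sub>1 y + c\<^sub>2 z = 0\<close> is parametrized so that the three coordinates restrict to multiples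
  of \<open>t\<close>, \<open>1\<close> and \<open>1 + t\<close>; this removes the coefficients of the line from the problem.\<close>

locale general_line =
  fixes cf :: "3 \<Rightarrow> 'k::field"
  assumes cf_nonzero: "cf i \<noteq> 0"
begin

abbreviation ell :: "'k poly3" where "ell \<equiv> linear_form cf"

definition par :: "3 \<Rightarrow> 'k poly"
  where "par i = (if i = 0 then [:0, 1 / cf 0:] else if i = 1 then [:1 / cf 1:] else [:- 1 / cf 2, - 1 / cf 2:])"

definition \<rho> :: "'k poly3 \<Rightarrow> 'k poly" where "\<rho> = subst par"

lemmas \<rho>_add = subst_add[of par, folded \<rho>_def]
lemmas \<rho>_diff = subst_diff[of par, folded \<rho>_def]
lemmas \<rho>_mult = subst_mult[of par, folded \<rho>_def]
lemmas \<rho>_sum = subst_sum[of par, folded \<rho>_def]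

lemma \<rho>_zero [simp]: "\<rho> 0 = 0" by (simp add: \<rho>_def)

lemma \<rho>_single: "\<rho> (Poly_Mapping.single m x) = [:x:] * (par 0 ^ Poly_Mapping.lookup m 0 * par 1 ^ Poly_Mapping.lookup m 1 * par 2 ^ Poly_Mapping.lookup m 2)"
  by (simp add: \<rho>_def subst_single prod_3)

lemma \<rho>_Var: "\<rho> (Var i) = par i"
  using exhaust_3'[of i] by (auto simp: Var_def \<rho>_single lookup_single)

lemma \<rho>_Const: "\<rho> (Const x) = [:x:]"
  by (simp add: Const_def \<rho>_single)

lemma \<rho>_ell: "\<rho> ell = 0"
  using cf_nonzero by (simp add: linear_form_eq \<rho>_add \<rho>_mult \<rho>_Var \<rho>_Const par_def)

lemma ell_nonzero: "ell \<noteq> 0"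
  using lookup_linear_form[of cf 0] cf_nonzero[of 0] by auto

lemma \<rho>_dle: assumes "g \<in> forms e" shows "dle (\<rho> g) e"
  unfolding \<rho>_def subst_def
proof (rule dle_sum)
  fix m assume m: "m \<in> Poly_Mapping.keys g"
  have p: "dle (par i ^ n) (int n)" for i n
  proof (induction n)
    case (Suc n)
    have "dle (par i) 1" using exhaust_3'[of i] by (auto simp: par_def dle_def)
    from dle_mult[OF this Suc] show ?case by simp
  qed (simp add: dle_def)
  have "dle ([:Poly_Mapping.lookup g m:] * (par 0 ^ Poly_Mapping.lookup m 0 * par 1 ^ Poly_Mapping.lookup m 1 * par 2 ^ Poly_Mapping.lookup m 2))
      (0 + (int (Poly_Mapping.lookup m 0) + int (Poly_Mapping.lookup m 1) + int (Poly_Mapping.lookup m 2)))"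
    by (intro dle_mult p dle_const) simp
  moreover have "int (Poly_Mapping.lookup m 0) + int (Poly_Mapping.lookup m 1) + int (Poly_Mapping.lookup m 2) = e"
    using assms m by (auto simp: forms_def mdeg_def sum_3')
  ultimately show "dle ([:Poly_Mapping.lookup g m:] * (\<Prod>i\<in>UNIV. par i ^ Poly_Mapping.lookup m i)) e" by (simp add: prod_3)
qed

definition bexp :: "nat \<Rightarrow> nat \<Rightarrow> 3 \<Rightarrow>\<^sub>0 nat"
  where "bexp i j = Poly_Mapping.single 0 i + Poly_Mapping.single 1 j"

lemma lookup_bexp [simp]: "Poly_Mapping.lookup (bexp i j) 0 = i" "Poly_Mapping.lookup (bexp i j) 1 = j" "Poly_Mapping.lookup (bexp i j) 2 = 0"
  by (simp_all add: bexp_def lookup_add lookup_single)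

lemma \<rho>_bexp: "\<rho> (Poly_Mapping.single (bexp i j) x) = Polynomial.monom (x / (cf 0 ^ i * cf 1 ^ j)) i"
proof -
  have "par 0 = Polynomial.smult (1 / cf 0) [:0, 1:]" by (simp add: par_def)
  then have "par 0 ^ i = Polynomial.monom ((1 / cf 0) ^ i) i"
    by (simp only: monom_altdef smult_power)
  moreover have "par 1 ^ j = [:(1 / cf 1) ^ j:]" by (simp add: par_def poly_const_pow)
  ultimately show ?thesis
    by (simp add: \<rho>_single smult_monom power_divide mult.commute)
qed

lemma \<rho>_surj: assumes "dle p e" shows "\<exists>g\<in>forms e. \<rho> g = p"
proof (cases "e < 0")
  case True
  then show ?thesis using dle_neg[OF assms] by (intro bexI[of _ 0]) auto
next
  case False
  let ?n = "nat e"
  let ?g = "\<Sum>i\<le>?n. Poly_Mapping.single (bexp i (?n - i)) (poly.coeff p i * (cf 0 ^ i * cf 1 ^ (?n - i)))"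
  have "?g \<in> forms e"
    by (rule forms_sum) (use False in \<open>auto simp: forms_def mdeg_def sum_3'\<close>)
  moreover have "\<rho> ?g = (\<Sum>i\<le>?n. Polynomial.monom (poly.coeff p i) i)"
    unfolding \<rho>_sum \<rho>_bexp using cf_nonzero by simp
  moreover have "\<dots> = p"
  proof (rule poly_eqI)
    fix j
    show "poly.coeff (\<Sum>i\<le>?n. Polynomial.monom (poly.coeff p i) i) j = poly.coeff p j"
      using assms by (auto simp: coeff_sum dle_iff_coeff)
  qed
  ultimately have "?g \<in> forms e \<and> \<rho> ?g = p" by (simp only: simp_thms)
  then show ?thesis by (intro bexI[of _ ?g]) simp_all
qed

text \<open>Modulo the linear form the third variable is a combination of the other two.\<close>

lemma reduce_monomial:
  assumes "int (mdeg m) = e"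
  shows "\<exists>h\<in>forms (e - 1). \<exists>b\<in>forms e. (\<forall>m'\<in>Poly_Mapping.keys b. Poly_Mapping.lookup m' 2 = 0) \<and> Poly_Mapping.single m x = h * ell + b"
  using assms
proof (induction "Poly_Mapping.lookup m 2" arbitrary: m x)
  case 0
  then show ?case by (intro bexI[of _ 0] bexI[of _ "Poly_Mapping.single m x"]) (auto simp: forms_def)
next
  case (Suc k)
  define m' where "m' = m - Poly_Mapping.single 2 1"
  have m: "m = m' + Poly_Mapping.single 2 1"
    unfolding m'_def by (rule exponent_diff_add[symmetric]) (use Suc.hyps(2) in \<open>auto simp: lookup_single when_def\<close>)
  have d: "int (mdeg m') = e - 1" using Suc.prems unfolding m mdeg_add by (simp add: mdeg_def lookup_single when_def)
  let ?s = "Poly_Mapping.single m' (x / cf 2)"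
  have s: "?s \<in> forms (e - 1)" using d by (auto simp: forms_def)
  have two: "Poly_Mapping.lookup m' 2 = k" using Suc.hyps(2) by (simp add: m'_def lookup_minus)
  have deg: "int (mdeg (m' + Poly_Mapping.single i 1)) = e" for i
    using d by (simp add: mdeg_add) (simp add: mdeg_def lookup_single when_def)
  have red: "\<exists>h\<in>forms (e - 1). \<exists>b\<in>forms e. (\<forall>m'\<in>Poly_Mapping.keys b. Poly_Mapping.lookup m' 2 = 0) \<and>
      Poly_Mapping.single (m' + Poly_Mapping.single i 1) y = h * ell + b" if "i \<noteq> 2" for i y
    by (rule Suc.hyps(1)[OF _ deg]) (use two that in \<open>simp add: lookup_add lookup_single\<close>)
  obtain h0 b0 where 0: "h0 \<in> forms (e - 1)" "b0 \<in> forms e" "\<forall>m'\<in>Poly_Mapping.keys b0. Poly_Mapping.lookup m' 2 = 0"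
    "Poly_Mapping.single (m' + Poly_Mapping.single 0 1) (x / cf 2 * cf 0) = h0 * ell + b0"
    using red[of 0 "x / cf 2 * cf 0"] by auto
  obtain h1 b1 where 1: "h1 \<in> forms (e - 1)" "b1 \<in> forms e" "\<forall>m'\<in>Poly_Mapping.keys b1. Poly_Mapping.lookup m' 2 = 0"
    "Poly_Mapping.single (m' + Poly_Mapping.single 1 1) (x / cf 2 * cf 1) = h1 * ell + b1"
    using red[of 1 "x / cf 2 * cf 1"] by auto
  have "?s * ell = Poly_Mapping.single (m' + Poly_Mapping.single 0 1) (x / cf 2 * cf 0)
      + Poly_Mapping.single (m' + Poly_Mapping.single 1 1) (x / cf 2 * cf 1) + Poly_Mapping.single m x"
    unfolding linear_form_eq distrib_left Var_def Const_mult_single mult_single m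
    using cf_nonzero[of 2] by simp
  then have "Poly_Mapping.single m x = ?s * ell - (h0 * ell + b0) - (h1 * ell + b1)"
    unfolding 0(4)[symmetric] 1(4)[symmetric] by simp
  then have "Poly_Mapping.single m x = (?s - h0 - h1) * ell + (- b0 - b1)" by (simp add: algebra_simps)
  moreover have "\<forall>m'\<in>Poly_Mapping.keys (- b0 - b1). Poly_Mapping.lookup m' 2 = 0"
    using 0(3) 1(3) by (auto simp: in_keys_iff lookup_minus)
  moreover have "?s - h0 - h1 \<in> forms (e - 1)" "- b0 - b1 \<in> forms e"
    using 0(1,2) 1(1,2) s by (auto intro: forms_diff forms_uminus)
  ultimately show ?case by blast
qed

text \<open>On forms in the first two variables the parametrization is injective: distinct monomials of one degree go
  to multiples of distinct powers of \<open>t\<close>.\<close>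

lemma binary_\<rho>_inj:
  assumes b: "b \<in> forms e" "\<forall>m\<in>Poly_Mapping.keys b. Poly_Mapping.lookup m 2 = 0" and 0: "\<rho> b = 0"
  shows "b = 0"
proof (rule ccontr)
  assume "b \<noteq> 0"
  then obtain m where m: "m \<in> Poly_Mapping.keys b" by (metis keys_eq_empty ex_in_conv)
  have eq: "bexp (Poly_Mapping.lookup n 0) (Poly_Mapping.lookup n 1) = n" if "n \<in> Poly_Mapping.keys b" for n
  proof (rule poly_mapping_eqI)
    show "Poly_Mapping.lookup (bexp (Poly_Mapping.lookup n 0) (Poly_Mapping.lookup n 1)) i = Poly_Mapping.lookup n i" for i
      using exhaust_3'[of i] b(2) that by auto
  qed
  have deg: "int (Poly_Mapping.lookup n 0 + Poly_Mapping.lookup n 1) = e" if "n \<in> Poly_Mapping.keys b" for n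
    using b that by (auto simp: forms_def mdeg_def sum_3')
  let ?w = "\<lambda>n. Poly_Mapping.lookup b n / (cf 0 ^ Poly_Mapping.lookup n 0 * cf 1 ^ Poly_Mapping.lookup n 1)"
  have "\<rho> b = (\<Sum>n\<in>Poly_Mapping.keys b. \<rho> (Poly_Mapping.single n (Poly_Mapping.lookup b n)))"
    unfolding \<rho>_sum[symmetric] sum_monomials ..
  also have "\<dots> = (\<Sum>n\<in>Poly_Mapping.keys b. Polynomial.monom (?w n) (Poly_Mapping.lookup n 0))"
    by (rule sum.cong[OF refl]) (metis eq \<rho>_bexp)
  finally have "poly.coeff (\<rho> b) (Poly_Mapping.lookup m 0) = (\<Sum>n\<in>Poly_Mapping.keys b. if Poly_Mapping.lookup n 0 = Poly_Mapping.lookup m 0 then ?w n else 0)"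
    by (simp add: coeff_sum)
  also have "\<dots> = (\<Sum>n\<in>Poly_Mapping.keys b. if n = m then ?w n else 0)"
  proof (rule sum.cong)
    fix n assume n: "n \<in> Poly_Mapping.keys b"
    have "Poly_Mapping.lookup n 0 = Poly_Mapping.lookup m 0 \<longleftrightarrow> n = m"
    proof
      assume *: "Poly_Mapping.lookup n 0 = Poly_Mapping.lookup m 0"
      then have "Poly_Mapping.lookup n 1 = Poly_Mapping.lookup m 1" using deg[OF n] deg[OF m] by simp
      with * have "bexp (Poly_Mapping.lookup n 0) (Poly_Mapping.lookup n 1) =
          bexp (Poly_Mapping.lookup m 0) (Poly_Mapping.lookup m 1)" by (simp only:)
      then show "n = m" unfolding eq[OF n] eq[OF m] .
    qed simp
    then show "(if Poly_Mapping.lookup n 0 = Poly_Mapping.lookup m 0 then ?w n else 0) = (if n = m then ?w n else 0)" by simp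
  qed simp
  also have "\<dots> = ?w m" using m by simp
  finally have "Poly_Mapping.lookup b m = 0" using 0 cf_nonzero by simp
  then show False using m by (simp add: in_keys_iff)
qed

lemma \<rho>_kernel: assumes g: "g \<in> forms e" and 0: "\<rho> g = 0" shows "\<exists>h\<in>forms (e - 1). g = h * ell"
proof -
  have "\<exists>h\<in>forms (e - 1). \<exists>b\<in>forms e. (\<forall>m'\<in>Poly_Mapping.keys b. Poly_Mapping.lookup m' 2 = 0) \<and>
      (\<Sum>m\<in>A. Poly_Mapping.single m (Poly_Mapping.lookup g m)) = h * ell + b" if "finite A" "A \<subseteq> Poly_Mapping.keys g" for A
    using that
  proof (induction A)
    case empty
    show ?case by (intro bexI[of _ 0]) auto
  next
    case (insert m A)
    obtain h b where 1: "h \<in> forms (e - 1)" "b \<in> forms e" "\<forall>m'\<in>Poly_Mapping.keys b. Poly_Mapping.lookup m' 2 = 0"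
      "(\<Sum>m\<in>A. Poly_Mapping.single m (Poly_Mapping.lookup g m)) = h * ell + b" using insert by blast
    have "int (mdeg m) = e" using insert.prems g by (auto simp: forms_def)
    from reduce_monomial[OF this, of "Poly_Mapping.lookup g m"]
    obtain h' b' where 2: "h' \<in> forms (e - 1)" "b' \<in> forms e" "\<forall>m'\<in>Poly_Mapping.keys b'. Poly_Mapping.lookup m' 2 = 0"
      "Poly_Mapping.single m (Poly_Mapping.lookup g m) = h' * ell + b'" by blast
    have "\<forall>m'\<in>Poly_Mapping.keys (b' + b). Poly_Mapping.lookup m' 2 = 0" using 1(3) 2(3) Poly_Mapping.keys_add[of b' b] by blast
    moreover have "(\<Sum>m\<in>insert m A. Poly_Mapping.single m (Poly_Mapping.lookup g m)) = (h' + h) * ell + (b' + b)"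
      using insert.hyps 1(4) 2(4) by (simp add: algebra_simps)
    moreover have "h' + h \<in> forms (e - 1)" "b' + b \<in> forms e" using 1(1,2) 2(1,2) by (auto intro: forms_add)
    ultimately show ?case by blast
  qed
  from this[OF finite_keys subset_refl] obtain h b where hb: "h \<in> forms (e - 1)" "b \<in> forms e"
    "\<forall>m'\<in>Poly_Mapping.keys b. Poly_Mapping.lookup m' 2 = 0" "g = h * ell + b" unfolding sum_monomials by blast
  have "\<rho> b = 0" using 0 hb(4) by (simp add: \<rho>_add \<rho>_mult \<rho>_ell)
  then have "b = 0" by (rule binary_\<rho>_inj[OF hb(2,3)])
  then show ?thesis using hb by auto
qed

end

section \<open>Reduction of graded modules modulo a linear form\<close>

text \<open>For submodules of a free module, the quotient modulo \<open>l\<close> is handled through representatives.\<close>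

locale vector_module =
  fixes M :: "('k::comm_ring_1 poly3, 'k poly3 ^ 'n) gmodule"
  assumes M_add: "add M = (+)" and M_smult: "smult M = (*s)"
    and Z_zero: "0 \<in> carrier M"
    and Z_add: "v \<in> carrier M \<Longrightarrow> w \<in> carrier M \<Longrightarrow> v + w \<in> carrier M"
    and Z_smult: "v \<in> carrier M \<Longrightarrow> r *s v \<in> carrier M"
    and Z_piece: "v \<in> piece M e \<Longrightarrow> v \<in> carrier M"
    and piece_add: "v \<in> piece M e \<Longrightarrow> w \<in> piece M e \<Longrightarrow> v + w \<in> piece M e"
    and piece_smult: "r \<in> forms d \<Longrightarrow> v \<in> piece M e \<Longrightarrow> r *s v \<in> piece M (d + e)"

locale vector_module_mod = vector_module M for M :: "('k::comm_ring_1 poly3, 'k poly3 ^ 'n) gmodule" +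
  fixes l :: "'k poly3"
begin

abbreviation N :: "('k poly3 ^ 'n) set" where "N \<equiv> (\<lambda>m. l \<odot>\<^bsub>M\<^esub> m) ` carrier M"

definition cs :: "'k poly3 ^ 'n \<Rightarrow> ('k poly3 ^ 'n) set" where "cs v = {l *s z + v |z. z \<in> carrier M}"

lemma coset_eq_cs: "N +>\<^bsub>M\<^esub> v = cs v"
  by (auto simp: a_r_coset_def r_coset_def cs_def M_add M_smult)

lemma Z_diff: "v \<in> carrier M \<Longrightarrow> w \<in> carrier M \<Longrightarrow> v - w \<in> carrier M"
  using Z_add[of v "(- 1) *s w"] Z_smult[of w "- 1"] by (simp add: vector_smult_lneg)

lemma cs_eqI: assumes "z \<in> carrier M" "v - w = l *s z" shows "cs v = cs w"
proof (rule Set.set_eqI)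
  fix x
  have v: "v = l *s z + w" using assms(2) by (simp add: algebra_simps)
  show "x \<in> cs v \<longleftrightarrow> x \<in> cs w"
  proof
    assume "x \<in> cs v"
    then obtain y where "y \<in> carrier M" "x = l *s y + v" by (auto simp: cs_def)
    then show "x \<in> cs w" unfolding cs_def v
      using assms(1) by (intro CollectI exI[of _ "y + z"]) (simp add: Z_add vector_add_ldistrib add.assoc)
  next
    assume "x \<in> cs w"
    then obtain y where "y \<in> carrier M" "x = l *s y + w" by (auto simp: cs_def)
    then show "x \<in> cs v" unfolding cs_def v
      using assms(1) by (intro CollectI exI[of _ "y - z"]) (simp add: Z_diff vector_ssub_ldistrib)
  qed
qed

lemma cs_self: "v \<in> cs v"
  unfolding cs_def by (intro CollectI exI[of _ 0]) (simp add: Z_zero)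

lemma cs_eqD: assumes "cs v = cs w" obtains z where "z \<in> carrier M" "v - w = l *s z"
proof -
  have "v \<in> cs w" using cs_self[of v] assms by simp
  then obtain z where "z \<in> carrier M" "v = l *s z + w" by (auto simp: cs_def)
  then show ?thesis by (intro that[of z]) auto
qed

abbreviation Q :: "('k poly3, ('k poly3 ^ 'n) set) gmodule" where "Q \<equiv> gquot M N"

lemma Q_carrier: "carrier Q = cs ` carrier M"
proof -
  have "carrier Q = {N +>\<^bsub>M\<^esub> v |v. v \<in> carrier M}"
    by (auto simp: gquot_def A_RCOSETS_def RCOSETS_def a_r_coset_def)
  then show ?thesis unfolding coset_eq_cs by auto
qed

lemma Q_piece: "piece Q e = cs ` piece M e"
  by (auto simp: gquot_def coset_eq_cs)

lemma Q_add: assumes "v \<in> carrier M" "w \<in> carrier M" shows "cs v \<oplus>\<^bsub>Q\<^esub> cs w = cs (v + w)"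
proof -
  have "cs v \<oplus>\<^bsub>Q\<^esub> cs w = {x + y |x y. x \<in> cs v \<and> y \<in> cs w}"
    by (auto simp: gquot_def set_add_def set_mult_def M_add)
  also have "\<dots> = cs (v + w)"
  proof (intro subset_antisym subsetI)
    fix u assume "u \<in> {x + y |x y. x \<in> cs v \<and> y \<in> cs w}"
    then obtain x y where xy: "u = x + y" "x \<in> cs v" "y \<in> cs w" by blast
    obtain z where z: "z \<in> carrier M" "x = l *s z + v" using xy(2) by (auto simp: cs_def)
    obtain z' where z': "z' \<in> carrier M" "y = l *s z' + w" using xy(3) by (auto simp: cs_def)
    show "u \<in> cs (v + w)" unfolding cs_def
      by (intro CollectI exI[of _ "z + z'"]) (use z z' xy(1) in \<open>simp add: Z_add vector_add_ldistrib algebra_simps\<close>)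
  next
    fix u assume "u \<in> cs (v + w)"
    then obtain y where y: "y \<in> carrier M" "u = l *s y + (v + w)" by (auto simp: cs_def)
    then have "u = (l *s y + v) + w" "l *s y + v \<in> cs v" by (auto simp: cs_def add.assoc)
    then show "u \<in> {x + y |x y. x \<in> cs v \<and> y \<in> cs w}" using cs_self[of w] by blast
  qed
  finally show ?thesis .
qed

lemma Q_smult: assumes "v \<in> carrier M" shows "r \<odot>\<^bsub>Q\<^esub> cs v = cs (r *s v)"
proof -
  have "r \<odot>\<^bsub>Q\<^esub> cs v = (\<Union>m\<in>cs v. cs (r *s m))"
    by (simp add: gquot_def coset_eq_cs) (simp add: M_smult)
  also have "\<dots> = (\<Union>m\<in>cs v. cs (r *s v))"
  proof (rule SUP_cong[OF refl])
    fix m assume "m \<in> cs v"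
    obtain z where z: "z \<in> carrier M" "m = l *s z + v" using \<open>m \<in> cs v\<close> by (auto simp: cs_def)
    show "cs (r *s m) = cs (r *s v)"
      by (rule cs_eqI[OF Z_smult[OF z(1), of r]])
        (simp add: z(2) vector_add_ldistrib vector_smult_assoc mult.commute)
  qed
  also have "\<dots> = cs (r *s v)" using cs_self[of v] unfolding UN_constant by (metis empty_iff)
  finally show ?thesis .
qed

lemma germ_module_Q: "germ_module Q"
proof
  show "x \<oplus>\<^bsub>Q\<^esub> y \<in> piece Q e" if x: "x \<in> piece Q e" and y: "y \<in> piece Q e" for x y e
  proof -
    obtain v w where "x = cs v" "y = cs w" "v \<in> piece M e" "w \<in> piece M e" using x y unfolding Q_piece by blast
    then show ?thesis using Z_piece by (auto simp: Q_add Q_piece intro!: piece_add)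
  qed
  show "x \<in> carrier Q" if "x \<in> piece Q e" for x e
    using that Z_piece by (auto simp: Q_piece Q_carrier)
  show "r \<odot>\<^bsub>Q\<^esub> x \<in> piece Q (d + e)" if r: "r \<in> forms d" and x: "x \<in> piece Q e" for r x d e
  proof -
    obtain v where "x = cs v" "v \<in> piece M e" using x unfolding Q_piece by blast
    then show ?thesis using r Z_piece by (auto simp: Q_piece Q_smult intro!: piece_smult)
  qed
  fix x assume "x \<in> carrier Q"
  then obtain v where v: "x = cs v" "v \<in> carrier M" unfolding Q_carrier by blast
  show "r \<odot>\<^bsub>Q\<^esub> x \<in> carrier Q" for r using v by (auto simp: Q_smult Q_carrier intro!: Z_smult)
  show "r \<odot>\<^bsub>Q\<^esub> (s \<odot>\<^bsub>Q\<^esub> x) = (r * s) \<odot>\<^bsub>Q\<^esub> x" for r s using v by (simp add: Q_smult Z_smult vector_smult_assoc)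
  show "1 \<odot>\<^bsub>Q\<^esub> x = x" using v by (simp add: Q_smult)
  show "r \<odot>\<^bsub>Q\<^esub> (x \<oplus>\<^bsub>Q\<^esub> y) = r \<odot>\<^bsub>Q\<^esub> x \<oplus>\<^bsub>Q\<^esub> r \<odot>\<^bsub>Q\<^esub> y" if y: "y \<in> carrier Q" for y r
  proof -
    obtain w where "y = cs w" "w \<in> carrier M" using y unfolding Q_carrier by blast
    then show ?thesis using v by (simp add: Q_add Q_smult Z_add Z_smult vector_add_ldistrib)
  qed
qed

end

lemma gfree_simps [simp]: "carrier (gfree d) = UNIV" "add (gfree d) = (+)" "smult (gfree d) = (*s)"
  "piece (gfree d) t = {v. \<forall>i. v $ i \<in> forms (t - d $ i)}"
  by (simp_all add: gfree_def)

lemma forms_mult_shift: "r \<in> forms d \<Longrightarrow> v \<in> forms (e - t) \<Longrightarrow> r * v \<in> forms (d + e - t)"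
  using forms_mult[of r d v "e - t"] by (simp add: algebra_simps)

lemma vector_module_gfree: "vector_module (gfree d)"
  by unfold_locales (auto intro: forms_add forms_mult_shift)

lemma vector_module_syz: "vector_module (syz (f :: 'k::comm_ring_1 poly3 ^ 'n))"
  by unfold_locales (auto simp: distrib_right sum.distrib mult.assoc sum_distrib_left[symmetric] intro: forms_add forms_mult_shift)

section \<open>The monomial syzygy bundle on a general line\<close>

locale monomial_setup = binary_forms a b c \<alpha> \<beta> \<gamma> "TYPE('k)"
  for a b c \<alpha> \<beta> \<gamma> :: nat and f :: "'k::field_char_0 poly3 ^ 4" +
  assumes f_vec: "f = vector [Var 0 ^ a, Var 1 ^ b, Var 2 ^ c, Var 0 ^ \<alpha> * Var 1 ^ \<beta> * Var 2 ^ \<gamma>]"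
begin

definition ex :: "4 \<Rightarrow> 3 \<Rightarrow>\<^sub>0 nat"
  where "ex i = Poly_Mapping.single 0 (xe i) + Poly_Mapping.single 1 (ye i) + Poly_Mapping.single 2 (ze i)"

lemma lookup_ex [simp]: "Poly_Mapping.lookup (ex i) 0 = xe i" "Poly_Mapping.lookup (ex i) 1 = ye i" "Poly_Mapping.lookup (ex i) 2 = ze i"
  by (simp_all add: ex_def lookup_add lookup_single)

lemma f_monom3: "f $ i = monom3 (ex i)"
  using exhaust_4[of i] by (auto simp: f_vec ex_def ex_defs Var_power mult_single)

lemma mdeg_ex: "mdeg (ex i) = xe i + ye i + ze i"
  by (simp add: mdeg_def sum_3')

lemma dd_eq: "dd i = int (mdeg (ex i))"
  by (simp add: dd_def mdeg_ex)

end

sublocale monomial_setup \<subseteq> four_forms f ex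
  by unfold_locales (rule f_monom3)

context monomial_setup
begin

lemma total_eq: "(\<Sum>i\<in>UNIV. dg i) = a + b + c + \<alpha> + \<beta> + \<gamma>"
  by (simp add: sum_4 mdeg_ex ex_defs)

lemma f_outside:
  assumes "p \<in> P2"
  shows "Var 0 \<notin> p \<Longrightarrow> f $ 1 \<notin> p" "Var 1 \<notin> p \<Longrightarrow> f $ 2 \<notin> p" "Var 2 \<notin> p \<Longrightarrow> f $ 3 \<notin> p"
  using P2_power[OF assms] by (simp_all add: f_vec)

lemma some_f_outside: assumes "p \<in> P2" shows "\<exists>i\<in>{1, 2, 3}. f $ i \<notin> p"
proof -
  obtain i where "Var i \<notin> p" using P2_Var[OF assms] by blast
  then show ?thesis using f_outside[OF assms] exhaust_3'[of i] by auto
qed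

text \<open>Semistability is tested on finitely many subsheaves: the rank two subsheaves generated by the Koszul
  syzygies of three of the forms bound the degree of the fourth form, and the syzygies of one pure power and
  the mixed monomial, which have the degree of their least common multiple, generate subsheaves of
  rank one.\<close>

lemma slope_bounds_of_semistable:
  assumes ss: "semistable (sheafify (syz f))"
  shows slope_bounds
proof -
  have whole: "is_slope (sheafify (syz f)) (\<lambda>U. carrier (sheafify (syz f) U)) (- real (a + b + c + \<alpha> + \<beta> + \<gamma>) / 3)"
  proof -
    have "is_slope (sheafify (syz f)) (\<lambda>U. carrier (sheafify (syz f) U)) (- real (\<Sum>i\<in>UNIV. dg i) / 3)"
    proof (rule slope_syz)
      show "Poly_Mapping.lookup (ex 1) i = 0 \<or> Poly_Mapping.lookup (ex 2) i = 0" for i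
        using exhaust_3'[of i] by (auto simp: ex_defs)
    qed (rule some_f_outside)
    then show ?thesis unfolding total_eq .
  qed
  have le: "\<mu> \<le> - real (a + b + c + \<alpha> + \<beta> + \<gamma>) / 3"
    if "\<exists>F. coherent_subsheaf (sheafify (syz f)) F \<and> nonzero_subsheaf (sheafify (syz f)) F \<and>
      is_slope (sheafify (syz f)) F \<mu>" for \<mu>
    using ss that whole unfolding semistable_def by blast
  have rank2: "2 * (a + b + c + \<alpha> + \<beta> + \<gamma>) \<le> 3 * (dg i + dg j + dg l)"
    if "i \<noteq> j" "j \<noteq> l" "i \<noteq> l" "codim2_complement {p \<in> P2. f $ i \<notin> p \<or> f $ j \<notin> p \<or> f $ l \<notin> p}" for i j l
    using le[OF slope_rank_two[OF that]] by linarith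
  have all: "codim2_complement {p \<in> P2. f $ 1 \<notin> p \<or> f $ 2 \<notin> p \<or> f $ 3 \<notin> p}"
    using some_f_outside unfolding codim2_complement_def by auto
  have "codim2_complement {p \<in> P2. f $ 1 \<notin> p \<or> f $ 2 \<notin> p \<or> f $ 4 \<notin> p}"
    unfolding codim2_complement_def
    using codim2_coordinate_point[of _ 0 1] f_outside by auto
  moreover have "codim2_complement {p \<in> P2. f $ 1 \<notin> p \<or> f $ 3 \<notin> p \<or> f $ 4 \<notin> p}"
    unfolding codim2_complement_def
    using codim2_coordinate_point[of _ 0 2] f_outside by auto
  moreover have "codim2_complement {p \<in> P2. f $ 2 \<notin> p \<or> f $ 3 \<notin> p \<or> f $ 4 \<notin> p}"
    unfolding codim2_complement_def
    using codim2_coordinate_point[of _ 1 2] f_outside by auto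
  ultimately have r2: "2 * (a + b + c + \<alpha> + \<beta> + \<gamma>) \<le> 3 * (a + b + c)"
    "2 * (a + b + c + \<alpha> + \<beta> + \<gamma>) \<le> 3 * (a + b + (\<alpha> + \<beta> + \<gamma>))"
    "2 * (a + b + c + \<alpha> + \<beta> + \<gamma>) \<le> 3 * (a + c + (\<alpha> + \<beta> + \<gamma>))"
    "2 * (a + b + c + \<alpha> + \<beta> + \<gamma>) \<le> 3 * (b + c + (\<alpha> + \<beta> + \<gamma>))"
    using rank2[of 1 2 3] rank2[of 1 2 4] rank2[of 1 3 4] rank2[of 2 3 4] all
    by (simp_all add: mdeg_ex ex_defs)
  \<comment> \<open>The common monomial \<open>m + ex i = m' + ex 4\<close> will be the least common multiple.\<close>
  have rank1: "a + b + c + \<alpha> + \<beta> + \<gamma> \<le> 3 * (mdeg m + dg i)"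
    if m: "m + ex i = m' + ex 4" and i: "i \<noteq> 4" for m m' i
  proof -
    let ?w = "(\<chi> l. if l = i then monom3 m else if l = 4 then - monom3 m' else 0) :: 'k poly3 ^ 4"
    have md: "mdeg m + dg i = mdeg m' + dg 4" using arg_cong[OF m, of mdeg] by (simp add: mdeg_add)
    have "(\<Sum>l\<in>UNIV. ?w $ l * f $ l) = (\<Sum>l\<in>UNIV. (if l = i then monom3 (m + ex i) else 0) - (if l = 4 then monom3 (m' + ex 4) else 0))"
      by (rule sum.cong) (use i in \<open>auto simp: f_monom3 mult_single\<close>)
    also have "\<dots> = 0" by (simp add: sum_subtractf m)
    finally have rel: "(\<Sum>l\<in>UNIV. ?w $ l * f $ l) = 0" .
    have e4: "int (mdeg m + dg i) - int (dg 4) = int (mdeg m')" using md by simp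
    have "?w $ l \<in> forms (int (mdeg m + dg i) - int (dg l))" for l
      using monom_forms[of m] monom_forms[of m'] e4 by (auto intro!: forms_uminus)
    then have "?w \<in> piece (syz f) (int (mdeg m + dg i))" using rel by simp
    moreover have "?w \<noteq> 0" using monom_nonzero[of m] by (auto simp: vec_eq_iff)
    ultimately have "\<exists>F. coherent_subsheaf (sheafify (syz f)) F \<and> nonzero_subsheaf (sheafify (syz f)) F \<and>
        is_slope (sheafify (syz f)) F (- real (mdeg m + dg i))" by (rule slope_rank_one)
    from le[OF this] have "real (a + b + c + \<alpha> + \<beta> + \<gamma>) \<le> real (3 * (mdeg m + dg i))" by (simp add: field_simps)
    then show ?thesis by (simp only: of_nat_le_iff)
  qed
  have r1: "a + b + c + \<alpha> + \<beta> + \<gamma> \<le> 3 * (a + \<beta> + \<gamma>)"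
  proof -
    have "bexp + ex 1 = Poly_Mapping.single 0 (a - \<alpha>) + ex 4" if "bexp = Poly_Mapping.single 1 \<beta> + Poly_Mapping.single 2 \<gamma>" for bexp
    proof (rule poly_mapping_eqI)
      show "Poly_Mapping.lookup (bexp + ex 1) i = Poly_Mapping.lookup (Poly_Mapping.single 0 (a - \<alpha>) + ex 4) i" for i
        using exhaust_3'[of i] bounds that by (auto simp: lookup_add lookup_single ex_defs)
    qed
    from rank1[OF this[OF refl]] show ?thesis
      by (simp add: mdeg_def sum_3' lookup_add lookup_single ex_defs)
  qed
  have r1': "a + b + c + \<alpha> + \<beta> + \<gamma> \<le> 3 * (b + \<alpha> + \<gamma>)"
  proof -
    have "bexp + ex 2 = Poly_Mapping.single 1 (b - \<beta>) + ex 4" if "bexp = Poly_Mapping.single 0 \<alpha> + Poly_Mapping.single 2 \<gamma>" for bexp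
    proof (rule poly_mapping_eqI)
      show "Poly_Mapping.lookup (bexp + ex 2) i = Poly_Mapping.lookup (Poly_Mapping.single 1 (b - \<beta>) + ex 4) i" for i
        using exhaust_3'[of i] bounds that by (auto simp: lookup_add lookup_single ex_defs)
    qed
    from rank1[OF this[OF refl]] show ?thesis
      by (simp add: mdeg_def sum_3' lookup_add lookup_single ex_defs)
  qed
  have r1'': "a + b + c + \<alpha> + \<beta> + \<gamma> \<le> 3 * (c + \<alpha> + \<beta>)"
  proof -
    have "bexp + ex 3 = Poly_Mapping.single 2 (c - \<gamma>) + ex 4" if "bexp = Poly_Mapping.single 0 \<alpha> + Poly_Mapping.single 1 \<beta>" for bexp
    proof (rule poly_mapping_eqI)
      show "Poly_Mapping.lookup (bexp + ex 3) i = Poly_Mapping.lookup (Poly_Mapping.single 2 (c - \<gamma>) + ex 4) i" for i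
        using exhaust_3'[of i] bounds that by (auto simp: lookup_add lookup_single ex_defs)
    qed
    from rank1[OF this[OF refl]] show ?thesis
      by (simp add: mdeg_def sum_3' lookup_add lookup_single ex_defs)
  qed
  have "3 * a \<le> a + b + c + \<alpha> + \<beta> + \<gamma>" "3 * b \<le> a + b + c + \<alpha> + \<beta> + \<gamma>"
    "3 * c \<le> a + b + c + \<alpha> + \<beta> + \<gamma>" "3 * (\<alpha> + \<beta> + \<gamma>) \<le> a + b + c + \<alpha> + \<beta> + \<gamma>"
    using r2 unfolding distrib_left by linarith+
  then show ?thesis
    unfolding slope_bounds_def using r1 r1' r1'' by (simp only: of_nat_le_iff[symmetric, where 'a=int] of_nat_mult of_nat_numeral simp_thms)
qed

text \<open>A multihomogeneous component of a syzygy involves at least two of the monomials, so that its degree is at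
  least the degree of their least common multiple.\<close>

lemma small_syzygy_zero:
  assumes sb: slope_bounds and v: "v \<in> piece (syz f) e" and e: "3 * e < total"
  shows "v = 0"
proof (rule ccontr)
  assume "v \<noteq> 0"
  then obtain i where "v $ i \<noteq> 0" by (auto simp: vec_eq_iff)
  then obtain m where m: "m \<in> Poly_Mapping.keys (v $ i)" by (metis keys_eq_empty ex_in_conv)
  let ?M = "m + ex i"
  have L: "Poly_Mapping.lookup (v $ l * f $ l) ?M \<noteq> 0 \<Longrightarrow> \<exists>m'. ?M = m' + ex l" for l
    using keys_mult_monom[of "v $ l" "ex l"] by (auto simp: f_monom3 in_keys_iff[symmetric])
  have nz: "Poly_Mapping.lookup (v $ i * f $ i) ?M \<noteq> 0"
    using m by (simp add: f_monom3 lookup_mult_monom in_keys_iff)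
  have "(\<Sum>l\<in>UNIV. Poly_Mapping.lookup (v $ l * f $ l) ?M) = Poly_Mapping.lookup (\<Sum>l\<in>UNIV. v $ l * f $ l) ?M"
    by (simp add: lookup_sum)
  also have "\<dots> = 0" using v by simp
  finally have s: "(\<Sum>l\<in>UNIV. Poly_Mapping.lookup (v $ l * f $ l) ?M) = 0" .
  have "\<exists>j. j \<noteq> i \<and> Poly_Mapping.lookup (v $ j * f $ j) ?M \<noteq> 0"
  proof (rule ccontr)
    assume "\<nexists>j. j \<noteq> i \<and> Poly_Mapping.lookup (v $ j * f $ j) ?M \<noteq> 0"
    then have "(\<Sum>l\<in>UNIV. Poly_Mapping.lookup (v $ l * f $ l) ?M) = (\<Sum>l\<in>UNIV. if l = i then Poly_Mapping.lookup (v $ i * f $ i) ?M else 0)"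
      by (intro sum.cong) auto
    then show False using s nz by simp
  qed
  then obtain j m' where j: "j \<noteq> i" "?M = m' + ex j" using L by blast
  have "xe i \<le> Poly_Mapping.lookup ?M 0" "ye i \<le> Poly_Mapping.lookup ?M 1" "ze i \<le> Poly_Mapping.lookup ?M 2" by (simp_all add: lookup_add)
  moreover have "xe j \<le> Poly_Mapping.lookup ?M 0" "ye j \<le> Poly_Mapping.lookup ?M 1" "ze j \<le> Poly_Mapping.lookup ?M 2"
    unfolding j(2) by (simp_all add: lookup_add)
  ultimately have "max (xe i) (xe j) + max (ye i) (ye j) + max (ze i) (ze j) \<le> mdeg ?M"
    unfolding mdeg_def sum_3' by (intro add_mono) simp_all
  moreover have "int (mdeg ?M) = e"
    using m v by (auto simp: mdeg_add forms_def)
  ultimately have "3 * int (max (xe i) (xe j) + max (ye i) (ye j) + max (ze i) (ze j)) \<le> 3 * e" by simp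
  with pair_bound[OF sb j(1)[symmetric]] have "total \<le> 3 * e" by (rule order_trans)
  then show False using e by simp
qed

end

locale monomial_line = monomial_setup a b c \<alpha> \<beta> \<gamma> f + general_line cf
  for a b c \<alpha> \<beta> \<gamma> :: nat and f :: "'k::field_char_0 poly3 ^ 4" and cf :: "3 \<Rightarrow> 'k"
begin

text \<open>The constant by which the restriction of a monomial differs from \<open>fh i\<close>; it is moved into the syzygies.\<close>

definition \<kappa> :: "4 \<Rightarrow> 'k"
  where "\<kappa> i = (1 / cf 0) ^ xe i * (1 / cf 1) ^ ye i * (- 1 / cf 2) ^ ze i"

lemma \<kappa>_nonzero: "\<kappa> i \<noteq> 0"
  using cf_nonzero by (simp add: \<kappa>_def)

lemma \<rho>_f: "\<rho> (f $ i) = [:\<kappa> i:] * fh i"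
proof -
  have "par 0 = [:1 / cf 0:] * tX" "par 1 = [:1 / cf 1:]" "par 2 = [:- 1 / cf 2:] * uX"
    by (simp_all add: par_def)
  then have "\<rho> (f $ i) = ([:1 / cf 0:] * tX) ^ xe i * [:1 / cf 1:] ^ ye i * ([:- 1 / cf 2:] * uX) ^ ze i"
    by (simp add: f_monom3 \<rho>_single del: mult_pCons_left)
  also have "\<dots> = [:1 / cf 0:] ^ xe i * [:1 / cf 1:] ^ ye i * [:- 1 / cf 2:] ^ ze i * fh i"
    unfolding power_mult_distrib fh_def by (simp only: mult_ac)
  also have "[:1 / cf 0:] ^ xe i * [:1 / cf 1:] ^ ye i * [:- 1 / cf 2:] ^ ze i = [:\<kappa> i:]"
    by (simp add: poly_const_pow \<kappa>_def mult_ac)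
  finally show ?thesis .
qed

definition toE :: "'k poly3 ^ 4 \<Rightarrow> 'k poly ^ 4" where "toE v = (\<chi> i. [:\<kappa> i:] * \<rho> (v $ i))"

lemma toE_add: "toE (v + w) = toE v + toE w"
  by (simp add: toE_def vec_eq_iff \<rho>_add smult_add_right)

lemma toE_diff: "toE (v - w) = toE v - toE w"
  by (simp add: toE_def vec_eq_iff \<rho>_diff smult_diff_right)

lemma toE_smult: "toE (r *s v) = \<rho> r *s toE v"
  by (simp add: toE_def vec_eq_iff \<rho>_mult)

lemma toE_zero_iff: "toE v = 0 \<longleftrightarrow> (\<forall>i. \<rho> (v $ i) = 0)"
  using \<kappa>_nonzero by (simp add: toE_def vec_eq_iff)

lemma \<rho>_sum_f: "\<rho> (\<Sum>i\<in>UNIV. v $ i * f $ i) = (\<Sum>i\<in>UNIV. toE v $ i * fh i)"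
  unfolding \<rho>_sum \<rho>_mult \<rho>_f by (rule sum.cong) (simp_all add: toE_def)

lemma toE_dle: "v $ i \<in> forms (e - int (dg i)) \<Longrightarrow> dle (toE v $ i) (e - dd i)"
  using dle_mult[OF dle_const[of 0 "\<kappa> i"] \<rho>_dle] by (simp add: toE_def dd_eq)

lemma toE_E: assumes "v \<in> piece (syz f) e" shows "toE v \<in> E e"
  using assms \<rho>_sum_f[of v] toE_dle[of v _ e] by (simp add: E_def)

lemma toE_lift:
  assumes "\<And>i. dle (V $ i) (e - dd i)"
  shows "\<exists>v. (\<forall>i. v $ i \<in> forms (e - int (dg i))) \<and> toE v = V"
proof -
  have "\<exists>g\<in>forms (e - int (dg i)). \<rho> g = [:1 / \<kappa> i:] * V $ i" for i
    using dle_mult[OF dle_const[of 0 "1 / \<kappa> i"] assms[of i]] by (intro \<rho>_surj) (simp add: dd_eq)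
  then obtain g where g: "\<And>i. g i \<in> forms (e - int (dg i)) \<and> \<rho> (g i) = [:1 / \<kappa> i:] * V $ i" by metis
  have "toE (\<chi> i. g i) = V"
    using g \<kappa>_nonzero by (simp add: toE_def vec_eq_iff)
  then show ?thesis using g by (intro exI[of _ "\<chi> i. g i"]) simp
qed

text \<open>A vector of forms that vanishes on the line is a multiple of the linear form.\<close>

lemma vector_kernel:
  fixes v :: "'k poly3 ^ 'm::finite"
  assumes "\<And>i. v $ i \<in> forms (d i)" "\<And>i. \<rho> (v $ i) = 0"
  obtains u where "v = ell *s u" "\<And>i. u $ i \<in> forms (d i - 1)"
proof -
  obtain h where "\<And>i. h i \<in> forms (d i - 1) \<and> v $ i = h i * ell" using \<rho>_kernel[OF assms] by metis
  then show ?thesis by (intro that[of "\<chi> i. h i"]) (auto simp: vec_eq_iff mult.commute)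
qed

lemma syz_cancel:
  assumes "(\<Sum>i\<in>UNIV. (ell *s u) $ i * f $ i) = 0"
  shows "(\<Sum>i\<in>UNIV. u $ i * f $ i) = 0"
  using assms ell_nonzero unfolding syz_smult_sum by simp

subsection \<open>The splitting\<close>

context
  fixes n :: "nat \<Rightarrow> 'k poly ^ 4" and \<delta> :: "nat \<Rightarrow> nat"
  assumes gb: "graded_basis n \<delta>"
begin

text \<open>The basis is listed in decreasing degree, since splitting types are listed in increasing order.\<close>

definition D :: "int ^ 3" where "D = vector [int (\<delta> 2), int (\<delta> 1), int (\<delta> 0)]"

definition coords :: "'k poly3 ^ 3 \<Rightarrow> nat \<Rightarrow> 'k poly"
  where "coords w j = (if j = 0 then \<rho> (w $ 3) else if j = 1 then \<rho> (w $ 2) else \<rho> (w $ 1))"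

definition gcomb :: "'k poly3 ^ 3 \<Rightarrow> 'k poly ^ 4" where "gcomb w = comb n (coords w)"

lemma gcomb_add: "gcomb (v + w) = gcomb v + gcomb w"
  by (simp add: gcomb_def comb_def coords_def \<rho>_add vector_sadd_rdistrib)

lemma gcomb_diff: "gcomb (v - w) = gcomb v - gcomb w"
  using gcomb_add[of "v - w" w] by (simp add: algebra_simps)

lemma gcomb_smult: "gcomb (r *s w) = \<rho> r *s gcomb w"
  by (simp add: gcomb_def comb_def coords_def \<rho>_mult vector_add_ldistrib vector_smult_assoc)

lemma gcomb_zeroD: assumes "gcomb w = 0" shows "\<rho> (w $ i) = 0"
proof -
  have "coords w j = 0" if "j < 3" for j using comb_zero[OF gb _ that] assms by (simp add: gcomb_def)
  from this[of 0] this[of 1] this[of 2] show ?thesis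
    using exhaust_3[of i] by (auto simp: coords_def)
qed

lemma gcomb_dle: assumes "w \<in> piece (gfree D) e" shows "gcomb w \<in> E e"
proof -
  have "w $ 1 \<in> forms (e - int (\<delta> 2))" "w $ 2 \<in> forms (e - int (\<delta> 1))" "w $ 3 \<in> forms (e - int (\<delta> 0))"
    using assms by (auto simp: D_def forall_3)
  then show ?thesis
    using E_mult[OF basis_mem[OF gb, of 0] \<rho>_dle, of "w $ 3" "e - int (\<delta> 0)"]
      E_mult[OF basis_mem[OF gb, of 1] \<rho>_dle, of "w $ 2" "e - int (\<delta> 1)"]
      E_mult[OF basis_mem[OF gb, of 2] \<rho>_dle, of "w $ 1" "e - int (\<delta> 2)"]
    by (simp add: gcomb_def comb_def coords_def E_add)
qed

lemma gcomb_surj: assumes "V \<in> E e" shows "\<exists>w\<in>piece (gfree D) e. gcomb w = V"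
proof -
  obtain x where x: "\<forall>j<3. dle (x j) (e - int (\<delta> j))" "V = comb n x"
    using gb assms unfolding graded_basis_def by blast
  have "\<exists>g\<in>forms (e - int (\<delta> j)). \<rho> g = x j" if "j < 3" for j using x(1) that by (intro \<rho>_surj) simp
  then obtain g where g: "\<And>j. j < 3 \<Longrightarrow> g j \<in> forms (e - int (\<delta> j)) \<and> \<rho> (g j) = x j" by metis
  show ?thesis
    by (rule bexI[of _ "vector [g 2, g 1, g 0]"])
      (use g[of 0] g[of 1] g[of 2] x(2) in \<open>simp_all add: gcomb_def comb_def coords_def D_def forall_3\<close>)
qed

text \<open>Cosets correspond if their representatives restrict to the same syzygy on the line.\<close>

definition corr :: "int \<Rightarrow> ('k poly3 ^ 4) set \<Rightarrow> ('k poly3 ^ 3) set \<Rightarrow> bool"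
  where "corr e A B \<longleftrightarrow> (\<exists>v w. v \<in> piece (syz f) e \<and> w \<in> piece (gfree D) e \<and>
    A = vector_module_mod.cs (syz f) ell v \<and> B = vector_module_mod.cs (gfree D) ell w \<and> toE v = gcomb w)"

text \<open>A syzygy of the restricted forms need not lift to a syzygy of the forms, but it does after
  multiplication by any of the forms.  At each point some form does not vanish, so the correspondence is
  locally total on both sides, although it is not an isomorphism of graded modules.\<close>

theorem splitting: "sheaf_iso (restrict_line ell (syz f)) (restrict_line ell (gfree D))"
proof -
  interpret S: vector_module_mod "syz f" ell by (intro vector_module_mod.intro vector_module_syz)
  interpret G: vector_module_mod "gfree D" ell by (intro vector_module_mod.intro vector_module_gfree)
  have TD: "\<exists>v w. v \<in> piece (syz f) e \<and> w \<in> piece (gfree D) e \<and> A = S.cs v \<and> B = G.cs w \<and> toE v = gcomb w"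
    if "corr e A B" for e A B using that by (simp only: corr_def)
  have TI: "corr e (S.cs v) (G.cs w)" if "v \<in> piece (syz f) e" "w \<in> piece (gfree D) e" "toE v = gcomb w" for e v w
    unfolding corr_def using that by blast
  have S_eq: "S.cs v = S.cs v'" if v: "v \<in> piece (syz f) e" "v' \<in> piece (syz f) e" "toE v = toE v'" for v v' e
  proof -
    have d: "v - v' \<in> piece (syz f) e"
      using v(1,2) by (auto simp: left_diff_distrib sum_subtractf intro: forms_diff)
    have "toE (v - v') = 0" using v(3) by (simp add: toE_diff)
    then have r0: "\<rho> ((v - v') $ i) = 0" for i unfolding toE_zero_iff by blast
    have f0: "(v - v') $ i \<in> forms (e - int (dg i))" for i using d by simp
    obtain u where u: "v - v' = ell *s u" by (rule vector_kernel[OF f0 r0])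
    have "u \<in> carrier (syz f)" using syz_cancel[of u] d unfolding u by simp
    then show ?thesis by (rule S.cs_eqI[OF _ u])
  qed
  have G_eq: "G.cs w = G.cs w'" if w: "w \<in> piece (gfree D) e" "w' \<in> piece (gfree D) e" "gcomb w = gcomb w'" for w w' e
  proof -
    have "gcomb (w - w') = 0" using w(3) by (simp add: gcomb_diff)
    then have "\<rho> ((w - w') $ i) = 0" for i by (rule gcomb_zeroD)
    moreover have "(w - w') $ i \<in> forms (e - D $ i)" for i using w by (auto intro: forms_diff)
    ultimately obtain u where "w - w' = ell *s u" using vector_kernel[of "w - w'" "\<lambda>i. e - D $ i"] by metis
    then show ?thesis by (intro G.cs_eqI[of u]) simp_all
  qed
  have S_inv: "toE v = toE v'" if cs: "S.cs v = S.cs v'" for v v'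
  proof -
    obtain z where "v - v' = ell *s z" by (rule S.cs_eqD[OF cs])
    then have "toE (v - v') = 0" by (simp add: toE_smult \<rho>_ell)
    then show ?thesis by (simp add: toE_diff)
  qed
  have G_inv: "gcomb w = gcomb w'" if cs: "G.cs w = G.cs w'" for w w'
  proof -
    obtain z where "w - w' = ell *s z" by (rule G.cs_eqD[OF cs])
    then have "gcomb (w - w') = 0" by (simp add: gcomb_smult \<rho>_ell)
    then show ?thesis by (simp add: gcomb_diff)
  qed
  have "local_correspondence S.Q G.Q corr"
  proof (intro local_correspondence.intro S.germ_module_Q G.germ_module_Q local_correspondence_axioms.intro)
    show "A \<in> piece S.Q e \<and> B \<in> piece G.Q e" if "corr e A B" for e A B
      using TD[OF that] unfolding S.Q_piece G.Q_piece by blast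
    show "corr e (A \<oplus>\<^bsub>S.Q\<^esub> A') (B \<oplus>\<^bsub>G.Q\<^esub> B')" if t: "corr e A B" and t': "corr e A' B'" for e A B A' B'
    proof -
      obtain v w where 1: "v \<in> piece (syz f) e" "w \<in> piece (gfree D) e" "A = S.cs v" "B = G.cs w" "toE v = gcomb w"
        using TD[OF t] by blast
      obtain v' w' where 2: "v' \<in> piece (syz f) e" "w' \<in> piece (gfree D) e" "A' = S.cs v'" "B' = G.cs w'" "toE v' = gcomb w'"
        using TD[OF t'] by blast
      show ?thesis
        unfolding 1(3,4) 2(3,4) S.Q_add[OF S.Z_piece[OF 1(1)] S.Z_piece[OF 2(1)]] G.Q_add[OF G.Z_piece[OF 1(2)] G.Z_piece[OF 2(2)]]
        by (rule TI[OF S.piece_add[OF 1(1) 2(1)] G.piece_add[OF 1(2) 2(2)]]) (simp add: toE_add gcomb_add 1(5) 2(5))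
    qed
    show "corr (d + e) (r \<odot>\<^bsub>S.Q\<^esub> A) (r \<odot>\<^bsub>G.Q\<^esub> B)" if t: "corr e A B" and r: "r \<in> forms d" for e A B r d
    proof -
      obtain v w where 1: "v \<in> piece (syz f) e" "w \<in> piece (gfree D) e" "A = S.cs v" "B = G.cs w" "toE v = gcomb w"
        using TD[OF t] by blast
      show ?thesis
        unfolding 1(3,4) S.Q_smult[OF S.Z_piece[OF 1(1)]] G.Q_smult[OF G.Z_piece[OF 1(2)]]
        by (rule TI[OF S.piece_smult[OF r 1(1)] G.piece_smult[OF r 1(2)]]) (simp add: toE_smult gcomb_smult 1(5))
    qed
    show "A = A'" if t: "corr e A B" and t': "corr e A' B" for e A A' B
    proof -
      obtain v w where 1: "v \<in> piece (syz f) e" "w \<in> piece (gfree D) e" "A = S.cs v" "B = G.cs w" "toE v = gcomb w"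
        using TD[OF t] by blast
      obtain v' w' where 2: "v' \<in> piece (syz f) e" "w' \<in> piece (gfree D) e" "A' = S.cs v'" "B = G.cs w'" "toE v' = gcomb w'"
        using TD[OF t'] by blast
      have "toE v = toE v'" using G_inv[of w w'] 1(4,5) 2(4,5) by simp
      then show ?thesis unfolding 1(3) 2(3) by (rule S_eq[OF 1(1) 2(1)])
    qed
    show "B = B'" if t: "corr e A B" and t': "corr e A B'" for e A B B'
    proof -
      obtain v w where 1: "v \<in> piece (syz f) e" "w \<in> piece (gfree D) e" "A = S.cs v" "B = G.cs w" "toE v = gcomb w"
        using TD[OF t] by blast
      obtain v' w' where 2: "v' \<in> piece (syz f) e" "w' \<in> piece (gfree D) e" "A = S.cs v'" "B' = G.cs w'" "toE v' = gcomb w'"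
        using TD[OF t'] by blast
      have "gcomb w = gcomb w'" using S_inv[of v v'] 1(3,5) 2(3,5) by simp
      then show ?thesis unfolding 1(4) 2(4) by (rule G_eq[OF 1(2) 2(2)])
    qed
    show "\<exists>d. \<exists>h\<in>forms d. h \<notin> p \<and> (\<exists>B. corr (d + e) (h \<odot>\<^bsub>S.Q\<^esub> A) B)"
      if A: "A \<in> piece S.Q e" and p: "p \<in> P2" for A e p
    proof -
      obtain v where v: "v \<in> piece (syz f) e" "A = S.cs v" using A unfolding S.Q_piece by blast
      obtain w where w: "w \<in> piece (gfree D) e" "gcomb w = toE v" using gcomb_surj[OF toE_E[OF v(1)]] by blast
      have "corr (0 + e) (1 \<odot>\<^bsub>S.Q\<^esub> A) (G.cs w)"
        unfolding v(2) S.Q_smult[OF S.Z_piece[OF v(1)]] using TI[OF v(1) w(1)] w(2) by simp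
      then show ?thesis using forms_one P2_one[OF p] by blast
    qed
    show "\<exists>d. \<exists>h\<in>forms d. h \<notin> p \<and> (\<exists>A. corr (d + e) A (h \<odot>\<^bsub>G.Q\<^esub> B))"
      if B: "B \<in> piece G.Q e" and p: "p \<in> P2" for B e p
    proof -
      obtain w where w: "w \<in> piece (gfree D) e" "B = G.cs w" using B unfolding G.Q_piece by blast
      have V: "gcomb w \<in> E e" by (rule gcomb_dle[OF w(1)])
      obtain u where u: "\<And>i. u $ i \<in> forms (e - int (dg i))" "toE u = gcomb w"
        using toE_lift[OF E_dle[OF V]] by blast
      let ?g = "\<Sum>i\<in>UNIV. u $ i * f $ i"
      have "?g \<in> forms e"
      proof (rule forms_sum)
        show "u $ i * f $ i \<in> forms e" for i using forms_mult[OF u(1)[of i] f_forms[of i]] by simp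
      qed
      moreover have "\<rho> ?g = 0" using V unfolding \<rho>_sum_f u(2) by (simp add: E_def)
      ultimately obtain h where h: "h \<in> forms (e - 1)" "?g = h * ell" using \<rho>_kernel by blast
      obtain j where j: "f $ j \<notin> p" using some_f_outside[OF p] by blast
      \<comment> \<open>The defect \<open>h l\<close> of the lift is compensated by the component \<open>j\<close> after multiplication by \<open>f\<^sub>j\<close>.\<close>
      define v where "v = f $ j *s u - (\<chi> i. if i = j then h * ell else 0)"
      have "(\<Sum>i\<in>UNIV. v $ i * f $ i) = (\<Sum>i\<in>UNIV. (f $ j *s u) $ i * f $ i) - (\<Sum>i\<in>UNIV. if i = j then h * ell * f $ j else 0)"
        unfolding sum_subtractf[symmetric] by (rule sum.cong) (auto simp: v_def algebra_simps)
      also have "\<dots> = 0" unfolding syz_smult_sum h(2) by (simp add: mult.commute)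
      finally have "(\<Sum>i\<in>UNIV. v $ i * f $ i) = 0" .
      moreover have "v $ i \<in> forms (int (dg j) + e - int (dg i))" for i
      proof -
        have "f $ j * u $ i \<in> forms (int (dg j) + e - int (dg i))"
          by (rule forms_mult_shift[OF f_forms u(1)])
        moreover have "h * ell \<in> forms e" using forms_mult[OF h(1) linear_form_forms[of cf]] by simp
        ultimately show ?thesis by (auto simp: v_def intro: forms_diff)
      qed
      ultimately have v: "v \<in> piece (syz f) (int (dg j) + e)" by simp
      have "toE v = \<rho> (f $ j) *s toE u"
        unfolding v_def toE_diff toE_smult by (simp add: toE_def vec_eq_iff \<rho>_mult \<rho>_ell)
      then have "corr (int (dg j) + e) (S.cs v) (G.cs (f $ j *s w))"
        using u(2) by (intro TI[OF v G.piece_smult[OF f_forms w(1)]]) (simp add: gcomb_smult)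
      then show ?thesis
        unfolding w(2) using G.Q_smult[OF G.Z_piece[OF w(1)]] j f_forms[of j] by metis
    qed
  qed
  then show ?thesis
    unfolding restrict_line_def by (rule sheaf_iso_of_local_correspondence)
qed

end

end

text \<open>The graded basis does not depend on the line, so the splitting is the same for all lines that avoid the
  coordinate points.  The form \<open>\<Phi>\<close> is the product of the three coefficients.\<close>

theorem (in monomial_setup) generic_splitting_type:
  assumes gb: "graded_basis n \<delta>" and "int (\<delta> 0) = - r" "int (\<delta> 1) = - q" "int (\<delta> 2) = - p"
  shows "has_generic_splitting_type (syz f) (p, q, r)"
proof -
  let ?e = "Poly_Mapping.single 0 1 + Poly_Mapping.single 1 1 + Poly_Mapping.single 2 1 :: 3 \<Rightarrow>\<^sub>0 nat"
  have "p \<le> q" "q \<le> r" using gb assms(2-4) by (auto simp: graded_basis_def)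
  moreover have "sheaf_iso (restrict_line (linear_form cf) (syz f))
      (restrict_line (linear_form cf) (gfree (vector [- p, - q, - r] :: int ^ 3)))"
    if "peval (monom3 ?e) cf \<noteq> 0" for cf :: "3 \<Rightarrow> 'k"
  proof -
    have "cf i \<noteq> 0" for i
      using that exhaust_3'[of i] by (auto simp: peval_def prod_3 lookup_add lookup_single)
    then interpret monomial_line a b c \<alpha> \<beta> \<gamma> f cf
      by unfold_locales
    show ?thesis using splitting[OF gb] assms(2-4) by (simp add: D_def[OF gb])
  qed
  moreover have "monom3 ?e \<in> (forms (int (mdeg ?e)) :: 'k poly3 set)" by (rule monom_forms)
  moreover have "monom3 ?e \<noteq> (0 :: 'k poly3)" by (rule monom_nonzero)
  ultimately show ?thesis
    unfolding has_generic_splitting_type_def prod.case by blast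
qed

section \<open>Cokernels in low and high degrees\<close>

lemma shift_decomposition: "(p :: 'a::comm_ring_1 poly) = [:poly.coeff p 0:] + tX * poly_shift 1 p"
  by (rule poly_eqI) (auto simp: coeff_pCons coeff_poly_shift split: nat.splits)

lemma dle_shift: "dle p m \<Longrightarrow> dle (poly_shift 1 p) (m - 1)"
  by (auto simp: dle_iff_coeff coeff_poly_shift)

lemma dle_tX_cancel: "dle (tX * p) m \<Longrightarrow> dle p (m - 1)" for p :: "'a::comm_ring_1 poly"
  unfolding dle_iff_coeff
proof (intro allI impI)
  fix j assume *: "\<forall>j. m < int j \<longrightarrow> poly.coeff (tX * p) j = 0" and j: "m - 1 < int j"
  have "poly.coeff (tX * p) (Suc j) = 0" using *[rule_format, of "Suc j"] j by simp
  then show "poly.coeff p j = 0" by simp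
qed

context binary_forms
begin

definition in_ideal :: "'k poly \<Rightarrow> int \<Rightarrow> bool"
  where "in_ideal p e \<longleftrightarrow> (\<exists>V :: 'k poly ^ 4. (\<forall>i. dle (V $ i) (e - dd i)) \<and> p = (\<Sum>i\<in>UNIV. V $ i * fh i))"

lemma basis_rep: assumes gb: "graded_basis n \<delta>" and v: "v \<in> E e"
  shows "\<exists>x. (\<forall>j<3. dle (x j) (e - int (\<delta> j))) \<and> v = comb n x"
proof -
  have "\<forall>e v. v \<in> E e \<longrightarrow> (\<exists>x. (\<forall>j<3. dle (x j) (e - int (\<delta> j))) \<and> v = comb n x)"
    using gb unfolding graded_basis_def by (elim conjE)
  then show ?thesis using v by (elim allE impE)
qed

lemma comb_E: assumes gb: "graded_basis n \<delta>" and x: "\<And>j. j < 3 \<Longrightarrow> dle (x j) (e - int (\<delta> j))"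
  shows "comb n x \<in> E e"
  using E_mult[OF basis_mem[OF gb, of 0] x[of 0]] E_mult[OF basis_mem[OF gb, of 1] x[of 1]]
    E_mult[OF basis_mem[OF gb, of 2] x[of 2]]
  by (simp add: comb_def E_add)

text \<open>The first two forms are \<open>t\<^sup>a\<close> and the \<open>b\<close>-th power of the other variable, so already these two generate all forms of
  large degree.\<close>

lemma in_ideal_large: assumes p: "dle p e" and e: "int (a + b) \<le> e" shows "in_ideal p e"
proof -
  let ?V = "vector [poly_shift a p, poly_cutoff a p, 0, 0] :: 'k poly ^ 4"
  have "p = Polynomial.monom 1 a * poly_shift a p + poly_cutoff a p"
    by (rule poly_eqI) (auto simp: coeff_monom_mult coeff_poly_shift coeff_poly_cutoff)
  also have "Polynomial.monom 1 a = (tX ^ a :: 'k poly)" by (simp add: monom_altdef)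
  finally have "p = (\<Sum>i\<in>UNIV. ?V $ i * fh i)" by (simp add: sum_4 fh_values mult.commute)
  moreover have "dle (?V $ i) (e - dd i)" for i
  proof -
    have "dle (poly_shift a p) (e - int a)" using p by (auto simp: dle_iff_coeff coeff_poly_shift)
    moreover have "dle (poly_cutoff a p) (e - int b)" using e by (auto simp: dle_iff_coeff coeff_poly_cutoff)
    ultimately show ?thesis using exhaust_4[of i] by (auto simp: dd_def ex_defs)
  qed
  ultimately show ?thesis unfolding in_ideal_def by (intro exI[of _ ?V]) simp
qed

text \<open>The proof descends from large degrees.  Two
  representations of \<open>x g\<close> and \<open>y g\<close> give a syzygy, whose coefficients in the basis have positive
  degree and can be split to find a representation of \<open>g\<close>.\<close>

lemma in_ideal_balanced:
  assumes gb: "graded_basis n \<delta>" and \<delta>: "\<And>j. j < 3 \<Longrightarrow> int (\<delta> j) = k"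
    and p: "dle p e" and e: "k - 1 \<le> e"
  shows "in_ideal p e"
  using p e
proof (induction "nat (int (a + b) - e)" arbitrary: p e rule: less_induct)
  case less
  show ?case
  proof (cases "int (a + b) \<le> e")
    case True
    then show ?thesis using in_ideal_large less.prems by blast
  next
    case False
    have tp: "dle (tX * p) (e + 1)" using dle_mult[of tX 1 p e] less.prems by (simp add: dle_def add.commute)
    obtain V where V: "\<And>i. dle (V $ i) (e + 1 - dd i)" "tX * p = (\<Sum>i\<in>UNIV. V $ i * fh i)"
      using less.hyps[of "e + 1" "tX * p", OF _ tp] False less.prems(2) unfolding in_ideal_def by auto
    obtain W where W: "\<And>i. dle (W $ i) (e + 1 - dd i)" "p = (\<Sum>i\<in>UNIV. W $ i * fh i)"
      using less.hyps[of "e + 1" p, OF _ dle_mono[OF less.prems(1)]] False less.prems(2) unfolding in_ideal_def by auto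
    have "V - tX *s W \<in> E (e + 2)"
    proof -
      have "(\<Sum>i\<in>UNIV. (V - tX *s W) $ i * fh i) = (\<Sum>i\<in>UNIV. V $ i * fh i) - tX * (\<Sum>i\<in>UNIV. W $ i * fh i)"
        by (simp add: left_diff_distrib sum_subtractf sum_distrib_left mult.assoc del: mult_pCons_left)
      moreover have "dle (V $ i - tX * W $ i) (e + 2 - dd i)" for i
      proof (rule dle_diff)
        show "dle (V $ i) (e + 2 - dd i)" by (rule dle_mono[OF V(1)]) simp
        show "dle (tX * W $ i) (e + 2 - dd i)" by (rule dle_mult'[of tX 1, OF _ W(1)]) (simp_all add: dle_def)
      qed
      ultimately show ?thesis using V(2) W(2) by (simp add: E_def del: mult_pCons_left)
    qed
    from basis_rep[OF gb this] obtain x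
      where x: "\<forall>j<3. dle (x j) (e + 2 - int (\<delta> j))" "V - tX *s W = comb n x" by (elim exE conjE)
    define y where "y j = poly_shift 1 (x j)" for j
    define z where "z j = [:poly.coeff (x j) 0:]" for j
    have xyz: "x j = z j + tX * y j" for j unfolding y_def z_def by (rule shift_decomposition)
    have split: "comb n x = comb n z + tX *s comb n y"
      unfolding comb_def xyz by (simp add: vec_eq_iff algebra_simps del: mult_pCons_left mult_pCons_right)
    have yE: "comb n y \<in> E (e + 1)"
    proof (rule comb_E[OF gb])
      show "dle (y j) (e + 1 - int (\<delta> j))" if "j < 3" for j
        unfolding y_def using dle_shift[of "x j" "e + 2 - int (\<delta> j)"] x(1) that by (simp add: algebra_simps)
    qed
    have zE: "comb n z \<in> E (e + 1)"
    proof (rule comb_E[OF gb])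
      show "dle (z j) (e + 1 - int (\<delta> j))" if "j < 3" for j
        unfolding z_def by (rule dle_const) (use \<delta>[OF that] less.prems(2) in simp)
    qed
    let ?U = "W + comb n y"
    have tU: "tX *s ?U = V - comb n z"
      using x(2) unfolding split by (simp add: vector_add_ldistrib algebra_simps)
    have "dle (tX * ?U $ i) (e + 1 - dd i)" for i
    proof -
      have "dle ((V - comb n z) $ i) (e + 1 - dd i)" using dle_diff[OF V(1) E_dle[OF zE]] by simp
      then show ?thesis unfolding tU[symmetric] by simp
    qed
    then have "dle (?U $ i) (e - dd i)" for i using dle_tX_cancel[of "?U $ i" "e + 1 - dd i"] by (simp add: algebra_simps)
    moreover have "p = (\<Sum>i\<in>UNIV. ?U $ i * fh i)"
      using yE W(2) by (simp add: E_def distrib_right sum.distrib)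
    ultimately show ?thesis unfolding in_ideal_def by blast
  qed
qed

text \<open>Conversely, the basis element of degree \<open>k + 1\<close> obstructs this in degree \<open>k - 1\<close>.  Writing it as \<open>A - t B\<close>, one
  gets a form \<open>g\<close> of degree \<open>k - 1\<close> for which \<open>A\<close> represents \<open>t g\<close> and \<open>B\<close> represents \<open>g\<close> in degree \<open>k\<close>.  If \<open>Z\<close>
  represented \<open>g\<close> in degree \<open>k - 1\<close>, then \<open>A - t Z\<close> and \<open>B - Z\<close> would be syzygies of degree \<open>k\<close>, and the basis element
  would be a combination of the others.\<close>

lemma not_in_ideal_unbalanced:
  assumes gb: "graded_basis n \<delta>" and \<delta>: "int (\<delta> 2) = k + 1"
    and dk: "\<And>i. dd i \<le> k"
  shows "\<exists>p. dle p (k - 1) \<and> \<not> in_ideal p (k - 1)"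
proof (rule ccontr)
  assume no: "\<nexists>p. dle p (k - 1) \<and> \<not> in_ideal p (k - 1)"
  have n2: "n 2 \<in> E (k + 1)" using basis_mem[OF gb, of 2] \<delta> by simp
  define A where "A = (\<chi> i. [:poly.coeff (n 2 $ i) 0:])"
  define B where "B = (\<chi> i. - poly_shift 1 (n 2 $ i))"
  have nAB: "n 2 = A - tX *s B"
    unfolding vec_eq_iff
  proof
    show "n 2 $ i = (A - tX *s B) $ i" for i
      using shift_decomposition[of "n 2 $ i"] by (simp add: A_def B_def del: mult_pCons_left)
  qed
  have A: "dle (A $ i) (k - dd i)" for i unfolding A_def using dle_const[of "k - dd i"] dk[of i] by simp
  have B: "dle (B $ i) (k - dd i)" for i
    unfolding B_def using dle_uminus[OF dle_shift[OF E_dle[OF n2]], of i] by (simp add: algebra_simps)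
  let ?P = "\<Sum>i\<in>UNIV. A $ i * fh i" and ?R = "\<Sum>i\<in>UNIV. B $ i * fh i"
  have PR: "?P = tX * ?R"
  proof -
    have "0 = (\<Sum>i\<in>UNIV. (A - tX *s B) $ i * fh i)" using n2 unfolding nAB[symmetric] by (simp add: E_def)
    also have "\<dots> = ?P - tX * ?R"
      by (simp add: left_diff_distrib sum_subtractf sum_distrib_left mult.assoc del: mult_pCons_left)
    finally show ?thesis by simp
  qed
  have "dle ?P k" by (rule dle_sum) (rule dle_mult'[OF A dle_fh], simp)
  then have "dle ?R (k - 1)" unfolding PR by (rule dle_tX_cancel)
  then have "in_ideal ?R (k - 1)" using no by blast
  then obtain Z where Z: "\<And>i. dle (Z $ i) (k - 1 - dd i)" "?R = (\<Sum>i\<in>UNIV. Z $ i * fh i)" unfolding in_ideal_def by blast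
  have "A - tX *s Z \<in> E k"
  proof -
    have "(\<Sum>i\<in>UNIV. (A - tX *s Z) $ i * fh i) = ?P - tX * (\<Sum>i\<in>UNIV. Z $ i * fh i)"
      by (simp add: left_diff_distrib sum_subtractf sum_distrib_left mult.assoc del: mult_pCons_left)
    moreover have "dle (A $ i - tX * Z $ i) (k - dd i)" for i
      by (rule dle_diff[OF A dle_mult'[of tX 1, OF _ Z(1)]]) (simp_all add: dle_def)
    ultimately show ?thesis using PR Z(2) by (simp add: E_def del: mult_pCons_left)
  qed
  then obtain x where x: "A - tX *s Z = comb n x" "\<forall>j<3. k < int (\<delta> j) \<longrightarrow> x j = 0" using comb_gap[OF gb] by blast
  have "B - Z \<in> E k"
  proof -
    have "dle (B $ i - Z $ i) (k - dd i)" for i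
      by (rule dle_diff[OF B dle_mono[OF Z(1)]]) simp
    then show ?thesis using Z(2) by (simp add: E_def left_diff_distrib sum_subtractf)
  qed
  then obtain y where y: "B - Z = comb n y" "\<forall>j<3. k < int (\<delta> j) \<longrightarrow> y j = 0" using comb_gap[OF gb] by blast
  have xy2: "x 2 = 0" "y 2 = 0" using x(2) y(2) \<delta> by auto
  have "n 2 = (A - tX *s Z) - tX *s (B - Z)"
    unfolding nAB by (simp add: vec_eq_iff algebra_simps del: mult_pCons_left mult_pCons_right)
  then have "comb n (\<lambda>j. if j = 2 then - 1 else x j - tX * y j) = 0"
    unfolding x(1) y(1) by (simp add: comb_def xy2 vec_eq_iff algebra_simps del: mult_pCons_left mult_pCons_right)
  from comb_zero[OF gb this, of 2] show False by simp
qed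

end

section \<open>The weak Lefschetz property of the monomial algebra\<close>

context monomial_setup
begin

text \<open>The ideal of the four monomials is described by exponents, so that membership is decided term by term.\<close>

definition mon_ideal :: "'k poly3 set"
  where "mon_ideal = {g. \<forall>m\<in>Poly_Mapping.keys g. \<exists>i. \<forall>j. Poly_Mapping.lookup (ex i) j \<le> Poly_Mapping.lookup m j}"

lemma mon_ideal_add: "g \<in> mon_ideal \<Longrightarrow> h \<in> mon_ideal \<Longrightarrow> g + h \<in> mon_ideal"
  using Poly_Mapping.keys_add[of g h] by (fastforce simp: mon_ideal_def)

lemma mon_ideal_mult: assumes "g \<in> mon_ideal" shows "h * g \<in> mon_ideal"
  unfolding mon_ideal_def
proof (intro CollectI ballI)
  fix m assume "m \<in> Poly_Mapping.keys (h * g)"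
  then obtain m1 m2 where m: "m = m1 + m2" "m2 \<in> Poly_Mapping.keys g" using keys_mult[of h g] by blast
  then obtain i where "\<forall>j. Poly_Mapping.lookup (ex i) j \<le> Poly_Mapping.lookup m2 j" using assms by (auto simp: mon_ideal_def)
  then show "\<exists>i. \<forall>j. Poly_Mapping.lookup (ex i) j \<le> Poly_Mapping.lookup m j"
    unfolding m(1) lookup_add by (intro exI[of _ i]) (metis trans_le_add2)
qed

lemma mon_ideal_diff: "g \<in> mon_ideal \<Longrightarrow> h \<in> mon_ideal \<Longrightarrow> g - h \<in> mon_ideal"
  using mon_ideal_add[of g "(- 1) * h"] mon_ideal_mult[of h "- 1"] by simp

text \<open>Each term is divided by one of the generators that divide it.\<close>

lemma mon_ideal_rep:
  assumes g: "g \<in> mon_ideal" and e: "g \<in> forms e"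
  shows "\<exists>w :: 'k poly3 ^ 4. (\<forall>i. w $ i \<in> forms (e - int (dg i))) \<and> g = (\<Sum>i\<in>UNIV. w $ i * f $ i)"
proof -
  have "\<forall>m\<in>Poly_Mapping.keys g. \<exists>i. \<forall>j. Poly_Mapping.lookup (ex i) j \<le> Poly_Mapping.lookup m j" using g by (simp add: mon_ideal_def)
  then obtain s where s: "\<And>m j. m \<in> Poly_Mapping.keys g \<Longrightarrow> Poly_Mapping.lookup (ex (s m)) j \<le> Poly_Mapping.lookup m j" by metis
  define w where "w = (\<chi> i. \<Sum>m | m \<in> Poly_Mapping.keys g \<and> s m = i. Poly_Mapping.single (m - ex i) (Poly_Mapping.lookup g m))"
  have m: "m - ex (s m) + ex (s m) = m" if "m \<in> Poly_Mapping.keys g" for m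
    by (rule exponent_diff_add[OF s[OF that]])
  have "(\<Sum>i\<in>UNIV. w $ i * f $ i) = (\<Sum>i\<in>UNIV. \<Sum>m | m \<in> Poly_Mapping.keys g \<and> s m = i. Poly_Mapping.single m (Poly_Mapping.lookup g m))"
    unfolding w_def
    by (rule sum.cong) (use m in \<open>auto simp: sum_distrib_right f_monom3 mult_single intro!: sum.cong\<close>)
  also have "\<dots> = (\<Sum>m\<in>Poly_Mapping.keys g. Poly_Mapping.single m (Poly_Mapping.lookup g m))"
    by (rule sum.group) auto
  finally have "g = (\<Sum>i\<in>UNIV. w $ i * f $ i)" by (simp only: sum_monomials)
  moreover have "w $ i \<in> forms (e - int (dg i))" for i
    unfolding w_def vec_lambda_beta
  proof (rule forms_sum)
    fix m' assume "m' \<in> {m \<in> Poly_Mapping.keys g. s m = i}"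
    then have "m' \<in> Poly_Mapping.keys g" "m' - ex i + ex i = m'" using m by auto
    then have "int (mdeg (m' - ex i)) = e - int (dg i)"
      using e mdeg_add[of "m' - ex i" "ex i"] by (auto simp: forms_def)
    then show "Poly_Mapping.single (m' - ex i) (Poly_Mapping.lookup g m') \<in> forms (e - int (dg i))" by (auto simp: forms_def)
  qed
  ultimately show ?thesis by blast
qed

lemma mon_ideal_f: "(\<Sum>i\<in>UNIV. w $ i * f $ i) \<in> mon_ideal"
proof -
  have "f $ i \<in> mon_ideal" for i by (auto simp: mon_ideal_def f_monom3)
  then have "w $ i * f $ i \<in> mon_ideal" for i by (rule mon_ideal_mult)
  then show ?thesis unfolding sum_4 by (intro mon_ideal_add)
qed

lemma genideal_eq: "genideal PR (range (($) f)) = mon_ideal"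
proof
  interpret R: cring "PR :: 'k poly3 ring" by (rule ring_PR)
  have f: "f $ i \<in> mon_ideal" for i by (auto simp: mon_ideal_def f_monom3)
  show "genideal PR (range (($) f)) \<subseteq> mon_ideal"
  proof (rule R.genideal_minimal)
    show "ideal mon_ideal PR"
      by (rule ideal_PR_I) (auto intro: mon_ideal_add mon_ideal_mult, simp add: mon_ideal_def)
  qed (use f in auto)
  show "mon_ideal \<subseteq> genideal PR (range (($) f))"
  proof
    fix g assume g: "g \<in> mon_ideal"
    interpret J: ideal "genideal PR (range (($) f))" PR by (rule R.genideal_ideal) simp
    have fJ: "f $ i \<in> genideal PR (range (($) f))" for i
      using R.genideal_self[of "range (($) f)"] by auto
    have "Poly_Mapping.single m (Poly_Mapping.lookup g m) \<in> genideal PR (range (($) f))" if m: "m \<in> Poly_Mapping.keys g" for m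
    proof -
      obtain i where "\<And>j. Poly_Mapping.lookup (ex i) j \<le> Poly_Mapping.lookup m j" using g m by (auto simp: mon_ideal_def)
      then have "Poly_Mapping.single m (Poly_Mapping.lookup g m) = Poly_Mapping.single (m - ex i) (Poly_Mapping.lookup g m) * f $ i"
        by (simp add: f_monom3 mult_single exponent_diff_add)
      then show ?thesis using J.I_l_closed[OF fJ[of i], of "Poly_Mapping.single (m - ex i) (Poly_Mapping.lookup g m)"] by simp
    qed
    note single = this
    have "(\<Sum>m\<in>A. Poly_Mapping.single m (Poly_Mapping.lookup g m)) \<in> genideal PR (range (($) f))" if A: "finite A" "A \<subseteq> Poly_Mapping.keys g" for A
      using A
    proof (induction A)
      case empty
      show ?case using additive_subgroup.zero_closed[OF J.is_additive_subgroup] by simp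
    next
      case (insert m A)
      then show ?case
        using additive_subgroup.a_closed[OF J.is_additive_subgroup, of "Poly_Mapping.single m (Poly_Mapping.lookup g m)"] single[of m] by simp
    qed
    from this[OF finite_keys subset_refl] show "g \<in> genideal PR (range (($) f))" by (simp only: sum_monomials)
  qed
qed

definition mult_inj :: "'k poly3 \<Rightarrow> int \<Rightarrow> bool"
  where "mult_inj l i \<longleftrightarrow> (\<forall>g\<in>forms i. l * g \<in> mon_ideal \<longrightarrow> g \<in> mon_ideal)"

definition mult_surj :: "'k poly3 \<Rightarrow> int \<Rightarrow> bool"
  where "mult_surj l i \<longleftrightarrow> (\<forall>h\<in>forms (i + 1). \<exists>g\<in>forms i. h - l * g \<in> mon_ideal)"

text \<open>Multiplication on the quotient ring is expressed through representatives: injectivity and surjectivity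
  become \<open>mult_inj\<close> and \<open>mult_surj\<close>.\<close>

lemma weak_lefschetz_iff:
  "weak_lefschetz mon_ideal \<longleftrightarrow> (\<exists>l\<in>forms 1. \<forall>i. mult_inj l (int i) \<or> mult_surj l (int i))"
proof -
  interpret R: cring "PR :: 'k poly3 ring" by (rule ring_PR)
  interpret J: ideal "mon_ideal" PR
    by (rule ideal_PR_I) (auto intro: mon_ideal_add mon_ideal_mult, simp add: mon_ideal_def)
  have coset: "mon_ideal +>\<^bsub>PR\<^esub> g = {h + g |h. h \<in> mon_ideal}" for g
    by (auto simp: a_r_coset_def r_coset_def)
  have eq: "mon_ideal +>\<^bsub>PR\<^esub> g = mon_ideal +>\<^bsub>PR\<^esub> h \<longleftrightarrow> g - h \<in> mon_ideal" for g h
  proof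
    assume "mon_ideal +>\<^bsub>PR\<^esub> g = mon_ideal +>\<^bsub>PR\<^esub> h"
    moreover have "g \<in> mon_ideal +>\<^bsub>PR\<^esub> g" unfolding coset
      by (intro CollectI exI[of _ 0]) (simp add: mon_ideal_def)
    ultimately show "g - h \<in> mon_ideal" unfolding coset by auto
  next
    assume *: "g - h \<in> mon_ideal"
    show "mon_ideal +>\<^bsub>PR\<^esub> g = mon_ideal +>\<^bsub>PR\<^esub> h"
    proof (rule subset_antisym; rule subsetI)
      fix x assume "x \<in> mon_ideal +>\<^bsub>PR\<^esub> g"
      then obtain y where "y \<in> mon_ideal" "x = y + g" unfolding coset by auto
      then show "x \<in> mon_ideal +>\<^bsub>PR\<^esub> h" unfolding coset
        using mon_ideal_add[OF _ *] by (intro CollectI exI[of _ "y + (g - h)"]) simp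
    next
      fix x assume "x \<in> mon_ideal +>\<^bsub>PR\<^esub> h"
      then obtain y where "y \<in> mon_ideal" "x = y + h" unfolding coset by auto
      then show "x \<in> mon_ideal +>\<^bsub>PR\<^esub> g" unfolding coset
        using mon_ideal_diff[OF _ *] by (intro CollectI exI[of _ "y - (g - h)"]) simp
    qed
  qed
  have mult: "(mon_ideal +>\<^bsub>PR\<^esub> l) \<otimes>\<^bsub>PR Quot mon_ideal\<^esub> (mon_ideal +>\<^bsub>PR\<^esub> g) = mon_ideal +>\<^bsub>PR\<^esub> (l * g)" for l g
    using J.rcoset_mult_add[of l g] by (simp add: FactRing_def)
  have inj: "inj_on (\<lambda>A. (mon_ideal +>\<^bsub>PR\<^esub> l) \<otimes>\<^bsub>PR Quot mon_ideal\<^esub> A) (quot_piece mon_ideal i) \<longleftrightarrow> mult_inj l (int i)" for l i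
  proof
    assume inj: "inj_on (\<lambda>A. (mon_ideal +>\<^bsub>PR\<^esub> l) \<otimes>\<^bsub>PR Quot mon_ideal\<^esub> A) (quot_piece mon_ideal i)"
    show "mult_inj l (int i)" unfolding mult_inj_def
    proof (intro ballI impI)
      fix g assume g: "g \<in> forms (int i)" "l * g \<in> mon_ideal"
      have "mon_ideal +>\<^bsub>PR\<^esub> (l * g) = mon_ideal +>\<^bsub>PR\<^esub> (l * 0)" unfolding eq using g by simp
      then have "(mon_ideal +>\<^bsub>PR\<^esub> l) \<otimes>\<^bsub>PR Quot mon_ideal\<^esub> (mon_ideal +>\<^bsub>PR\<^esub> g)
          = (mon_ideal +>\<^bsub>PR\<^esub> l) \<otimes>\<^bsub>PR Quot mon_ideal\<^esub> (mon_ideal +>\<^bsub>PR\<^esub> 0)" unfolding mult .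
      moreover have "mon_ideal +>\<^bsub>PR\<^esub> g \<in> quot_piece mon_ideal i" "mon_ideal +>\<^bsub>PR\<^esub> 0 \<in> quot_piece mon_ideal i"
        unfolding quot_piece_def by (rule imageI, simp add: g(1))+
      ultimately have "mon_ideal +>\<^bsub>PR\<^esub> g = mon_ideal +>\<^bsub>PR\<^esub> 0" by (rule inj_onD[OF inj])
      then show "g \<in> mon_ideal" unfolding eq by simp
    qed
  next
    assume m: "mult_inj l (int i)"
    show "inj_on (\<lambda>A. (mon_ideal +>\<^bsub>PR\<^esub> l) \<otimes>\<^bsub>PR Quot mon_ideal\<^esub> A) (quot_piece mon_ideal i)"
    proof (rule inj_onI)
      fix A B assume "A \<in> quot_piece mon_ideal i" "B \<in> quot_piece mon_ideal i"
        and AB: "(mon_ideal +>\<^bsub>PR\<^esub> l) \<otimes>\<^bsub>PR Quot mon_ideal\<^esub> A = (mon_ideal +>\<^bsub>PR\<^esub> l) \<otimes>\<^bsub>PR Quot mon_ideal\<^esub> B"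
      then obtain g h where gh: "g \<in> forms (int i)" "h \<in> forms (int i)" "A = mon_ideal +>\<^bsub>PR\<^esub> g" "B = mon_ideal +>\<^bsub>PR\<^esub> h"
        unfolding quot_piece_def by blast
      have "l * (g - h) \<in> mon_ideal" using AB unfolding gh mult eq by (simp add: right_diff_distrib)
      then have "g - h \<in> mon_ideal" using m forms_diff[OF gh(1,2)] unfolding mult_inj_def by blast
      then show "A = B" unfolding gh eq .
    qed
  qed
  have surj: "(\<lambda>A. (mon_ideal +>\<^bsub>PR\<^esub> l) \<otimes>\<^bsub>PR Quot mon_ideal\<^esub> A) ` quot_piece mon_ideal i = quot_piece mon_ideal (Suc i) \<longleftrightarrow> mult_surj l (int i)"
    if l: "l \<in> forms 1" for l i
  proof -
    have i1: "int (Suc i) = int i + 1" by simp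
    have lg: "l * g \<in> forms (int i + 1)" if "g \<in> forms (int i)" for g
      using forms_mult[OF l that] by (simp add: add.commute)
    have img: "(\<lambda>A. (mon_ideal +>\<^bsub>PR\<^esub> l) \<otimes>\<^bsub>PR Quot mon_ideal\<^esub> A) ` quot_piece mon_ideal i
        = (\<lambda>g. mon_ideal +>\<^bsub>PR\<^esub> (l * g)) ` forms (int i)"
      unfolding quot_piece_def image_image mult ..
    show ?thesis unfolding img
    proof
      assume *: "(\<lambda>g. mon_ideal +>\<^bsub>PR\<^esub> (l * g)) ` forms (int i) = quot_piece mon_ideal (Suc i)"
      show "mult_surj l (int i)" unfolding mult_surj_def
      proof
        fix h :: "'k poly3" assume "h \<in> forms (int i + 1)"
        then have "mon_ideal +>\<^bsub>PR\<^esub> h \<in> quot_piece mon_ideal (Suc i)" unfolding quot_piece_def i1 by blast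
        then obtain g where g: "g \<in> forms (int i)" "mon_ideal +>\<^bsub>PR\<^esub> h = mon_ideal +>\<^bsub>PR\<^esub> (l * g)" unfolding *[symmetric] by (elim imageE)
        show "\<exists>g\<in>forms (int i). h - l * g \<in> mon_ideal" using g unfolding eq by (intro bexI[of _ g])
      qed
    next
      assume m: "mult_surj l (int i)"
      show "(\<lambda>g. mon_ideal +>\<^bsub>PR\<^esub> (l * g)) ` forms (int i) = quot_piece mon_ideal (Suc i)"
      proof (rule subset_antisym; rule subsetI)
        fix A assume "A \<in> (\<lambda>g. mon_ideal +>\<^bsub>PR\<^esub> (l * g)) ` forms (int i)"
        then show "A \<in> quot_piece mon_ideal (Suc i)" unfolding quot_piece_def i1 using lg by blast
      next
        fix A assume "A \<in> quot_piece mon_ideal (Suc i)"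
        then obtain h where h: "h \<in> forms (int i + 1)" "A = mon_ideal +>\<^bsub>PR\<^esub> h" unfolding quot_piece_def i1 by blast
        then obtain g where g: "g \<in> forms (int i)" "h - l * g \<in> mon_ideal" using m unfolding mult_surj_def by blast
        have "A = mon_ideal +>\<^bsub>PR\<^esub> (l * g)" using eq[THEN iffD2, OF g(2)] by (simp only: h(2))
        then show "A \<in> (\<lambda>g. mon_ideal +>\<^bsub>PR\<^esub> (l * g)) ` forms (int i)"
          using image_eqI[where f = "\<lambda>g. mon_ideal +>\<^bsub>PR\<^esub> (l * g)", OF refl g(1)] by (simp only:)
      qed
    qed
  qed
  have "(\<forall>i. inj_on (\<lambda>A. (mon_ideal +>\<^bsub>PR\<^esub> l) \<otimes>\<^bsub>PR Quot mon_ideal\<^esub> A) (quot_piece mon_ideal i) \<or>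
        (\<lambda>A. (mon_ideal +>\<^bsub>PR\<^esub> l) \<otimes>\<^bsub>PR Quot mon_ideal\<^esub> A) ` quot_piece mon_ideal i = quot_piece mon_ideal (Suc i))
      \<longleftrightarrow> (\<forall>i. mult_inj l (int i) \<or> mult_surj l (int i))" if "l \<in> forms 1" for l
    by (simp only: inj surj[OF that])
  then show ?thesis unfolding weak_lefschetz_def Let_def by (rule bex_cong[OF refl])
qed

subsection \<open>Filling in the missing variables of a linear form\<close>

text \<open>The ideal is monomial.  Hence a linear form that does not involve a variable may be seen as the
  part of lowest degree in this variable of a linear form that does, and maximal rank passes from the
  former to the latter.\<close>

lemma keys_mult_grade:
  assumes "\<And>m. m \<in> Poly_Mapping.keys g \<Longrightarrow> Poly_Mapping.lookup m j = r" "\<And>m. m \<in> Poly_Mapping.keys h \<Longrightarrow> Poly_Mapping.lookup m j = s" "m \<in> Poly_Mapping.keys (g * h)"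
  shows "Poly_Mapping.lookup m j = r + s"
  using assms keys_mult[of g h] by (fastforce simp: lookup_add)

lemma linear_form_without:
  assumes "cf j = 0" "m \<in> Poly_Mapping.keys (linear_form cf)"
  shows "Poly_Mapping.lookup m j = 0"
proof -
  have "Poly_Mapping.keys (linear_form cf) \<subseteq> (\<Union>i\<in>UNIV. Poly_Mapping.keys (Const (cf i) * Var i))"
    unfolding linear_form_def by (rule keys_sum)
  then obtain i where i: "m \<in> Poly_Mapping.keys (Const (cf i) * Var i)" using assms(2) by blast
  then have "cf i \<noteq> 0" "m = Poly_Mapping.single i 1" by (auto simp: Var_def Const_mult_single split: if_splits)
  then show ?thesis using assms(1) by (auto simp: lookup_single when_def)
qed

lemma linear_form_upd: assumes "cf j = 0" shows "linear_form (cf(j := 1)) = linear_form cf + Var j"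
proof -
  have "linear_form (cf(j := 1)) = (\<Sum>i\<in>UNIV. Const (cf i) * Var i + (if i = j then Var j else 0))"
    unfolding linear_form_def using assms by (intro sum.cong) (auto simp: Const_def)
  then show ?thesis by (simp add: linear_form_def sum.distrib)
qed

text \<open>The monomials outside the ideal form a basis of the quotient.\<close>

definition outside :: "(3 \<Rightarrow>\<^sub>0 nat) \<Rightarrow> bool"
  where "outside m \<longleftrightarrow> \<not> (\<exists>i. \<forall>j. Poly_Mapping.lookup (ex i) j \<le> Poly_Mapping.lookup m j)"

lemma mon_ideal_iff: "g \<in> mon_ideal \<longleftrightarrow> (\<forall>m\<in>Poly_Mapping.keys g. \<not> outside m)"
  by (simp add: mon_ideal_def outside_def)

lemma part_mon_ideal: "g \<in> mon_ideal \<Longrightarrow> part Q g \<in> mon_ideal"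
  by (auto simp: mon_ideal_iff keys_part)

text \<open>In a form of the kernel, the terms outside the ideal with the least exponent of the variable \<open>j\<close> would be
  in the kernel of the linear form without \<open>j\<close>: no other terms contribute to the same exponent.\<close>

lemma inj_fill:
  assumes cj: "cf j = 0" and inj: "mult_inj (linear_form cf) i"
  shows "mult_inj (linear_form (cf(j := 1))) i"
  unfolding mult_inj_def
proof (intro ballI impI, rule ccontr)
  let ?l = "linear_form cf" and ?l' = "linear_form (cf(j := 1))"
  fix g assume g: "g \<in> forms i" and lg: "?l' * g \<in> mon_ideal" and no: "g \<notin> mon_ideal"
  define r where "r = (LEAST r. \<exists>m\<in>Poly_Mapping.keys g. outside m \<and> Poly_Mapping.lookup m j = r)"
  have "\<exists>r. \<exists>m\<in>Poly_Mapping.keys g. outside m \<and> Poly_Mapping.lookup m j = r" using no by (auto simp: mon_ideal_iff)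
  then have "\<exists>m\<in>Poly_Mapping.keys g. outside m \<and> Poly_Mapping.lookup m j = r" unfolding r_def by (rule LeastI_ex)
  then obtain m0 where m0: "m0 \<in> Poly_Mapping.keys g" "outside m0" "Poly_Mapping.lookup m0 j = r" by blast
  have least: "r \<le> Poly_Mapping.lookup m j" if "m \<in> Poly_Mapping.keys g" "outside m" for m
    unfolding r_def by (rule Least_le) (use that in blast)
  \<comment> \<open>In \<open>g\<close>, the part \<open>g1\<close> has the least exponent of \<open>j\<close> outside the ideal, and \<open>g2\<close> larger ones.\<close>
  define g1 where "g1 = part (\<lambda>m. outside m \<and> Poly_Mapping.lookup m j = r) g"
  define g2 where "g2 = part (\<lambda>m. outside m \<and> Poly_Mapping.lookup m j \<noteq> r) g"
  define g3 where "g3 = part (\<lambda>m. \<not> outside m) g"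
  have g123: "g = g1 + g2 + g3"
    by (rule poly_mapping_eqI) (simp add: g1_def g2_def g3_def lookup_add lookup_part)
  have "g1 \<notin> mon_ideal" using m0 by (auto simp: g1_def mon_ideal_iff keys_part)
  moreover have "g1 \<in> forms i" unfolding g1_def by (rule part_forms[OF g])
  ultimately have "?l * g1 \<notin> mon_ideal" using inj unfolding mult_inj_def by blast
  then obtain m where m: "m \<in> Poly_Mapping.keys (?l * g1)" "outside m" by (auto simp: mon_ideal_iff)
  have g1r: "Poly_Mapping.lookup m' j = r" if "m' \<in> Poly_Mapping.keys g1" for m' using that by (simp add: g1_def keys_part)
  have mr: "Poly_Mapping.lookup m j = 0 + r"
    by (rule keys_mult_grade[OF linear_form_without[of cf j, OF cj] g1r m(1)])
  have z1: "Poly_Mapping.lookup (Var j * g1) m = 0"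
  proof (rule ccontr)
    assume "Poly_Mapping.lookup (Var j * g1) m \<noteq> 0"
    then have k: "m \<in> Poly_Mapping.keys (Var j * g1)" by (simp add: in_keys_iff)
    have "Poly_Mapping.lookup m j = 1 + r"
      by (rule keys_mult_grade[OF _ g1r k]) (simp add: Var_def)
    then show False using mr by simp
  qed
  have z2: "Poly_Mapping.lookup (?l' * g2) m = 0"
  proof (rule ccontr)
    assume "Poly_Mapping.lookup (?l' * g2) m \<noteq> 0"
    then have "m \<in> Poly_Mapping.keys (?l' * g2)" by (simp add: in_keys_iff)
    then obtain m1 m2 where m12: "m = m1 + m2" "m2 \<in> Poly_Mapping.keys g2" using keys_mult[of ?l' g2] by blast
    then have "r < Poly_Mapping.lookup m2 j" using least[of m2] by (auto simp: g2_def keys_part)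
    then show False using mr m12(1) by (simp add: lookup_add)
  qed
  have z3: "Poly_Mapping.lookup (?l' * g3) m = 0"
  proof -
    have "?l' * g3 \<in> mon_ideal" by (rule mon_ideal_mult) (simp add: g3_def mon_ideal_iff keys_part)
    then show ?thesis using m(2) by (auto simp: mon_ideal_iff in_keys_iff)
  qed
  have "?l' * g = ?l * g1 + Var j * g1 + ?l' * g2 + ?l' * g3"
    unfolding g123 linear_form_upd[of cf j, OF cj] by (simp add: algebra_simps)
  then have "Poly_Mapping.lookup (?l' * g) m = Poly_Mapping.lookup (?l * g1) m" using z1 z2 z3 by (simp add: lookup_add)
  then have "m \<in> Poly_Mapping.keys (?l' * g)" using m(1) by (simp add: in_keys_iff)
  then show False using lg m(2) by (auto simp: mon_ideal_iff)
qed

text \<open>Preimages are built from low to high exponents of the variable \<open>j\<close>.  The part of lowest exponent is hit by the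
  linear form without \<open>j\<close>, and the summand \<open>Var j\<close> produces terms of higher exponent, until the exponent exceeds
  the degree.\<close>

lemma surj_fill:
  assumes cj: "cf j = 0" and surj: "mult_surj (linear_form cf) i"
  shows "mult_surj (linear_form (cf(j := 1))) i"
proof -
  let ?l = "linear_form cf" and ?l' = "linear_form (cf(j := 1))"
  have step: "\<exists>g\<in>forms i. h - ?l' * g \<in> mon_ideal"
    if "h \<in> forms (i + 1)" "\<forall>m\<in>Poly_Mapping.keys h. r \<le> Poly_Mapping.lookup m j" for h r
    using that
  \<comment> \<open>An exponent \<open>i + 2\<close> exceeds the degree \<open>i + 1\<close>, so that nothing is left when \<open>r\<close> reaches it.\<close>
  proof (induction "nat (i + 2) - r" arbitrary: h r rule: less_induct)
    case less
    show ?case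
    proof (cases "nat (i + 2) \<le> r")
      case True
      have "h = 0"
      proof (rule ccontr)
        assume "h \<noteq> 0"
        then obtain m where m: "m \<in> Poly_Mapping.keys h" by (metis keys_eq_empty ex_in_conv)
        have "Poly_Mapping.lookup m j \<le> mdeg m" unfolding mdeg_def by (rule member_le_sum) auto
        moreover have "int (mdeg m) = i + 1" using less.prems(1) m by (simp add: forms_def)
        moreover have "r \<le> Poly_Mapping.lookup m j" using less.prems(2) m by blast
        ultimately show False using True by linarith
      qed
      then show ?thesis by (intro bexI[of _ 0]) (auto simp: mon_ideal_def)
    next
      case False
      let ?r = "\<lambda>m. Poly_Mapping.lookup m j = r"
      obtain g where g: "g \<in> forms i" "part ?r h - ?l * g \<in> mon_ideal"
        using surj part_forms[OF less.prems(1)] unfolding mult_surj_def by blast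
      let ?g = "part ?r g"
      have gF: "?g \<in> forms i" by (rule part_forms[OF g(1)])
      have split_l: "part ?r (?l * g) = ?l * ?g"
      proof (rule poly_mapping_eqI)
        fix m
        have "g = ?g + part (\<lambda>m. \<not> ?r m) g"
          by (rule poly_mapping_eqI) (simp add: lookup_add lookup_part)
        then have "?l * g = ?l * ?g + ?l * part (\<lambda>m. \<not> ?r m) g" by (metis distrib_left)
        moreover have "Poly_Mapping.lookup (?l * ?g) m = 0" if "\<not> ?r m"
        proof (rule ccontr)
          assume "Poly_Mapping.lookup (?l * ?g) m \<noteq> 0"
          then have k: "m \<in> Poly_Mapping.keys (?l * ?g)" by (simp add: in_keys_iff)
          have "Poly_Mapping.lookup m j = 0 + r"
            by (rule keys_mult_grade[OF linear_form_without[of cf j, OF cj] _ k]) (auto simp: keys_part)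
          then show False using that by simp
        qed
        moreover have "Poly_Mapping.lookup (?l * part (\<lambda>m. \<not> ?r m) g) m = 0" if "?r m"
        proof (rule ccontr)
          assume "Poly_Mapping.lookup (?l * part (\<lambda>m. \<not> ?r m) g) m \<noteq> 0"
          then have "m \<in> Poly_Mapping.keys (?l * part (\<lambda>m. \<not> ?r m) g)" by (simp add: in_keys_iff)
          then obtain m1 m2 where "m = m1 + m2" "m1 \<in> Poly_Mapping.keys ?l" "m2 \<in> Poly_Mapping.keys (part (\<lambda>m. \<not> ?r m) g)"
            using keys_mult[of ?l "part (\<lambda>m. \<not> ?r m) g"] by blast
          then show False using linear_form_without[of cf j m1, OF cj] that by (simp add: keys_part lookup_add)
        qed
        ultimately show "Poly_Mapping.lookup (part ?r (?l * g)) m = Poly_Mapping.lookup (?l * ?g) m" by (auto simp: lookup_part lookup_add)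
      qed
      have "part ?r (part ?r h - ?l * g) = part ?r h - part ?r (?l * g)"
        by (rule poly_mapping_eqI) (simp add: lookup_part lookup_minus)
      then have red: "part ?r h - ?l * ?g \<in> mon_ideal"
        using part_mon_ideal[OF g(2), of ?r] split_l by simp
      let ?h = "(h - part ?r h) - Var j * ?g"
      have hF: "?h \<in> forms (i + 1)"
      proof (intro forms_diff part_forms less.prems(1))
        show "Var j * ?g \<in> forms (i + 1)" using forms_mult[OF Var_forms gF] by (simp add: add.commute)
      qed
      moreover have "\<forall>m\<in>Poly_Mapping.keys ?h. Suc r \<le> Poly_Mapping.lookup m j"
      proof
        fix m assume m: "m \<in> Poly_Mapping.keys ?h"
        have "m \<in> Poly_Mapping.keys (h - part ?r h) \<or> m \<in> Poly_Mapping.keys (Var j * ?g)"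
          using m by (auto simp: in_keys_iff lookup_minus)
        then show "Suc r \<le> Poly_Mapping.lookup m j"
        proof
          assume "m \<in> Poly_Mapping.keys (h - part ?r h)"
          then have "m \<in> Poly_Mapping.keys h" "\<not> ?r m" by (auto simp: in_keys_iff lookup_minus lookup_part split: if_splits)
          then show ?thesis using less.prems(2) by fastforce
        next
          assume k: "m \<in> Poly_Mapping.keys (Var j * ?g)"
          have "Poly_Mapping.lookup m j = 1 + r"
            by (rule keys_mult_grade[OF _ _ k]) (simp_all add: Var_def keys_part)
          then show ?thesis by simp
        qed
      qed
      ultimately obtain g' where g': "g' \<in> forms i" "?h - ?l' * g' \<in> mon_ideal"
        using less.hyps[of "Suc r" ?h] False by (metis diff_less_mono2 lessI not_le)
      have "h - ?l' * (?g + g') = (part ?r h - ?l * ?g) + (?h - ?l' * g')"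
        unfolding linear_form_upd[of cf j, OF cj] by (simp add: algebra_simps)
      then have "h - ?l' * (?g + g') \<in> mon_ideal" using mon_ideal_add[OF red g'(2)] by (simp only:)
      then show ?thesis using forms_add[OF gF g'(1)] by blast
    qed
  qed
  show ?thesis unfolding mult_surj_def using step[of _ 0] by simp
qed

lemma forms_one_linear: assumes "l \<in> forms 1" shows "l = linear_form (\<lambda>i. Poly_Mapping.lookup l (Poly_Mapping.single i 1))"
proof (rule poly_mapping_eqI)
  fix m
  show "Poly_Mapping.lookup l m = Poly_Mapping.lookup (linear_form (\<lambda>i. Poly_Mapping.lookup l (Poly_Mapping.single i 1))) m"
  proof (cases "\<exists>i. m = Poly_Mapping.single i 1")
    case True
    then show ?thesis by (elim exE) (simp only: lookup_linear_form)
  next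
    case False
    have "mdeg m \<noteq> 1"
    proof
      assume 1: "mdeg m = 1"
      then obtain i where i: "Poly_Mapping.lookup m i \<noteq> 0" unfolding mdeg_def by (metis sum.neutral zero_neq_one)
      have "(\<Sum>j\<in>UNIV. Poly_Mapping.lookup m j) = Poly_Mapping.lookup m i + (\<Sum>j\<in>UNIV - {i}. Poly_Mapping.lookup m j)" by (rule sum.remove) auto
      then have s: "Poly_Mapping.lookup m i = 1" "(\<Sum>j\<in>UNIV - {i}. Poly_Mapping.lookup m j) = 0" using 1 i unfolding mdeg_def by linarith+
      have "m = Poly_Mapping.single i 1"
      proof (rule poly_mapping_eqI)
        show "Poly_Mapping.lookup m j = Poly_Mapping.lookup (Poly_Mapping.single i 1) j" for j
          using s by (cases "j = i") (auto simp: lookup_single when_def)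
      qed
      then show False using False by blast
    qed
    then have "m \<notin> Poly_Mapping.keys l" "m \<notin> Poly_Mapping.keys (linear_form (\<lambda>i. Poly_Mapping.lookup l (Poly_Mapping.single i 1)))"
      using assms linear_form_forms[of "\<lambda>i. Poly_Mapping.lookup l (Poly_Mapping.single i 1)"] by (auto simp: forms_def)
    then show ?thesis by (simp add: in_keys_iff)
  qed
qed

text \<open>The three variables are filled in one after the other.  Thus maximal rank in one degree may be tested on a
  line that avoids the coordinate points.\<close>

lemma general_linear_form:
  assumes "mult_inj (linear_form cf) i \<or> mult_surj (linear_form cf) i"
  shows "\<exists>cf'. (\<forall>j. cf' j \<noteq> 0) \<and> (mult_inj (linear_form cf') i \<or> mult_surj (linear_form cf') i)"
proof -
  let ?P = "\<lambda>cf. mult_inj (linear_form cf) i \<or> mult_surj (linear_form cf) i"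
  have fill: "\<exists>cf'. ?P cf' \<and> cf' j \<noteq> 0 \<and> (\<forall>l. cf l \<noteq> 0 \<longrightarrow> cf' l \<noteq> 0)" if cf: "?P cf" for cf j
  proof (cases "cf j = 0")
    case True
    then have "?P (cf(j := 1))" using cf inj_fill[of cf j i] surj_fill[of cf j i] by blast
    then show ?thesis by (intro exI[of _ "cf(j := 1)"]) simp
  qed (use cf in blast)
  obtain c0 where 0: "?P c0" "c0 0 \<noteq> 0" using fill[OF assms, of 0] by blast
  obtain c1 where 1: "?P c1" "c1 0 \<noteq> 0" "c1 1 \<noteq> 0" using fill[OF 0(1), of 1] 0(2) by blast
  obtain c2 where 2: "?P c2" "c2 0 \<noteq> 0" "c2 1 \<noteq> 0" "c2 2 \<noteq> 0" using fill[OF 1(1), of 2] 1(2,3) by blast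
  have "c2 j \<noteq> 0" for j using exhaust_3'[of j] 2 by auto
  then show ?thesis using 2(1) by blast
qed

end

subsection \<open>Maximal rank and the splitting type\<close>

context monomial_line
begin

text \<open>If \<open>l g\<close> is a combination of the monomials, then its coefficients restrict to a syzygy on the line.  When this
  vanishes, the coefficients are divisible by \<open>l\<close>.\<close>

lemma mult_inj_of_no_syzygies:
  assumes "E (i + 1) = {0}"
  shows "mult_inj ell i"
  unfolding mult_inj_def
proof (intro ballI impI)
  fix g assume g: "g \<in> forms i" and lg: "ell * g \<in> mon_ideal"
  have "ell * g \<in> forms (i + 1)" using forms_mult[OF linear_form_forms g] by (simp add: add.commute)
  from mon_ideal_rep[OF lg this] obtain w :: "'k poly3 ^ 4" where w: "\<And>j. w $ j \<in> forms (i + 1 - int (dg j))"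
    "ell * g = (\<Sum>j\<in>UNIV. w $ j * f $ j)" by blast
  have "\<rho> (\<Sum>j\<in>UNIV. w $ j * f $ j) = 0" unfolding w(2)[symmetric] by (simp add: \<rho>_mult \<rho>_ell)
  then have "toE w \<in> E (i + 1)" using toE_dle[OF w(1)] unfolding \<rho>_sum_f by (simp add: E_def)
  then have "toE w = 0" using assms by simp
  then have r: "\<rho> (w $ j) = 0" for j unfolding toE_zero_iff by blast
  obtain u where u: "w = ell *s u" by (rule vector_kernel[OF w(1) r])
  have "ell * g = ell * (\<Sum>j\<in>UNIV. u $ j * f $ j)" using w(2) unfolding u syz_smult_sum .
  then have "g = (\<Sum>j\<in>UNIV. u $ j * f $ j)" using ell_nonzero by simp
  then show "g \<in> mon_ideal" using mon_ideal_f by simp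
qed

text \<open>The cokernel of the multiplication by \<open>l\<close> is the homogeneous quotient of the binary forms by the restricted
  monomials.\<close>

lemma mult_surj_iff: "mult_surj ell i \<longleftrightarrow> (\<forall>p. dle p (i + 1) \<longrightarrow> in_ideal p (i + 1))"
proof
  assume s: "mult_surj ell i"
  show "\<forall>p. dle p (i + 1) \<longrightarrow> in_ideal p (i + 1)"
  proof (intro allI impI)
    fix p :: "'k poly" assume "dle p (i + 1)"
    then obtain h where h: "h \<in> forms (i + 1)" "\<rho> h = p" using \<rho>_surj by blast
    obtain g where g: "g \<in> forms i" "h - ell * g \<in> mon_ideal" using s h(1) unfolding mult_surj_def by blast
    have "h - ell * g \<in> forms (i + 1)"
      using forms_diff[OF h(1)] forms_mult[OF linear_form_forms g(1)] by (simp add: add.commute)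
    from mon_ideal_rep[OF g(2) this] obtain w :: "'k poly3 ^ 4" where w: "\<And>j. w $ j \<in> forms (i + 1 - int (dg j))"
      "h - ell * g = (\<Sum>j\<in>UNIV. w $ j * f $ j)" by blast
    have "p = \<rho> (h - ell * g)" using h(2) by (simp add: \<rho>_diff \<rho>_mult \<rho>_ell)
    also have "\<dots> = (\<Sum>j\<in>UNIV. toE w $ j * fh j)" unfolding w(2) by (rule \<rho>_sum_f)
    finally show "in_ideal p (i + 1)" unfolding in_ideal_def using toE_dle[OF w(1)] by blast
  qed
next
  assume *: "\<forall>p. dle p (i + 1) \<longrightarrow> in_ideal p (i + 1)"
  show "mult_surj ell i" unfolding mult_surj_def
  proof
    fix h :: "'k poly3" assume h: "h \<in> forms (i + 1)"
    then have "in_ideal (\<rho> h) (i + 1)" using * \<rho>_dle by blast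
    then obtain V where V: "\<And>j. dle (V $ j) (i + 1 - dd j)" "\<rho> h = (\<Sum>j\<in>UNIV. V $ j * fh j)"
      unfolding in_ideal_def by blast
    obtain v where v: "\<And>j. v $ j \<in> forms (i + 1 - int (dg j))" "toE v = V" using toE_lift[OF V(1)] by blast
    let ?s = "\<Sum>j\<in>UNIV. v $ j * f $ j"
    have "?s \<in> forms (i + 1)"
    proof (rule forms_sum)
      show "v $ j * f $ j \<in> forms (i + 1)" for j using forms_mult[OF v(1)[of j] f_forms[of j]] by simp
    qed
    then have "h - ?s \<in> forms (i + 1)" by (rule forms_diff[OF h])
    moreover have "\<rho> (h - ?s) = 0" unfolding \<rho>_diff \<rho>_sum_f v(2) V(2) by simp
    ultimately obtain g where g: "g \<in> forms (i + 1 - 1)" "h - ?s = g * ell" using \<rho>_kernel[of "h - ?s" "i + 1"] by auto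
    have "h - ell * g = ?s" unfolding mult.commute[of ell] g(2)[symmetric] by simp
    then have "h - ell * g \<in> mon_ideal" using mon_ideal_f[of v] by (simp only:)
    then show "\<exists>g\<in>forms i. h - ell * g \<in> mon_ideal" using g(1) by (intro bexI[of _ g]) simp_all
  qed
qed

text \<open>A lift of a syzygy on the line maps to a multiple \<open>l g\<close>, and \<open>g\<close> lies in the kernel of the multiplication.  If \<open>g\<close>
  is in the ideal, the lift can be corrected to a syzygy on the plane; but semistability forbids those of
  degree less than a third of the total.\<close>

lemma no_syzygies_of_mult_inj:
  assumes sb: slope_bounds and inj: "mult_inj ell (e - 1)" and e: "3 * e < total"
  shows "E e = {0}"
proof -
  have "V = 0" if V: "V \<in> E e" for V
  proof -
    obtain v where v: "\<And>i. v $ i \<in> forms (e - int (dg i))" "toE v = V" using toE_lift[OF E_dle[OF V]] by blast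
    let ?s = "\<Sum>i\<in>UNIV. v $ i * f $ i"
    have sF: "?s \<in> forms e"
    proof (rule forms_sum)
      show "v $ j * f $ j \<in> forms e" for j using forms_mult[OF v(1)[of j] f_forms[of j]] by simp
    qed
    moreover have "\<rho> ?s = 0" using V unfolding \<rho>_sum_f v(2) by (simp add: E_def)
    ultimately obtain g where g: "g \<in> forms (e - 1)" "?s = g * ell" using \<rho>_kernel by blast
    have "ell * g \<in> mon_ideal" using mon_ideal_f[of v] unfolding g(2) by (simp add: mult.commute)
    then have "g \<in> mon_ideal" using inj g(1) unfolding mult_inj_def by blast
    from mon_ideal_rep[OF this g(1)] obtain w :: "'k poly3 ^ 4"
      where w: "\<And>i. w $ i \<in> forms (e - 1 - int (dg i))" "g = (\<Sum>i\<in>UNIV. w $ i * f $ i)" by blast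
    have "v - ell *s w \<in> piece (syz f) e"
    proof -
      have "(\<Sum>i\<in>UNIV. (v - ell *s w) $ i * f $ i) = ?s - (\<Sum>i\<in>UNIV. (ell *s w) $ i * f $ i)"
        by (simp add: left_diff_distrib sum_subtractf)
      also have "\<dots> = 0" unfolding syz_smult_sum g(2) w(2)[symmetric] by (simp add: mult.commute)
      finally have "(\<Sum>i\<in>UNIV. (v - ell *s w) $ i * f $ i) = 0" .
      moreover have "ell * w $ i \<in> forms (e - int (dg i))" for i
        using forms_mult[OF linear_form_forms[of cf] w(1)[of i]] by simp
      ultimately show ?thesis using v(1) by (auto intro: forms_diff)
    qed
    then have "v - ell *s w = 0" by (rule small_syzygy_zero[OF sb _ e])
    then have "toE v = toE (ell *s w)" by simp
    then show "V = 0" using v(2) by (simp add: toE_smult \<rho>_ell)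
  qed
  then show ?thesis using E_zero by blast
qed

end

context monomial_setup
begin

lemma E_below_basis:
  assumes gb: "graded_basis n \<delta>" and "\<And>j. j < 3 \<Longrightarrow> e < int (\<delta> j)"
  shows "E e = {0}"
proof -
  have "V = 0" if V: "V \<in> E e" for V
  proof -
    obtain x where x: "V = comb n x" "\<forall>j<3. e < int (\<delta> j) \<longrightarrow> x j = 0" using comb_gap[OF gb V] by blast
    then have "x 0 = 0" "x 1 = 0" "x 2 = 0" using assms(2) by auto
    then show "V = 0" using x(1) by (simp add: comb_def)
  qed
  then show ?thesis using E_zero by blast
qed

text \<open>The linear form is \<open>x + y + z\<close>.  Below degree \<open>k\<close> there are no syzygies on the line, and from degree \<open>k - 1\<close> on the
  cokernel vanishes.\<close>

lemma weak_lefschetz_of_balanced: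
  assumes gb: "graded_basis n \<delta>" and \<delta>: "\<And>j. j < 3 \<Longrightarrow> int (\<delta> j) = k"
  shows "weak_lefschetz mon_ideal"
proof -
  interpret L: monomial_line a b c \<alpha> \<beta> \<gamma> f "\<lambda>_. 1"
    by unfold_locales simp
  have "mult_inj L.ell (int i) \<or> mult_surj L.ell (int i)" for i
  proof (cases "int i + 1 < k")
    case True
    have "E (int i + 1) = {0}" by (rule E_below_basis[OF gb]) (use \<delta> True in simp)
    then show ?thesis using L.mult_inj_of_no_syzygies by blast
  next
    case False
    have "in_ideal p (int i + 1)" if "dle p (int i + 1)" for p
      by (rule in_ideal_balanced[OF gb \<delta> that]) (use False in auto)
    then show ?thesis unfolding L.mult_surj_iff by blast
  qed
  then show ?thesis unfolding weak_lefschetz_iff using linear_form_forms by blast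
qed

text \<open>Multiplication from degree \<open>k - 2\<close> to degree \<open>k - 1\<close> is neither injective, because of the basis element of degree
  \<open>k - 1\<close>, nor surjective, because of that of degree \<open>k + 1\<close>.\<close>

lemma balanced_of_weak_lefschetz:
  assumes gb: "graded_basis n \<delta>" and sb: slope_bounds and t: "total = 3 * k"
    and wl: "weak_lefschetz mon_ideal"
  shows "\<not> (int (\<delta> 0) = k - 1 \<and> int (\<delta> 1) = k \<and> int (\<delta> 2) = k + 1)"
proof
  assume \<delta>: "int (\<delta> 0) = k - 1 \<and> int (\<delta> 1) = k \<and> int (\<delta> 2) = k + 1"
  have k2: "2 \<le> k" using t bounds by simp
  obtain l where l: "l \<in> forms 1" "\<forall>i. mult_inj l (int i) \<or> mult_surj l (int i)" using wl unfolding weak_lefschetz_iff by blast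
  obtain cf where cf: "l = linear_form cf" using forms_one_linear[OF l(1)] by blast
  have "int (nat (k - 2)) = k - 2" using k2 by simp
  then have "mult_inj (linear_form cf) (k - 2) \<or> mult_surj (linear_form cf) (k - 2)"
    using l(2) unfolding cf by metis
  then obtain cf where cf: "\<forall>j. cf j \<noteq> 0" "mult_inj (linear_form cf) (k - 2) \<or> mult_surj (linear_form cf) (k - 2)"
    using general_linear_form by blast
  interpret L: monomial_line a b c \<alpha> \<beta> \<gamma> f cf
    by unfold_locales (use cf(1) in blast)
  have n0: "n 0 \<in> E (k - 1)" using basis_mem[OF gb, of 0] \<delta> by simp
  from cf(2) show False
  proof
    assume "mult_inj L.ell (k - 2)"
    then have "E (k - 1) = {0}" by (intro L.no_syzygies_of_mult_inj[OF sb]) (use t in simp_all)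
    then show False using n0 basis_nonzero[OF gb] by blast
  next
    assume "mult_surj L.ell (k - 2)"
    then have all: "\<forall>p. dle p (k - 1) \<longrightarrow> in_ideal p (k - 1)" unfolding L.mult_surj_iff by simp
    have "3 * int a \<le> 3 * k" "3 * int b \<le> 3 * k" "3 * int c \<le> 3 * k" "3 * int (\<alpha> + \<beta> + \<gamma>) \<le> 3 * k"
      using sb[unfolded slope_bounds_def t] by blast+
    then have "int a \<le> k" "int b \<le> k" "int c \<le> k" "int (\<alpha> + \<beta> + \<gamma>) \<le> k" by (simp_all del: of_nat_add)
    then have dk: "dd i \<le> k" for i
      using exhaust_4[of i] by (elim disjE) (simp_all add: dd_def ex_defs del: of_nat_add)
    obtain p where "dle p (k - 1)" "\<not> in_ideal p (k - 1)"
      using not_in_ideal_unbalanced[OF gb conjunct2[OF conjunct2[OF \<delta>]] dk] by (elim exE conjE)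
    then show False using all by (elim allE impE) (assumption, elim notE)
  qed
qed

end

section \<open>The generic splitting type\<close>

theorem proposition4p21:
  fixes a b c \<alpha> \<beta> \<gamma> :: nat
    and f :: "'k::field_char_0 poly3 ^ 4"
    and I :: "'k poly3 set"
    and k :: int
  assumes "0 < \<alpha>" "\<alpha> < a" "0 < \<beta>" "\<beta> < b" "0 < \<gamma>" "\<gamma> < c"
    and f: "f = vector [Var 0 ^ a, Var 1 ^ b, Var 2 ^ c, Var 0 ^ \<alpha> * Var 1 ^ \<beta> * Var 2 ^ \<gamma>]"
    and I: "I = genideal PR (range (($) f))"
    and "semistable (sheafify (syz f))"
    and k: "k = \<lfloor>real (a + b + c + \<alpha> + \<beta> + \<gamma>) / 3\<rfloor>"
  shows "(int (a + b + c + \<alpha> + \<beta> + \<gamma>) = 3 * k + 1 \<longrightarrow>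
            has_generic_splitting_type (syz f) (- k - 1, - k, - k)) \<and>
         (int (a + b + c + \<alpha> + \<beta> + \<gamma>) = 3 * k + 2 \<longrightarrow>
            has_generic_splitting_type (syz f) (- k - 1, - k - 1, - k)) \<and>
         (int (a + b + c + \<alpha> + \<beta> + \<gamma>) = 3 * k \<and> weak_lefschetz I \<longrightarrow>
            has_generic_splitting_type (syz f) (- k, - k, - k)) \<and>
         (int (a + b + c + \<alpha> + \<beta> + \<gamma>) = 3 * k \<and> \<not> weak_lefschetz I \<longrightarrow>
            has_generic_splitting_type (syz f) (- k - 1, - k, - k + 1))"
proof -
  interpret monomial_setup a b c \<alpha> \<beta> \<gamma> f
    by unfold_locales (use assms in auto)
  have sb: slope_bounds by (rule slope_bounds_of_semistable) fact
  obtain n \<delta> where gb: "graded_basis n \<delta>" using graded_basis_exists by blast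
  note deg = basis_degrees[OF gb sb]
  have J: "I = mon_ideal" unfolding I by (rule genideal_eq)
  show ?thesis
  proof (intro conjI impI)
    assume "total = 3 * k + 1"
    then show "has_generic_splitting_type (syz f) (- k - 1, - k, - k)"
      using deg(1)[of k] by (intro generic_splitting_type[OF gb]) auto
  next
    assume "total = 3 * k + 2"
    then show "has_generic_splitting_type (syz f) (- k - 1, - k - 1, - k)"
      using deg(2)[of k] by (intro generic_splitting_type[OF gb]) auto
  next
    assume "total = 3 * k \<and> weak_lefschetz I"
    then show "has_generic_splitting_type (syz f) (- k, - k, - k)"
      using deg(3)[of k] balanced_of_weak_lefschetz[OF gb sb, of k] unfolding J
      by (intro generic_splitting_type[OF gb]) auto
  next
    assume t: "total = 3 * k \<and> \<not> weak_lefschetz I"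
    have "\<not> (int (\<delta> 0) = k \<and> int (\<delta> 1) = k \<and> int (\<delta> 2) = k)"
    proof
      assume "int (\<delta> 0) = k \<and> int (\<delta> 1) = k \<and> int (\<delta> 2) = k"
      then have "int (\<delta> j) = k" if "j < 3" for j using that by (auto simp: less_Suc_eq numeral_3_eq_3 numeral_2_eq_2)
      then have "weak_lefschetz mon_ideal" by (rule weak_lefschetz_of_balanced[OF gb])
      then show False using t J by simp
    qed
    then show "has_generic_splitting_type (syz f) (- k - 1, - k, - k + 1)"
      using deg(3)[of k] t by (intro generic_splitting_type[OF gb]) auto
  qed
qed

end
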